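(* Let $X$ be a locally irreducible complex space and $A\subset X$ an (unreduced) analytic subspace with ideal sheaf $\mathscr{J}_A$. Let $\pi\colon Y\to X$ be a proper modification with $Y$ locally irreducible, and let $B:=\pi^{-1}(A)$ be the unreduced analytic preimage with ideal sheaf $\mathscr{J}_B$. Then $\pi^T\mathscr{J}_A=\mathscr{J}_B$.
   Context: A complex space is locally irreducible if every stalk of its structure sheaf is an integral domain (in particular it is reduced). A proper modification $\pi\colon Y\to X$ is a proper surjective holomorphic map of complex spaces for which there are closed analytically rare (in the reduced case: nowhere dense) analytic sets $E\subset Y$, $C\subset X$ with $C=\pi(E)$ such that $\pi|_{Y\setminus E}\colon Y\setminus E\to X\setminus C$ is biholomorphic. The torsion-free preimage sheaf is $\pi^T\mathscr{S}:=\pi^*\mathscr{S}/\mathscr{T}(\pi^*\mathscr{S})$, where $\pi^*$ is the analytic inverse image and $\mathscr{T}(\cdot)$ the torsion subsheaf. The unreduced analytic preimage $B=\pi^{-1}(A)$ is the fiber product $Y\times_X A$, i.e. $\mathscr{J}_B$ is the ideal sheaf in $\mathcal{O}_Y$ generated by the pullbacks of sections of $\mathscr{J}_A$. The equality is understood via the canonical map $\pi^T\mathscr{J}_A\to\pi^T\mathcal{O}_X=\mathcal{O}_Y$ induced by the inclusion $\mathscr{J}_A\hookrightarrow\mathcal{O}_X$. *)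

theory Defs
  imports
    "HOL-Analysis.Analysis"
    "HOL-Algebra.QuotRing"
    "HOL-Algebra.Module"
    "HOL-Algebra.Free_Abelian_Groups"
begin

section \<open>Ringed spaces over the complex numbers\<close>

text \<open>
  Sheaves are represented by their etale spaces: a sheaf is a family of stalks together with,
  for every open set, the set of its sections. A section over \<open>U\<close> is a function on \<open>U\<close>
  (extended by \<open>undefined\<close>) whose value at a point is the germ of the section at that point.
  The complex constants in the stalk at \<open>x\<close> are given by \<open>scal X x\<close>.
\<close>

record ('a, 'b) ringed =
  base :: "'a topology"
  stalk :: "'a \<Rightarrow> 'b ring"
  sect :: "'a set \<Rightarrow> ('a \<Rightarrow> 'b) set"
  scal :: "'a \<Rightarrow> complex \<Rightarrow> 'b"

definition complex_ring :: "complex ring" where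
  "complex_ring = \<lparr>carrier = UNIV, monoid.mult = (*), one = 1, ring.zero = 0, ring.add = (+)\<rparr>"

locale ringed_space =
  fixes X :: "('a, 'b) ringed"
  assumes stalk_cring: "x \<in> topspace (base X) \<Longrightarrow> cring (stalk X x)"
    and scal_hom: "x \<in> topspace (base X) \<Longrightarrow> scal X x \<in> ring_hom complex_ring (stalk X x)"
    and sect_germs: "openin (base X) U \<Longrightarrow> sect X U \<subseteq> (\<Pi>\<^sub>E x\<in>U. carrier (stalk X x))"
    and sect_restrict: "\<lbrakk>openin (base X) U; openin (base X) V; V \<subseteq> U; s \<in> sect X U\<rbrakk>
      \<Longrightarrow> restrict s V \<in> sect X V"
    and sect_glue: "\<lbrakk>openin (base X) U; s \<in> extensional U;
        \<And>x. x \<in> U \<Longrightarrow> \<exists>V. openin (base X) V \<and> x \<in> V \<and> V \<subseteq> U \<and> restrict s V \<in> sect X V\<rbrakk>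
      \<Longrightarrow> s \<in> sect X U"
    and germ_represented: "\<lbrakk>x \<in> topspace (base X); g \<in> carrier (stalk X x)\<rbrakk>
      \<Longrightarrow> \<exists>U s. openin (base X) U \<and> x \<in> U \<and> s \<in> sect X U \<and> s x = g"
    and germ_eq: "\<lbrakk>openin (base X) U; s \<in> sect X U; t \<in> sect X U; x \<in> U; s x = t x\<rbrakk>
      \<Longrightarrow> \<exists>V. openin (base X) V \<and> x \<in> V \<and> V \<subseteq> U \<and> (\<forall>z\<in>V. s z = t z)"
    and sect_scal: "openin (base X) U \<Longrightarrow> (\<lambda>x\<in>U. scal X x c) \<in> sect X U"
    and sect_add: "\<lbrakk>openin (base X) U; s \<in> sect X U; t \<in> sect X U\<rbrakk>
      \<Longrightarrow> (\<lambda>x\<in>U. s x \<oplus>\<^bsub>stalk X x\<^esub> t x) \<in> sect X U"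
    and sect_mult: "\<lbrakk>openin (base X) U; s \<in> sect X U; t \<in> sect X U\<rbrakk>
      \<Longrightarrow> (\<lambda>x\<in>U. s x \<otimes>\<^bsub>stalk X x\<^esub> t x) \<in> sect X U"

text \<open>
  A morphism \<open>Y \<rightarrow> X\<close> is a pair \<open>(p, h)\<close> with \<open>p\<close> continuous and \<open>h y\<close> the comorphism
  from the stalk of \<open>X\<close> at \<open>p y\<close> to the stalk of \<open>Y\<close> at \<open>y\<close>.
\<close>

definition pullback_section ::
    "('a, 'b) ringed \<Rightarrow> ('a \<Rightarrow> 'c) \<Rightarrow> ('a \<Rightarrow> 'd \<Rightarrow> 'b) \<Rightarrow> 'c set \<Rightarrow> ('c \<Rightarrow> 'd) \<Rightarrow> 'a \<Rightarrow> 'b" where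
  "pullback_section Y p h U s = (\<lambda>y\<in>{y \<in> topspace (base Y). p y \<in> U}. h y (s (p y)))"

definition ringed_morphism ::
    "('a, 'b) ringed \<Rightarrow> ('c, 'd) ringed \<Rightarrow> ('a \<Rightarrow> 'c) \<Rightarrow> ('a \<Rightarrow> 'd \<Rightarrow> 'b) \<Rightarrow> bool" where
  "ringed_morphism Y X p h \<longleftrightarrow>
     continuous_map (base Y) (base X) p \<and>
     (\<forall>y\<in>topspace (base Y). h y \<in> ring_hom (stalk X (p y)) (stalk Y y) \<and>
        (\<forall>c. h y (scal X (p y) c) = scal Y y c)) \<and>
     (\<forall>U. openin (base X) U \<longrightarrow>
        pullback_section Y p h U ` sect X U \<subseteq> sect Y {y \<in> topspace (base Y). p y \<in> U})"

definition ringed_isomorphism ::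
    "('a, 'b) ringed \<Rightarrow> ('c, 'd) ringed \<Rightarrow> ('a \<Rightarrow> 'c) \<Rightarrow> ('a \<Rightarrow> 'd \<Rightarrow> 'b) \<Rightarrow> bool" where
  "ringed_isomorphism Y X p h \<longleftrightarrow>
     homeomorphic_map (base Y) (base X) p \<and>
     (\<forall>y\<in>topspace (base Y). h y \<in> ring_iso (stalk X (p y)) (stalk Y y) \<and>
        (\<forall>c. h y (scal X (p y) c) = scal Y y c)) \<and>
     (\<forall>U. openin (base X) U \<longrightarrow>
        pullback_section Y p h U ` sect X U = sect Y {y \<in> topspace (base Y). p y \<in> U})"

definition open_subspace :: "('a, 'b) ringed \<Rightarrow> 'a set \<Rightarrow> ('a, 'b) ringed" where
  "open_subspace X U = X\<lparr>base := subtopology (base X) U\<rparr>"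

text \<open>An ideal sheaf, as a subsheaf of the structure sheaf, is given by its stalks.\<close>

definition ideal_sheaf :: "('a, 'b) ringed \<Rightarrow> ('a \<Rightarrow> 'b set) \<Rightarrow> bool" where
  "ideal_sheaf X J \<longleftrightarrow>
     (\<forall>x\<in>topspace (base X). ideal (J x) (stalk X x)) \<and>
     (\<forall>U s x. openin (base X) U \<and> s \<in> sect X U \<and> x \<in> U \<and> s x \<in> J x \<longrightarrow>
        (\<exists>V. openin (base X) V \<and> x \<in> V \<and> V \<subseteq> U \<and> (\<forall>z\<in>V. s z \<in> J z)))"

definition finite_type :: "('a, 'b) ringed \<Rightarrow> ('a \<Rightarrow> 'b set) \<Rightarrow> bool" where
  "finite_type X J \<longleftrightarrow>
     (\<forall>x\<in>topspace (base X). \<exists>U F. openin (base X) U \<and> x \<in> U \<and> finite F \<and> F \<subseteq> sect X U \<and>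
        (\<forall>z\<in>U. J z = Idl\<^bsub>stalk X z\<^esub> ((\<lambda>f. f z) ` F)))"

text \<open>
  The support of \<open>\<O>/J\<close> with the structure sheaf \<open>\<O>/J\<close>; its sections are locally induced
  by sections of \<open>\<O>\<close> over open subsets of the ambient space.
\<close>

definition closed_subspace :: "('a, 'b) ringed \<Rightarrow> ('a \<Rightarrow> 'b set) \<Rightarrow> ('a, 'b set) ringed" where
  "closed_subspace X J =
     \<lparr>base = subtopology (base X) {x \<in> topspace (base X). J x \<noteq> carrier (stalk X x)},
      stalk = (\<lambda>x. stalk X x Quot J x),
      sect = (\<lambda>U. {s \<in> (\<Pi>\<^sub>E x\<in>U. carrier (stalk X x Quot J x)).
         \<forall>x\<in>U. \<exists>W t. openin (base X) W \<and> x \<in> W \<and> t \<in> sect X W \<and>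
            (\<forall>z\<in>W \<inter> U. s z = J z +>\<^bsub>stalk X z\<^esub> t z)}),
      scal = (\<lambda>x c. J x +>\<^bsub>stalk X x\<^esub> scal X x c)\<rparr>"


section \<open>Complex spaces\<close>

text \<open>
  The number space of dimension \<open>n\<close>, following the encoding of \<^const>\<open>Euclidean_space\<close>: the
  dimensions of the local models of one complex space need not be bounded.
\<close>

definition Cspace :: "nat \<Rightarrow> (nat \<Rightarrow> complex) topology" where
  "Cspace n = subtopology (product_topology (\<lambda>_. euclidean) UNIV) {z. \<forall>i\<ge>n. z i = 0}"

text \<open>
  \<open>f\<close> is the sum of a power series on a polydisc around \<open>a\<close>; multi-indices of length \<open>n\<close> are
  functions vanishing from \<open>n\<close> on. In particular \<open>f\<close> is holomorphic near \<open>a\<close>.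
\<close>

definition holomorphic_at :: "nat \<Rightarrow> ((nat \<Rightarrow> complex) \<Rightarrow> complex) \<Rightarrow> (nat \<Rightarrow> complex) \<Rightarrow> bool" where
  "holomorphic_at n f a \<longleftrightarrow>
     (\<exists>(c :: (nat \<Rightarrow> nat) \<Rightarrow> complex) (r :: real). r > 0 \<and>
        (\<forall>z\<in>topspace (Cspace n). (\<forall>i<n. cmod (z i - a i) < r) \<longrightarrow>
           ((\<lambda>\<alpha>. c \<alpha> * (\<Prod>i<n. (z i - a i) ^ \<alpha> i)) has_sum f z) {\<alpha>. \<forall>i\<ge>n. \<alpha> i = 0}))"

definition germ :: "nat \<Rightarrow> ((nat \<Rightarrow> complex) \<Rightarrow> complex) \<Rightarrow> (nat \<Rightarrow> complex)
    \<Rightarrow> ((nat \<Rightarrow> complex) \<Rightarrow> complex) set" where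
  "germ n f a = {g. eventually (\<lambda>z. g z = f z) (nhdsin (Cspace n) a)}"

definition germ_ring :: "nat \<Rightarrow> (nat \<Rightarrow> complex) \<Rightarrow> ((nat \<Rightarrow> complex) \<Rightarrow> complex) set ring" where
  "germ_ring n a =
     \<lparr>carrier = {germ n f a | f. holomorphic_at n f a},
      monoid.mult = (\<lambda>A B. \<Union>f\<in>A. \<Union>g\<in>B. germ n (\<lambda>z. f z * g z) a),
      one = germ n (\<lambda>_. 1) a,
      ring.zero = germ n (\<lambda>_. 0) a,
      add = (\<lambda>A B. \<Union>f\<in>A. \<Union>g\<in>B. germ n (\<lambda>z. f z + g z) a)\<rparr>"

definition Cspace_ringed ::
    "nat \<Rightarrow> (nat \<Rightarrow> complex, ((nat \<Rightarrow> complex) \<Rightarrow> complex) set) ringed" where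
  "Cspace_ringed n =
     \<lparr>base = Cspace n,
      stalk = germ_ring n,
      sect = (\<lambda>U. {(\<lambda>z\<in>U. germ n f z) | f. \<forall>z\<in>U. holomorphic_at n f z}),
      scal = (\<lambda>z c. germ n (\<lambda>_. c) z)\<rparr>"

text \<open>The zero locus in \<open>D\<close> of finitely many holomorphic functions, with the quotient sheaf.\<close>

definition local_model :: "nat \<Rightarrow> (nat \<Rightarrow> complex) set \<Rightarrow> ((nat \<Rightarrow> complex) \<Rightarrow> complex) set
    \<Rightarrow> (nat \<Rightarrow> complex, ((nat \<Rightarrow> complex) \<Rightarrow> complex) set set) ringed" where
  "local_model n D F =
     closed_subspace (open_subspace (Cspace_ringed n) D)
       (\<lambda>z. Idl\<^bsub>germ_ring n z\<^esub> ((\<lambda>f. germ n f z) ` F))"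

definition complex_space :: "('a, 'b) ringed \<Rightarrow> bool" where
  "complex_space X \<longleftrightarrow>
     ringed_space X \<and> Hausdorff_space (base X) \<and>
     (\<forall>x\<in>topspace (base X). \<exists>U n D F p h.
        openin (base X) U \<and> x \<in> U \<and>
        openin (Cspace n) D \<and> finite F \<and> (\<forall>f\<in>F. \<forall>z\<in>D. holomorphic_at n f z) \<and>
        ringed_isomorphism (open_subspace X U) (local_model n D F) p h)"

definition locally_irreducible :: "('a, 'b) ringed \<Rightarrow> bool" where
  "locally_irreducible X \<longleftrightarrow>
     complex_space X \<and> (\<forall>x\<in>topspace (base X). domain (stalk X x))"

text \<open>
  For complex spaces, a morphism of ringed spaces over the complex numbers is automatically a
  morphism of locally ringed spaces, so locality need not be demanded.
\<close>

definition holomorphic_map ::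
    "('a, 'b) ringed \<Rightarrow> ('c, 'd) ringed \<Rightarrow> ('a \<Rightarrow> 'c) \<Rightarrow> ('a \<Rightarrow> 'd \<Rightarrow> 'b) \<Rightarrow> bool" where
  "holomorphic_map Y X p h \<longleftrightarrow> complex_space Y \<and> complex_space X \<and> ringed_morphism Y X p h"

text \<open>The ideal sheaves of the (not necessarily reduced) closed analytic subspaces of \<open>X\<close>.\<close>

definition analytic_subspace_ideal :: "('a, 'b) ringed \<Rightarrow> ('a \<Rightarrow> 'b set) \<Rightarrow> bool" where
  "analytic_subspace_ideal X J \<longleftrightarrow> ideal_sheaf X J \<and> finite_type X J"

text \<open>A section vanishes at a point iff its germ there is not a unit of the (local) stalk.\<close>

definition analytic_set :: "('a, 'b) ringed \<Rightarrow> 'a set \<Rightarrow> bool" where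
  "analytic_set X A \<longleftrightarrow>
     A \<subseteq> topspace (base X) \<and>
     (\<forall>x\<in>topspace (base X). \<exists>U F. openin (base X) U \<and> x \<in> U \<and> finite F \<and> F \<subseteq> sect X U \<and>
        A \<inter> U = {z \<in> U. \<forall>f\<in>F. f z \<notin> Units (stalk X z)})"

text \<open>For reduced complex spaces, an analytic set has this property iff it is nowhere dense.\<close>

definition analytically_rare :: "('a, 'b) ringed \<Rightarrow> 'a set \<Rightarrow> bool" where
  "analytically_rare X A \<longleftrightarrow>
     (\<forall>U. openin (base X) U \<longrightarrow> inj_on (\<lambda>s. restrict s (U - A)) (sect X U))"

definition proper_modification ::
    "('a, 'b) ringed \<Rightarrow> ('c, 'd) ringed \<Rightarrow> ('a \<Rightarrow> 'c) \<Rightarrow> ('a \<Rightarrow> 'd \<Rightarrow> 'b) \<Rightarrow> bool" where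
  "proper_modification Y X p h \<longleftrightarrow>
     holomorphic_map Y X p h \<and> proper_map (base Y) (base X) p \<and>
     p ` topspace (base Y) = topspace (base X) \<and>
     (\<exists>E C. closedin (base Y) E \<and> analytic_set Y E \<and> analytically_rare Y E \<and>
        closedin (base X) C \<and> analytic_set X C \<and> analytically_rare X C \<and> C = p ` E \<and>
        ringed_isomorphism (open_subspace Y (topspace (base Y) - E))
          (open_subspace X (topspace (base X) - C)) p h)"


section \<open>Modules: quotients, torsion, extension of scalars\<close>

text \<open>
  The map induced on cosets by a map \<open>f\<close> that is constant on each coset. The multiplicative
  fields of a module record carry no meaning.
\<close>

definition induced :: "('m \<Rightarrow> 'n) \<Rightarrow> 'm set \<Rightarrow> 'n" where
  "induced f C = the_elem (f ` C)"

definition quot_module :: "('r, 'm) module \<Rightarrow> 'm set \<Rightarrow> ('r, 'm set) module" where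
  "quot_module M N =
     \<lparr>carrier = a_rcosets\<^bsub>M\<^esub> N, monoid.mult = undefined, one = undefined, ring.zero = N, add = set_add M,
      smult = (\<lambda>r. induced (\<lambda>m. N +>\<^bsub>M\<^esub> (r \<odot>\<^bsub>M\<^esub> m)))\<rparr>"

definition torsion :: "'r ring \<Rightarrow> ('r, 'm) module \<Rightarrow> 'm set" where
  "torsion R M = {m \<in> carrier M. \<exists>r\<in>carrier R.
     (\<forall>s\<in>carrier R. r \<otimes>\<^bsub>R\<^esub> s = \<zero>\<^bsub>R\<^esub> \<longrightarrow> s = \<zero>\<^bsub>R\<^esub>) \<and> r \<odot>\<^bsub>M\<^esub> m = \<zero>\<^bsub>M\<^esub>}"

text \<open>
  For \<open>h : R \<rightarrow> S\<close> and an \<open>R\<close>-module \<open>M\<close>, the \<open>S\<close>-module \<open>M \<otimes>\<^sub>R S\<close> is the free abelian group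
  on the pairs \<open>(m, s)\<close> modulo the relations of bilinearity and \<open>R\<close>-balancedness.
\<close>

definition free_pairs :: "'s ring \<Rightarrow> ('r, 'm) module \<Rightarrow> ('s, ('m \<times> 's) \<Rightarrow>\<^sub>0 int) module" where
  "free_pairs S M =
     \<lparr>carrier = carrier (free_Abelian_group (carrier M \<times> carrier S)),
      monoid.mult = undefined, one = undefined, ring.zero = 0, ring.add = (+),
      smult = (\<lambda>s. frag_extend (\<lambda>(m, t). frag_of (m, s \<otimes>\<^bsub>S\<^esub> t)))\<rparr>"

definition tensor_relations ::
    "'r ring \<Rightarrow> 's ring \<Rightarrow> ('r \<Rightarrow> 's) \<Rightarrow> ('r, 'm) module \<Rightarrow> (('m \<times> 's) \<Rightarrow>\<^sub>0 int) set" where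
  "tensor_relations R S h M =
     generate (free_Abelian_group (carrier M \<times> carrier S))
       ({frag_of (m \<oplus>\<^bsub>M\<^esub> m', s) - frag_of (m, s) - frag_of (m', s) | m m' s.
           m \<in> carrier M \<and> m' \<in> carrier M \<and> s \<in> carrier S} \<union>
        {frag_of (m, s \<oplus>\<^bsub>S\<^esub> s') - frag_of (m, s) - frag_of (m, s') | m s s'.
           m \<in> carrier M \<and> s \<in> carrier S \<and> s' \<in> carrier S} \<union>
        {frag_of (r \<odot>\<^bsub>M\<^esub> m, s) - frag_of (m, h r \<otimes>\<^bsub>S\<^esub> s) | r m s.
           r \<in> carrier R \<and> m \<in> carrier M \<and> s \<in> carrier S})"

definition base_change ::
    "'r ring \<Rightarrow> 's ring \<Rightarrow> ('r \<Rightarrow> 's) \<Rightarrow> ('r, 'm) module \<Rightarrow> ('s, (('m \<times> 's) \<Rightarrow>\<^sub>0 int) set) module" where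
  "base_change R S h M = quot_module (free_pairs S M) (tensor_relations R S h M)"

definition pure_tensor ::
    "'r ring \<Rightarrow> 's ring \<Rightarrow> ('r \<Rightarrow> 's) \<Rightarrow> ('r, 'm) module \<Rightarrow> 'm \<Rightarrow> 's \<Rightarrow> (('m \<times> 's) \<Rightarrow>\<^sub>0 int) set" where
  "pure_tensor R S h M m s = tensor_relations R S h M +>\<^bsub>free_pairs S M\<^esub> frag_of (m, s)"

text \<open>The map \<open>M \<otimes>\<^sub>R S \<rightarrow> M' \<otimes>\<^sub>R S\<close> induced by an \<open>R\<close>-linear map \<open>f : M \<rightarrow> M'\<close>.\<close>

definition base_change_map ::
    "'r ring \<Rightarrow> 's ring \<Rightarrow> ('r \<Rightarrow> 's) \<Rightarrow> ('r, 'n) module \<Rightarrow> ('m \<Rightarrow> 'n)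
      \<Rightarrow> (('m \<times> 's) \<Rightarrow>\<^sub>0 int) set \<Rightarrow> (('n \<times> 's) \<Rightarrow>\<^sub>0 int) set" where
  "base_change_map R S h M' f =
     induced (\<lambda>u. tensor_relations R S h M' +>\<^bsub>free_pairs S M'\<^esub>
       frag_extend (\<lambda>(m, s). frag_of (f m, s)) u)"

text \<open>The canonical isomorphism \<open>R \<otimes>\<^sub>R S \<rightarrow> S\<close>, \<open>r \<otimes> s \<mapsto> h r * s\<close>.\<close>

definition base_change_unit ::
    "'s ring \<Rightarrow> ('r \<Rightarrow> 's) \<Rightarrow> (('r \<times> 's) \<Rightarrow>\<^sub>0 int) set \<Rightarrow> 's" where
  "base_change_unit S h =
     induced (\<lambda>u. \<Oplus>\<^bsub>S\<^esub>q\<in>Poly_Mapping.keys u.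
       add_pow S (Poly_Mapping.lookup u q) (h (fst q) \<otimes>\<^bsub>S\<^esub> snd q))"


section \<open>Sheaves of modules and the torsion-free preimage\<close>

text \<open>Sheaves of modules over the structure sheaf of a ringed space, in the same encoding.\<close>

record ('a, 'r, 'm) module_sheaf =
  mstalk :: "'a \<Rightarrow> ('r, 'm) module"
  msect :: "'a set \<Rightarrow> ('a \<Rightarrow> 'm) set"

definition ideal_module :: "('a, 'b) ringed \<Rightarrow> ('a \<Rightarrow> 'b set) \<Rightarrow> ('a, 'b, 'b) module_sheaf" where
  "ideal_module X J =
     \<lparr>mstalk = (\<lambda>x. \<lparr>carrier = J x, monoid.mult = undefined, one = undefined,
         ring.zero = \<zero>\<^bsub>stalk X x\<^esub>, add = add (stalk X x), smult = mult (stalk X x)\<rparr>),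
      msect = (\<lambda>U. {s \<in> sect X U. \<forall>x\<in>U. s x \<in> J x})\<rparr>"

definition structure_module :: "('a, 'b) ringed \<Rightarrow> ('a, 'b, 'b) module_sheaf" where
  "structure_module X = ideal_module X (\<lambda>x. carrier (stalk X x))"

definition module_sheaf_iso ::
    "('a, 'r) ringed \<Rightarrow> ('a, 'r, 'm) module_sheaf \<Rightarrow> ('a, 'r, 'n) module_sheaf
      \<Rightarrow> ('a \<Rightarrow> 'm \<Rightarrow> 'n) \<Rightarrow> bool" where
  "module_sheaf_iso Y M N f \<longleftrightarrow>
     (\<forall>y\<in>topspace (base Y).
        bij_betw (f y) (carrier (mstalk M y)) (carrier (mstalk N y)) \<and>
        (\<forall>a\<in>carrier (mstalk M y). \<forall>b\<in>carrier (mstalk M y).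
           f y (a \<oplus>\<^bsub>mstalk M y\<^esub> b) = f y a \<oplus>\<^bsub>mstalk N y\<^esub> f y b) \<and>
        (\<forall>r\<in>carrier (stalk Y y). \<forall>a\<in>carrier (mstalk M y).
           f y (r \<odot>\<^bsub>mstalk M y\<^esub> a) = r \<odot>\<^bsub>mstalk N y\<^esub> f y a)) \<and>
     (\<forall>V. openin (base Y) V \<longrightarrow> (\<lambda>s. \<lambda>y\<in>V. f y (s y)) ` msect M V = msect N V)"

text \<open>
  The analytic inverse image, the sheaf with stalks \<open>M\<^bsub>p y\<^esub> \<otimes> \<O>\<^bsub>Y,y\<^esub>\<close> over \<open>\<O>\<^bsub>X,p y\<^esub>\<close>; its
  sections are locally finite sums of \<open>a \<otimes> g\<close> with \<open>a\<close> a section of \<open>M\<close> over an open subset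
  of \<open>X\<close> and \<open>g\<close> a section of \<open>\<O>\<^sub>Y\<close>.
\<close>

definition inverse_image ::
    "('a, 'b) ringed \<Rightarrow> ('c, 'd) ringed \<Rightarrow> ('a \<Rightarrow> 'c) \<Rightarrow> ('a \<Rightarrow> 'd \<Rightarrow> 'b)
      \<Rightarrow> ('c, 'd, 'm) module_sheaf \<Rightarrow> ('a, 'b, (('m \<times> 'b) \<Rightarrow>\<^sub>0 int) set) module_sheaf" where
  "inverse_image Y X p h M =
     (let T = (\<lambda>y. base_change (stalk X (p y)) (stalk Y y) (h y) (mstalk M (p y)))
      in \<lparr>mstalk = T,
          msect = (\<lambda>V. {t \<in> (\<Pi>\<^sub>E y\<in>V. carrier (T y)).
             \<forall>y\<in>V. \<exists>W U (k::nat) a g. openin (base Y) W \<and> y \<in> W \<and> W \<subseteq> V \<and>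
               openin (base X) U \<and> p ` W \<subseteq> U \<and>
               (\<forall>i<k. a i \<in> msect M U \<and> g i \<in> sect Y W) \<and>
               (\<forall>z\<in>W. t z = (\<Oplus>\<^bsub>T z\<^esub>i\<in>{..<k}.
                  pure_tensor (stalk X (p z)) (stalk Y z) (h z) (mstalk M (p z)) (a i (p z)) (g i z)))})\<rparr>)"

text \<open>Quotient by a subsheaf that is given by its stalks \<open>N\<close>.\<close>

definition quot_sheaf ::
    "('a, 'r) ringed \<Rightarrow> ('a, 'r, 'm) module_sheaf \<Rightarrow> ('a \<Rightarrow> 'm set) \<Rightarrow> ('a, 'r, 'm set) module_sheaf" where
  "quot_sheaf Y M N =
     \<lparr>mstalk = (\<lambda>y. quot_module (mstalk M y) (N y)),
      msect = (\<lambda>V. {q \<in> (\<Pi>\<^sub>E y\<in>V. carrier (quot_module (mstalk M y) (N y))).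
         \<forall>y\<in>V. \<exists>W s. openin (base Y) W \<and> y \<in> W \<and> W \<subseteq> V \<and> s \<in> msect M W \<and>
           (\<forall>z\<in>W. q z = N z +>\<^bsub>mstalk M z\<^esub> s z)})\<rparr>"

definition torsion_sheaf :: "('a, 'r) ringed \<Rightarrow> ('a, 'r, 'm) module_sheaf \<Rightarrow> 'a \<Rightarrow> 'm set" where
  "torsion_sheaf Y M y = torsion (stalk Y y) (mstalk M y)"

definition torsion_free_preimage ::
    "('a, 'b) ringed \<Rightarrow> ('c, 'd) ringed \<Rightarrow> ('a \<Rightarrow> 'c) \<Rightarrow> ('a \<Rightarrow> 'd \<Rightarrow> 'b)
      \<Rightarrow> ('c, 'd, 'm) module_sheaf \<Rightarrow> ('a, 'b, (('m \<times> 'b) \<Rightarrow>\<^sub>0 int) set set) module_sheaf" where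
  "torsion_free_preimage Y X p h M =
     quot_sheaf Y (inverse_image Y X p h M) (torsion_sheaf Y (inverse_image Y X p h M))"

text \<open>The stalk maps of the morphism of torsion-free preimages induced by \<open>f : M \<rightarrow> M'\<close>.\<close>

definition torsion_free_preimage_map ::
    "('a, 'b) ringed \<Rightarrow> ('c, 'd) ringed \<Rightarrow> ('a \<Rightarrow> 'c) \<Rightarrow> ('a \<Rightarrow> 'd \<Rightarrow> 'b)
      \<Rightarrow> ('c, 'd, 'n) module_sheaf \<Rightarrow> ('c \<Rightarrow> 'm \<Rightarrow> 'n)
      \<Rightarrow> 'a \<Rightarrow> (('m \<times> 'b) \<Rightarrow>\<^sub>0 int) set set \<Rightarrow> (('n \<times> 'b) \<Rightarrow>\<^sub>0 int) set set" where
  "torsion_free_preimage_map Y X p h M' f y =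
     induced (\<lambda>t. torsion_sheaf Y (inverse_image Y X p h M') y
       +>\<^bsub>mstalk (inverse_image Y X p h M') y\<^esub>
       base_change_map (stalk X (p y)) (stalk Y y) (h y) (mstalk M' (p y)) (f (p y)) t)"

text \<open>
  The identification of the torsion-free preimage of \<open>\<O>\<^sub>X\<close> with \<open>\<O>\<^sub>Y\<close>. It is meant for \<open>Y\<close> with
  torsion-free structure sheaf, where \<^const>\<open>base_change_unit\<close> is constant on the torsion cosets.
\<close>

definition torsion_free_preimage_unit ::
    "('a, 'b) ringed \<Rightarrow> ('a \<Rightarrow> 'd \<Rightarrow> 'b) \<Rightarrow> 'a \<Rightarrow> (('d \<times> 'b) \<Rightarrow>\<^sub>0 int) set set \<Rightarrow> 'b" where
  "torsion_free_preimage_unit Y h y = induced (base_change_unit (stalk Y y) (h y))"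

text \<open>The canonical map from the torsion-free preimage of an ideal sheaf of \<open>X\<close> to \<open>\<O>\<^sub>Y\<close>.\<close>

definition canonical_map ::
    "('a, 'b) ringed \<Rightarrow> ('c, 'd) ringed \<Rightarrow> ('a \<Rightarrow> 'c) \<Rightarrow> ('a \<Rightarrow> 'd \<Rightarrow> 'b)
      \<Rightarrow> 'a \<Rightarrow> (('d \<times> 'b) \<Rightarrow>\<^sub>0 int) set set \<Rightarrow> 'b" where
  "canonical_map Y X p h y =
     torsion_free_preimage_unit Y h y \<circ>
     torsion_free_preimage_map Y X p h (structure_module X) (\<lambda>_ a. a) y"

text \<open>
  The ideal sheaf of the analytic preimage (the fibre product): generated by the pullbacks of
  the sections of \<open>J\<close>.
\<close>

definition preimage_ideal ::
    "('a, 'b) ringed \<Rightarrow> ('a \<Rightarrow> 'c) \<Rightarrow> ('a \<Rightarrow> 'd \<Rightarrow> 'b) \<Rightarrow> ('c \<Rightarrow> 'd set) \<Rightarrow> 'a \<Rightarrow> 'b set" where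
  "preimage_ideal Y p h J y = Idl\<^bsub>stalk Y y\<^esub> (h y ` J (p y))"

end

theory Submission
  imports Defs "HOL-Complex_Analysis.Conformal_Mappings"
begin

text \<open>
  On stalks the canonical map sends a class \<open>a \<otimes> s\<close> to \<open>h(a)s\<close>, so its image is the ideal generated
  by \<open>h(J)\<close>. If \<open>h\<close> is injective, then its kernel consists of torsion: for \<open>0 \<noteq> a \<in> J\<close> the identity
  \<open>h(a) \<cdot> (m \<otimes> s) = a \<otimes> h(m)s\<close> shows that the non-zero element \<open>h(a)\<close> annihilates the kernel. The
  comorphism \<open>h\<close> is injective because a non-zero section \<open>s\<close> of a locally irreducible space has
  non-zero germs at all nearby points (the ideals \<open>(F)\<close> and \<open>(F) : s\<close> of the local model are coherent by
  Oka's theorem), whereas the pullback of \<open>s\<close> could only vanish near a point if the germs of \<open>s\<close>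
  vanished over points outside the rare set, where the modification is biholomorphic.
\<close>

section \<open>Holomorphic functions of several variables\<close>

text \<open>Vanishing of a germ on a complex space means membership of a function in the ideal
  \<open>(F)\<close> of a local model, so passing from a point to its neighbours is a question about
  ideals and not about zeros. Coherence answers it as follows. Over a domain stalk,
  \<open>(F) : s\<close> and \<open>(F)\<close> agree at the point; finitely many germs generating
  \<open>(F) : s\<close> at all nearby points then lie in \<open>(F)\<close> nearby. If
  \<open>s\<close> lay in \<open>(F)\<close> at such a point, 1 would belong to
  \<open>(F) : s\<close> and hence to \<open>(F)\<close>, which is excluded on the support. The
  obstacle in Oka's theorem, proved by induction on the number of variables, is that one generating
  system must serve all nearby points, while the order of a pivot in the last coordinate may drop
  from \<open>d\<close> to some \<open>e\<close> between the centre and those points; relations are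
  therefore reduced to polynomial entries of degree below the fixed \<open>d\<close>. The
  several-variable analysis works along complex lines, and one difference form of the Schwarz lemma
  supplies its main estimates, among them the contraction behind Weierstrass division. Bijectivity
  on stalks does not finish the proof, since the isomorphism is also claimed on sections over every
  open set.\<close>

abbreviation near :: "nat \<Rightarrow> (nat \<Rightarrow> complex) \<Rightarrow> (nat \<Rightarrow> complex) filter" where
  "near n a \<equiv> nhdsin (Cspace n) a"

definition Cn :: "nat \<Rightarrow> (nat \<Rightarrow> complex) set" where
  "Cn n = {z. \<forall>i\<ge>n. z i = 0}"

definition polydisc :: "nat \<Rightarrow> (nat \<Rightarrow> complex) \<Rightarrow> real \<Rightarrow> (nat \<Rightarrow> complex) set" where
  "polydisc n a r = {z \<in> Cn n. \<forall>i<n. cmod (z i - a i) < r}"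

definition line :: "(nat \<Rightarrow> complex) \<Rightarrow> complex \<Rightarrow> (nat \<Rightarrow> complex) \<Rightarrow> nat \<Rightarrow> complex" where
  "line z t u = (\<lambda>i. z i + t * u i)"

lemma topspace_Cspace [simp]: "topspace (Cspace n) = Cn n"
  by (simp add: Cspace_def Cn_def)

lemma polydisc_subset_Cn: "polydisc n a r \<subseteq> Cn n"
  by (auto simp: polydisc_def)

lemma polydisc_mono: "r \<le> s \<Longrightarrow> polydisc n a r \<subseteq> polydisc n a s"
  by (force simp: polydisc_def)

lemma center_in_polydisc: "a \<in> Cn n \<Longrightarrow> r > 0 \<Longrightarrow> a \<in> polydisc n a r"
  by (auto simp: polydisc_def)

lemma polydisc_nested:
  assumes "z \<in> polydisc n a r"
  obtains s where "s > 0" "polydisc n z s \<subseteq> polydisc n a r"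
proof -
  \<comment> \<open>The extra 1 keeps the minimum defined for \<open>n = 0\<close>, where there is
    no coordinate to bound.\<close>
  let ?A = "insert 1 ((\<lambda>i. r - cmod (z i - a i)) ` {..<n})"
  let ?s = "Min ?A"
  have s: "?s > 0"
    using assms by (auto simp: polydisc_def)
  have "polydisc n z ?s \<subseteq> polydisc n a r"
  proof
    fix w assume w: "w \<in> polydisc n z ?s"
    have "cmod (w i - a i) < r" if i: "i < n" for i
    proof -
      have "?s \<le> r - cmod (z i - a i)"
        using i by (intro Min_le) auto
      moreover have "cmod (w i - z i) < ?s"
        using w i by (auto simp only: polydisc_def)
      moreover have "cmod (w i - a i) \<le> cmod (w i - z i) + cmod (z i - a i)"
        by (metis add_diff_eq diff_add_cancel norm_triangle_ineq)
      ultimately show ?thesis by linarith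
    qed
    then show "w \<in> polydisc n a r"
      using w by (auto simp only: polydisc_def)
  qed
  with s show ?thesis by (rule that)
qed

lemma openin_Cspace_iff:
  "openin (Cspace n) S \<longleftrightarrow> S \<subseteq> Cn n \<and> (\<forall>z\<in>S. \<exists>r>0. polydisc n z r \<subseteq> S)"
proof
  assume "openin (Cspace n) S"
  then obtain T where T: "openin (product_topology (\<lambda>_. euclidean) UNIV) T" "S = T \<inter> Cn n"
    unfolding Cspace_def Cn_def openin_subtopology by blast
  have "\<exists>r>0. polydisc n z r \<subseteq> S" if "z \<in> S" for z
  proof -
    have "z \<in> T" using that T by blast
    then obtain U where U0: "finite {i \<in> UNIV. U i \<noteq> topspace (euclidean :: complex topology)}"
      "\<forall>i\<in>UNIV. openin euclidean (U i)" "z \<in> Pi\<^sub>E UNIV U" "Pi\<^sub>E UNIV U \<subseteq> T"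
      using T(1) unfolding openin_product_topology_alt by blast
    have U: "\<And>i. open (U i)" "\<And>i. z i \<in> U i" "finite {i. U i \<noteq> (UNIV :: complex set)}"
      using U0(1-3) by (auto simp: PiE_iff)
    have UT: "w \<in> T" if "\<And>i. w i \<in> U i" for w
      using U0(4) that by (auto simp: PiE_iff)
    have "\<exists>e>0. ball (z i) e \<subseteq> U i" for i
      using U(1,2)[of i] by (auto elim: openE)
    then obtain e where e: "\<And>i. e i > 0" "\<And>i. ball (z i) (e i) \<subseteq> U i"
      by metis
    let ?F = "{i. U i \<noteq> (UNIV :: complex set)}"
    \<comment> \<open>Only the finitely many coordinates in \<open>?F\<close> are restricted by the
      basic open set. Coordinates from \<open>n\<close> on vanish on all of \<open>Cn n\<close>, so
      they agree with those of \<open>z\<close> and satisfy any bound \<open>?r > 0\<close>.\<close>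
    let ?r = "Min (insert 1 (e ` ?F))"
    have r0: "?r > 0"
      using U(3) e(1) by auto
    moreover have "polydisc n z ?r \<subseteq> S"
    proof
      fix w assume w: "w \<in> polydisc n z ?r"
      have z: "z \<in> Cn n" using that T by auto
      have "w i \<in> U i" for i
      proof (cases "i \<in> ?F")
        case True
        have "?r \<le> e i" using True U(3) by (intro Min_le) auto
        moreover have "cmod (w i - z i) < ?r"
          using w z r0 by (cases "i < n") (auto simp: polydisc_def Cn_def simp del: Min_less_iff Min_gr_iff)
        ultimately show ?thesis using e(2)[of i] by (auto simp: dist_norm norm_minus_commute)
      qed auto
      then show "w \<in> S"
        using UT w T(2) by (auto simp: polydisc_def)
    qed
    ultimately show ?thesis by blast
  qed
  then show "S \<subseteq> Cn n \<and> (\<forall>z\<in>S. \<exists>r>0. polydisc n z r \<subseteq> S)"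
    using T(2) by auto
next
  assume S: "S \<subseteq> Cn n \<and> (\<forall>z\<in>S. \<exists>r>0. polydisc n z r \<subseteq> S)"
  then obtain r where r: "\<And>z. z \<in> S \<Longrightarrow> r z > 0" "\<And>z. z \<in> S \<Longrightarrow> polydisc n z (r z) \<subseteq> S"
    by metis
  let ?B = "\<lambda>z. \<Inter>i\<in>{..<n}. {w :: nat \<Rightarrow> complex. cmod (w i - z i) < r z}"
  have op: "open {w :: nat \<Rightarrow> complex. cmod (w i - z i) < r z}" for z i
    by (intro open_Collect_less continuous_intros continuous_on_product_coordinates)
  have "open (\<Union>z\<in>S. ?B z)"
    by (intro open_UN ballI open_INT finite_lessThan op)
  moreover have "S = (\<Union>z\<in>S. ?B z) \<inter> Cn n"
  proof
    show "S \<subseteq> (\<Union>z\<in>S. ?B z) \<inter> Cn n"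
      using S r(1) by force
    have "(?B z) \<inter> Cn n = polydisc n z (r z)" for z
      by (auto simp: polydisc_def)
    then show "(\<Union>z\<in>S. ?B z) \<inter> Cn n \<subseteq> S"
      using r(2) by blast
  qed
  ultimately show "openin (Cspace n) S"
    unfolding Cspace_def Cn_def openin_subtopology euclidean_product_topology by auto
qed

lemma openin_polydisc: "openin (Cspace n) (polydisc n a r)"
  unfolding openin_Cspace_iff by (meson polydisc_nested polydisc_subset_Cn)

lemma eventually_near:
  assumes "a \<in> Cn n"
  shows "eventually Q (near n a) \<longleftrightarrow> (\<exists>r>0. \<forall>z\<in>polydisc n a r. Q z)"
proof
  assume "eventually Q (near n a)"
  then obtain S where "openin (Cspace n) S" "a \<in> S" "\<forall>z\<in>S. Q z"
    using assms by (auto simp: eventually_nhdsin)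
  then show "\<exists>r>0. \<forall>z\<in>polydisc n a r. Q z"
    unfolding openin_Cspace_iff by blast
next
  assume "\<exists>r>0. \<forall>z\<in>polydisc n a r. Q z"
  then show "eventually Q (near n a)"
    unfolding eventually_nhdsin using openin_polydisc center_in_polydisc assms by metis
qed

lemma eventually_near_self:
  "a \<in> Cn n \<Longrightarrow> eventually Q (near n a) \<Longrightarrow> Q a"
  by (auto simp: eventually_near intro: center_in_polydisc)

lemma eventually_near_Cn: "a \<in> Cn n \<Longrightarrow> eventually (\<lambda>z. z \<in> Cn n) (near n a)"
  using polydisc_subset_Cn by (force simp: eventually_near intro!: exI[of _ 1])

text \<open>An open set on which \<open>Q\<close> holds is a neighbourhood of each of its points.
  Every coherence claim uses this to turn an identity near \<open>x\<close> into identities of germs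
  at all nearby points.\<close>

lemma eventually_near_near:
  assumes "a \<in> Cn n" "eventually Q (near n a)"
  shows "eventually (\<lambda>b. b \<in> Cn n \<and> eventually Q (near n b)) (near n a)"
proof -
  obtain S where "openin (Cspace n) S" "a \<in> S" "\<forall>z\<in>S. Q z"
    using assms by (auto simp: eventually_nhdsin)
  then show ?thesis
    unfolding eventually_nhdsin[of _ "Cspace n" a] using openin_subset[of "Cspace n" S]
    by (auto simp: eventually_nhdsin subset_iff)
qed

lemma line_simps [simp]: "line z 0 u = z" "line (line z s u) t u = line z (s + t) u"
  by (auto simp: line_def algebra_simps)

lemma line_in_Cn: "z \<in> Cn n \<Longrightarrow> u \<in> Cn n \<Longrightarrow> line z t u \<in> Cn n"
  by (auto simp: Cn_def line_def)

lemma coords_bounded: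
  fixes u :: "nat \<Rightarrow> complex"
  obtains K where "K > 0" "\<And>i. i < n \<Longrightarrow> cmod (u i) \<le> K"
proof -
  have "cmod (u i) \<le> (\<Sum>i<n. cmod (u i)) + 1" if "i < n" for i
    using that member_le_sum[of i "{..<n}" "\<lambda>i. cmod (u i)"] by auto
  moreover have "(\<Sum>i<n. cmod (u i)) + 1 > 0"
    by (simp add: add_nonneg_pos sum_nonneg)
  ultimately show ?thesis using that by blast
qed

lemma line_in_polydisc:
  assumes "z \<in> Cn n" "u \<in> Cn n" "r > 0"
  obtains e where "e > 0" "\<And>t. cmod t < e \<Longrightarrow> line z t u \<in> polydisc n z r"
proof -
  obtain K where K: "K > 0" "\<And>i. i < n \<Longrightarrow> cmod (u i) \<le> K"
    using coords_bounded by blast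
  have "line z t u \<in> polydisc n z r" if "cmod t < r / K" for t
  proof -
    have "cmod t * cmod (u i) < r" if "i < n" for i
    proof -
      have "cmod t * cmod (u i) \<le> cmod t * K"
        using K that by (intro mult_left_mono) auto
      also have "\<dots> < r" using \<open>cmod t < r / K\<close> K(1) by (simp add: field_simps)
      finally show ?thesis .
    qed
    then show ?thesis
      using line_in_Cn[OF assms(1,2)] by (auto simp: polydisc_def line_def norm_mult)
  qed
  then show ?thesis using that[of "r / K"] K(1) assms(3) by auto
qed

lemma line_in_open:
  assumes "openin (Cspace n) S" "z \<in> S" "u \<in> Cn n"
  obtains e where "e > 0" "\<And>t. cmod t < e \<Longrightarrow> line z t u \<in> S"
proof -
  obtain r where "r > 0" "polydisc n z r \<subseteq> S" "z \<in> Cn n"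
    using assms(1,2) unfolding openin_Cspace_iff by blast
  then show ?thesis
    using line_in_polydisc[of z n u r] assms(3) that by (metis subsetD)
qed

text \<open>Local boundedness together with complex differentiability along every complex line
  characterizes holomorphy in several variables. Closure properties become one-variable facts, with
  only bounds to be carried along; the equivalence with power series expansions is
  \<open>holomorphic_at_iff_holo\<close>.\<close>

definition holo :: "nat \<Rightarrow> (nat \<Rightarrow> complex) set \<Rightarrow> ((nat \<Rightarrow> complex) \<Rightarrow> complex) \<Rightarrow> bool" where
  "holo n S f \<longleftrightarrow> openin (Cspace n) S \<and>
     (\<forall>z\<in>S. (\<exists>r>0. bounded (f ` polydisc n z r)) \<and>
        (\<forall>u\<in>Cn n. (\<lambda>t. f (line z t u)) field_differentiable at 0))"

lemma holo_openin: "holo n S f \<Longrightarrow> openin (Cspace n) S"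
  by (simp add: holo_def)

lemma holo_subset: "holo n S f \<Longrightarrow> openin (Cspace n) T \<Longrightarrow> T \<subseteq> S \<Longrightarrow> holo n T f"
  by (auto simp: holo_def)

lemma holo_line:
  assumes "holo n S f" "u \<in> Cn n" "open T" "\<And>t. t \<in> T \<Longrightarrow> line z t u \<in> S"
  shows "(\<lambda>t. f (line z t u)) holomorphic_on T"
proof -
  have "(\<lambda>t. f (line z t u)) field_differentiable at t0" if "t0 \<in> T" for t0
  proof -
    have "(\<lambda>s. f (line (line z t0 u) s u)) field_differentiable at (t0 - t0)"
      using assms that by (simp add: holo_def del: line_simps)
    then have "((\<lambda>s. f (line (line z t0 u) s u)) \<circ> (\<lambda>t. t - t0)) field_differentiable at t0"
      by (intro field_differentiable_compose derivative_intros) auto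
    then show ?thesis by (simp add: o_def)
  qed
  then show ?thesis
    by (auto simp: holomorphic_on_def intro: field_differentiable_at_within)
qed

text \<open>Schwarz's lemma for a normalised version of \<open>h - h 0\<close>. Applied along a
  line, it turns a sup bound into a Lipschitz bound at the centre; continuity, the bounds on
  difference quotients and the smallness needed for Weierstrass division all come from it.\<close>

lemma schwarz_difference:
  fixes h :: "complex \<Rightarrow> complex"
  assumes hol: "h holomorphic_on ball 0 R" and R: "R > 0"
    and M: "\<And>t. cmod t < R \<Longrightarrow> cmod (h t) \<le> M" and t: "cmod t < R"
  shows "cmod (h t - h 0) \<le> 2 * M / R * cmod t"
proof (rule field_le_epsilon)
  fix e :: real assume e: "e > 0"
  have M0: "M \<ge> 0" using M[of 0] R by (smt (verit) norm_ge_zero norm_zero)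
  \<comment> \<open>The summand \<open>e > 0\<close> makes the bound by 1 strict and keeps the
    denominator non-zero when \<open>M = 0\<close>; it is removed by
    \<open>field_le_epsilon\<close>.\<close>
  define g where "g = (\<lambda>s. (h (of_real R * s) - h 0) / of_real (2 * M + e))"
  have "g holomorphic_on ball 0 1"
    unfolding g_def using R e M0
    by (intro holomorphic_intros holomorphic_on_compose_gen[OF _ hol, unfolded o_def])
       (auto simp: norm_mult simp flip: of_real_mult of_real_add)
  moreover have "cmod (g s) < 1" if "cmod s < 1" for s
  proof -
    have "cmod (h (of_real R * s) - h 0) \<le> M + M"
      using that R by (intro order.trans[OF norm_triangle_ineq4] add_mono M) (auto simp: norm_mult)
    then show ?thesis unfolding g_def using e M0
      by (simp add: norm_divide divide_less_eq del: of_real_add of_real_mult)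
  qed
  moreover have "cmod (t / of_real R) < 1" using t R by (simp add: norm_divide)
  ultimately have "cmod (g (t / of_real R)) \<le> cmod (t / of_real R)"
    by (intro Schwarz_Lemma(1)) (auto simp: g_def)
  then have "cmod (h t - h 0) \<le> cmod t / R * (2 * M + e)"
    unfolding g_def using R e M0
    by (simp add: norm_divide divide_le_eq del: of_real_add of_real_mult)
  also have "\<dots> = 2 * M / R * cmod t + cmod t / R * e"
    by (simp add: algebra_simps)
  also have "cmod t / R * e \<le> 1 * e"
    using t R e by (intro mult_right_mono) auto
  finally show "cmod (h t - h 0) \<le> 2 * M / R * cmod t + e" by simp
qed

lemma holo_continuous:
  assumes "holo n S f" "z \<in> S"
  shows "(f \<longlongrightarrow> f z) (near n z)"
proof (rule tendstoI)
  fix e :: real assume e: "e > 0"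
  obtain r1 where r1: "r1 > 0" "polydisc n z r1 \<subseteq> S" and z: "z \<in> Cn n"
    using assms holo_openin[OF assms(1)] unfolding openin_Cspace_iff by blast
  obtain r2 where r2: "r2 > 0" and "bounded (f ` polydisc n z r2)"
    using assms unfolding holo_def by blast
  then obtain M where bd: "\<And>w. w \<in> polydisc n z r2 \<Longrightarrow> cmod (f w) \<le> M"
    unfolding bounded_iff by blast
  define r where "r = min r1 r2"
  have r: "r > 0" "polydisc n z r \<subseteq> S" "\<And>w. w \<in> polydisc n z r \<Longrightarrow> cmod (f w) \<le> M"
    using r1 r2 bd polydisc_mono[of r r1 n z] polydisc_mono[of r r2 n z] by (auto simp: r_def)
  have M: "M \<ge> 0" using r(3)[OF center_in_polydisc[OF z r(1)]] norm_ge_zero order.trans by blast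
  \<comment> \<open>A point within \<open>d\<close> of \<open>z\<close> lies on a line through
    \<open>z\<close> that stays in the \<open>r\<close>-polydisc for parameters below
    \<open>r / d > 1\<close>, so the Schwarz estimate at parameter 1 gives
    \<open>2 * M * d / r\<close>. The second entry of the minimum makes this less than
    \<open>e\<close>, also for \<open>M = 0\<close>.\<close>
  define d where "d = min (r / 2) (e * r / (4 * M + 4))"
  have d: "d > 0" "d < r" using r(1) e M by (auto simp: d_def)
  have "dist (f w) (f z) < e" if w: "w \<in> polydisc n z d" for w
  proof -
    define u where "u = (\<lambda>i. w i - z i)"
    have u: "u \<in> Cn n" using w z by (auto simp: u_def polydisc_def Cn_def)
    have inr: "line z t u \<in> polydisc n z r" if "cmod t < r / d" for t
    proof -
      have "cmod t * cmod (u i) < r" if "i < n" for i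
      proof -
        have "cmod t * cmod (u i) \<le> cmod t * d"
          using w that by (intro mult_left_mono) (auto simp: u_def polydisc_def less_imp_le)
        also have "\<dots> < r" using \<open>cmod t < r / d\<close> d by (simp add: field_simps)
        finally show ?thesis .
      qed
      then show ?thesis
        using line_in_Cn[OF z u] by (auto simp: polydisc_def line_def norm_mult)
    qed
    have "cmod (f (line z 1 u) - f (line z 0 u)) \<le> 2 * M / (r / d) * cmod 1"
    proof (rule schwarz_difference[where h = "\<lambda>t. f (line z t u)"])
      show "(\<lambda>t. f (line z t u)) holomorphic_on ball 0 (r / d)"
        using assms(1) u inr r(2) by (intro holo_line) auto
    qed (use inr r d in auto)
    moreover have "line z 1 u = w" by (auto simp: line_def u_def)
    ultimately have "cmod (f w - f z) \<le> 2 * M * d / r" by simp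
    also have "\<dots> \<le> 2 * M * (e * r / (4 * M + 4)) / r"
      using M r by (intro divide_right_mono mult_left_mono) (auto simp: d_def)
    also have "\<dots> = e * (2 * M / (4 * M + 4))" using r by simp
    also have "\<dots> < e * 1" using e M by (intro mult_strict_left_mono) (auto simp: field_simps)
    finally show ?thesis by (simp add: dist_norm)
  qed
  then show "eventually (\<lambda>w. dist (f w) (f z) < e) (near n z)"
    using eventually_near[OF z] d(1) by blast
qed

lemma holo_bounded_near:
  assumes "holo n S f" "z \<in> S"
  obtains r M where "r > 0" "polydisc n z r \<subseteq> S" "\<And>w. w \<in> polydisc n z r \<Longrightarrow> cmod (f w) \<le> M"
proof -
  obtain r1 where r1: "r1 > 0" "polydisc n z r1 \<subseteq> S"
    using assms holo_openin[OF assms(1)] unfolding openin_Cspace_iff by blast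
  obtain r2 where r2: "r2 > 0" and "bounded (f ` polydisc n z r2)"
    using assms unfolding holo_def by blast
  then obtain M where bd: "\<And>w. w \<in> polydisc n z r2 \<Longrightarrow> cmod (f w) \<le> M"
    unfolding bounded_iff by blast
  show ?thesis
    using r1 r2 bd polydisc_mono[of "min r1 r2" r1 n z] polydisc_mono[of "min r1 r2" r2 n z]
    by (intro that[of "min r1 r2" M]) auto
qed

lemma holoI:
  assumes "openin (Cspace n) S"
    and "\<And>z. z \<in> S \<Longrightarrow> \<exists>r>0. \<exists>M. \<forall>w\<in>polydisc n z r. cmod (f w) \<le> M"
    and "\<And>z u. z \<in> S \<Longrightarrow> u \<in> Cn n \<Longrightarrow> (\<lambda>t. f (line z t u)) field_differentiable at 0"
  shows "holo n S f"
  unfolding holo_def bounded_iff using assms by (metis (no_types, lifting) imageE)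

lemma holo_differentiable:
  "holo n S f \<Longrightarrow> z \<in> S \<Longrightarrow> u \<in> Cn n \<Longrightarrow> (\<lambda>t. f (line z t u)) field_differentiable at 0"
  by (simp add: holo_def)

lemma holo_const: "openin (Cspace n) S \<Longrightarrow> holo n S (\<lambda>_. c)"
  by (rule holoI) (auto intro: exI[of _ 1])

lemma holo_coordinate: 
  assumes "openin (Cspace n) S"
  shows "holo n S (\<lambda>z. z i)"
proof (rule holoI)
  fix z assume "z \<in> S"
  then have z: "z \<in> Cn n" using assms openin_Cspace_iff by blast
  have "cmod (w i) \<le> cmod (z i) + 1" if "w \<in> polydisc n z 1" for w
    using that z norm_triangle_ineq[of "w i - z i" "z i"] by (cases "i < n") (auto simp: polydisc_def Cn_def)
  then show "\<exists>r>0. \<exists>M. \<forall>w\<in>polydisc n z r. cmod (w i) \<le> M"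
    by (intro exI[of _ 1] exI[of _ "cmod (z i) + 1"]) auto
qed (auto simp: line_def assms intro!: derivative_intros)

lemma holo_add:
  assumes "holo n S f" "holo n S g"
  shows "holo n S (\<lambda>z. f z + g z)"
proof (rule holoI)
  fix z assume z: "z \<in> S"
  obtain r M where 1: "r > 0" "polydisc n z r \<subseteq> S" "\<And>w. w \<in> polydisc n z r \<Longrightarrow> cmod (f w) \<le> M"
    using holo_bounded_near[OF assms(1) z] by blast
  obtain s N where 2: "s > 0" "polydisc n z s \<subseteq> S" "\<And>w. w \<in> polydisc n z s \<Longrightarrow> cmod (g w) \<le> N"
    using holo_bounded_near[OF assms(2) z] by blast
  have "cmod (f w + g w) \<le> M + N" if "w \<in> polydisc n z (min r s)" for w
    using that polydisc_mono[of "min r s" r n z] polydisc_mono[of "min r s" s n z]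
    by (intro order.trans[OF norm_triangle_ineq] add_mono 1(3) 2(3)) auto
  then show "\<exists>r>0. \<exists>M. \<forall>w\<in>polydisc n z r. cmod (f w + g w) \<le> M"
    using 1(1) 2(1) by (intro exI[of _ "min r s"]) auto
qed (use assms in \<open>auto simp: holo_openin intro!: derivative_intros holo_differentiable\<close>)

lemma holo_mult:
  assumes "holo n S f" "holo n S g"
  shows "holo n S (\<lambda>z. f z * g z)"
proof (rule holoI)
  fix z assume z: "z \<in> S"
  obtain r M where 1: "r > 0" "polydisc n z r \<subseteq> S" "\<And>w. w \<in> polydisc n z r \<Longrightarrow> cmod (f w) \<le> M"
    using holo_bounded_near[OF assms(1) z] by blast
  obtain s N where 2: "s > 0" "polydisc n z s \<subseteq> S" "\<And>w. w \<in> polydisc n z s \<Longrightarrow> cmod (g w) \<le> N"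
    using holo_bounded_near[OF assms(2) z] by blast
  have "cmod (f w * g w) \<le> \<bar>M\<bar> * \<bar>N\<bar>" if "w \<in> polydisc n z (min r s)" for w
  proof -
    have "w \<in> polydisc n z r" "w \<in> polydisc n z s"
      using that polydisc_mono[of "min r s" r n z] polydisc_mono[of "min r s" s n z] by auto
    then show ?thesis using 1(3)[of w] 2(3)[of w] by (auto simp: norm_mult intro!: mult_mono)
  qed
  then show "\<exists>r>0. \<exists>M. \<forall>w\<in>polydisc n z r. cmod (f w * g w) \<le> M"
    using 1(1) 2(1) by (intro exI[of _ "min r s"]) auto
qed (use assms in \<open>auto simp: holo_openin intro!: derivative_intros holo_differentiable\<close>)

lemma holo_uminus: "holo n S f \<Longrightarrow> holo n S (\<lambda>z. - f z)"
  using holo_mult[OF holo_const[of n S "-1"]] holo_openin by fastforce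

lemma holo_diff: "holo n S f \<Longrightarrow> holo n S g \<Longrightarrow> holo n S (\<lambda>z. f z - g z)"
  using holo_add[of n S f "\<lambda>z. - g z"] holo_uminus[of n S g] by simp

lemma holo_sum:
  assumes "openin (Cspace n) S" "\<And>i. i \<in> I \<Longrightarrow> holo n S (f i)"
  shows "holo n S (\<lambda>z. \<Sum>i\<in>I. f i z)"
  using assms(2) by (induction I rule: infinite_finite_induct) (auto intro: holo_const holo_add assms(1))

lemma holo_power: "holo n S f \<Longrightarrow> holo n S (\<lambda>z. f z ^ k)"
  by (induction k) (auto intro: holo_mult holo_const holo_openin)

text \<open>Beyond calculus along lines only boundedness is at stake: continuity keeps the modulus
  of \<open>f\<close> above half its value at \<open>z\<close>.\<close>

lemma holo_inverse:
  assumes f: "holo n S f" and nz: "\<And>z. z \<in> S \<Longrightarrow> f z \<noteq> 0"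
  shows "holo n S (\<lambda>z. inverse (f z))"
proof (rule holoI)
  fix z assume z: "z \<in> S"
  have zC: "z \<in> Cn n" using z holo_openin[OF f] openin_Cspace_iff by blast
  have "eventually (\<lambda>w. dist (f w) (f z) < cmod (f z) / 2) (near n z)"
    by (rule tendstoD[OF holo_continuous[OF f z]]) (use nz[OF z] in auto)
  then obtain r where r: "r > 0" "\<And>w. w \<in> polydisc n z r \<Longrightarrow> dist (f w) (f z) < cmod (f z) / 2"
    unfolding eventually_near[OF zC] by blast
  have "cmod (inverse (f w)) \<le> 2 / cmod (f z)" if "w \<in> polydisc n z r" for w
  proof -
    have "cmod (f z) \<le> cmod (f w) + dist (f w) (f z)"
      by (metis dist_commute dist_norm norm_triangle_sub)
    with r(2)[OF that] have "cmod (f w) \<ge> cmod (f z) / 2" by linarith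
    moreover have "cmod (f z) > 0" using nz[OF z] by simp
    ultimately have "inverse (cmod (f w)) \<le> inverse (cmod (f z) / 2)"
      by (intro le_imp_inverse_le) auto
    then show ?thesis by (simp add: norm_inverse)
  qed
  then show "\<exists>r>0. \<exists>M. \<forall>w\<in>polydisc n z r. cmod (inverse (f w)) \<le> M"
    using r(1) by blast
qed (use assms in \<open>auto simp: holo_openin intro!: derivative_intros holo_differentiable\<close>)

lemma holo_cong:
  assumes "holo n S f" "\<And>z. z \<in> S \<Longrightarrow> f z = g z"
  shows "holo n S g"
proof (rule holoI)
  fix z assume z: "z \<in> S"
  show "\<exists>r>0. \<exists>M. \<forall>w\<in>polydisc n z r. cmod (g w) \<le> M"
    using holo_bounded_near[OF assms(1) z] assms(2) by (metis subsetD)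
  fix u assume u: "u \<in> Cn n"
  obtain e where e: "e > 0" "\<And>t. cmod t < e \<Longrightarrow> line z t u \<in> S"
    using line_in_open[OF holo_openin[OF assms(1)] z u] by blast
  show "(\<lambda>t. g (line z t u)) field_differentiable at 0"
    by (rule field_differentiable_transform_within[OF e(1) _ _ holo_differentiable[OF assms(1) z u]])
       (auto simp: assms(2) e(2))
qed (use assms holo_openin in auto)

lemma holo_local:
  assumes "openin (Cspace n) S" "\<And>z. z \<in> S \<Longrightarrow> \<exists>T. z \<in> T \<and> holo n T f"
  shows "holo n S f"
  using assms by (auto simp: holo_def)

text \<open>Along each line this is the one-variable theorem on uniform limits. The filter is
  arbitrary because the lemma serves both unordered sums, along
  \<open>finite_subsets_at_top\<close>, and the iterates of Weierstrass division, along
  \<open>sequentially\<close>.\<close>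

lemma holo_uniform_limit:
  fixes f :: "'i \<Rightarrow> (nat \<Rightarrow> complex) \<Rightarrow> complex"
  assumes S: "openin (Cspace n) S" and f: "\<And>k. holo n S (f k)" and F: "F \<noteq> bot"
    and lim: "uniform_limit S f g F"
  shows "holo n S g"
proof (rule holoI)
  fix z assume z: "z \<in> S"
  obtain k where k: "\<And>w. w \<in> S \<Longrightarrow> dist (f k w) (g w) < 1"
    using eventually_happens[OF uniform_limitD[OF lim zero_less_one]] F by blast
  obtain r M where r: "r > 0" "polydisc n z r \<subseteq> S" "\<And>w. w \<in> polydisc n z r \<Longrightarrow> cmod (f k w) \<le> M"
    using holo_bounded_near[OF f z] by blast
  have "cmod (g w) \<le> M + 1" if "w \<in> polydisc n z r" for w
    using r(2,3) that k[of w] norm_triangle_ineq4[of "f k w" "f k w - g w"]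
    by (fastforce simp: dist_norm)
  then show "\<exists>r>0. \<exists>M. \<forall>w\<in>polydisc n z r. cmod (g w) \<le> M" using r(1) by blast
  fix u assume u: "u \<in> Cn n"
  obtain e where e: "e > 0" "\<And>t. cmod t < e \<Longrightarrow> line z t u \<in> S"
    using line_in_open[OF S z u] by blast
  have hol: "(\<lambda>t. f k (line z t u)) holomorphic_on ball 0 e" for k
    using f u e by (intro holo_line) auto
  have sub: "cball 0 (e / 2) \<subseteq> ball (0::complex) e" "ball 0 (e / 2) \<subseteq> ball (0::complex) e"
    using e by auto
  have "uniform_limit (cball 0 (e/2)) (\<lambda>k t. f k (line z t u)) (\<lambda>t. g (line z t u)) F"
    using sub e(2) by (intro uniform_limit_compose'[OF lim]) auto
  then have "(\<lambda>t. g (line z t u)) holomorphic_on ball 0 (e / 2)"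
    using F by (rule holomorphic_uniform_limit[rotated])
      (auto intro!: always_eventually holomorphic_on_imp_continuous_on
         holomorphic_on_subset[OF hol sub(1)] holomorphic_on_subset[OF hol sub(2)])
  then show "(\<lambda>t. g (line z t u)) field_differentiable at 0"
    using e(1) holomorphic_on_imp_differentiable_at[of _ "ball 0 (e/2)" 0] by auto
qed (rule S)

section \<open>Cylinders over an open set and difference quotients in the last coordinate\<close>

definition cyl :: "nat \<Rightarrow> (nat \<Rightarrow> complex) set \<Rightarrow> complex \<Rightarrow> real \<Rightarrow> (nat \<Rightarrow> complex) set" where
  "cyl n S b R = {z \<in> Cn (Suc n). z(n := 0) \<in> S \<and> cmod (z n - b) < R}"

text \<open>\<open>Cn n\<close> sits inside \<open>Cn (Suc n)\<close> as the points whose coordinate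
  with index \<open>n\<close>, the last one, is 0. Hence \<open>z(n := 0)\<close> plays the role of
  the projection to the first \<open>n\<close> coordinates and \<open>z(n := w)\<close> that of a
  lift.\<close>

lemma drop_in_Cn: "z \<in> Cn (Suc n) \<Longrightarrow> z(n := 0) \<in> Cn n"
  by (auto simp: Cn_def le_less_Suc_eq not_less_eq_eq)

lemma upd_in_Cn: "z \<in> Cn n \<or> z \<in> Cn (Suc n) \<Longrightarrow> z(n := w) \<in> Cn (Suc n)"
  by (auto simp: Cn_def)

lemma Cn_upd_0: "z \<in> Cn n \<Longrightarrow> z(n := 0) = z"
  by (auto simp: Cn_def)

lemma polydisc_Suc: "polydisc (Suc n) a r = cyl n (polydisc n (a(n := 0)) r) (a n) r"
  unfolding polydisc_def cyl_def by (auto simp: less_Suc_eq drop_in_Cn)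

lemma polydisc_cong: "(\<And>i. i < n \<Longrightarrow> a i = b i) \<Longrightarrow> polydisc n a r = polydisc n b r"
  by (auto simp: polydisc_def)

lemma openin_cyl:
  assumes "openin (Cspace n) S"
  shows "openin (Cspace (Suc n)) (cyl n S b R)"
  unfolding openin_Cspace_iff
proof (intro conjI ballI)
  fix z assume z: "z \<in> cyl n S b R"
  then obtain r where r: "r > 0" "polydisc n (z(n := 0)) r \<subseteq> S"
    using assms unfolding openin_Cspace_iff cyl_def by blast
  let ?s = "min r (R - cmod (z n - b))"
  have "?s > 0" using r z by (auto simp: cyl_def)
  moreover have "polydisc (Suc n) z ?s \<subseteq> cyl n S b R"
  proof
    fix w assume w: "w \<in> polydisc (Suc n) z ?s"
    then have "w(n := 0) \<in> polydisc n (z(n := 0)) r"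
      using polydisc_mono[of ?s r n "z(n:=0)"] by (auto simp: polydisc_Suc cyl_def)
    moreover have "cmod (w n - b) < R"
      using w norm_triangle_ineq[of "w n - z n" "z n - b"] by (auto simp: polydisc_Suc cyl_def)
    moreover have "w \<in> Cn (Suc n)" using w polydisc_subset_Cn by blast
    ultimately show "w \<in> cyl n S b R" using r by (auto simp: cyl_def)
  qed
  ultimately show "\<exists>r>0. polydisc (Suc n) z r \<subseteq> cyl n S b R" by blast
qed (auto simp: cyl_def)

lemma line_drop: "(line z t u)(n := 0) = line (z(n := 0)) t (u(n := 0))"
  by (auto simp: line_def)

lemma line_upd: "(line z t u)(n := w) = line (z(n := w)) t (u(n := 0))"
  by (auto simp: line_def)

lemma holo_drop:
  assumes "holo n S f"
  shows "holo (Suc n) (cyl n S b R) (\<lambda>z. f (z(n := 0)))"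
proof (rule holoI)
  fix z assume z: "z \<in> cyl n S b R"
  then have z0: "z(n := 0) \<in> S" by (simp add: cyl_def)
  obtain r M where r: "r > 0" "polydisc n (z(n := 0)) r \<subseteq> S"
      "\<And>w. w \<in> polydisc n (z(n := 0)) r \<Longrightarrow> cmod (f w) \<le> M"
    using holo_bounded_near[OF assms z0] by metis
  then show "\<exists>r>0. \<exists>M. \<forall>w\<in>polydisc (Suc n) z r. cmod (f (w(n := 0))) \<le> M"
    by (intro exI[of _ r]) (auto simp: polydisc_Suc cyl_def)
  fix u assume "u \<in> Cn (Suc n)"
  then show "(\<lambda>t. f ((line z t u)(n := 0))) field_differentiable at 0"
    using holo_differentiable[OF assms z0 drop_in_Cn] by (simp add: line_drop)
qed (intro openin_cyl holo_openin[OF assms])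

lemma holo_slice:
  assumes g: "holo (Suc n) (cyl n S b R) g" and S: "openin (Cspace n) S" and w: "cmod (w - b) < R"
  shows "holo n S (\<lambda>z. g (z(n := w)))"
proof (rule holoI)
  fix z assume z: "z \<in> S"
  have zC: "z \<in> Cn n" using S z openin_Cspace_iff by blast
  have z1: "z(n := w) \<in> cyl n S b R"
    using z zC w by (auto simp: cyl_def upd_in_Cn Cn_upd_0)
  obtain r M where r: "r > 0" "polydisc (Suc n) (z(n := w)) r \<subseteq> cyl n S b R"
      "\<And>y. y \<in> polydisc (Suc n) (z(n := w)) r \<Longrightarrow> cmod (g y) \<le> M"
    using holo_bounded_near[OF g z1] by metis
  have "y(n := w) \<in> polydisc (Suc n) (z(n := w)) r" if "y \<in> polydisc n z r" for y
    using that r(1) upd_in_Cn by (auto simp: polydisc_def less_Suc_eq)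
  then show "\<exists>r>0. \<exists>M. \<forall>y\<in>polydisc n z r. cmod (g (y(n := w))) \<le> M"
    using r by blast
  fix u assume u: "u \<in> Cn n"
  then have "(\<lambda>t. g (line (z(n := w)) t u)) field_differentiable at 0"
    by (intro holo_differentiable[OF g z1]) (auto simp: Cn_def)
  moreover have "line (z(n := w)) t u = (line z t u)(n := w)" for t
    using u by (auto simp: line_def Cn_def)
  ultimately show "(\<lambda>t. g ((line z t u)(n := w))) field_differentiable at 0" by simp
qed (rule S)

lemma holo_section:
  assumes g: "holo (Suc n) (cyl n S b R) g" and z: "z \<in> S" "z \<in> Cn n"
  shows "(\<lambda>w. g (z(n := w))) holomorphic_on ball b R"
proof -
  have l: "line z w ((\<lambda>_. 0)(n := 1)) = z(n := w)" for w
    using z by (auto simp: line_def Cn_def)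
  have "(\<lambda>w. g (line z w ((\<lambda>_. 0)(n := 1)))) holomorphic_on ball b R"
    using z by (intro holo_line[OF g])
      (auto simp: l Cn_def cyl_def dist_norm norm_minus_commute Cn_upd_0)
  then show ?thesis by (simp add: l)
qed

text \<open>The quotient in the division of \<open>g\<close> by \<open>z n - b\<close>, the
  remainder being the restriction of \<open>g\<close> to \<open>z n = b\<close>; the derivative
  fills the removable singularity. The \<open>d\<close>-th iterate is the quotient in the division
  by \<open>(z n - b) ^ d\<close>, and the restrictions of the iterates to \<open>z n = b\<close>
  are the Taylor coefficients in the last coordinate.\<close>

definition slope :: "nat \<Rightarrow> complex \<Rightarrow> ((nat \<Rightarrow> complex) \<Rightarrow> complex) \<Rightarrow> (nat \<Rightarrow> complex) \<Rightarrow> complex" where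
  "slope n b g z = (if z n = b then deriv (\<lambda>w. g (z(n := w))) b
     else (g z - g (z(n := b))) / (z n - b))"

lemma slope_eq: "g z = g (z(n := b)) + (z n - b) * slope n b g z"
  by (auto simp: slope_def fun_upd_idem)

lemma slope_section_holomorphic:
  assumes g: "holo (Suc n) (cyl n S b R) g" and z: "z \<in> S" "z \<in> Cn n" and R: "R > 0"
  shows "(\<lambda>w. slope n b g (z(n := w))) holomorphic_on ball b R"
proof -
  have "(\<lambda>w. if w = b then deriv (\<lambda>w. g (z(n := w))) b
      else (g (z(n := w)) - g (z(n := b))) / (w - b)) holomorphic_on ball b R"
    using R by (intro pole_lemma holo_section[OF g z]) auto
  then show ?thesis by (simp add: slope_def cong: if_cong)
qed

text \<open>Off the hyperplane \<open>z n = b\<close> this is \<open>schwarz_difference\<close> on a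
  vertical section; on it, the value is a limit. The bound holds on the same cylinder, so
  \<open>slope\<close> can be iterated without shrinking, at the cost of a factor
  \<open>2 / R\<close> each time.\<close>

lemma slope_bound:
  assumes g: "holo (Suc n) (cyl n S b R) g" and M: "\<And>z. z \<in> cyl n S b R \<Longrightarrow> cmod (g z) \<le> M"
    and z: "z \<in> cyl n S b R"
  shows "cmod (slope n b g z) \<le> 2 * M / R"
proof -
  have R: "R > 0" using z by (auto simp: cyl_def) (metis norm_ge_zero order.strict_trans1)
  define y where "y = z(n := 0)"
  have y: "y \<in> S" "y \<in> Cn n" using z drop_in_Cn by (auto simp: y_def cyl_def)
  have inD: "y(n := w) \<in> cyl n S b R" if "cmod (w - b) < R" for w
    using that y by (auto simp: cyl_def upd_in_Cn Cn_upd_0)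
  have off: "cmod (slope n b g (y(n := w))) \<le> 2 * M / R" if w: "cmod (w - b) < R" "w \<noteq> b" for w
  proof -
    have "cmod (g (y(n := b + (w - b))) - g (y(n := b + 0))) \<le> 2 * M / R * cmod (w - b)"
    proof (rule schwarz_difference[where h = "\<lambda>t. g (y(n := b + t))"])
      show "(\<lambda>t. g (y(n := b + t))) holomorphic_on ball 0 R"
        by (rule holomorphic_on_compose_gen[OF _ holo_section[OF g y], unfolded o_def])
          (auto intro!: holomorphic_intros simp: dist_norm)
    qed (use R w M inD in auto)
    then show ?thesis using w(2)
      by (simp add: slope_def norm_divide divide_le_eq)
  qed
  show ?thesis
  proof (cases "z n = b")
    case False
    have "cmod (z n - b) < R" using z by (auto simp: cyl_def)
    then show ?thesis using off[OF _ False] by (simp add: y_def)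
  next
    case True
    have "isCont (\<lambda>w. slope n b g (y(n := w))) b"
      using holomorphic_on_imp_continuous_on[OF slope_section_holomorphic[OF g y R]] R
      by (simp add: continuous_on_eq_continuous_at)
    then have "((\<lambda>w. cmod (slope n b g (y(n := w)))) \<longlongrightarrow> cmod (slope n b g (y(n := b)))) (at b)"
      by (intro tendsto_norm) (simp add: isCont_def)
    moreover have "eventually (\<lambda>w. cmod (slope n b g (y(n := w))) \<le> 2 * M / R) (at b)"
      using R off by (auto simp: eventually_at dist_norm)
    ultimately have "cmod (slope n b g (y(n := b))) \<le> 2 * M / R"
      by (rule tendsto_upperbound) simp
    then show ?thesis using True by (auto simp: y_def)
  qed
qed

text \<open>The Schwarz estimate a second time, now for a section of \<open>slope\<close> with its
  bound \<open>2 * M / R\<close>. The constant does not depend on the point of the base, which gives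
  the uniform convergence and the continuity across \<open>z n = b\<close> used in
  \<open>holo_slope\<close>.\<close>

lemma slope_lipschitz:
  assumes g: "holo (Suc n) (cyl n S b R) g" and M: "\<And>z. z \<in> cyl n S b R \<Longrightarrow> cmod (g z) \<le> M"
    and z: "z \<in> cyl n S b R" and w: "cmod (w - b) < R"
  shows "cmod (slope n b g (z(n := w)) - slope n b g (z(n := b))) \<le> 4 * M / (R * R) * cmod (w - b)"
proof -
  have R: "R > 0" using z by (auto simp: cyl_def) (metis norm_ge_zero order.strict_trans1)
  define y where "y = z(n := 0)"
  have y: "y \<in> S" "y \<in> Cn n" using z drop_in_Cn by (auto simp: y_def cyl_def)
  have inD: "y(n := w) \<in> cyl n S b R" if "cmod (w - b) < R" for w
    using that y by (auto simp: cyl_def upd_in_Cn Cn_upd_0)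
  have "cmod (slope n b g (y(n := b + (w - b))) - slope n b g (y(n := b + 0)))
      \<le> 2 * (2 * M / R) / R * cmod (w - b)"
  proof (rule schwarz_difference[where h = "\<lambda>t. slope n b g (y(n := b + t))"])
    show "(\<lambda>t. slope n b g (y(n := b + t))) holomorphic_on ball 0 R"
      by (rule holomorphic_on_compose_gen[OF _ slope_section_holomorphic[OF g y R], unfolded o_def])
        (auto intro!: holomorphic_intros simp: dist_norm)
    show "cmod (slope n b g (y(n := b + t))) \<le> 2 * M / R" if "cmod t < R" for t
      using that by (intro slope_bound[OF g M] inD) auto
  qed (use R w in auto)
  then show ?thesis by (simp add: y_def)
qed

text \<open>Off the hyperplane \<open>z n = b\<close> the function is a quotient of differentiable
  ones. At a point on it, a direction \<open>u\<close> is compared with its tangential part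
  \<open>u(n := 0)\<close>: the tangential line stays in the hyperplane, while the given one meets
  it only at \<open>t = 0\<close> unless \<open>u n = 0\<close>.\<close>

lemma holo_slope:
  assumes g: "holo (Suc n) (cyl n S b R) g" and S: "openin (Cspace n) S"
    and M: "\<And>z. z \<in> cyl n S b R \<Longrightarrow> cmod (g z) \<le> M"
  shows "holo (Suc n) (cyl n S b R) (slope n b g)"
proof (rule holoI)
  show op: "openin (Cspace (Suc n)) (cyl n S b R)" by (rule openin_cyl[OF S])
  fix z assume z: "z \<in> cyl n S b R"
  have R: "R > 0" using z by (auto simp: cyl_def) (metis norm_ge_zero order.strict_trans1)
  obtain r where r: "r > 0" "polydisc (Suc n) z r \<subseteq> cyl n S b R"
    using op z unfolding openin_Cspace_iff by blast
  then show "\<exists>r>0. \<exists>B. \<forall>w\<in>polydisc (Suc n) z r. cmod (slope n b g w) \<le> B"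
    using slope_bound[OF g M] by blast
  fix u assume u: "u \<in> Cn (Suc n)"
  obtain e where e: "e > 0" "\<And>t. cmod t < e \<Longrightarrow> line z t u \<in> cyl n S b R"
    using line_in_open[OF op z u] by metis
  have upd: "y(n := w) \<in> cyl n S b R" if "y \<in> cyl n S b R" "cmod (w - b) < R" for y w
    using that upd_in_Cn by (auto simp: cyl_def)
  show "(\<lambda>t. slope n b g (line z t u)) field_differentiable at 0"
  proof (cases "z n = b")
    case False
    have "((\<lambda>t. line z t u n) \<longlongrightarrow> line z 0 u n) (at 0)"
      unfolding line_def by (intro tendsto_intros)
    then have "eventually (\<lambda>t. line z t u n \<noteq> b) (at 0)"
      using False by (intro tendsto_imp_eventually_ne[where c = "z n"]) auto
    then obtain d where d: "d > 0" "\<And>t. t \<noteq> 0 \<Longrightarrow> cmod t < d \<Longrightarrow> line z t u n \<noteq> b"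
      by (auto simp: eventually_at dist_norm)
    have zb: "z(n := b) \<in> cyl n S b R" using upd[OF z] R by simp
    have "(\<lambda>t. (g (line z t u) - g (line (z(n := b)) t (u(n := 0)))) / (z n + t * u n - b))
        field_differentiable at 0"
      using False u by (intro derivative_intros holo_differentiable[OF g] z zb)
        (auto simp: upd_in_Cn)
    moreover have "(g (line z t u) - g (line (z(n := b)) t (u(n := 0)))) / (z n + t * u n - b)
        = slope n b g (line z t u)" if "dist t 0 < d" for t
    proof -
      have "line z t u n \<noteq> b" using d(2)[of t] that False by (cases "t = 0") auto
      then show ?thesis by (simp add: slope_def line_upd[symmetric]) (simp add: line_def)
    qed
    ultimately show ?thesis
      by (rule field_differentiable_transform_within[OF d(1) UNIV_I, rotated]) auto
  next
    case zn: True
    let ?v = "u(n := 0)"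
    have v: "?v \<in> Cn (Suc n)" using u upd_in_Cn by auto
    have lb: "(line z t u)(n := b) = line z t ?v" for t
      using zn by (auto simp: line_def)
    have lv: "line z t ?v \<in> cyl n S b R" if "cmod t < e" for t
      using upd[OF e(2)[OF that], of b] R by (simp add: lb)
    \<comment> \<open>Inside the hyperplane \<open>slope\<close> is the derivative in the last
      coordinate. It is the uniform limit, as \<open>w\<close> tends to \<open>b\<close>, of
      difference quotients with step \<open>w - b\<close>, and these are holomorphic in
      \<open>t\<close>.\<close>
    have tang: "(\<lambda>t. slope n b g (line z t ?v)) holomorphic_on ball 0 (e / 2)"
    proof (rule holomorphic_uniform_limit[where F = "at b" and z = 0 and r = "e / 2"])
      have "(\<lambda>t. slope n b g ((line z t ?v)(n := w))) holomorphic_on ball 0 e"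
        if w: "w \<noteq> b" "cmod (w - b) < R" for w
      proof -
        have "(\<lambda>t. (g (line (z(n := w)) t ?v) - g (line z t ?v)) / (w - b)) holomorphic_on ball 0 e"
          using w v lv upd[OF lv w(2)]
          by (intro holomorphic_intros holo_line[OF g]) (auto simp: line_upd)
        moreover have "slope n b g ((line z t ?v)(n := w))
            = (g (line (z(n := w)) t ?v) - g (line z t ?v)) / (w - b)" for t
        proof -
          have "(line z t ?v)(n := w) = line (z(n := w)) t ?v" "(line z t ?v)(n := b) = line z t ?v"
            using zn by (auto simp: line_def)
          then show ?thesis using w by (metis slope_def fun_upd_same fun_upd_upd)
        qed
        ultimately show ?thesis by simp
      qed
      moreover have "eventually (\<lambda>w. w \<noteq> b \<and> cmod (w - b) < R) (at b)"
        using R by (auto simp: eventually_at dist_norm)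
      moreover have "cball 0 (e / 2) \<subseteq> ball (0::complex) e" "ball 0 (e / 2) \<subseteq> ball (0::complex) e"
        using e(1) by auto
      ultimately show "eventually (\<lambda>w. continuous_on (cball 0 (e/2)) (\<lambda>t. slope n b g ((line z t ?v)(n := w))) \<and>
          (\<lambda>t. slope n b g ((line z t ?v)(n := w))) holomorphic_on ball 0 (e/2)) (at b)"
        by (smt (verit, ccfv_SIG) eventually_mono holomorphic_on_imp_continuous_on holomorphic_on_subset)
      show "uniform_limit (cball 0 (e/2)) (\<lambda>w t. slope n b g ((line z t ?v)(n := w)))
          (\<lambda>t. slope n b g (line z t ?v)) (at b)"
      proof (rule uniform_limitI)
        fix d :: real assume d: "d > 0"
        have "((\<lambda>w. 4 * M / (R * R) * cmod (w - b)) \<longlongrightarrow> 4 * M / (R * R) * cmod (b - b)) (at b)"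
          by (intro tendsto_intros)
        then have "eventually (\<lambda>w. 4 * M / (R * R) * cmod (w - b) < d) (at b)"
          using d by (intro order_tendstoD(2)) auto
        moreover have "eventually (\<lambda>w. cmod (w - b) < R) (at b)"
          using R by (auto simp: eventually_at dist_norm)
        ultimately show "eventually (\<lambda>w. \<forall>t\<in>cball 0 (e/2).
            dist (slope n b g ((line z t ?v)(n := w))) (slope n b g (line z t ?v)) < d) (at b)"
        proof eventually_elim
          case (elim w)
          show ?case
          proof
            fix t :: complex assume "t \<in> cball 0 (e/2)"
            then have t: "cmod t < e" using e(1) by auto
            have "(line z t ?v)(n := b) = line z t ?v" using zn by (auto simp: line_def)
            then show "dist (slope n b g ((line z t ?v)(n := w))) (slope n b g (line z t ?v)) < d"
              using slope_lipschitz[OF g M lv[OF t] elim(2)] elim(1) by (simp add: dist_norm)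
          qed
        qed
      qed
    qed (use e in auto)
    have tang0: "isCont (\<lambda>t. slope n b g (line z t ?v)) 0"
      and tangd: "(\<lambda>t. slope n b g (line z t ?v)) field_differentiable at 0"
      using tang e(1) by (auto intro!: field_differentiable_imp_continuous_at
        holomorphic_on_imp_differentiable_at[of _ "ball 0 (e/2)"])
    show ?thesis
    proof (cases "u n = 0")
      case True
      then show ?thesis using tangd by (simp add: fun_upd_idem)
    next
      case un: False
      \<comment> \<open>Along the slanted line \<open>z n - b\<close> equals \<open>t * u n\<close>,
        so for \<open>t \<noteq> 0\<close> the slope is \<open>k t / (t * u n)\<close>. As
        \<open>k 0 = 0\<close>, the singularity of \<open>k t / t\<close> is removable and
        \<open>G\<close> fills it; what remains is that the actual value at \<open>t = 0\<close> is
        the filled one.\<close>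
      define k where "k = (\<lambda>t. g (line z t u) - g (line z t ?v))"
      define G where "G = (\<lambda>t. if t = 0 then deriv k 0 else (k t - k 0) / (t - 0))"
      have "k holomorphic_on ball 0 e"
        unfolding k_def using e lv u v by (intro holomorphic_intros holo_line[OF g]) auto
      then have G: "G holomorphic_on ball 0 e"
        unfolding G_def using e by (intro pole_lemma) auto
      have BG: "slope n b g (line z t u) = G t / u n" if "t \<noteq> 0" for t
      proof -
        have "line z t u n = b + t * u n" using zn by (simp add: line_def)
        then show ?thesis using that un by (simp add: slope_def G_def k_def lb)
      qed
      \<comment> \<open>The Lipschitz bound in the last coordinate compares the slanted with the
        tangential line; continuity along the latter identifies the limit at 0 with the value
        there.\<close>
      have "((\<lambda>t. slope n b g (line z t u) - slope n b g (line z t ?v)) \<longlongrightarrow> 0) (at 0)"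
      proof (rule Lim_null_comparison)
        have "((\<lambda>t. line z t u n - b) \<longlongrightarrow> line z 0 u n - b) (at 0)"
          unfolding line_def by (intro tendsto_intros)
        then have "((\<lambda>t. cmod (line z t u n - b)) \<longlongrightarrow> 0) (at 0)"
          using zn by (simp add: tendsto_norm_zero)
        then show "((\<lambda>t. 4 * M / (R * R) * cmod (line z t u n - b)) \<longlongrightarrow> 0) (at 0)"
          by (rule tendsto_mult_right_zero)
        have "cmod (slope n b g (line z t u) - slope n b g (line z t ?v)) \<le> 4 * M / (R * R) * cmod (line z t u n - b)"
          if "cmod t < e" for t
          using slope_lipschitz[OF g M e(2)[OF that], of "line z t u n"] e(2)[OF that]
          by (auto simp: lb cyl_def)
        then show "eventually (\<lambda>t. norm (slope n b g (line z t u) - slope n b g (line z t ?v))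
            \<le> 4 * M / (R * R) * cmod (line z t u n - b)) (at 0)"
          using e(1) by (auto simp: eventually_at dist_norm)
      qed
      from tendsto_add[OF this] tang0
      have "((\<lambda>t. slope n b g (line z t u)) \<longlongrightarrow> slope n b g (line z 0 ?v)) (at 0)"
        unfolding isCont_def by fastforce
      moreover have "((\<lambda>t. slope n b g (line z t u)) \<longlongrightarrow> G 0 / u n) (at 0)"
      proof (rule Lim_transform_eventually)
        have "isCont G 0"
          using G e(1) by (auto intro!: field_differentiable_imp_continuous_at
            holomorphic_on_imp_differentiable_at[of _ "ball 0 e"])
        then show "((\<lambda>t. G t / u n) \<longlongrightarrow> G 0 / u n) (at 0)"
          using un unfolding isCont_def by (intro tendsto_intros)
        show "eventually (\<lambda>t. G t / u n = slope n b g (line z t u)) (at 0)"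
          using BG by (auto simp: eventually_at_filter)
      qed
      ultimately have "slope n b g z = G 0 / u n"
        using tendsto_unique[of "at (0::complex)"] by force
      then have "slope n b g (line z t u) = G t / u n" for t
        using BG by (cases "t = 0") auto
      moreover have "(\<lambda>t. G t / u n) field_differentiable at 0"
        using G e(1) un by (intro derivative_intros holomorphic_on_imp_differentiable_at[of _ "ball 0 e"]) auto
      ultimately show ?thesis by simp
    qed
  qed
qed

section \<open>Power series expansion and its equivalence with holomorphy along lines\<close>

definition multiindices :: "nat \<Rightarrow> (nat \<Rightarrow> nat) set" where
  "multiindices n = {\<alpha>. \<forall>i\<ge>n. \<alpha> i = 0}"

lemma bij_betw_multiindices_Suc:
  "bij_betw (\<lambda>(k, \<alpha>). \<alpha>(n := k)) (UNIV \<times> multiindices n) (multiindices (Suc n))"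
  by (rule bij_betw_byWitness[where f' = "\<lambda>\<beta>. (\<beta> n, \<beta>(n := 0))"])
    (auto simp: multiindices_def fun_eq_iff le_less_Suc_eq not_less_eq_eq)

lemma prod_upd_Suc:
  "(\<Prod>i<Suc n. x i ^ ((\<alpha>(n := k)) i)) = (\<Prod>i<n. x i ^ \<alpha> i) * (x n :: 'a::comm_monoid_mult) ^ k"
  by (simp add: prod.lessThan_Suc)

lemma summable_geometric_multi:
  fixes x :: "nat \<Rightarrow> real"
  assumes "\<And>i. i < n \<Longrightarrow> 0 \<le> x i \<and> x i < 1"
  shows "(\<lambda>\<alpha>. \<Prod>i<n. x i ^ \<alpha> i) summable_on multiindices n"
  using assms
proof (induction n)
  case 0
  have "multiindices 0 = {\<lambda>_. 0}" by (auto simp: multiindices_def)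
  then show ?case by simp
next
  case (Suc n)
  have IH: "(\<lambda>\<alpha>. \<Prod>i<n. x i ^ \<alpha> i) summable_on multiindices n"
    using Suc by auto
  have xn: "0 \<le> x n" "x n < 1" using Suc.prems by auto
  have nn: "(\<Prod>i<n. x i ^ \<alpha> i) \<ge> 0" for \<alpha>
    using Suc.prems by (intro prod_nonneg) auto
  let ?f = "\<lambda>(k, \<alpha>). (\<Prod>i<n. x i ^ \<alpha> i) * x n ^ k"
  have f: "(\<lambda>q. norm (?f q)) summable_on UNIV \<times> multiindices n"
    unfolding Infinite_Sum.abs_summable_on_Sigma_iff
  proof (intro conjI ballI)
    fix k
    show "(\<lambda>\<alpha>. norm (?f (k, \<alpha>))) summable_on multiindices n"
      using nn xn IH by (simp add: abs_mult summable_on_cmult_left)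
    have "(\<lambda>k. infsum (\<lambda>\<alpha>. \<Prod>i<n. x i ^ \<alpha> i) (multiindices n) * x n ^ k) summable_on UNIV"
      using xn by (intro summable_on_cmult_right norm_summable_imp_summable_on)
        (simp add: summable_geometric norm_power)
    then show "(\<lambda>k. norm (infsum (\<lambda>\<alpha>. norm (?f (k, \<alpha>))) (multiindices n))) summable_on UNIV"
      using nn xn by (simp add: abs_mult infsum_cmult_left' infsum_nonneg)
  qed
  then have "(\<lambda>q. \<Prod>i<Suc n. x i ^ ((\<lambda>(k, \<alpha>). \<alpha>(n := k)) q) i) summable_on UNIV \<times> multiindices n"
  proof -
    have "(\<Prod>i<Suc n. x i ^ ((\<lambda>(k, \<alpha>). \<alpha>(n := k)) q) i) = ?f q" for q
      by (cases q) (simp only: prod.case prod_upd_Suc)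
    then show ?thesis using abs_summable_summable[OF f] by (simp only:)
  qed
  then show ?case
    by (subst (asm) summable_on_reindex_bij_betw[OF bij_betw_multiindices_Suc])
qed

text \<open>Taylor expansion in the last coordinate by iterated \<open>slope\<close>, each
  coefficient being expanded by the induction hypothesis. The bounds carry \<open>2 / R\<close> in
  place of the \<open>1 / R\<close> of Cauchy's inequalities, the price of the Schwarz estimate;
  therefore convergence is obtained on half the radius.\<close>

lemma holo_power_series:
  assumes "holo n (polydisc n a R) f" and "\<And>z. z \<in> polydisc n a R \<Longrightarrow> cmod (f z) \<le> M" and R: "R > 0"
  shows "\<exists>c. (\<forall>\<alpha>\<in>multiindices n. cmod (c \<alpha>) \<le> M * (\<Prod>i<n. (2 / R) ^ \<alpha> i)) \<and>
    (\<forall>z\<in>polydisc n a (R / 2).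
      ((\<lambda>\<alpha>. c \<alpha> * (\<Prod>i<n. (z i - a i) ^ \<alpha> i)) has_sum f z) (multiindices n))"
  using assms(1,2)
proof (induction n arbitrary: f M a)
  case 0
  have "multiindices 0 = {\<lambda>_. 0}" by (auto simp: multiindices_def)
  moreover have "polydisc 0 a r = {\<lambda>_. 0}" for a r by (auto simp: polydisc_def Cn_def)
  moreover have "((\<lambda>_. f (\<lambda>_. 0)) has_sum f (\<lambda>_. 0)) {\<lambda>_::nat. 0::nat}"
    using has_sum_finite[of "{\<lambda>_::nat. 0::nat}" "\<lambda>_. f (\<lambda>_. 0)"] by simp
  ultimately show ?case using 0 by (intro exI[of _ "\<lambda>_. f (\<lambda>_. 0)"]) auto
next
  case (Suc n)
  define b where "b = a n"
  define S where "S = polydisc n a R"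
  have cyl: "polydisc (Suc n) a r = cyl n (polydisc n a r) b r" for r
    unfolding polydisc_Suc b_def by (metis fun_upd_other nat_neq_iff polydisc_cong)
  have S: "openin (Cspace n) S" "S \<subseteq> Cn n"
    by (auto simp: S_def openin_polydisc polydisc_subset_Cn)
  \<comment> \<open>\<open>g k (z(n := b))\<close> is the coefficient of
    \<open>(z n - b) ^ k\<close>, a function of the first \<open>n\<close> coordinates bounded by
    \<open>M * (2 / R) ^ k\<close>.\<close>
  define g where "g = (\<lambda>k. (slope n b ^^ k) f)"
  have g: "holo (Suc n) (cyl n S b R) (g k) \<and> (\<forall>z\<in>cyl n S b R. cmod (g k z) \<le> M * (2 / R) ^ k)" for k
  proof (induction k)
    case 0
    then show ?case using Suc.prems by (simp add: g_def cyl S_def)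
  next
    case (Suc k)
    have gS: "g (Suc k) = slope n b (g k)" by (simp add: g_def)
    have "cmod (slope n b (g k) z) \<le> 2 * (M * (2 / R) ^ k) / R" if "z \<in> cyl n S b R" for z
      using Suc that by (intro slope_bound) auto
    moreover have "holo (Suc n) (cyl n S b R) (slope n b (g k))"
      using Suc S by (intro holo_slope[where M = "M * (2 / R) ^ k"]) auto
    ultimately show ?case unfolding gS by (simp add: field_simps)
  qed
  have fk: "holo n S (\<lambda>z. g k (z(n := b)))" for k
    using g S R by (intro holo_slice) auto
  have fkb: "cmod (g k (z(n := b))) \<le> M * (2 / R) ^ k" if "z \<in> S" for z k
  proof -
    have "z(n := b) \<in> cyl n S b R" using that S R by (auto simp: cyl_def upd_in_Cn Cn_upd_0 subsetD)
    then show ?thesis using g by blast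
  qed
  define P where "P k c \<longleftrightarrow> (\<forall>\<alpha>\<in>multiindices n. cmod (c \<alpha>) \<le> M * (2 / R) ^ k * (\<Prod>i<n. (2 / R) ^ \<alpha> i)) \<and>
    (\<forall>z\<in>polydisc n a (R / 2).
      ((\<lambda>\<alpha>. c \<alpha> * (\<Prod>i<n. (z i - a i) ^ \<alpha> i)) has_sum g k (z(n := b))) (multiindices n))" for k c
  have "\<exists>c. P k c" for k
    using fk fkb unfolding S_def P_def
    by (intro Suc.IH[where f = "\<lambda>z. g k (z(n := b))" and M = "M * (2 / R) ^ k"])
  then obtain c where c: "\<And>k. P k (c k)"
    by metis
  have c1: "cmod (c k \<alpha>) \<le> M * (2 / R) ^ k * (\<Prod>i<n. (2 / R) ^ \<alpha> i)" if "\<alpha> \<in> multiindices n" for k \<alpha>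
    using c that unfolding P_def by blast
  have c2: "((\<lambda>\<alpha>. c k \<alpha> * (\<Prod>i<n. (z i - a i) ^ \<alpha> i)) has_sum g k (z(n := b))) (multiindices n)"
    if "z \<in> polydisc n a (R / 2)" for k z
    using c that unfolding P_def by blast
  define C where "C = (\<lambda>\<beta>. c (\<beta> n) (\<beta>(n := 0)))"
  have Cc: "C (\<alpha>(n := k)) = c k \<alpha>" if "\<alpha> \<in> multiindices n" for \<alpha> k
    using that by (auto simp: C_def multiindices_def fun_upd_idem)
  show ?case
  proof (intro exI[of _ C] conjI ballI)
    fix \<beta> assume \<beta>: "\<beta> \<in> multiindices (Suc n)"
    then have "\<beta>(n := 0) \<in> multiindices n"
      by (auto simp: multiindices_def le_less_Suc_eq not_less_eq_eq)
    from c1[OF this, of "\<beta> n"] show "cmod (C \<beta>) \<le> M * (\<Prod>i<Suc n. (2 / R) ^ \<beta> i)"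
      by (simp add: C_def mult_ac prod.lessThan_Suc)
  next
    fix z assume z: "z \<in> polydisc (Suc n) a (R / 2)"
    have z0: "z(n := 0) \<in> polydisc n a (R / 2)" and zn: "cmod (z n - b) < R / 2"
      using z by (auto simp: cyl cyl_def)
    have zS: "z \<in> cyl n S b R"
      using z polydisc_mono[of "R/2" R "Suc n" a] R by (auto simp: cyl[symmetric] S_def)
    have M0: "M \<ge> 0" using g[of 0] zS by (metis mult.right_neutral norm_ge_zero order.trans power_0)
    let ?F = "\<lambda>\<alpha>. C \<alpha> * (\<Prod>i<Suc n. (z i - a i) ^ \<alpha> i)"
    let ?F2 = "\<lambda>(k, \<alpha>). c k \<alpha> * (\<Prod>i<n. (z i - a i) ^ \<alpha> i) * (z n - b) ^ k"
    \<comment> \<open>On the half polydisc these ratios are below 1, so a multiple of the geometric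
      series in \<open>q\<close> majorizes the expansion. Absolute summability allows the sum over
      all multi-indices to be taken first over \<open>\<alpha>\<close> and then over
      \<open>k\<close>.\<close>
    define q where "q = (\<lambda>i. 2 * cmod (z i - a i) / R)"
    have q: "0 \<le> q i \<and> q i < 1" if "i < Suc n" for i
      using z that R by (auto simp: q_def polydisc_def field_simps)
    have F12: "?F ((\<lambda>(k, \<alpha>). \<alpha>(n := k)) p) = ?F2 p" if "p \<in> UNIV \<times> multiindices n" for p
      using that by (auto simp: Cc b_def prod.lessThan_Suc mult_ac)
    have F2b: "cmod (?F2 (k, \<alpha>)) \<le> cmod (of_real (M * (\<Prod>i<Suc n. q i ^ (\<alpha>(n := k)) i)))"
      if "\<alpha> \<in> multiindices n" for k \<alpha>
    proof -
      have "cmod (?F2 (k, \<alpha>)) = cmod (c k \<alpha>) * (\<Prod>i<n. cmod (z i - a i) ^ \<alpha> i) * cmod (z n - b) ^ k"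
        by (simp add: norm_mult norm_power prod_norm[symmetric])
      also have "\<dots> \<le> M * (2 / R) ^ k * (\<Prod>i<n. (2 / R) ^ \<alpha> i) * (\<Prod>i<n. cmod (z i - a i) ^ \<alpha> i) * cmod (z n - b) ^ k"
        by (intro mult_right_mono c1 that prod_nonneg) auto
      also have "\<dots> = M * ((\<Prod>i<n. (2 / R * cmod (z i - a i)) ^ \<alpha> i) * (2 / R * cmod (z n - b)) ^ k)"
        by (simp only: prod.distrib power_mult_distrib mult_ac)
      also have "\<dots> = M * (\<Prod>i<Suc n. q i ^ (\<alpha>(n := k)) i)"
        unfolding prod_upd_Suc by (simp add: q_def b_def)
      finally show ?thesis by (simp only: norm_of_real)
    qed
    have "(\<lambda>\<beta>. M * (\<Prod>i<Suc n. q i ^ \<beta> i)) summable_on multiindices (Suc n)"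
      using q by (intro summable_on_cmult_right summable_geometric_multi) auto
    then have "(\<lambda>p. M * (\<Prod>i<Suc n. q i ^ ((\<lambda>(k, \<alpha>). \<alpha>(n := k)) p) i)) summable_on UNIV \<times> multiindices n"
      by (subst summable_on_reindex_bij_betw[OF bij_betw_multiindices_Suc])
    then have "(\<lambda>p. cmod (of_real (M * (\<Prod>i<Suc n. q i ^ ((\<lambda>(k, \<alpha>). \<alpha>(n := k)) p) i))))
        summable_on UNIV \<times> multiindices n"
      by (subst (asm) summable_on_iff_abs_summable_on_real) (simp only: norm_of_real real_norm_def)
    then have "(\<lambda>p. cmod (?F2 p)) summable_on UNIV \<times> multiindices n"
      by (rule Infinite_Sum.abs_summable_on_comparison_test) (use F2b in auto)
    then have "?F2 summable_on UNIV \<times> multiindices n" by (rule abs_summable_summable)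
    then obtain T where T: "(?F2 has_sum T) (UNIV \<times> multiindices n)"
      by (auto simp: summable_on_def)
    have inner: "((\<lambda>\<alpha>. ?F2 (k, \<alpha>)) has_sum (g k (z(n := b)) * (z n - b) ^ k)) (multiindices n)" for k
    proof -
      have "((\<lambda>\<alpha>. c k \<alpha> * (\<Prod>i<n. ((z(n := 0)) i - a i) ^ \<alpha> i)) has_sum g k ((z(n := 0))(n := b))) (multiindices n)"
        by (rule c2[OF z0])
      then show ?thesis using has_sum_cmult_left by fastforce
    qed
    have "((\<lambda>k. g k (z(n := b)) * (z n - b) ^ k) has_sum T) UNIV"
      by (rule has_sum_Sigma[OF _ T inner]) (simp add: uniformly_continuous_on_add)
    moreover have "(\<lambda>k. g k (z(n := b)) * (z n - b) ^ k) sums f z"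
    proof -
      \<comment> \<open>Finite Taylor formula. The modulus of the remainder is at most
        \<open>M * q n ^ N\<close> and tends to 0, so the iterated sum is \<open>f z\<close> and not
        merely some limit.\<close>
      have part: "f z = (\<Sum>k<N. g k (z(n := b)) * (z n - b) ^ k) + (z n - b) ^ N * g N z" for N
      proof (induction N)
        case (Suc N)
        have "g N z = g N (z(n := b)) + (z n - b) * g (Suc N) z"
          unfolding g_def funpow.simps o_def by (rule slope_eq)
        then have "(z n - b) ^ N * g N z = (z n - b) ^ N * (g N (z(n := b)) + (z n - b) * g (Suc N) z)"
          by (simp only:)
        also have "\<dots> = g N (z(n := b)) * (z n - b) ^ N + (z n - b) ^ Suc N * g (Suc N) z"
          by (simp only: distrib_left power_Suc mult_ac)
        finally show ?case using Suc by (simp only: sum.lessThan_Suc add.assoc)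
      qed (simp add: g_def)
      have "(\<lambda>N. (z n - b) ^ N * g N z) \<longlonglongrightarrow> 0"
      proof (rule Lim_null_comparison)
        show "eventually (\<lambda>N. norm ((z n - b) ^ N * g N z) \<le> M * q n ^ N) sequentially"
        proof (intro always_eventually allI)
          fix N
          have "norm ((z n - b) ^ N * g N z) \<le> cmod (z n - b) ^ N * (M * (2 / R) ^ N)"
            using g zS by (auto simp: norm_mult norm_power intro!: mult_left_mono)
          also have "\<dots> = M * q n ^ N"
            by (simp add: q_def b_def power_mult_distrib power_divide)
          finally show "norm ((z n - b) ^ N * g N z) \<le> M * q n ^ N" .
        qed
        show "(\<lambda>N. M * q n ^ N) \<longlonglongrightarrow> 0"
          using q[of n] by (intro tendsto_mult_right_zero LIMSEQ_realpow_zero) auto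
      qed
      from tendsto_diff[OF tendsto_const this, of "f z"]
      have "(\<lambda>N. f z - (z n - b) ^ N * g N z) \<longlonglongrightarrow> f z" by simp
      moreover have "(\<lambda>N. f z - (z n - b) ^ N * g N z) = (\<lambda>N. \<Sum>k<N. g k (z(n := b)) * (z n - b) ^ k)"
        using part by (simp add: fun_eq_iff) (metis add_diff_cancel_right')
      ultimately show ?thesis by (simp add: sums_def)
    qed
    ultimately have "T = f z"
      using has_sum_imp_sums sums_unique2 by blast
    with T have "((\<lambda>p. ?F ((\<lambda>(k, \<alpha>). \<alpha>(n := k)) p)) has_sum f z) (UNIV \<times> multiindices n)"
      by (subst has_sum_cong[OF F12]) auto
    then show "(?F has_sum f z) (multiindices (Suc n))"
      by (subst (asm) has_sum_reindex_bij_betw[OF bij_betw_multiindices_Suc])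
  qed
qed

lemma power_series_holo:
  assumes r: "r > 0"
    and f: "\<And>z. z \<in> polydisc n a r \<Longrightarrow>
      ((\<lambda>\<alpha>. c \<alpha> * (\<Prod>i<n. (z i - a i) ^ \<alpha> i)) has_sum f z) (multiindices n)"
  shows "holo n (polydisc n a (r / 2)) f"
proof -
  let ?S = "polydisc n a (r / 2)"
  \<comment> \<open>Each of the first \<open>n\<close> coordinates of this point has distance
    exactly \<open>r / 2\<close> from that of \<open>a\<close>, and the series converges there.
    Unordered summability of complex numbers is absolute, so the terms at \<open>p\<close> majorize
    the terms on the polydisc of radius \<open>r / 2\<close>.\<close>
  define p where "p = (\<lambda>i. if i < n then a i + of_real (r / 2) else 0)"
  have "p \<in> polydisc n a r" using r by (auto simp: p_def polydisc_def Cn_def)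
  from has_sum_imp_summable[OF f[OF this]]
  have "(\<lambda>\<alpha>. cmod (c \<alpha> * (\<Prod>i<n. (p i - a i) ^ \<alpha> i))) summable_on multiindices n"
    unfolding summable_on_iff_abs_summable_on_complex .
  then have sum: "(\<lambda>\<alpha>. cmod (c \<alpha>) * (\<Prod>i<n. (r / 2) ^ \<alpha> i)) summable_on multiindices n"
    using r by (simp add: p_def norm_mult norm_power prod_norm[symmetric])
  have "uniform_limit ?S (\<lambda>X z. \<Sum>\<alpha>\<in>X. c \<alpha> * (\<Prod>i<n. (z i - a i) ^ \<alpha> i)) f
      (finite_subsets_at_top (multiindices n))"
  proof (rule Weierstrass_m_test_general'[OF _ _ sum])
    fix \<alpha> z assume z: "z \<in> ?S"
    have "cmod (c \<alpha> * (\<Prod>i<n. (z i - a i) ^ \<alpha> i)) = cmod (c \<alpha>) * (\<Prod>i<n. cmod (z i - a i) ^ \<alpha> i)"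
      by (simp add: norm_mult norm_power prod_norm[symmetric])
    also have "\<dots> \<le> cmod (c \<alpha>) * (\<Prod>i<n. (r / 2) ^ \<alpha> i)"
      using z by (intro mult_left_mono prod_mono conjI power_mono) (auto simp: polydisc_def less_imp_le)
    finally show "cmod (c \<alpha> * (\<Prod>i<n. (z i - a i) ^ \<alpha> i)) \<le> cmod (c \<alpha>) * (\<Prod>i<n. (r / 2) ^ \<alpha> i)" .
  next
    fix z assume "z \<in> ?S"
    then show "((\<lambda>\<alpha>. c \<alpha> * (\<Prod>i<n. (z i - a i) ^ \<alpha> i)) has_sum f z) (multiindices n)"
      using r polydisc_mono[of "r/2" r n a] by (intro f) auto
  qed
  moreover have "holo n ?S (\<lambda>z. \<Prod>i<m. (z i - a i) ^ \<alpha> i)" for m \<alpha>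
    by (induction m) (auto intro!: holo_const holo_mult holo_power holo_diff holo_coordinate openin_polydisc)
  then have "holo n ?S (\<lambda>z. \<Sum>\<alpha>\<in>X. c \<alpha> * (\<Prod>i<n. (z i - a i) ^ \<alpha> i))" for X
    by (intro holo_sum holo_mult holo_const openin_polydisc)
  ultimately show ?thesis
    using holo_uniform_limit[OF openin_polydisc, where
        f = "\<lambda>X z. \<Sum>\<alpha>\<in>X. c \<alpha> * (\<Prod>i<n. (z i - a i) ^ \<alpha> i)" and
        F = "finite_subsets_at_top (multiindices n)"] finite_subsets_at_top_neq_bot by blast
qed

text \<open>The bridge between the power series in \<open>holomorphic_at\<close>, which define the
  structure sheaf, and the line-wise notion in which the arguments are carried out. Each direction
  gives up a factor 2 in the radius.\<close>

lemma holomorphic_at_iff_holo: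
  assumes a: "a \<in> Cn n"
  shows "holomorphic_at n f a \<longleftrightarrow> (\<exists>r>0. holo n (polydisc n a r) f)"
proof
  assume "holomorphic_at n f a"
  then obtain c r where r: "r > 0" "\<And>z. z \<in> polydisc n a r \<Longrightarrow>
      ((\<lambda>\<alpha>. c \<alpha> * (\<Prod>i<n. (z i - a i) ^ \<alpha> i)) has_sum f z) (multiindices n)"
    unfolding holomorphic_at_def multiindices_def polydisc_def topspace_Cspace by blast
  then show "\<exists>r>0. holo n (polydisc n a r) f"
    using power_series_holo[of r n a c f] by (intro exI[of _ "r / 2"]) auto
next
  assume "\<exists>r>0. holo n (polydisc n a r) f"
  then obtain r where r: "r > 0" "holo n (polydisc n a r) f" by blast
  obtain R M where R: "R > 0" "polydisc n a R \<subseteq> polydisc n a r"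
      "\<And>w. w \<in> polydisc n a R \<Longrightarrow> cmod (f w) \<le> M"
    using holo_bounded_near[OF r(2) center_in_polydisc[OF a r(1)]] by metis
  obtain c where "\<forall>z\<in>polydisc n a (R / 2).
      ((\<lambda>\<alpha>. c \<alpha> * (\<Prod>i<n. (z i - a i) ^ \<alpha> i)) has_sum f z) (multiindices n)"
    using holo_power_series[OF holo_subset[OF r(2) openin_polydisc R(2)] R(3,1)] by blast
  then show "holomorphic_at n f a"
    using R(1) unfolding holomorphic_at_def multiindices_def polydisc_def topspace_Cspace
    by (intro exI[of _ c] exI[of _ "R / 2"]) auto
qed

lemma holomorphic_atE:
  assumes "a \<in> Cn n" "holomorphic_at n f a" "eventually Q (near n a)"
  obtains r M where "r > 0" "holo n (polydisc n a r) f"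
    "\<And>z. z \<in> polydisc n a r \<Longrightarrow> cmod (f z) \<le> M \<and> Q z"
proof -
  obtain r where r: "r > 0" "holo n (polydisc n a r) f"
    using assms holomorphic_at_iff_holo by blast
  obtain s M where s: "s > 0" "polydisc n a s \<subseteq> polydisc n a r" "\<And>w. w \<in> polydisc n a s \<Longrightarrow> cmod (f w) \<le> M"
    using holo_bounded_near[OF r(2) center_in_polydisc[OF assms(1) r(1)]] by metis
  obtain t where t: "t > 0" "\<And>z. z \<in> polydisc n a t \<Longrightarrow> Q z"
    using assms(3) unfolding eventually_near[OF assms(1)] by blast
  have "polydisc n a (min s t) \<subseteq> polydisc n a s" "polydisc n a (min s t) \<subseteq> polydisc n a t"
    by (auto intro!: polydisc_mono)
  then show ?thesis
    using s t holo_subset[OF r(2) openin_polydisc] by (intro that[of "min s t" M]) auto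
qed

lemma holomorphic_at_common:
  assumes "a \<in> Cn n" "holomorphic_at n f a" "holomorphic_at n g a"
  obtains r where "r > 0" "holo n (polydisc n a r) f" "holo n (polydisc n a r) g"
proof -
  obtain r s where "r > 0" "holo n (polydisc n a r) f" "s > 0" "holo n (polydisc n a s) g"
    using assms holomorphic_at_iff_holo by metis
  then show ?thesis
    using polydisc_mono[of "min r s" r n a] polydisc_mono[of "min r s" s n a]
    by (intro that[of "min r s"]) (auto intro: holo_subset[OF _ openin_polydisc])
qed

lemma holomorphic_at_const: "a \<in> Cn n \<Longrightarrow> holomorphic_at n (\<lambda>_. c) a"
  using holo_const openin_polydisc by (auto simp: holomorphic_at_iff_holo intro!: exI[of _ 1])

lemma holomorphic_at_coordinate: "a \<in> Cn n \<Longrightarrow> holomorphic_at n (\<lambda>z. z i) a"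
  using holo_coordinate openin_polydisc by (auto simp: holomorphic_at_iff_holo intro!: exI[of _ 1])

lemma holomorphic_at_add:
  assumes "a \<in> Cn n" "holomorphic_at n f a" "holomorphic_at n g a"
  shows "holomorphic_at n (\<lambda>z. f z + g z) a"
  using holomorphic_at_common[OF assms] holo_add holomorphic_at_iff_holo[OF assms(1)] by metis

lemma holomorphic_at_mult:
  assumes "a \<in> Cn n" "holomorphic_at n f a" "holomorphic_at n g a"
  shows "holomorphic_at n (\<lambda>z. f z * g z) a"
  using holomorphic_at_common[OF assms] holo_mult holomorphic_at_iff_holo[OF assms(1)] by metis

lemma holomorphic_at_uminus:
  assumes "a \<in> Cn n" "holomorphic_at n f a"
  shows "holomorphic_at n (\<lambda>z. - f z) a"
  using holo_uminus holomorphic_at_iff_holo[OF assms(1)] assms by metis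

lemma holomorphic_at_diff:
  assumes "a \<in> Cn n" "holomorphic_at n f a" "holomorphic_at n g a"
  shows "holomorphic_at n (\<lambda>z. f z - g z) a"
  using holomorphic_at_add[OF assms(1,2) holomorphic_at_uminus[OF assms(1,3)]] by simp

lemma holomorphic_at_sum:
  assumes "a \<in> Cn n" "\<And>i. i \<in> I \<Longrightarrow> holomorphic_at n (f i) a"
  shows "holomorphic_at n (\<lambda>z. \<Sum>i\<in>I. f i z) a"
  using assms(2) by (induction I rule: infinite_finite_induct)
    (auto intro: holomorphic_at_const holomorphic_at_add assms(1))

lemma holomorphic_at_power:
  "a \<in> Cn n \<Longrightarrow> holomorphic_at n f a \<Longrightarrow> holomorphic_at n (\<lambda>z. f z ^ k) a"
  by (induction k) (auto intro: holomorphic_at_const holomorphic_at_mult)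

lemma holomorphic_at_continuous:
  assumes "a \<in> Cn n" "holomorphic_at n f a"
  shows "(f \<longlongrightarrow> f a) (near n a)"
  using assms holomorphic_at_iff_holo holo_continuous center_in_polydisc by metis

lemma holomorphic_at_eventually_nonzero:
  assumes "a \<in> Cn n" "holomorphic_at n f a" "f a \<noteq> 0"
  shows "eventually (\<lambda>z. f z \<noteq> 0) (near n a)"
  using tendsto_imp_eventually_ne[OF holomorphic_at_continuous[OF assms(1,2)] assms(3)] .

lemma holomorphic_at_inverse:
  assumes "a \<in> Cn n" "holomorphic_at n f a" "f a \<noteq> 0"
  shows "holomorphic_at n (\<lambda>z. inverse (f z)) a"
proof -
  obtain r M where r: "r > 0" "holo n (polydisc n a r) f"
    "\<And>z. z \<in> polydisc n a r \<Longrightarrow> cmod (f z) \<le> M \<and> f z \<noteq> 0"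
    using holomorphic_atE[OF assms(1,2) holomorphic_at_eventually_nonzero[OF assms]] by metis
  then show ?thesis
    using holo_inverse[OF r(2)] holomorphic_at_iff_holo[OF assms(1)] by blast
qed

lemma holomorphic_at_divide:
  assumes "a \<in> Cn n" "holomorphic_at n f a" "holomorphic_at n g a" "g a \<noteq> 0"
  shows "holomorphic_at n (\<lambda>z. f z / g z) a"
  using holomorphic_at_mult[OF assms(1,2) holomorphic_at_inverse[OF assms(1,3,4)]]
  by (simp add: divide_inverse)

lemma holomorphic_at_cong:
  assumes "a \<in> Cn n" "holomorphic_at n f a" "eventually (\<lambda>z. f z = g z) (near n a)"
  shows "holomorphic_at n g a"
proof -
  obtain r M where r: "r > 0" "holo n (polydisc n a r) f"
    "\<And>z. z \<in> polydisc n a r \<Longrightarrow> cmod (f z) \<le> M \<and> f z = g z"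
    using holomorphic_atE[OF assms] by metis
  then show ?thesis
    using holo_cong[OF r(2)] holomorphic_at_iff_holo[OF assms(1)] by blast
qed

lemma holo_imp_holomorphic_at:
  assumes "holo n S f" "z \<in> S"
  shows "holomorphic_at n f z"
proof -
  obtain r where "r > 0" "polydisc n z r \<subseteq> S" "z \<in> Cn n"
    using assms holo_openin[OF assms(1)] unfolding openin_Cspace_iff by blast
  then show ?thesis
    using holo_subset[OF assms(1) openin_polydisc] holomorphic_at_iff_holo by blast
qed

lemma eventually_holomorphic_at:
  assumes "a \<in> Cn n" "holomorphic_at n f a"
  shows "eventually (\<lambda>b. holomorphic_at n f b) (near n a)"
  using assms holo_imp_holomorphic_at unfolding eventually_near[OF assms(1)] holomorphic_at_iff_holo[OF assms(1)]
  by metis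

lemma eventually_near_drop:
  assumes "a \<in> Cn (Suc n)" "eventually Q (near n (a(n := 0)))"
  shows "eventually (\<lambda>z. Q (z(n := 0))) (near (Suc n) a)"
proof -
  obtain r where "r > 0" "\<And>z. z \<in> polydisc n (a(n := 0)) r \<Longrightarrow> Q z"
    using assms(2) unfolding eventually_near[OF drop_in_Cn[OF assms(1)]] by blast
  then show ?thesis
    unfolding eventually_near[OF assms(1)] polydisc_Suc cyl_def by blast
qed

lemma holomorphic_at_drop:
  assumes "a \<in> Cn (Suc n)" "holomorphic_at n f (a(n := 0))"
  shows "holomorphic_at (Suc n) (\<lambda>z. f (z(n := 0))) a"
proof -
  obtain r where "r > 0" "holo n (polydisc n (a(n := 0)) r) f"
    using assms holomorphic_at_iff_holo drop_in_Cn by metis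
  then show ?thesis
    using holo_drop holomorphic_at_iff_holo[OF assms(1)] polydisc_Suc by metis
qed

text \<open>The unit factor in \<open>regular_at\<close> depends on the last coordinate only; this
  makes it a holomorphic function on a cylinder, as needed in
  \<open>weierstrass_setup\<close>.\<close>

lemma holo_coordinate_comp:
  assumes "u holomorphic_on ball b r" "openin (Cspace n) S"
  shows "holo (Suc n) (cyl n S b r) (\<lambda>z. u (z n))"
proof (rule holoI)
  show op: "openin (Cspace (Suc n)) (cyl n S b r)" by (rule openin_cyl[OF assms(2)])
  fix z assume z: "z \<in> cyl n S b r"
  then have zC: "z \<in> Cn (Suc n)" and zn: "z n \<in> ball b r"
    by (auto simp: cyl_def dist_norm norm_minus_commute)
  have d: "u field_differentiable at (z n)"
    using holomorphic_on_imp_differentiable_at[OF assms(1) open_ball zn] .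
  have "((\<lambda>w. w n) \<longlongrightarrow> z n) (near (Suc n) z)"
    by (rule holomorphic_at_continuous[OF zC holomorphic_at_coordinate[OF zC]])
  then have "((\<lambda>w. u (w n)) \<longlongrightarrow> u (z n)) (near (Suc n) z)"
    by (rule isCont_tendsto_compose[OF field_differentiable_imp_continuous_at[OF d]])
  then have "eventually (\<lambda>w. dist (u (w n)) (u (z n)) < 1) (near (Suc n) z)"
    by (rule tendstoD) simp
  then obtain s where s: "s > 0" "\<And>w. w \<in> polydisc (Suc n) z s \<Longrightarrow> dist (u (w n)) (u (z n)) < 1"
    unfolding eventually_near[OF zC] by blast
  have "cmod (u (w n)) \<le> cmod (u (z n)) + 1" if "w \<in> polydisc (Suc n) z s" for w
    using s(2)[OF that] norm_triangle_ineq2[of "u (w n)" "u (z n)"] by (simp add: dist_norm)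
  then show "\<exists>s>0. \<exists>M. \<forall>w\<in>polydisc (Suc n) z s. cmod (u (w n)) \<le> M"
    using s(1) by blast
  fix v assume "v \<in> Cn (Suc n)"
  have "(u \<circ> (\<lambda>t. z n + t * v n)) field_differentiable at 0"
    using d by (intro field_differentiable_compose derivative_intros) auto
  then show "(\<lambda>t. u (line z t v n)) field_differentiable at 0"
    by (simp add: line_def o_def)
qed

text \<open>A linear change of coordinates that fixes the last coordinate whenever
  \<open>c n = 0\<close>; its inverse is then the shear with \<open>- c\<close>. It carries the
  vertical direction to the direction with entries \<open>c i\<close> and last entry 1, so up to
  scaling every direction with non-zero last entry can be made vertical.\<close>

definition shear :: "nat \<Rightarrow> (nat \<Rightarrow> complex) \<Rightarrow> (nat \<Rightarrow> complex) \<Rightarrow> nat \<Rightarrow> complex" where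
  "shear n c z = (\<lambda>i. z i + c i * z n)"

lemma shear_in_Cn: "c \<in> Cn n \<Longrightarrow> z \<in> Cn (Suc n) \<Longrightarrow> shear n c z \<in> Cn (Suc n)"
  by (auto simp: Cn_def shear_def)

lemma shear_shear:
  assumes "c \<in> Cn n"
  shows "shear n (\<lambda>i. - c i) (shear n c z) = z" "shear n c (shear n (\<lambda>i. - c i) z) = z"
  using assms by (auto simp: shear_def Cn_def)

lemma shear_line: "shear n c (line z t u) = line (shear n c z) t (shear n c u)"
  by (auto simp: shear_def line_def algebra_simps)

lemma shear_polydisc:
  assumes "c \<in> Cn n" "r > 0"
  obtains s where "s > 0" "\<And>a z. a \<in> Cn (Suc n) \<Longrightarrow> z \<in> polydisc (Suc n) a s \<Longrightarrow>
    shear n c z \<in> polydisc (Suc n) (shear n c a) r"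
proof -
  obtain K where K: "K > 0" "\<And>i. i < Suc n \<Longrightarrow> cmod (c i) \<le> K"
    using coords_bounded by blast
  have "shear n c z \<in> polydisc (Suc n) (shear n c a) r"
    if a: "a \<in> Cn (Suc n)" and z: "z \<in> polydisc (Suc n) a (r / (1 + K))" for a z
  proof -
    have "cmod (shear n c z i - shear n c a i) < r" if i: "i < Suc n" for i
    proof -
      have "cmod (shear n c z i - shear n c a i) = cmod ((z i - a i) + c i * (z n - a n))"
        by (simp add: shear_def algebra_simps)
      also have "\<dots> \<le> cmod (z i - a i) + cmod (c i) * cmod (z n - a n)"
        by (metis norm_mult norm_triangle_ineq)
      also have "\<dots> \<le> cmod (z i - a i) + K * cmod (z n - a n)"
        using K i by (intro add_left_mono mult_right_mono) auto
      also have "\<dots> < r / (1 + K) + K * (r / (1 + K))"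
        using z i K(1) by (intro add_less_le_mono mult_left_mono) (auto simp: polydisc_def less_imp_le)
      also have "\<dots> = (1 + K) * (r / (1 + K))" by (simp only: distrib_right mult_1)
      also have "\<dots> = r"
        unfolding times_divide_eq_right using K(1) by (intro nonzero_mult_div_cancel_left) auto
      finally show ?thesis .
    qed
    moreover have "shear n c z \<in> Cn (Suc n)"
      using z polydisc_subset_Cn shear_in_Cn[OF assms(1)] by blast
    ultimately show ?thesis by (auto simp: polydisc_def)
  qed
  then show ?thesis using that[of "r / (1 + K)"] K(1) assms(2) by (simp add: divide_pos_pos)
qed

lemma eventually_near_shear:
  assumes "c \<in> Cn n" "a \<in> Cn (Suc n)" "eventually Q (near (Suc n) (shear n c a))"
  shows "eventually (\<lambda>z. Q (shear n c z)) (near (Suc n) a)"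
proof -
  obtain r where r: "r > 0" "\<And>z. z \<in> polydisc (Suc n) (shear n c a) r \<Longrightarrow> Q z"
    using assms(3) unfolding eventually_near[OF shear_in_Cn[OF assms(1,2)]] by blast
  obtain s where "s > 0" "\<And>a z. a \<in> Cn (Suc n) \<Longrightarrow> z \<in> polydisc (Suc n) a s \<Longrightarrow>
    shear n c z \<in> polydisc (Suc n) (shear n c a) r"
    using shear_polydisc[OF assms(1) r(1)] by metis
  then show ?thesis
    using r(2) assms(2) unfolding eventually_near[OF assms(2)] by blast
qed

lemma holomorphic_at_shear:
  assumes c: "c \<in> Cn n" and a: "a \<in> Cn (Suc n)" and f: "holomorphic_at (Suc n) f (shear n c a)"
  shows "holomorphic_at (Suc n) (\<lambda>z. f (shear n c z)) a"
proof -
  obtain r where r: "r > 0" "holo (Suc n) (polydisc (Suc n) (shear n c a) r) f"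
    using f holomorphic_at_iff_holo shear_in_Cn[OF c a] by blast
  obtain s where s: "s > 0" "\<And>z. z \<in> polydisc (Suc n) a s \<Longrightarrow>
    shear n c z \<in> polydisc (Suc n) (shear n c a) r"
    using shear_polydisc[OF c r(1)] a by metis
  have "holo (Suc n) (polydisc (Suc n) a s) (\<lambda>z. f (shear n c z))"
  proof (rule holoI)
    fix z assume z: "z \<in> polydisc (Suc n) a s"
    have zC: "z \<in> Cn (Suc n)" using z polydisc_subset_Cn by blast
    obtain R M where R: "R > 0" "polydisc (Suc n) (shear n c z) R \<subseteq> polydisc (Suc n) (shear n c a) r"
        "\<And>w. w \<in> polydisc (Suc n) (shear n c z) R \<Longrightarrow> cmod (f w) \<le> M"
      using holo_bounded_near[OF r(2) s(2)[OF z]] by metis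
    obtain d where "d > 0" "\<And>a z. a \<in> Cn (Suc n) \<Longrightarrow> z \<in> polydisc (Suc n) a d \<Longrightarrow>
        shear n c z \<in> polydisc (Suc n) (shear n c a) R"
      using shear_polydisc[OF c R(1)] by metis
    then show "\<exists>r>0. \<exists>M. \<forall>w\<in>polydisc (Suc n) z r. cmod (f (shear n c w)) \<le> M"
      using R(3) zC by blast
    fix u assume u: "u \<in> Cn (Suc n)"
    show "(\<lambda>t. f (shear n c (line z t u))) field_differentiable at 0"
      unfolding shear_line by (rule holo_differentiable[OF r(2) s(2)[OF z] shear_in_Cn[OF c u]])
  qed (rule openin_polydisc)
  then show ?thesis using s(1) holomorphic_at_iff_holo[OF a] by blast
qed

section \<open>Weierstrass division and preparation\<close>

text \<open>Schwarz's lemma along the horizontal segment from the vertical line through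
  \<open>a\<close> to \<open>z\<close>. A function that vanishes on the vertical line becomes small
  when the base is shrunk while the height \<open>R\<close> stays fixed.\<close>

lemma holo_bound_vanishing_section:
  assumes g: "holo (Suc n) (cyl n (polydisc n a r) b R) g" and a: "a \<in> Cn n"
    and M: "\<And>z. z \<in> cyl n (polydisc n a r) b R \<Longrightarrow> cmod (g z) \<le> M"
    and zero: "\<And>w. cmod (w - b) < R \<Longrightarrow> g (a(n := w)) = 0"
    and d: "0 < d" "d \<le> r / 2" and z: "z \<in> cyl n (polydisc n a d) b R"
  shows "cmod (g z) \<le> 2 * M * d / r"
proof -
  let ?D = "cyl n (polydisc n a r) b R"
  define y where "y = a(n := z n)"
  define u where "u = (\<lambda>i. z i - y i)"
  have zC: "z \<in> Cn (Suc n)" and zn: "cmod (z n - b) < R" using z by (auto simp: cyl_def)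
  have u: "u \<in> Cn (Suc n)" using zC a by (auto simp: u_def y_def Cn_def)
  have r: "r > 0" using d by simp
  have inD: "line y t u \<in> ?D" if "cmod t < r / d" for t
  proof -
    have "cmod t * cmod (u i) < r" if "i < n" for i
    proof -
      have "cmod (u i) \<le> d" using z that by (auto simp: u_def y_def cyl_def polydisc_def less_imp_le)
      then have "cmod t * cmod (u i) \<le> cmod t * d" by (intro mult_left_mono) auto
      also have "\<dots> < r" using \<open>cmod t < r / d\<close> d by (simp add: field_simps)
      finally show ?thesis .
    qed
    moreover have "line y t u \<in> Cn (Suc n)"
      using u a by (intro line_in_Cn) (auto simp: y_def upd_in_Cn)
    moreover have "line y t u n = z n" by (simp add: line_def u_def y_def)
    ultimately show ?thesis
      using zn drop_in_Cn[of "line y t u" n]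
      by (auto simp: cyl_def polydisc_def line_def u_def y_def norm_mult)
  qed
  have "cmod (g (line y 1 u) - g (line y 0 u)) \<le> 2 * M / (r / d) * cmod 1"
  proof (rule schwarz_difference[where h = "\<lambda>t. g (line y t u)"])
    show "(\<lambda>t. g (line y t u)) holomorphic_on ball 0 (r / d)"
      using u inD by (intro holo_line[OF g]) auto
  qed (use inD M r d in \<open>auto simp: field_simps\<close>)
  moreover have "line y 1 u = z" by (auto simp: line_def u_def)
  moreover have "g y = 0" unfolding y_def by (rule zero[OF zn])
  ultimately show ?thesis by simp
qed

lemma holo_section_differentiable:
  assumes "holo (Suc n) (cyl n S b R) g" "z \<in> cyl n S b R"
  shows "(\<lambda>w. g (z(n := w))) field_differentiable at b"
proof -
  have R: "R > 0" using assms(2) by (auto simp: cyl_def) (metis norm_ge_zero order.strict_trans1)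
  have "(\<lambda>w. g ((z(n := 0))(n := w))) holomorphic_on ball b R"
    using assms(2) drop_in_Cn by (intro holo_section[OF assms(1)]) (auto simp: cyl_def)
  then show ?thesis
    using R by (auto intro: holomorphic_on_imp_differentiable_at[of _ "ball b R"])
qed

lemma slope_diff:
  assumes "holo (Suc n) (cyl n S b R) f" "holo (Suc n) (cyl n S b R) g" "z \<in> cyl n S b R"
  shows "slope n b (\<lambda>z. f z - g z) z = slope n b f z - slope n b g z"
  using deriv_diff[OF holo_section_differentiable[OF assms(1,3)] holo_section_differentiable[OF assms(2,3)]]
  by (simp add: slope_def diff_divide_distrib)

lemma slope_cong:
  assumes "z \<in> cyl n S b R" "\<And>z. z \<in> cyl n S b R \<Longrightarrow> f z = g z"
  shows "slope n b f z = slope n b g z"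
proof -
  have R: "R > 0" using assms(1) by (auto simp: cyl_def) (metis norm_ge_zero order.strict_trans1)
  have upd: "z(n := w) \<in> cyl n S b R" if "cmod (w - b) < R" for w
    using that assms(1) upd_in_Cn by (auto simp: cyl_def)
  have "eventually (\<lambda>w. w \<in> ball b R) (nhds b)"
    using R by (intro eventually_nhds_in_open) auto
  then have "eventually (\<lambda>w. f (z(n := w)) = g (z(n := w))) (nhds b)"
    by eventually_elim (auto intro!: assms(2) upd simp: dist_norm norm_minus_commute)
  then have "deriv (\<lambda>w. f (z(n := w))) b = deriv (\<lambda>w. g (z(n := w))) b"
    by (intro deriv_cong_ev) auto
  moreover have "f (z(n := b)) = g (z(n := b))" using R by (intro assms(2) upd) auto
  ultimately show ?thesis using assms by (simp add: slope_def)
qed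

lemma slope_affine:
  assumes h: "holo (Suc n) (cyl n S b R) h" and z: "z \<in> cyl n S b R"
  shows "slope n b (\<lambda>z. c (z(n := 0)) + (z n - b) * h z) z = h z"
proof (cases "z n = b")
  case True
  have "((\<lambda>w. c (z(n := 0)) + (w - b) * h (z(n := w))) has_field_derivative
      (0 + ((b - b) * deriv (\<lambda>w. h (z(n := w))) b + (1 - 0) * h (z(n := b))))) (at b)"
    by (rule derivative_eq_intros refl
      field_differentiable_derivI[OF holo_section_differentiable[OF h z]])+ simp
  then have "deriv (\<lambda>w. c (z(n := 0)) + (w - b) * h (z(n := w))) b = h (z(n := b))"
    by (intro DERIV_imp_deriv) auto
  then show ?thesis using True by (simp add: slope_def fun_upd_idem)
qed (simp add: slope_def)

lemma funpow_slope_bound: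
  assumes g: "holo (Suc n) (cyl n S b R) g" and S: "openin (Cspace n) S"
    and M: "\<And>z. z \<in> cyl n S b R \<Longrightarrow> cmod (g z) \<le> M"
  shows "holo (Suc n) (cyl n S b R) ((slope n b ^^ d) g)"
    and "z \<in> cyl n S b R \<Longrightarrow> cmod ((slope n b ^^ d) g z) \<le> M * (2 / R) ^ d"
proof -
  have "holo (Suc n) (cyl n S b R) ((slope n b ^^ d) g) \<and>
      (\<forall>z\<in>cyl n S b R. cmod ((slope n b ^^ d) g z) \<le> M * (2 / R) ^ d)"
  proof (induction d)
    case 0
    then show ?case using assms by simp
  next
    case (Suc d)
    have "cmod (slope n b ((slope n b ^^ d) g) z) \<le> 2 * (M * (2 / R) ^ d) / R" if "z \<in> cyl n S b R" for z
      using Suc that by (intro slope_bound) auto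
    moreover have "holo (Suc n) (cyl n S b R) (slope n b ((slope n b ^^ d) g))"
      using Suc S by (intro holo_slope[where M = "M * (2 / R) ^ d"]) auto
    ultimately show ?case by (simp add: field_simps)
  qed
  then show "holo (Suc n) (cyl n S b R) ((slope n b ^^ d) g)"
    and "z \<in> cyl n S b R \<Longrightarrow> cmod ((slope n b ^^ d) g z) \<le> M * (2 / R) ^ d"
    by auto
qed

lemma funpow_slope_diff:
  assumes f: "holo (Suc n) (cyl n S b R) f" "\<And>z. z \<in> cyl n S b R \<Longrightarrow> cmod (f z) \<le> M"
    and g: "holo (Suc n) (cyl n S b R) g" "\<And>z. z \<in> cyl n S b R \<Longrightarrow> cmod (g z) \<le> N"
    and S: "openin (Cspace n) S" and z: "z \<in> cyl n S b R"
  shows "(slope n b ^^ d) (\<lambda>z. f z - g z) z = (slope n b ^^ d) f z - (slope n b ^^ d) g z"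
  using z
proof (induction d arbitrary: z)
  case (Suc d)
  have "slope n b ((slope n b ^^ d) (\<lambda>z. f z - g z)) z
      = slope n b (\<lambda>z. (slope n b ^^ d) f z - (slope n b ^^ d) g z) z"
    by (rule slope_cong[OF Suc.prems Suc.IH])
  also have "\<dots> = slope n b ((slope n b ^^ d) f) z - slope n b ((slope n b ^^ d) g) z"
    by (intro slope_diff[OF _ _ Suc.prems] funpow_slope_bound[OF f(1) S f(2)] funpow_slope_bound[OF g(1) S g(2)])
  finally show ?case by simp
qed simp

text \<open>Taylor's formula in the last coordinate, with the iterated \<open>slope\<close> as the
  cofactor in the remainder.\<close>

lemma funpow_slope_expansion:
  "g z = (\<Sum>k<d. (slope n b ^^ k) g (z(n := b)) * (z n - b) ^ k) + (z n - b) ^ d * (slope n b ^^ d) g z"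
proof (induction d)
  case (Suc d)
  have "(slope n b ^^ d) g z = (slope n b ^^ d) g (z(n := b)) + (z n - b) * (slope n b ^^ Suc d) g z"
    unfolding funpow.simps o_def by (rule slope_eq)
  then have "(z n - b) ^ d * (slope n b ^^ d) g z
      = (z n - b) ^ d * ((slope n b ^^ d) g (z(n := b)) + (z n - b) * (slope n b ^^ Suc d) g z)"
    by (simp only:)
  also have "\<dots> = (slope n b ^^ d) g (z(n := b)) * (z n - b) ^ d + (z n - b) ^ Suc d * (slope n b ^^ Suc d) g z"
    by (simp only: distrib_left power_Suc mult_ac)
  finally show ?case using Suc by (simp only: sum.lessThan_Suc add.assoc)
qed simp

text \<open>Uniqueness of division by \<open>(z n - b) ^ d\<close>: iterated \<open>slope\<close>
  discards a polynomial of degree below \<open>d\<close> in \<open>z n - b\<close> and recovers the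
  quotient. It turns a division identity into a fixed-point equation.\<close>

lemma funpow_slope_polynomial:
  assumes q: "holo (Suc n) (cyl n S b R) q" and c: "\<And>k. k < d \<Longrightarrow> holo n S (c k)" 
    and z: "z \<in> cyl n S b R"
  shows "(slope n b ^^ d) (\<lambda>z. (\<Sum>k<d. c k (z(n := 0)) * (z n - b) ^ k) + (z n - b) ^ d * q z) z = q z"
  using c z
proof (induction d arbitrary: c z)
  case (Suc d)
  let ?h = "\<lambda>z. (\<Sum>k<d. c (Suc k) (z(n := 0)) * (z n - b) ^ k) + (z n - b) ^ d * q z"
  have op: "openin (Cspace (Suc n)) (cyl n S b R)" using q holo_openin by blast
  have h: "holo (Suc n) (cyl n S b R) ?h"
    using Suc.prems(1) q op
    by (intro holo_add holo_sum holo_mult holo_power holo_diff holo_coordinate holo_const holo_drop) auto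
  have fe: "(\<lambda>z. (\<Sum>k<Suc d. c k (z(n := 0)) * (z n - b) ^ k) + (z n - b) ^ Suc d * q z)
      = (\<lambda>z. c 0 (z(n := 0)) + (z n - b) * ?h z)"
    by (rule ext, subst sum.lessThan_Suc_shift) (simp add: distrib_left sum_distrib_left mult_ac)
  have "(slope n b ^^ d) (slope n b (\<lambda>z. c 0 (z(n := 0)) + (z n - b) * ?h z)) z
      = (slope n b ^^ d) ?h z"
  proof -
    have "(slope n b ^^ e) (slope n b (\<lambda>z. c 0 (z(n := 0)) + (z n - b) * ?h z)) y = (slope n b ^^ e) ?h y"
      if "y \<in> cyl n S b R" for e y
      using that
    proof (induction e arbitrary: y)
      case 0
      show ?case unfolding funpow_0 by (rule slope_affine[OF h 0])
    next
      case (Suc e)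
      then show ?case by (auto intro!: slope_cong)
    qed
    then show ?thesis using Suc.prems by blast
  qed
  also have "\<dots> = q z"
    by (rule Suc.IH[where c = "\<lambda>k. c (Suc k)"]) (use Suc.prems in auto)
  finally show ?case unfolding fe funpow_Suc_right o_def .
qed simp

text \<open>The classical regularity of order \<open>d\<close> in the last coordinate: on the
  vertical line through \<open>a\<close> the function has a zero of order exactly \<open>d\<close>
  at \<open>a\<close>. The order 0 is allowed and means \<open>W a \<noteq> 0\<close>.\<close>

definition regular_at :: "nat \<Rightarrow> nat \<Rightarrow> ((nat \<Rightarrow> complex) \<Rightarrow> complex) \<Rightarrow> (nat \<Rightarrow> complex) \<Rightarrow> bool" where
  "regular_at n d W a \<longleftrightarrow> (\<exists>u r. r > 0 \<and> u holomorphic_on ball (a n) r \<and>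
     (\<forall>w\<in>ball (a n) r. u w \<noteq> 0 \<and> W (a(n := w)) = (w - a n) ^ d * u w))"

text \<open>With \<open>U\<close> the inverse of the unit factor, \<open>U * W\<close> equals
  \<open>(z n - a n) ^ d\<close> on the vertical line through \<open>a\<close>, so the difference of
  the two vanishes there. First \<open>R\<close> is fixed and then the base is made thin; the final
  bound says that multiplication by this difference followed by \<open>d\<close> slopes, which cost
  \<open>(2 / R) ^ d\<close>, is a contraction with factor 1/2.\<close>

lemma weierstrass_setup:
  assumes a: "a \<in> Cn (Suc n)" and W: "holomorphic_at (Suc n) W a" and reg: "regular_at n d W a"
    and \<rho>: "\<rho> > 0"
  obtains R \<delta> U B where "0 < R" "R \<le> \<rho>" "0 < \<delta>" "\<delta> \<le> \<rho>"
    "holo (Suc n) (cyl n (polydisc n (a(n := 0)) \<delta>) (a n) R) U"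
    "holo (Suc n) (cyl n (polydisc n (a(n := 0)) \<delta>) (a n) R) (\<lambda>z. (z n - a n) ^ d - U z * W z)"
    "\<And>z. z \<in> cyl n (polydisc n (a(n := 0)) \<delta>) (a n) R \<Longrightarrow> U z \<noteq> 0 \<and> cmod (inverse (U z)) \<le> B \<and>
       cmod ((z n - a n) ^ d - U z * W z) * (2 / R) ^ d \<le> 1 / 2"
proof -
  define b where "b = a n"
  obtain u r where r: "r > 0" and u: "u holomorphic_on ball b r"
    and uW: "\<And>w. w \<in> ball b r \<Longrightarrow> u w \<noteq> 0 \<and> W (a(n := w)) = (w - b) ^ d * u w"
    using reg unfolding regular_at_def b_def by blast
  have a0: "a(n := 0) \<in> Cn n" using drop_in_Cn[OF a] .
  have "holo (Suc n) (cyl n (Cn n) b r) (\<lambda>z. u (z n))"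
    using openin_topspace[of "Cspace n"] by (intro holo_coordinate_comp[OF u]) simp
  moreover have acyl: "a \<in> cyl n (Cn n) b r" using a a0 r by (simp add: cyl_def b_def)
  ultimately have V: "holomorphic_at (Suc n) (\<lambda>z. u (z n)) a"
    by (rule holo_imp_holomorphic_at)
  define U where "U = (\<lambda>z. inverse (u (z n)))"
  have ua: "u (a n) \<noteq> 0" using uW[of b] r by (simp add: b_def)
  have U: "holomorphic_at (Suc n) U a"
    unfolding U_def by (rule holomorphic_at_inverse[OF a V ua])
  define E where "E = (\<lambda>z. (z n - b) ^ d - U z * W z)"
  have E: "holomorphic_at (Suc n) E a"
    unfolding E_def
    by (intro holomorphic_at_diff holomorphic_at_power holomorphic_at_mult holomorphic_at_const
        holomorphic_at_coordinate a U W)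
  obtain r1 B where r1: "r1 > 0" "\<And>z. z \<in> polydisc (Suc n) a r1 \<Longrightarrow> cmod (u (z n)) \<le> B \<and> u (z n) \<noteq> 0"
    using holomorphic_atE[OF a V holomorphic_at_eventually_nonzero[OF a V ua]] by metis
  obtain r2 where r2: "r2 > 0" "holo (Suc n) (polydisc (Suc n) a r2) U"
    using U holomorphic_at_iff_holo[OF a] by blast
  obtain r3 M where r3: "r3 > 0" "holo (Suc n) (polydisc (Suc n) a r3) E"
      "\<And>z. z \<in> polydisc (Suc n) a r3 \<Longrightarrow> cmod (E z) \<le> M \<and> True"
    by (rule holomorphic_atE[OF a E eventually_True]) (rule that)
  define R where "R = Min {r, r1, r2, r3, \<rho>}"
  have R: "R > 0" "R \<le> r" "R \<le> r1" "R \<le> r2" "R \<le> r3" "R \<le> \<rho>"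
    using r r1(1) r2(1) r3(1) \<rho> by (auto simp: R_def)
  have cylR: "polydisc (Suc n) a R = cyl n (polydisc n (a(n := 0)) R) b R"
    unfolding b_def by (rule polydisc_Suc)
  define K where "K = (2 / R) ^ d"
  have K: "K > 0" using R(1) by (simp add: K_def)
  \<comment> \<open>\<open>holo_bound_vanishing_section\<close> requires
    \<open>\<delta> \<le> R / 2\<close> and yields the bound
    \<open>2 * \<bar>M\<bar> * \<delta> / R\<close>; the second entry makes \<open>K\<close> times
    this at most 1/2. The summand 1 avoids division by 0.\<close>
  define \<delta> where "\<delta> = min (R / 2) (R / (4 * (\<bar>M\<bar> + 1) * K))"
  have "R / (4 * (\<bar>M\<bar> + 1) * K) > 0" using R(1) K by (intro divide_pos_pos mult_pos_pos) auto
  then have \<delta>: "\<delta> > 0" "\<delta> \<le> R / 2" "\<delta> \<le> R / (4 * (\<bar>M\<bar> + 1) * K)"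
    using R(1) unfolding \<delta>_def by linarith+
  let ?D = "cyl n (polydisc n (a(n := 0)) \<delta>) b R"
  have sub: "?D \<subseteq> polydisc (Suc n) a R"
    unfolding cylR using polydisc_mono[of \<delta> R n "a(n := 0)"] \<delta>(2) R(1) by (auto simp: cyl_def)
  have op: "openin (Cspace (Suc n)) ?D" by (intro openin_cyl openin_polydisc)
  have Ebound: "cmod (E z) * K \<le> 1 / 2" if z: "z \<in> ?D" for z
  proof -
    have "cmod (E z) \<le> 2 * \<bar>M\<bar> * \<delta> / R"
    proof (rule holo_bound_vanishing_section[where g = E and z = z and a = "a(n := 0)" and b = b and R = R])
      show "holo (Suc n) (cyl n (polydisc n (a(n := 0)) R) b R) E"
        unfolding cylR[symmetric]
        by (rule holo_subset[OF r3(2) openin_polydisc polydisc_mono[OF R(5)]])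
      show "cmod (E z) \<le> \<bar>M\<bar>" if "z \<in> cyl n (polydisc n (a(n := 0)) R) b R" for z
        using that r3(3)[of z] polydisc_mono[OF R(5), of "Suc n" a] unfolding cylR[symmetric]
        by fastforce
      show "E ((a(n := 0))(n := w)) = 0" if "cmod (w - b) < R" for w
      proof -
        have "w \<in> ball b r" using that R(2) by (simp add: dist_norm norm_minus_commute)
        then show ?thesis using uW[of w] by (simp add: E_def U_def)
      qed
    qed (use a0 \<delta> z in auto)
    then have "cmod (E z) * K \<le> 2 * \<bar>M\<bar> * \<delta> / R * K"
      using K by (intro mult_right_mono) auto
    also have "\<dots> \<le> 2 * (\<bar>M\<bar> + 1) * (R / (4 * (\<bar>M\<bar> + 1) * K)) / R * K"
      using K R(1) \<delta> by (intro mult_right_mono divide_right_mono mult_mono) auto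
    also have "\<dots> = 1 / 2"
    proof -
      have "2 * m * (R / (4 * m * K)) / R * K = 1 / 2" if "m > 0" for m
        using that K R(1) by (simp add: field_simps)
      from this[of "\<bar>M\<bar> + 1"] show ?thesis by linarith
    qed
    finally show ?thesis .
  qed
  show ?thesis
  proof (rule that[of R \<delta> U B])
    show "holo (Suc n) (cyl n (polydisc n (a(n := 0)) \<delta>) (a n) R) U"
      using holo_subset[OF r2(2) op] sub polydisc_mono[OF R(4)] by (fastforce simp: b_def)
    show "holo (Suc n) (cyl n (polydisc n (a(n := 0)) \<delta>) (a n) R) (\<lambda>z. (z n - a n) ^ d - U z * W z)"
      using holo_subset[OF r3(2) op] sub polydisc_mono[OF R(5)] by (fastforce simp: b_def E_def)
    fix z assume "z \<in> cyl n (polydisc n (a(n := 0)) \<delta>) (a n) R"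
    then have z: "z \<in> ?D" by (simp add: b_def)
    then have "z \<in> polydisc (Suc n) a r1"
      using sub polydisc_mono[OF R(3)] by blast
    then show "U z \<noteq> 0 \<and> cmod (inverse (U z)) \<le> B \<and>
       cmod ((z n - a n) ^ d - U z * W z) * (2 / R) ^ d \<le> 1 / 2"
      using r1(2) Ebound[OF z] by (simp add: U_def E_def K_def b_def)
  qed (use R \<delta> in auto)
qed

lemma holo_if_holomorphic_at:
  assumes "openin (Cspace n) S" "\<And>z. z \<in> S \<Longrightarrow> holomorphic_at n f z"
  shows "holo n S f"
proof (rule holo_local[OF assms(1)])
  fix z assume z: "z \<in> S"
  then have zC: "z \<in> Cn n" using assms(1) openin_Cspace_iff by blast
  then show "\<exists>T. z \<in> T \<and> holo n T f"
    using assms(2)[OF z] center_in_polydisc unfolding holomorphic_at_iff_holo[OF zC] by blast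
qed

text \<open>Put \<open>e = (z n - b) ^ d - U * W\<close>. A division
  \<open>f = (U * q) * W + r\<close> is the same as
  \<open>f + e * q = (z n - b) ^ d * q + r\<close>, and this holds with \<open>r\<close> of degree
  below \<open>d\<close> once \<open>q\<close> is the \<open>d\<close>-fold slope of
  \<open>f + e * q\<close>. That slope depends on \<open>q\<close> as a contraction, by the choice
  of the cylinder, and the fixed point is found by iteration.\<close>

theorem weierstrass_division:
  assumes a: "a \<in> Cn (Suc n)" and W: "holomorphic_at (Suc n) W a" and reg: "regular_at n d W a"
    and f: "holomorphic_at (Suc n) f a"
  obtains q c where "holomorphic_at (Suc n) q a"
    "\<And>k. k < d \<Longrightarrow> holomorphic_at n (c k) (a(n := 0))"
    "eventually (\<lambda>z. f z = q z * W z + (\<Sum>k<d. c k (z(n := 0)) * (z n - a n) ^ k)) (near (Suc n) a)"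
proof -
  define b where "b = a n"
  have a0: "a(n := 0) \<in> Cn n" using drop_in_Cn[OF a] .
  obtain \<rho> M where \<rho>: "\<rho> > 0" "holo (Suc n) (polydisc (Suc n) a \<rho>) f"
      "\<And>z. z \<in> polydisc (Suc n) a \<rho> \<Longrightarrow> cmod (f z) \<le> M \<and> True"
    by (rule holomorphic_atE[OF a f eventually_True]) (rule that)
  obtain R \<delta> U B0 where R: "0 < R" "R \<le> \<rho>" and \<delta>: "0 < \<delta>" "\<delta> \<le> \<rho>"
    and U: "holo (Suc n) (cyl n (polydisc n (a(n := 0)) \<delta>) b R) U"
    and E: "holo (Suc n) (cyl n (polydisc n (a(n := 0)) \<delta>) b R) (\<lambda>z. (z n - b) ^ d - U z * W z)"
    and UE: "\<And>z. z \<in> cyl n (polydisc n (a(n := 0)) \<delta>) b R \<Longrightarrow> U z \<noteq> 0 \<and> cmod (inverse (U z)) \<le> B0 \<and>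
       cmod ((z n - b) ^ d - U z * W z) * (2 / R) ^ d \<le> 1 / 2"
    by (rule weierstrass_setup[OF a W reg \<rho>(1), folded b_def]) (rule that)
  define S where "S = polydisc n (a(n := 0)) \<delta>"
  define D where "D = cyl n S b R"
  define e where "e = (\<lambda>z. (z n - b) ^ d - U z * W z)"
  define T where "T = (\<lambda>g. (slope n b ^^ d) g)"
  define K where "K = (2 / R) ^ d"
  have K: "K > 0" using R by (simp add: K_def)
  have S: "openin (Cspace n) S" by (simp add: S_def openin_polydisc)
  have opD: "openin (Cspace (Suc n)) D" unfolding D_def by (rule openin_cyl[OF S])
  have aD: "a \<in> D" using a a0 R \<delta> by (simp add: D_def S_def cyl_def b_def center_in_polydisc)
  have DR: "D \<subseteq> polydisc (Suc n) a \<rho>"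
    unfolding polydisc_Suc D_def S_def b_def
    using polydisc_mono[OF \<delta>(2), of n "a(n := 0)"] R(2) by (auto simp: cyl_def)
  have fD: "holo (Suc n) D f" "\<And>z. z \<in> D \<Longrightarrow> cmod (f z) \<le> M"
    using holo_subset[OF \<rho>(2) opD DR] \<rho>(3) DR by blast+
  have eD: "holo (Suc n) D e" "\<And>z. z \<in> D \<Longrightarrow> cmod (e z) * K \<le> 1 / 2"
    using E UE by (auto simp: D_def S_def e_def K_def)
  have M: "M \<ge> 0" using fD(2)[OF aD] norm_ge_zero order.trans by blast
  have Tholo: "holo (Suc n) D (T g)" and Tbound: "z \<in> D \<Longrightarrow> cmod (T g z) \<le> N * K"
    if "holo (Suc n) D g" "\<And>z. z \<in> D \<Longrightarrow> cmod (g z) \<le> N" for g N z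
    using funpow_slope_bound[of n S b R g N] that S unfolding D_def T_def K_def by blast+
  have ebound: "cmod (e z * h z) \<le> N / (2 * K)" if "z \<in> D" "cmod (h z) \<le> N" for z N and h :: "_ \<Rightarrow> complex"
  proof -
    have "cmod (e z) \<le> 1 / (2 * K)" using eD(2)[OF that(1)] K by (simp add: field_simps)
    then have "cmod (e z) * cmod (h z) \<le> 1 / (2 * K) * N"
      using that(2) K by (intro mult_mono) auto
    then show ?thesis by (simp add: norm_mult)
  qed
  \<comment> \<open>The radius of the ball preserved by the iteration: it solves
    \<open>(M + B / (2 * K)) * K = B\<close>.\<close>
  define B where "B = 2 * M * K"
  have fe: "holo (Suc n) D (\<lambda>z. f z + e z * h z)" "\<And>z. z \<in> D \<Longrightarrow> cmod (f z + e z * h z) \<le> B / K"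
    if h: "holo (Suc n) D h" "\<And>z. z \<in> D \<Longrightarrow> cmod (h z) \<le> B" for h
  proof -
    show "holo (Suc n) D (\<lambda>z. f z + e z * h z)" by (intro holo_add holo_mult fD eD h)
    fix z assume z: "z \<in> D"
    have "cmod (f z + e z * h z) \<le> M + B / (2 * K)"
      by (intro order.trans[OF norm_triangle_ineq] add_mono fD z ebound h)
    also have "\<dots> = B / K" using K by (simp add: B_def field_simps)
    finally show "cmod (f z + e z * h z) \<le> B / K" .
  qed
  have Tdiff: "cmod (T (\<lambda>z. f z + e z * h z) z - T (\<lambda>z. f z + e z * g z) z) \<le> \<epsilon> / 2"
    if h: "holo (Suc n) D h" "\<And>z. z \<in> D \<Longrightarrow> cmod (h z) \<le> B"
      and g: "holo (Suc n) D g" "\<And>z. z \<in> D \<Longrightarrow> cmod (g z) \<le> B"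
      and \<epsilon>: "\<And>z. z \<in> D \<Longrightarrow> cmod (h z - g z) \<le> \<epsilon>" and z: "z \<in> D" for g h \<epsilon> z
  proof -
    let ?d = "\<lambda>z. (f z + e z * h z) - (f z + e z * g z)"
    have "T (\<lambda>z. f z + e z * h z) z - T (\<lambda>z. f z + e z * g z) z = T ?d z"
      unfolding T_def using fe[OF h] fe[OF g] z S unfolding D_def
      by (intro funpow_slope_diff[symmetric])
    moreover have "cmod (T ?d z) \<le> \<epsilon> / (2 * K) * K"
    proof (rule Tbound[OF _ _ z])
      show "holo (Suc n) D ?d" by (intro holo_diff fe h g)
      show "cmod (?d z) \<le> \<epsilon> / (2 * K)" if "z \<in> D" for z
        using ebound[OF that, of "\<lambda>z. h z - g z" \<epsilon>] \<epsilon>[OF that] by (simp add: algebra_simps)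
    qed
    ultimately show ?thesis using K by simp
  qed
  define Q where "Q = (\<lambda>N. ((\<lambda>q. T (\<lambda>z. f z + e z * q z)) ^^ N) (\<lambda>_. 0))"
  have Q0: "Q 0 = (\<lambda>_. 0)" and QS: "Q (Suc N) = T (\<lambda>z. f z + e z * Q N z)" for N
    by (simp_all add: Q_def)
  have B: "B \<ge> 0" using M K by (simp add: B_def)
  have Qh: "holo (Suc n) D (Q N) \<and> (\<forall>z\<in>D. cmod (Q N z) \<le> B)" for N
  proof (induction N)
    case 0
    then show ?case using B by (simp add: Q0 holo_const[OF opD])
  next
    case (Suc N)
    then show ?case unfolding QS
      using Tholo[OF fe] Tbound[OF fe] K by fastforce
  qed
  have Qdiff: "\<forall>z\<in>D. cmod (Q (Suc N) z - Q N z) \<le> B * (1 / 2) ^ N" for N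
  proof (induction N)
    case 0
    then show ?case using Qh[of "Suc 0"] by (simp add: Q0)
  next
    case (Suc N)
    have "cmod (Q (Suc (Suc N)) z - Q (Suc N) z) \<le> B * (1 / 2) ^ N / 2" if "z \<in> D" for z
    proof -
      have "cmod (T (\<lambda>z. f z + e z * Q (Suc N) z) z - T (\<lambda>z. f z + e z * Q N z) z) \<le> B * (1 / 2) ^ N / 2"
        using Suc that Qh by (intro Tdiff) blast+
      then show ?thesis by (simp only: QS)
    qed
    then show ?case by simp
  qed
  \<comment> \<open>The limit of the iterates as a telescoping series with majorant
    \<open>B * (1 / 2) ^ N\<close>, so that convergence is uniform on \<open>D\<close> and the limit
    is holomorphic.\<close>
  define q where "q = (\<lambda>z. suminf (\<lambda>N. Q (Suc N) z - Q N z))"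
  have "uniform_limit D (\<lambda>n z. \<Sum>i<n. Q (Suc i) z - Q i z) q sequentially"
    unfolding q_def
  proof (rule Weierstrass_m_test)
    show "norm (Q (Suc N) z - Q N z) \<le> B * (1 / 2) ^ N" if "z \<in> D" for N z
      using Qdiff that by blast
    show "summable (\<lambda>N. B * (1 / 2) ^ N)"
      by (intro summable_mult summable_geometric) auto
  qed
  then have lim: "uniform_limit D Q q sequentially"
    unfolding sum_lessThan_telescope[of "\<lambda>i. Q i _"] by (simp add: Q0)
  have qh: "holo (Suc n) D q"
    using Qh by (intro holo_uniform_limit[OF opD _ _ lim]) auto
  have qb: "cmod (q z) \<le> B" if "z \<in> D" for z
    using tendsto_norm[OF tendsto_uniform_limitI[OF lim that]] Qh that
    by (intro tendsto_upperbound[where F = sequentially]) auto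
  \<comment> \<open>No limit is taken inside \<open>T\<close>: the contraction estimate compares
    \<open>T\<close> at \<open>q\<close> with \<open>T\<close> at a late iterate, and the latter
    value is the next iterate.\<close>
  have fixp: "T (\<lambda>z. f z + e z * q z) z = q z" if z: "z \<in> D" for z
  proof -
    have "cmod (T (\<lambda>z. f z + e z * q z) z - q z) \<le> 0"
    proof (rule field_le_epsilon)
      fix \<epsilon> :: real assume \<epsilon>: "\<epsilon> > 0"
      then have "eventually (\<lambda>N. \<forall>z\<in>D. dist (Q N z) (q z) < \<epsilon> / 2) sequentially"
        by (intro uniform_limitD[OF lim]) auto
      then obtain N where N: "\<And>m z. m \<ge> N \<Longrightarrow> z \<in> D \<Longrightarrow> dist (Q m z) (q z) < \<epsilon> / 2"
        unfolding eventually_sequentially by blast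
      have "cmod (T (\<lambda>z. f z + e z * q z) z - T (\<lambda>z. f z + e z * Q N z) z) \<le> \<epsilon> / 2 / 2"
        using N[of N] Qh qh qb z by (intro Tdiff) (auto simp: dist_norm norm_minus_commute less_imp_le)
      moreover have "cmod (T (\<lambda>z. f z + e z * Q N z) z - q z) \<le> \<epsilon> / 2"
        using N[of "Suc N" z] z by (simp add: QS dist_norm)
      ultimately show "cmod (T (\<lambda>z. f z + e z * q z) z - q z) \<le> 0 + \<epsilon>"
        using norm_triangle_ineq[of "T (\<lambda>z. f z + e z * q z) z - T (\<lambda>z. f z + e z * Q N z) z"
          "T (\<lambda>z. f z + e z * Q N z) z - q z"] \<epsilon> by simp
    qed
    then show ?thesis by simp
  qed
  let ?g = "\<lambda>z. f z + e z * q z"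
  \<comment> \<open>The remainder consists of the first \<open>d\<close> Taylor coefficients in the
    last coordinate of \<open>f + e * q\<close>, as \<open>funpow_slope_expansion\<close>
    shows.\<close>
  define c where "c = (\<lambda>k z. (slope n b ^^ k) ?g (z(n := b)))"
  show ?thesis
  proof (rule that[of "\<lambda>z. U z * q z" c])
    show "holomorphic_at (Suc n) (\<lambda>z. U z * q z) a"
      using U qh unfolding S_def[symmetric] D_def[symmetric]
      by (intro holo_imp_holomorphic_at[OF holo_mult aD])
    have "holo n S (c k)" for k
      unfolding c_def using R(1)
      by (intro holo_slice[where b = b and R = R] funpow_slope_bound(1)[where M = "B / K"]
          fe[OF qh qb, unfolded D_def] S) auto
    then show "holomorphic_at n (c k) (a(n := 0))" for k
      using center_in_polydisc[OF a0 \<delta>(1)] holo_imp_holomorphic_at unfolding S_def by blast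
    have "f z = (U z * q z) * W z + (\<Sum>k<d. c k (z(n := 0)) * (z n - a n) ^ k)" if z: "z \<in> D" for z
    proof -
      have "?g z = (\<Sum>k<d. (slope n b ^^ k) ?g (z(n := b)) * (z n - b) ^ k) + (z n - b) ^ d * T ?g z"
        unfolding T_def by (rule funpow_slope_expansion)
      also have "\<dots> = (\<Sum>k<d. c k (z(n := 0)) * (z n - b) ^ k) + (z n - b) ^ d * q z"
        unfolding fixp[OF z] c_def by (simp only: fun_upd_upd)
      finally show ?thesis unfolding e_def b_def by (simp add: algebra_simps)
    qed
    then show "eventually (\<lambda>z. f z = (U z * q z) * W z + (\<Sum>k<d. c k (z(n := 0)) * (z n - a n) ^ k)) (near (Suc n) a)"
      using opD aD a unfolding eventually_nhdsin by blast
  qed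
qed

lemma polynomial_zero_on_ball:
  fixes c :: "nat \<Rightarrow> complex" and b :: complex
  assumes "R > 0" "\<And>w. cmod (w - b) < R \<Longrightarrow> (\<Sum>k<d. c k * w ^ k) = 0" "k < d"
  shows "c k = 0"
proof (rule ccontr)
  assume "c k \<noteq> 0"
  obtain m where d: "d = Suc m" using assms(3) by (cases d) auto
  have "finite {x. (\<Sum>i\<le>m. c i * x ^ i) = 0}"
    unfolding polyfun_finite_roots using \<open>c k \<noteq> 0\<close> assms(3) unfolding d by (metis less_Suc_eq_le)
  moreover have "ball b R \<subseteq> {x. (\<Sum>i\<le>m. c i * x ^ i) = 0}"
    using assms(2) by (auto simp: d lessThan_Suc_atMost dist_norm norm_minus_commute)
  ultimately have "finite (ball b R)" by (rule finite_subset[rotated])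
  then have "ball b R = {}" by (rule finite_imp_not_open) simp
  then show False using assms(1) by simp
qed

text \<open>Dividing by \<open>U\<close> turns the vanishing combination into
  \<open>e * p = r + (z n - b) ^ d * p\<close>. Taking \<open>d\<close> slopes exhibits
  \<open>p\<close> as a contraction applied to \<open>p\<close> itself, so its bound halves
  indefinitely. Afterwards the remainder vanishes as a polynomial on each vertical disc.\<close>

theorem weierstrass_division_unique:
  assumes a: "a \<in> Cn (Suc n)" and W: "holomorphic_at (Suc n) W a" and reg: "regular_at n d W a"
    and q: "holomorphic_at (Suc n) q a" and c: "\<And>k. k < d \<Longrightarrow> holomorphic_at n (c k) (a(n := 0))"
    and zero: "eventually (\<lambda>z. q z * W z + (\<Sum>k<d. c k (z(n := 0)) * (z n - a n) ^ k) = 0) (near (Suc n) a)"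
  shows "eventually (\<lambda>z. q z = 0) (near (Suc n) a)"
    and "\<And>k. k < d \<Longrightarrow> eventually (\<lambda>z. c k z = 0) (near n (a(n := 0)))"
proof -
  define b where "b = a n"
  have a0: "a(n := 0) \<in> Cn n" using drop_in_Cn[OF a] .
  have "eventually (\<lambda>z. \<forall>k\<in>{..<d}. holomorphic_at n (c k) z) (near n (a(n := 0)))"
    using c eventually_holomorphic_at[OF a0] by (intro eventually_ball_finite) auto
  then have "eventually (\<lambda>z. \<forall>k\<in>{..<d}. holomorphic_at n (c k) (z(n := 0))) (near (Suc n) a)"
    by (rule eventually_near_drop[OF a])
  with zero have "eventually (\<lambda>z. (\<forall>k\<in>{..<d}. holomorphic_at n (c k) (z(n := 0))) \<and>
      q z * W z + (\<Sum>k<d. c k (z(n := 0)) * (z n - a n) ^ k) = 0) (near (Suc n) a)"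
    by eventually_elim auto
  then obtain \<rho> M where \<rho>: "\<rho> > 0" "holo (Suc n) (polydisc (Suc n) a \<rho>) q"
    and \<rho>': "\<And>z. z \<in> polydisc (Suc n) a \<rho> \<Longrightarrow> cmod (q z) \<le> M \<and>
      (\<forall>k\<in>{..<d}. holomorphic_at n (c k) (z(n := 0))) \<and>
      q z * W z + (\<Sum>k<d. c k (z(n := 0)) * (z n - a n) ^ k) = 0"
    by (rule holomorphic_atE[OF a q]) (rule that)
  obtain R \<delta> U B0 where R: "0 < R" "R \<le> \<rho>" and \<delta>: "0 < \<delta>" "\<delta> \<le> \<rho>"
    and U: "holo (Suc n) (cyl n (polydisc n (a(n := 0)) \<delta>) b R) U"
    and E: "holo (Suc n) (cyl n (polydisc n (a(n := 0)) \<delta>) b R) (\<lambda>z. (z n - b) ^ d - U z * W z)"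
    and UE: "\<And>z. z \<in> cyl n (polydisc n (a(n := 0)) \<delta>) b R \<Longrightarrow> U z \<noteq> 0 \<and> cmod (inverse (U z)) \<le> B0 \<and>
       cmod ((z n - b) ^ d - U z * W z) * (2 / R) ^ d \<le> 1 / 2"
    by (rule weierstrass_setup[OF a W reg \<rho>(1), folded b_def]) (rule that)
  define S where "S = polydisc n (a(n := 0)) \<delta>"
  define D where "D = cyl n S b R"
  have S: "openin (Cspace n) S" "S \<subseteq> Cn n" by (simp_all add: S_def openin_polydisc polydisc_subset_Cn)
  have opD: "openin (Cspace (Suc n)) D" unfolding D_def by (rule openin_cyl[OF S(1)])
  have aS: "a(n := 0) \<in> S" using center_in_polydisc[OF a0 \<delta>(1)] by (simp add: S_def)
  have aD: "a \<in> D" using a R aS by (simp add: D_def cyl_def b_def)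
  have DR: "D \<subseteq> polydisc (Suc n) a \<rho>"
    unfolding polydisc_Suc D_def S_def b_def
    using polydisc_mono[OF \<delta>(2), of n "a(n := 0)"] R(2) by (auto simp: cyl_def)
  have SD: "z(n := w) \<in> D" if "z \<in> S" "cmod (w - b) < R" for z w
    using that S by (auto simp: D_def cyl_def upd_in_Cn Cn_upd_0 subsetD)
  define e where "e = (\<lambda>z. (z n - b) ^ d - U z * W z)"
  have UD: "holo (Suc n) D U" and eD: "holo (Suc n) D e"
    using U E by (auto simp: D_def S_def e_def)
  have UE: "U z \<noteq> 0" "cmod (inverse (U z)) \<le> B0" "cmod (e z) * (2 / R) ^ d \<le> 1 / 2" if "z \<in> D" for z
    using UE that by (auto simp: D_def S_def e_def)
  \<comment> \<open>The coefficients are given as holomorphic at one point. Holomorphy at nearby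
    points is part of the property secured on the \<open>\<rho>\<close>-polydisc, and a point of the
    base is brought into that polydisc by lifting it to height \<open>b\<close>.\<close>
  have cS: "holo n S (c k)" if "k < d" for k
  proof (rule holo_if_holomorphic_at[OF S(1)])
    fix z assume "z \<in> S"
    then have "z(n := b) \<in> polydisc (Suc n) a \<rho>" "z \<in> Cn n" using SD[of z b] R DR S by auto
    then show "holomorphic_at n (c k) z"
      using \<rho>'[of "z(n := b)"] that by (simp add: Cn_upd_0)
  qed
  define p where "p = (\<lambda>z. q z * inverse (U z))"
  have pD: "holo (Suc n) D p"
    unfolding p_def using UE(1) by (intro holo_mult holo_inverse UD holo_subset[OF \<rho>(2) opD DR])
  have rel: "e z * p z = (\<Sum>k<d. c k (z(n := 0)) * (z n - b) ^ k) + (z n - b) ^ d * p z" if "z \<in> D" for z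
  proof -
    have "q z = p z * U z" using UE(1)[OF that] by (simp add: p_def)
    moreover have "q z * W z + (\<Sum>k<d. c k (z(n := 0)) * (z n - a n) ^ k) = 0"
      using \<rho>' DR that by blast
    ultimately have "p z * U z * W z = - (\<Sum>k<d. c k (z(n := 0)) * (z n - b) ^ k)"
      unfolding b_def by (simp add: eq_neg_iff_add_eq_0)
    then show ?thesis by (simp add: e_def algebra_simps)
  qed
  have Tp: "(slope n b ^^ d) (\<lambda>z. e z * p z) z = p z" if "z \<in> D" for z
  proof -
    have "(slope n b ^^ i) (\<lambda>z. e z * p z) y
        = (slope n b ^^ i) (\<lambda>z. (\<Sum>k<d. c k (z(n := 0)) * (z n - b) ^ k) + (z n - b) ^ d * p z) y"
      if "y \<in> D" for i y
      using that
    proof (induction i arbitrary: y)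
      case 0
      then show ?case unfolding funpow_0 by (rule rel)
    next
      case (Suc i)
      then show ?case unfolding funpow.simps o_def D_def by (intro slope_cong)
    qed
    from this[OF that] show ?thesis
      by (rule trans) (intro funpow_slope_polynomial[OF pD[unfolded D_def]] cS that[unfolded D_def])
  qed
  \<comment> \<open>The starting bound combines \<open>M\<close> for \<open>q\<close> with
    \<open>B0\<close> for the inverse of \<open>U\<close>; each application of the contraction
    contributes a factor 1/2.\<close>
  have pb: "\<forall>z\<in>D. cmod (p z) \<le> M * B0 * (1 / 2) ^ N" for N
  proof (induction N)
    case 0
    show ?case
    proof
      fix z assume z: "z \<in> D"
      have "cmod (q z) \<le> M" using \<rho>' DR z by blast
      then show "cmod (p z) \<le> M * B0 * (1 / 2) ^ 0"
        unfolding p_def norm_mult using UE(2)[OF z]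
        by (simp, intro mult_mono) (auto intro: order.trans[OF norm_ge_zero])
    qed
  next
    case (Suc N)
    let ?K = "(2 / R) ^ d"
    have K: "?K > 0" using R by simp
    have "cmod (p z) \<le> M * B0 * (1 / 2) ^ N / (2 * ?K) * ?K" if z: "z \<in> D" for z
    proof -
      have "cmod (e z * p z) \<le> M * B0 * (1 / 2) ^ N / (2 * ?K)" if "z \<in> D" for z
      proof -
        have "cmod (e z) \<le> 1 / (2 * ?K)" using UE(3)[OF that] K by (simp only: field_simps)
        then have "cmod (e z) * cmod (p z) \<le> 1 / (2 * ?K) * (M * B0 * (1 / 2) ^ N)"
          using Suc that K by (intro mult_mono) auto
        then show ?thesis by (simp add: norm_mult)
      qed
      then show ?thesis
        using funpow_slope_bound(2)[of n S b R "\<lambda>z. e z * p z" "M * B0 * (1 / 2) ^ N / (2 * ?K)" z d]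
          holo_mult[OF eD pD] S(1) z Tp[OF z] unfolding D_def by simp
    qed
    moreover have "x / (2 * k) * k = x / 2" if "k > 0" for x k :: real
      using that by simp
    from this[OF K] have "M * B0 * (1 / 2) ^ N / (2 * ?K) * ?K = M * B0 * (1 / 2) ^ Suc N"
      by simp
    ultimately show ?case by (simp only:) blast
  qed
  have p0: "p z = 0" if "z \<in> D" for z
  proof -
    have "(\<lambda>N. M * B0 * (1 / 2) ^ N) \<longlonglongrightarrow> 0"
      by (intro tendsto_mult_right_zero LIMSEQ_realpow_zero) auto
    then have "cmod (p z) \<le> 0"
      by (rule tendsto_lowerbound) (use pb that in auto)
    then show ?thesis by simp
  qed
  then have q0: "q z = 0" if "z \<in> D" for z
    using UE(1) that by (auto simp: p_def)
  then show "eventually (\<lambda>z. q z = 0) (near (Suc n) a)"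
    using opD aD unfolding eventually_nhdsin by blast
  fix k assume k: "k < d"
  have "c k z = 0" if z: "z \<in> S" for z
  proof (rule polynomial_zero_on_ball[OF R(1) _ k, where c = "\<lambda>k. c k z" and b = 0])
    fix t assume "cmod (t - 0) < R"
    then have "z(n := t + b) \<in> D" using SD[OF z, of "t + b"] by simp
    then show "(\<Sum>k<d. c k z * t ^ k) = 0"
      using rel[of "z(n := t + b)"] p0[of "z(n := t + b)"] z S by (simp add: Cn_upd_0 subsetD)
  qed
  then show "eventually (\<lambda>z. c k z = 0) (near n (a(n := 0)))"
    using S aS unfolding eventually_nhdsin by blast
qed

section \<open>Polynomials in the last coordinate over germs in the other coordinates\<close>

definition polynomial_at :: "nat \<Rightarrow> (nat \<Rightarrow> complex) \<Rightarrow> nat \<Rightarrow> ((nat \<Rightarrow> complex) \<Rightarrow> complex) \<Rightarrow> bool" where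
  "polynomial_at n a d f \<longleftrightarrow> (\<exists>c. (\<forall>k<d. holomorphic_at n (c k) (a(n := 0))) \<and>
     eventually (\<lambda>z. f z = (\<Sum>k<d. c k (z(n := 0)) * z n ^ k)) (near (Suc n) a))"

text \<open>Both notions use powers of \<open>z n\<close> and not of \<open>z n - a n\<close>: the
  coefficients then serve unchanged at all nearby points, as a generating system valid in a
  neighbourhood demands. Degree bounds are strict, so \<open>polynomial_at n a d\<close> means
  degree at most \<open>d - 1\<close>, and for \<open>d = 0\<close> the zero germ.\<close>

definition monic_at :: "nat \<Rightarrow> (nat \<Rightarrow> complex) \<Rightarrow> nat \<Rightarrow> ((nat \<Rightarrow> complex) \<Rightarrow> complex) \<Rightarrow> bool" where
  "monic_at n a d f \<longleftrightarrow> polynomial_at n a d (\<lambda>z. f z - z n ^ d)"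

lemma polynomial_atI:
  "(\<And>k. k < d \<Longrightarrow> holomorphic_at n (c k) (a(n := 0))) \<Longrightarrow>
   eventually (\<lambda>z. f z = (\<Sum>k<d. c k (z(n := 0)) * z n ^ k)) (near (Suc n) a) \<Longrightarrow> polynomial_at n a d f"
  by (auto simp: polynomial_at_def)

lemma polynomial_at_cong:
  assumes "polynomial_at n a d f" "eventually (\<lambda>z. f z = g z) (near (Suc n) a)"
  shows "polynomial_at n a d g"
proof -
  obtain c where c: "\<And>k. k < d \<Longrightarrow> holomorphic_at n (c k) (a(n := 0))"
    "eventually (\<lambda>z. f z = (\<Sum>k<d. c k (z(n := 0)) * z n ^ k)) (near (Suc n) a)"
    using assms(1) by (auto simp: polynomial_at_def)
  show ?thesis
  proof (rule polynomial_atI[where c = c])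
    show "eventually (\<lambda>z. g z = (\<Sum>k<d. c k (z(n := 0)) * z n ^ k)) (near (Suc n) a)"
      using c(2) assms(2) by eventually_elim simp
  qed (rule c(1))
qed

context
  fixes n :: nat and a :: "nat \<Rightarrow> complex"
  assumes a: "a \<in> Cn (Suc n)"
begin

lemma polynomial_at_holomorphic:
  assumes "polynomial_at n a d f"
  shows "holomorphic_at (Suc n) f a"
proof -
  obtain c where c: "\<And>k. k < d \<Longrightarrow> holomorphic_at n (c k) (a(n := 0))"
    "eventually (\<lambda>z. f z = (\<Sum>k<d. c k (z(n := 0)) * z n ^ k)) (near (Suc n) a)"
    using assms(1) by (auto simp: polynomial_at_def)
  have "holomorphic_at (Suc n) (\<lambda>z. \<Sum>k<d. c k (z(n := 0)) * z n ^ k) a"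
    using c(1) by (intro holomorphic_at_sum holomorphic_at_mult holomorphic_at_power
      holomorphic_at_coordinate holomorphic_at_drop a) auto
  then show ?thesis
    by (rule holomorphic_at_cong[OF a]) (use c(2) in eventually_elim, auto)
qed

lemma polynomial_at_mono:
  assumes "polynomial_at n a d f" "d \<le> e"
  shows "polynomial_at n a e f"
proof -
  obtain c where c: "\<And>k. k < d \<Longrightarrow> holomorphic_at n (c k) (a(n := 0))"
    "eventually (\<lambda>z. f z = (\<Sum>k<d. c k (z(n := 0)) * z n ^ k)) (near (Suc n) a)"
    using assms(1) by (auto simp: polynomial_at_def)
  define C where "C = (\<lambda>k. if k < d then c k else (\<lambda>_. 0))"
  show ?thesis
  proof (rule polynomial_atI[where c = C])
    show "holomorphic_at n (C k) (a(n := 0))" for k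
      using c(1) holomorphic_at_const[OF drop_in_Cn[OF a]] by (auto simp: C_def)
    have "(\<Sum>k<d. c k y * w ^ k) = (\<Sum>k<e. C k y * w ^ k)" for y w
      using assms(2) by (intro sum.mono_neutral_cong_left) (auto simp: C_def)
    then show "eventually (\<lambda>z. f z = (\<Sum>k<e. C k (z(n := 0)) * z n ^ k)) (near (Suc n) a)"
      using c(2) by (simp only:)
  qed
qed

lemma polynomial_at_zero: "polynomial_at n a d (\<lambda>_. 0)"
  by (rule polynomial_atI[where c = "\<lambda>_ _. 0"]) (auto intro: holomorphic_at_const drop_in_Cn a)

lemma polynomial_at_add:
  assumes "polynomial_at n a d f" "polynomial_at n a d g"
  shows "polynomial_at n a d (\<lambda>z. f z + g z)"
proof -
  obtain c where c: "\<And>k. k < d \<Longrightarrow> holomorphic_at n (c k) (a(n := 0))"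
    "eventually (\<lambda>z. f z = (\<Sum>k<d. c k (z(n := 0)) * z n ^ k)) (near (Suc n) a)"
    using assms(1) by (auto simp: polynomial_at_def)
  obtain e where e: "\<And>k. k < d \<Longrightarrow> holomorphic_at n (e k) (a(n := 0))"
    "eventually (\<lambda>z. g z = (\<Sum>k<d. e k (z(n := 0)) * z n ^ k)) (near (Suc n) a)"
    using assms(2) by (auto simp: polynomial_at_def)
  show ?thesis
  proof (rule polynomial_atI[where c = "\<lambda>k z. c k z + e k z"])
    show "eventually (\<lambda>z. f z + g z = (\<Sum>k<d. (c k (z(n := 0)) + e k (z(n := 0))) * z n ^ k)) (near (Suc n) a)"
      using c(2) e(2) by eventually_elim (simp add: sum.distrib distrib_right)
  qed (intro holomorphic_at_add drop_in_Cn a c e)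
qed

lemma polynomial_at_cmult:
  assumes "polynomial_at n a d f" "holomorphic_at n c (a(n := 0))"
  shows "polynomial_at n a d (\<lambda>z. c (z(n := 0)) * f z)"
proof -
  obtain e where e: "\<And>k. k < d \<Longrightarrow> holomorphic_at n (e k) (a(n := 0))"
    "eventually (\<lambda>z. f z = (\<Sum>k<d. e k (z(n := 0)) * z n ^ k)) (near (Suc n) a)"
    using assms(1) by (auto simp: polynomial_at_def)
  show ?thesis
  proof (rule polynomial_atI[where c = "\<lambda>k z. c z * e k z"])
    show "eventually (\<lambda>z. c (z(n := 0)) * f z = (\<Sum>k<d. (c (z(n := 0)) * e k (z(n := 0))) * z n ^ k)) (near (Suc n) a)"
      using e(2) by eventually_elim (simp only: sum_distrib_left mult.assoc)
  qed (intro holomorphic_at_mult drop_in_Cn a e assms)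
qed

lemma polynomial_at_scale: "polynomial_at n a d f \<Longrightarrow> polynomial_at n a d (\<lambda>z. c * f z)"
  using polynomial_at_cmult[of d f "\<lambda>_. c"] holomorphic_at_const[OF drop_in_Cn[OF a]] by auto

lemma polynomial_at_diff:
  assumes "polynomial_at n a d f" "polynomial_at n a d g"
  shows "polynomial_at n a d (\<lambda>z. f z - g z)"
  using polynomial_at_add[OF assms(1) polynomial_at_scale[OF assms(2), of "-1"]] by simp

lemma polynomial_at_sum:
  "(\<And>i. i \<in> I \<Longrightarrow> polynomial_at n a d (f i)) \<Longrightarrow> polynomial_at n a d (\<lambda>z. \<Sum>i\<in>I. f i z)"
  by (induction I rule: infinite_finite_induct) (auto intro: polynomial_at_zero polynomial_at_add)

lemma polynomial_at_const:
  assumes "holomorphic_at n c (a(n := 0))"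
  shows "polynomial_at n a (Suc d) (\<lambda>z. c (z(n := 0)))"
  by (rule polynomial_at_mono[where d = "Suc 0"], rule polynomial_atI[where c = "\<lambda>_. c"])
    (use assms in auto)

lemma polynomial_at_mult_coordinate:
  assumes "polynomial_at n a d f"
  shows "polynomial_at n a (Suc d) (\<lambda>z. z n * f z)"
proof -
  obtain e where e: "\<And>k. k < d \<Longrightarrow> holomorphic_at n (e k) (a(n := 0))"
    "eventually (\<lambda>z. f z = (\<Sum>k<d. e k (z(n := 0)) * z n ^ k)) (near (Suc n) a)"
    using assms(1) by (auto simp: polynomial_at_def)
  define C where "C = (\<lambda>k. case k of 0 \<Rightarrow> (\<lambda>_. 0) | Suc k \<Rightarrow> e k)"
  show ?thesis
  proof (rule polynomial_atI[where c = C])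
    show "holomorphic_at n (C k) (a(n := 0))" if "k < Suc d" for k
      using that e(1) holomorphic_at_const[OF drop_in_Cn[OF a]] by (auto simp: C_def split: nat.split)
    have "w * (\<Sum>k<d. e k y * w ^ k) = (\<Sum>k<Suc d. C k y * w ^ k)" for y w
      unfolding sum.lessThan_Suc_shift by (simp add: C_def sum_distrib_left mult_ac)
    then show "eventually (\<lambda>z. z n * f z = (\<Sum>k<Suc d. C k (z(n := 0)) * z n ^ k)) (near (Suc n) a)"
      using e(2) by (auto elim!: eventually_mono simp only:)
  qed
qed

lemma polynomial_at_mult_power:
  "polynomial_at n a d f \<Longrightarrow> polynomial_at n a (k + d) (\<lambda>z. z n ^ k * f z)"
  by (induction k) (auto dest: polynomial_at_mult_coordinate simp: mult.assoc)

lemma polynomial_at_mult_centered: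
  assumes "polynomial_at n a d f"
  shows "polynomial_at n a (Suc d) (\<lambda>z. (z n - b) * f z)"
  using polynomial_at_diff[OF polynomial_at_mult_coordinate[OF assms]
      polynomial_at_mono[OF polynomial_at_scale[OF assms, of b], of "Suc d"]]
  by (simp add: left_diff_distrib)

text \<open>In terms of strict bounds, \<open>(d - 1) + (e - 1) < d + e - 1\<close>. The sharp bound
  is what lets \<open>relation_reduce\<close> end with entries of degree below
  \<open>d\<close>.\<close>

lemma polynomial_at_mult:
  assumes f: "polynomial_at n a d f" and g: "polynomial_at n a e g"
  shows "polynomial_at n a (d + e - 1) (\<lambda>z. f z * g z)"
proof -
  obtain c where c: "\<And>k. k < d \<Longrightarrow> holomorphic_at n (c k) (a(n := 0))"
    "eventually (\<lambda>z. f z = (\<Sum>k<d. c k (z(n := 0)) * z n ^ k)) (near (Suc n) a)"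
    using f by (auto simp: polynomial_at_def)
  have "polynomial_at n a (d + e - 1) (\<lambda>z. \<Sum>k<d. c k (z(n := 0)) * (z n ^ k * g z))"
  proof (intro polynomial_at_sum polynomial_at_cmult)
    fix k assume "k \<in> {..<d}"
    then show "polynomial_at n a (d + e - 1) (\<lambda>z. z n ^ k * g z)" "holomorphic_at n (c k) (a(n := 0))"
      using c(1) by (auto intro: polynomial_at_mono[OF polynomial_at_mult_power[OF g, of k]])
  qed
  then show ?thesis
    by (rule polynomial_at_cong) (use c(2) in eventually_elim, simp add: sum_distrib_right mult.assoc)
qed

lemma polynomial_at_centered:
  assumes "\<And>k. k < d \<Longrightarrow> holomorphic_at n (c k) (a(n := 0))"
  shows "polynomial_at n a d (\<lambda>z. \<Sum>k<d. c k (z(n := 0)) * (z n - b) ^ k)"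
proof (rule polynomial_at_sum)
  fix k assume k: "k \<in> {..<d}"
  have "polynomial_at n a (Suc j) (\<lambda>z. (z n - b) ^ j)" for j
  proof (induction j)
    case 0
    show ?case using polynomial_at_const[of "\<lambda>_. 1" 0] holomorphic_at_const[OF drop_in_Cn[OF a]] by simp
  next
    case (Suc j)
    then show ?case using polynomial_at_mult_centered by fastforce
  qed
  then have "polynomial_at n a (Suc k) (\<lambda>z. c k (z(n := 0)) * (z n - b) ^ k)"
    using assms k by (intro polynomial_at_cmult) auto
  then show "polynomial_at n a d (\<lambda>z. c k (z(n := 0)) * (z n - b) ^ k)"
    by (rule polynomial_at_mono) (use k in auto)
qed

lemma monic_at_power: "monic_at n a d (\<lambda>z. (z n - b) ^ d)"
  unfolding monic_at_def
proof (induction d)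
  case (Suc d)
  have "polynomial_at n a (Suc d) (\<lambda>z. z n ^ d)"
    using polynomial_at_mult_power[OF polynomial_at_const[of "\<lambda>_. 1" 0], of d]
      holomorphic_at_const[OF drop_in_Cn[OF a]] by simp
  then have "polynomial_at n a (Suc d) (\<lambda>z. (z n - b) * ((z n - b) ^ d - z n ^ d) - b * z n ^ d)"
    by (intro polynomial_at_diff polynomial_at_mult_centered polynomial_at_scale Suc)
  then show ?case by (simp add: algebra_simps)
qed (simp add: polynomial_at_zero)

lemma polynomial_at_coeffs_zero:
  assumes c: "\<And>k. k < d \<Longrightarrow> holomorphic_at n (c k) (a(n := 0))"
    and zero: "eventually (\<lambda>z. (\<Sum>k<d. c k (z(n := 0)) * z n ^ k) = 0) (near (Suc n) a)" and k: "k < d"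
  shows "eventually (\<lambda>z. c k z = 0) (near n (a(n := 0)))"
proof -
  obtain r where r: "r > 0" "\<And>z. z \<in> polydisc (Suc n) a r \<Longrightarrow> (\<Sum>k<d. c k (z(n := 0)) * z n ^ k) = 0"
    using zero unfolding eventually_near[OF a] by blast
  have "c k z = 0" if z: "z \<in> polydisc n (a(n := 0)) r" for z
  proof (rule polynomial_zero_on_ball[OF r(1) _ k, where c = "\<lambda>k. c k z" and b = "a n"])
    fix w assume w: "cmod (w - a n) < r"
    have zC: "z \<in> Cn n" using z polydisc_subset_Cn by blast
    then have "z(n := w) \<in> polydisc (Suc n) a r"
      using z w by (auto simp: polydisc_Suc cyl_def upd_in_Cn Cn_upd_0)
    from r(2)[OF this] show "(\<Sum>k<d. c k z * w ^ k) = 0" using zC by (simp add: Cn_upd_0)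
  qed
  then show ?thesis
    using r(1) unfolding eventually_near[OF drop_in_Cn[OF a]] by blast
qed

text \<open>Euclidean division: the leading term of \<open>f\<close> is cancelled and the bound
  drops by one. In Weierstrass division the quotient is merely holomorphic; here it is a polynomial
  with bound \<open>N - d\<close>, which truncates to 0 if \<open>N \<le> d\<close>.\<close>

lemma monic_division:
  assumes W: "monic_at n a d W" and f: "polynomial_at n a N f"
  obtains Q R where "polynomial_at n a (N - d) Q" "polynomial_at n a d R"
    "eventually (\<lambda>z. f z = Q z * W z + R z) (near (Suc n) a)"
  using f
proof (induction N arbitrary: f thesis)
  case 0
  show ?case
    by (rule "0.prems"(1)[of "\<lambda>_. 0" f])
      (use polynomial_at_mono[OF "0.prems"(2)] polynomial_at_zero in auto)
next
  case (Suc N)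
  show ?case
  proof (cases "Suc N \<le> d")
    case True
    then show ?thesis
      by (intro Suc.prems(1)[of "\<lambda>_. 0" f]) (use Suc.prems(2) polynomial_at_zero polynomial_at_mono in auto)
  next
    case False
    then have Nd: "N - d + d = N" "Suc N - d = Suc (N - d)" by auto
    obtain c where c: "\<And>k. k < Suc N \<Longrightarrow> holomorphic_at n (c k) (a(n := 0))"
      "eventually (\<lambda>z. f z = (\<Sum>k<Suc N. c k (z(n := 0)) * z n ^ k)) (near (Suc n) a)"
      using Suc.prems(2) unfolding polynomial_at_def by blast
    let ?m = "\<lambda>z. c N (z(n := 0)) * z n ^ (N - d)"
    let ?V = "\<lambda>z. W z - z n ^ d"
    have V: "polynomial_at n a d ?V" using W by (simp add: monic_at_def)
    have f': "polynomial_at n a N (\<lambda>z. \<Sum>k<N. c k (z(n := 0)) * z n ^ k)"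
      by (rule polynomial_atI[where c = c]) (use c in auto)
    have "polynomial_at n a N (\<lambda>z. c N (z(n := 0)) * (z n ^ (N - d) * ?V z))"
      using polynomial_at_cmult[OF polynomial_at_mult_power[OF V, of "N - d"] c(1)] Nd by simp
    from polynomial_at_diff[OF f' this] have pf: "polynomial_at n a N (\<lambda>z. f z - ?m z * W z)"
    proof (rule polynomial_at_cong)
      show "eventually (\<lambda>z. (\<Sum>k<N. c k (z(n := 0)) * z n ^ k) - c N (z(n := 0)) * (z n ^ (N - d) * ?V z)
          = f z - ?m z * W z) (near (Suc n) a)"
        using c(2)
      proof eventually_elim
        case (elim z)
        have "z n ^ (N - d) * z n ^ d = z n ^ N" by (metis Nd(1) power_add)
        moreover have "f z = (\<Sum>k<N. c k (z(n := 0)) * z n ^ k) + c N (z(n := 0)) * z n ^ N"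
          using elim by (simp only: sum.lessThan_Suc)
        ultimately show ?case by (simp only: right_diff_distrib) (simp only: mult.assoc algebra_simps)
      qed
    qed
    obtain Q R where Q: "polynomial_at n a (N - d) Q" and R: "polynomial_at n a d R"
      and QR: "eventually (\<lambda>z. f z - ?m z * W z = Q z * W z + R z) (near (Suc n) a)"
      by (rule Suc.IH[OF _ pf]) (rule that)
    have "polynomial_at n a (Suc N - d) (\<lambda>z. Q z + ?m z)"
    proof -
      have "polynomial_at n a (Suc (N - d)) ?m"
        using polynomial_at_cmult[OF polynomial_at_mult_power[OF polynomial_at_const[of "\<lambda>_. 1" 0], of "N - d"] c(1)]
          holomorphic_at_const[OF drop_in_Cn[OF a]] by simp
      then show ?thesis
        unfolding Nd(2) by (intro polynomial_at_add polynomial_at_mono[OF Q]) auto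
    qed
    then show ?thesis
      by (rule Suc.prems(1)[OF _ R]) (use QR in eventually_elim, simp only: diff_eq_eq distrib_right add_ac)
  qed
qed

end

text \<open>Letting \<open>w\<close> tend to \<open>b\<close> kills the lowest coefficient; then one
  factor \<open>w - b\<close> is cancelled on both sides.\<close>

lemma polynomial_divisible_coeffs_zero:
  fixes r :: "nat \<Rightarrow> complex"
  assumes "eventually (\<lambda>w. (\<Sum>k<d. r k * (w - b) ^ k) = (w - b) ^ d * h w) (at b)" "isCont h b"
    and "k < d"
  shows "r k = 0"
  using assms(1,3)
proof (induction d arbitrary: r k)
  case (Suc d)
  have "((\<lambda>w. \<Sum>k<Suc d. r k * (w - b) ^ k) \<longlongrightarrow> (\<Sum>k<Suc d. r k * (b - b) ^ k)) (at b)"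
    by (intro tendsto_intros)
  moreover have "((\<lambda>w. (w - b) ^ Suc d * h w) \<longlongrightarrow> (b - b) ^ Suc d * h b) (at b)"
    using assms(2) unfolding isCont_def by (intro tendsto_intros)
  then have "((\<lambda>w. \<Sum>k<Suc d. r k * (w - b) ^ k) \<longlongrightarrow> (b - b) ^ Suc d * h b) (at b)"
    by (rule Lim_transform_eventually) (use Suc.prems(1) in eventually_elim, simp)
  ultimately have "(\<Sum>k<Suc d. r k * (b - b) ^ k) = (b - b) ^ Suc d * h b"
    by (intro tendsto_unique[of "at b"]) auto
  then have r0: "r 0 = 0"
    unfolding sum.lessThan_Suc_shift by simp
  have "eventually (\<lambda>w. (\<Sum>k<d. r (Suc k) * (w - b) ^ k) = (w - b) ^ d * h w) (at b)"
    using Suc.prems(1) eventually_neq_at_within[of b b UNIV]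
  proof eventually_elim
    case (elim w)
    have "(w - b) * (\<Sum>k<d. r (Suc k) * (w - b) ^ k) = (w - b) * ((w - b) ^ d * h w)"
      using elim(1) unfolding sum.lessThan_Suc_shift by (simp add: r0 sum_distrib_left mult_ac)
    then show ?case using elim(2) by simp
  qed
  from Suc.IH[OF this] show ?case using Suc.prems(2) r0 by (cases k) auto
qed simp

lemma eventually_near_section:
  assumes a: "a \<in> Cn (Suc n)" and Q: "eventually Q (near (Suc n) a)"
  shows "eventually (\<lambda>w. Q (a(n := w))) (nhds (a n))"
proof -
  obtain r where r: "r > 0" "\<And>z. z \<in> polydisc (Suc n) a r \<Longrightarrow> Q z"
    using Q unfolding eventually_near[OF a] by blast
  have "Q (a(n := w))" if "w \<in> ball (a n) r" for w
    using that r(1) a by (intro r(2)) (auto simp: polydisc_def upd_in_Cn dist_norm norm_minus_commute)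
  moreover have "eventually (\<lambda>w. w \<in> ball (a n) r) (nhds (a n))"
    using r(1) by (intro eventually_nhds_in_open) auto
  ultimately show ?thesis by (auto elim: eventually_mono)
qed

lemma holomorphic_at_section_isCont:
  assumes a: "a \<in> Cn (Suc n)" and f: "holomorphic_at (Suc n) f a"
  shows "isCont (\<lambda>w. f (a(n := w))) (a n)"
proof -
  have "eventually (\<lambda>z. dist (f z) (f a) < e) (near (Suc n) a)" if "e > 0" for e
    using tendstoD[OF holomorphic_at_continuous[OF a f] that] .
  from eventually_near_section[OF a this]
  have "((\<lambda>w. f (a(n := w))) \<longlongrightarrow> f a) (nhds (a n))"
    by (intro tendstoI) auto
  then show ?thesis
    unfolding isCont_def by (auto intro: tendsto_mono[OF at_within_le_nhds])
qed

text \<open>Dividing the power of the last coordinate by \<open>W\<close> and restricting to the line through \<open>a\<close>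
  shows that the remainder vanishes at \<open>a\<close>, which is why the quotient is a unit.\<close>

theorem weierstrass_preparation:
  assumes a: "a \<in> Cn (Suc n)" and W: "holomorphic_at (Suc n) W a" and reg: "regular_at n d W a"
  obtains u where "holomorphic_at (Suc n) u a" "u a \<noteq> 0" "monic_at n a d (\<lambda>z. u z * W z)"
proof -
  define b where "b = a n"
  have "holomorphic_at (Suc n) (\<lambda>z. (z n - b) ^ d) a"
    by (intro holomorphic_at_power holomorphic_at_diff holomorphic_at_coordinate holomorphic_at_const a)
  then obtain q c where q: "holomorphic_at (Suc n) q a"
    and c: "\<And>k. k < d \<Longrightarrow> holomorphic_at n (c k) (a(n := 0))"
    and eq: "eventually (\<lambda>z. (z n - b) ^ d = q z * W z + (\<Sum>k<d. c k (z(n := 0)) * (z n - b) ^ k)) (near (Suc n) a)"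
    by (rule weierstrass_division[OF a W reg, folded b_def]) (rule that)
  obtain u r where r: "r > 0" and u: "u holomorphic_on ball b r"
    and uW: "\<And>w. w \<in> ball b r \<Longrightarrow> u w \<noteq> 0 \<and> W (a(n := w)) = (w - b) ^ d * u w"
    using reg unfolding regular_at_def b_def by blast
  define h where "h = (\<lambda>w. 1 - q (a(n := w)) * u w)"
  have "isCont u b"
    using u r by (auto intro!: field_differentiable_imp_continuous_at holomorphic_on_imp_differentiable_at)
  then have h: "isCont h b"
    unfolding h_def using holomorphic_at_section_isCont[OF a q] b_def by (intro continuous_intros) auto
  have "eventually (\<lambda>w. w \<in> ball b r) (nhds b)"
    using r by (intro eventually_nhds_in_open) auto
  with eventually_near_section[OF a eq, folded b_def]
  have ev: "eventually (\<lambda>w. (\<Sum>k<d. c k (a(n := 0)) * (w - b) ^ k) = (w - b) ^ d * h w) (nhds b)"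
  proof eventually_elim
    case (elim w)
    have "(w - b) ^ d = q (a(n := w)) * ((w - b) ^ d * u w) + (\<Sum>k<d. c k (a(n := 0)) * (w - b) ^ k)"
      using elim uW[of w] by simp
    then show ?case unfolding h_def by (simp add: algebra_simps)
  qed
  then have ev': "eventually (\<lambda>w. (\<Sum>k<d. c k (a(n := 0)) * (w - b) ^ k) = (w - b) ^ d * h w) (at b)"
    by (rule filter_leD[OF at_within_le_nhds])
  then have c0: "c k (a(n := 0)) = 0" if "k < d" for k
    using polynomial_divisible_coeffs_zero[where r = "\<lambda>k. c k (a(n := 0))", OF _ h that] by blast
  have "eventually (\<lambda>w. h w = 0) (at b)"
    using ev' eventually_neq_at_within[of b b UNIV] by eventually_elim (simp add: c0)
  then have "(h \<longlongrightarrow> 0) (at b)"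
    by (simp add: tendsto_eventually)
  moreover have "(h \<longlongrightarrow> h b) (at b)" using h by (simp add: isCont_def)
  \<comment> \<open>Since \<open>h b = 1 - q a * u b\<close>, this forces \<open>q a\<close> to be
    non-zero.\<close>
  ultimately have "h b = 0" using tendsto_unique[of "at b"] by force
  then have qa: "q a \<noteq> 0" by (auto simp: h_def b_def)
  have "polynomial_at n a d (\<lambda>z. ((z n - b) ^ d - z n ^ d) - (\<Sum>k<d. c k (z(n := 0)) * (z n - b) ^ k))"
    using monic_at_power[OF a, of d b] c unfolding monic_at_def
    by (rule polynomial_at_diff[OF a _ polynomial_at_centered[OF a]])
  then have "monic_at n a d (\<lambda>z. q z * W z)"
    unfolding monic_at_def by (rule polynomial_at_cong) (use eq in eventually_elim, simp)
  then show ?thesis using that q qa by blast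
qed

lemma monic_at_holomorphic:
  assumes "a \<in> Cn (Suc n)" "monic_at n a d W"
  shows "holomorphic_at (Suc n) W a"
proof -
  have "holomorphic_at (Suc n) (\<lambda>z. (W z - z n ^ d) + z n ^ d) a"
    using polynomial_at_holomorphic[OF assms(1)] assms unfolding monic_at_def
    by (intro holomorphic_at_add holomorphic_at_power holomorphic_at_coordinate)
  then show ?thesis by simp
qed

text \<open>At a point near the centre a monic polynomial of degree \<open>d\<close> may vanish to
  lower order along the vertical line. The order \<open>e\<close> is the multiplicity of
  \<open>a n\<close> as a root of the polynomial with coefficients evaluated at
  \<open>a(n := 0)\<close>, which is non-zero because it is monic.\<close>

lemma monic_at_regular:
  assumes a: "a \<in> Cn (Suc n)" and W: "monic_at n a d W"
  obtains e where "e \<le> d" "regular_at n e W a"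
proof -
  obtain c where eq: "eventually (\<lambda>z. W z - z n ^ d = (\<Sum>k<d. c k (z(n := 0)) * z n ^ k)) (near (Suc n) a)"
    using W unfolding monic_at_def polynomial_at_def by blast
  define P where "P = (\<Sum>k<d. monom (c k (a(n := 0))) k) + monom 1 d"
  have "coeff P d = 1" by (simp add: P_def coeff_sum)
  then have P0: "P \<noteq> 0" by auto
  have deg: "degree P \<le> d"
    unfolding P_def by (intro degree_add_le degree_sum_le) (auto intro: order.trans[OF degree_monom_le])
  define e where "e = Polynomial.order (a n) P"
  obtain q where q: "P = [:- a n, 1:] ^ e * q" "\<not> [:- a n, 1:] dvd q"
    using order_decomp[OF P0, of "a n"] unfolding e_def by blast
  have "poly q (a n) \<noteq> 0" using q(2) by (simp add: poly_eq_0_iff_dvd)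
  moreover have "open {w. poly q w \<noteq> 0}"
    by (intro open_Collect_neq continuous_intros)
  ultimately have "eventually (\<lambda>w. w \<in> {w. poly q w \<noteq> 0}) (nhds (a n))"
    by (intro eventually_nhds_in_open) auto
  with eventually_near_section[OF a eq]
  have "eventually (\<lambda>w. poly q w \<noteq> 0 \<and> W (a(n := w)) = (w - a n) ^ e * poly q w) (nhds (a n))"
  proof eventually_elim
    case (elim w)
    have "W (a(n := w)) = poly P w"
      using elim(1) by (simp add: P_def poly_sum poly_monom diff_eq_eq)
    also have "\<dots> = (w - a n) ^ e * poly q w"
      unfolding q(1) by (simp add: poly_power)
    finally show ?case using elim(2) by simp
  qed
  then obtain r where "r > 0" "\<And>w. dist w (a n) < r \<Longrightarrow> poly q w \<noteq> 0 \<and> W (a(n := w)) = (w - a n) ^ e * poly q w"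
    unfolding eventually_nhds_metric by blast
  then have "regular_at n e W a"
    unfolding regular_at_def by (intro exI[of _ "poly q"] exI[of _ r]) (auto simp: dist_commute intro!: holomorphic_intros)
  moreover have "e \<le> d"
    unfolding e_def using order_degree[OF P0] deg by (rule order.trans)
  ultimately show ?thesis using that by blast
qed

text \<open>Some point \<open>y\<close> near \<open>x\<close> has \<open>f y \<noteq> 0\<close> and
  a last coordinate different from that of \<open>x\<close>. A shear makes the line through
  \<open>x\<close> and \<open>y\<close> vertical, and on this line \<open>f\<close> does not vanish
  identically, so its order at \<open>x\<close> is finite.\<close>

lemma regular_after_shear:
  assumes x: "x \<in> Cn (Suc n)" and f: "holomorphic_at (Suc n) f x"
    and nz: "\<not> eventually (\<lambda>z. f z = 0) (near (Suc n) x)"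
  obtains c d where "c \<in> Cn n" "regular_at n d (\<lambda>z. f (shear n c z)) (shear n (\<lambda>i. - c i) x)"
proof -
  obtain r where r: "r > 0" "holo (Suc n) (polydisc (Suc n) x r) f"
    using f holomorphic_at_iff_holo[OF x] by blast
  obtain y0 where y0: "y0 \<in> polydisc (Suc n) x (r / 2)" "f y0 \<noteq> 0"
    using nz r(1) unfolding eventually_near[OF x] by (metis half_gt_zero)
  have y0C: "y0 \<in> Cn (Suc n)" using y0 polydisc_subset_Cn by blast
  have sub: "polydisc (Suc n) x (r / 2) \<subseteq> polydisc (Suc n) x r"
    using r(1) by (intro polydisc_mono) auto
  have "eventually (\<lambda>z. z \<in> polydisc (Suc n) x (r / 2)) (near (Suc n) y0)"
    using y0(1) openin_polydisc y0C unfolding eventually_nhdsin by blast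
  moreover have "eventually (\<lambda>z. f z \<noteq> 0) (near (Suc n) y0)"
    using y0 sub holo_imp_holomorphic_at[OF r(2)] by (intro holomorphic_at_eventually_nonzero y0C) auto
  ultimately have "eventually (\<lambda>z. z \<in> polydisc (Suc n) x (r / 2) \<and> f z \<noteq> 0) (near (Suc n) y0)"
    by eventually_elim auto
  from eventually_near_section[OF y0C this]
  have "eventually (\<lambda>w. y0(n := w) \<in> polydisc (Suc n) x (r / 2) \<and> f (y0(n := w)) \<noteq> 0) (at (y0 n))"
    by (rule filter_leD[OF at_within_le_nhds])
  \<comment> \<open>\<open>y0\<close> may share its last coordinate with \<open>x\<close>. Moving it
    slightly keeps \<open>f\<close> non-zero and gives \<open>y - x\<close> a non-zero last entry,
    so that the direction can be scaled to last entry 1.\<close>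
  moreover have "eventually (\<lambda>w. w \<noteq> x n) (at (y0 n))"
    by (rule eventually_neq_at_within)
  ultimately have "eventually (\<lambda>w. (y0(n := w) \<in> polydisc (Suc n) x (r / 2) \<and> f (y0(n := w)) \<noteq> 0)
      \<and> w \<noteq> x n) (at (y0 n))"
    by (rule eventually_conj)
  from eventually_happens'[OF at_neq_bot this]
  obtain w where w: "y0(n := w) \<in> polydisc (Suc n) x (r / 2)" "f (y0(n := w)) \<noteq> 0" "w \<noteq> x n"
    by blast
  define y where "y = y0(n := w)"
  define t1 where "t1 = y n - x n"
  have y: "y \<in> polydisc (Suc n) x (r / 2)" "f y \<noteq> 0" and t1: "t1 \<noteq> 0"
    using w by (auto simp: y_def t1_def)
  have yC: "y \<in> Cn (Suc n)" using y polydisc_subset_Cn by blast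
  define c where "c = (\<lambda>i. if i < n then (y i - x i) / t1 else 0)"
  have c: "c \<in> Cn n" by (simp add: c_def Cn_def)
  define v where "v = c(n := 1)"
  have v: "v \<in> Cn (Suc n)" using c upd_in_Cn by (auto simp: v_def)
  have tv: "t1 * v i = y i - x i" if "i < Suc n" for i
    using that t1 by (auto simp: v_def c_def t1_def)
  define \<phi> where "\<phi> = (\<lambda>t. f (line x t v))"
  \<comment> \<open>\<open>y\<close> was chosen within \<open>r / 2\<close>, so the parameter disc
    of radius \<open>2 * cmod t1\<close> stays in the domain and contains \<open>t1\<close>, the
    parameter of \<open>y\<close>.\<close>
  have "line x t v \<in> polydisc (Suc n) x r" if "cmod t < 2 * cmod t1" for t
  proof -
    have "cmod (t * v i) < r" if i: "i < Suc n" for i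
    proof -
      have "cmod (t * v i) \<le> 2 * cmod t1 * cmod (v i)"
        unfolding norm_mult using \<open>cmod t < 2 * cmod t1\<close> by (intro mult_right_mono) auto
      also have "\<dots> = 2 * cmod (y i - x i)"
        using tv[OF i] by (simp add: norm_mult[symmetric])
      also have "\<dots> < r" using y(1) i by (auto simp: polydisc_def)
      finally show ?thesis .
    qed
    then show ?thesis using line_in_Cn[OF x v] by (auto simp: polydisc_def line_def)
  qed
  then have hol: "\<phi> holomorphic_on ball 0 (2 * cmod t1)"
    unfolding \<phi>_def by (intro holo_line[OF r(2) v]) auto
  have "line x t1 v = y"
  proof
    fix i show "line x t1 v i = y i"
    proof (cases "i < Suc n")
      case True
      then show ?thesis using tv[of i] by (simp add: line_def)
    next
      case False
      then show ?thesis using x v yC by (simp add: line_def Cn_def)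
    qed
  qed
  then have \<phi>1: "\<phi> t1 \<noteq> 0" using y by (simp add: \<phi>_def)
  have "\<exists>d u s. s > 0 \<and> u holomorphic_on ball 0 s \<and> (\<forall>t\<in>ball 0 s. u t \<noteq> 0 \<and> \<phi> t = t ^ d * u t)"
  proof (cases "\<phi> 0 = 0")
    case False
    have "continuous_on (ball 0 (2 * cmod t1)) \<phi>" using hol holomorphic_on_imp_continuous_on by blast
    then have "isCont \<phi> 0" using t1 by (simp add: continuous_on_eq_continuous_at)
    then obtain s where s: "s > 0" "\<And>t. dist 0 t < s \<Longrightarrow> \<phi> t \<noteq> 0"
      using continuous_at_avoid[of 0 \<phi> 0] False by auto
    have "\<phi> holomorphic_on ball 0 (min s (2 * cmod t1))"
      by (rule holomorphic_on_subset[OF hol]) auto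
    then show ?thesis using s t1
      by (intro exI[of _ 0] exI[of _ \<phi>] exI[of _ "min s (2 * cmod t1)"]) auto
  next
    case True
    have "\<not> \<phi> constant_on ball 0 (2 * cmod t1)"
    proof
      assume "\<phi> constant_on ball 0 (2 * cmod t1)"
      then obtain k where "\<And>t. t \<in> ball 0 (2 * cmod t1) \<Longrightarrow> \<phi> t = k" by (auto simp: constant_on_def)
      from this[of 0] this[of t1] show False using True \<phi>1 t1 by simp
    qed
    from holomorphic_factor_zero_nonconstant[OF hol open_ball connected_ball _ True this]
    obtain g s d where "0 < s" "g holomorphic_on ball 0 s"
      "\<And>w. w \<in> ball 0 s \<Longrightarrow> \<phi> w = (w - 0) ^ d * g w" "\<And>w. w \<in> ball 0 s \<Longrightarrow> g w \<noteq> 0"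
      using t1 by (metis centre_in_ball mult_pos_pos zero_less_norm_iff zero_less_numeral)
    then show ?thesis by (intro exI[of _ d] exI[of _ g] exI[of _ s]) auto
  qed
  then obtain d u s where s: "s > 0" and u: "u holomorphic_on ball 0 s"
    and us: "\<And>t. t \<in> ball 0 s \<Longrightarrow> u t \<noteq> 0 \<and> \<phi> t = t ^ d * u t"
    by blast
  define a where "a = shear n (\<lambda>i. - c i) x"
  have an: "a n = x n" using c by (simp add: a_def shear_def Cn_def)
  have "shear n c (a(n := w)) = line x (w - x n) v" for w
    using c by (auto simp: a_def shear_def line_def v_def Cn_def fun_eq_iff algebra_simps)
  then have fw: "f (shear n c (a(n := w))) = \<phi> (w - a n)" for w
    by (simp add: \<phi>_def an)
  have "regular_at n d (\<lambda>z. f (shear n c z)) a"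
    unfolding regular_at_def
  proof (intro exI[of _ "\<lambda>w. u (w - a n)"] exI[of _ s] conjI ballI s)
    show "(\<lambda>w. u (w - a n)) holomorphic_on ball (a n) s"
      by (rule holomorphic_on_compose_gen[OF _ u, unfolded o_def])
        (auto intro!: holomorphic_intros simp: dist_norm norm_minus_commute)
    fix w assume "w \<in> ball (a n) s"
    then have "w - a n \<in> ball 0 s" by (simp add: dist_norm norm_minus_commute)
    then show "u (w - a n) \<noteq> 0" "f (shear n c (a(n := w))) = (w - a n) ^ d * u (w - a n)"
      using us fw by auto
  qed
  then show ?thesis using that[OF c] by (simp add: a_def)
qed

section \<open>Oka's coherence theorem\<close>

type_synonym 'i vector = "'i \<Rightarrow> (nat \<Rightarrow> complex) \<Rightarrow> complex"

definition relation_at :: "nat \<Rightarrow> 'i set \<Rightarrow> 'i vector \<Rightarrow> (nat \<Rightarrow> complex) \<Rightarrow> 'i vector \<Rightarrow> bool" where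
  "relation_at n I f a v \<longleftrightarrow> (\<forall>j\<in>I. holomorphic_at n (v j) a) \<and>
     eventually (\<lambda>z. (\<Sum>j\<in>I. f j z * v j z) = 0) (near n a)"

text \<open>Coefficients are indexed by the generating vectors themselves, which avoids an
  enumeration of \<open>G\<close>. Equality is equality of germs, and only entries with index in
  \<open>I\<close> are compared.\<close>

definition spanned_at :: "nat \<Rightarrow> 'i set \<Rightarrow> 'i vector set \<Rightarrow> (nat \<Rightarrow> complex) \<Rightarrow> 'i vector \<Rightarrow> bool" where
  "spanned_at n I G a v \<longleftrightarrow> (\<exists>c. (\<forall>g\<in>G. holomorphic_at n (c g) a) \<and>
     (\<forall>j\<in>I. eventually (\<lambda>z. v j z = (\<Sum>g\<in>G. c g z * g j z)) (near n a)))"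


text \<open>Local finite generation near \<open>x\<close> of the sheaf of common relations of the rows \<open>A r\<close>, \<open>r \<in> Q\<close>.\<close>

definition coherent_at :: "nat \<Rightarrow> 'i set \<Rightarrow> 'r set \<Rightarrow> ('r \<Rightarrow> 'i vector) \<Rightarrow> (nat \<Rightarrow> complex) \<Rightarrow> bool" where
  "coherent_at n I Q A x \<longleftrightarrow> (\<exists>G. finite G \<and> eventually (\<lambda>a.
     (\<forall>g\<in>G. (\<forall>j\<in>I. holomorphic_at n (g j) a) \<and> (\<forall>r\<in>Q. relation_at n I (A r) a g)) \<and>
     (\<forall>v. (\<forall>j\<in>I. holomorphic_at n (v j) a) \<and> (\<forall>r\<in>Q. relation_at n I (A r) a v) \<longrightarrow> spanned_at n I G a v))
     (near n x))"

lemma coherent_at_single: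
  "coherent_at n I {r} A x \<longleftrightarrow> (\<exists>G. finite G \<and> eventually (\<lambda>a.
     (\<forall>g\<in>G. relation_at n I (A r) a g) \<and>
     (\<forall>v. relation_at n I (A r) a v \<longrightarrow> spanned_at n I G a v)) (near n x))"
proof -
  have "(\<forall>j\<in>I. holomorphic_at n (v j) a) \<and> (\<forall>r'\<in>{r}. relation_at n I (A r') a v) \<longleftrightarrow> relation_at n I (A r) a v"
    for v a by (auto simp: relation_at_def)
  then show ?thesis unfolding coherent_at_def by (simp only:)
qed

text \<open>Transitivity of generation. Together with \<open>spanned_at_member\<close> it reduces
  later claims of generation to displaying coefficients.\<close>

lemma spanned_at_lincomb:
  assumes a: "a \<in> Cn n" and G: "finite G" and T: "finite T"
    and d: "\<And>t. t \<in> T \<Longrightarrow> holomorphic_at n (d t) a"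
    and w: "\<And>t. t \<in> T \<Longrightarrow> spanned_at n I G a (w t)"
    and v: "\<And>j. j \<in> I \<Longrightarrow> eventually (\<lambda>z. v j z = (\<Sum>t\<in>T. d t z * w t j z)) (near n a)"
  shows "spanned_at n I G a v"
proof -
  have "\<forall>t\<in>T. \<exists>c. (\<forall>g\<in>G. holomorphic_at n (c g) a) \<and>
     (\<forall>j\<in>I. eventually (\<lambda>z. w t j z = (\<Sum>g\<in>G. c g z * g j z)) (near n a))"
    using w unfolding spanned_at_def by blast
  from bchoice[OF this] obtain c where c: "\<And>t g. t \<in> T \<Longrightarrow> g \<in> G \<Longrightarrow> holomorphic_at n (c t g) a"
    "\<And>t j. t \<in> T \<Longrightarrow> j \<in> I \<Longrightarrow> eventually (\<lambda>z. w t j z = (\<Sum>g\<in>G. c t g z * g j z)) (near n a)"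
    by blast
  show ?thesis unfolding spanned_at_def
  proof (intro exI[of _ "\<lambda>g z. \<Sum>t\<in>T. d t z * c t g z"] conjI ballI)
    show "holomorphic_at n (\<lambda>z. \<Sum>t\<in>T. d t z * c t g z) a" if "g \<in> G" for g
      using c(1) d that by (intro holomorphic_at_sum holomorphic_at_mult a) auto
    fix j assume j: "j \<in> I"
    have "eventually (\<lambda>z. \<forall>t\<in>T. w t j z = (\<Sum>g\<in>G. c t g z * g j z)) (near n a)"
      using c(2) j T by (intro eventually_ball_finite) auto
    with v[OF j] show "eventually (\<lambda>z. v j z = (\<Sum>g\<in>G. (\<Sum>t\<in>T. d t z * c t g z) * g j z)) (near n a)"
    proof eventually_elim
      case (elim z)
      have "v j z = (\<Sum>t\<in>T. \<Sum>g\<in>G. d t z * c t g z * g j z)"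
        using elim by (simp add: sum_distrib_left mult.assoc)
      also have "\<dots> = (\<Sum>g\<in>G. (\<Sum>t\<in>T. d t z * c t g z) * g j z)"
        by (subst sum.swap) (simp add: sum_distrib_right)
      finally show ?case .
    qed
  qed
qed

lemma spanned_at_member:
  assumes "a \<in> Cn n" "finite G" "g \<in> G"
  shows "spanned_at n I G a g"
  unfolding spanned_at_def
proof (intro exI[of _ "\<lambda>h _. if h = g then 1 else 0"] conjI ballI always_eventually allI)
  fix j z show "g j z = (\<Sum>h\<in>G. (if h = g then 1 else 0) * h j z)"
    using assms by (simp add: if_distrib[where f = "\<lambda>x. x * _"] cong: if_cong)
qed (rule holomorphic_at_const[OF assms(1)])

lemma coherent_at_no_rows:
  fixes I :: "'i set"
  assumes x: "x \<in> Cn n" and I: "finite I"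
  shows "coherent_at n I {} A x"
proof -
  define e where "e = (\<lambda>i j :: 'i. \<lambda>z :: nat \<Rightarrow> complex. if j = i then 1 else 0 :: complex)"
  have hol: "holomorphic_at n (e i j) a" if "a \<in> Cn n" for a i j
    using holomorphic_at_const[OF that] by (simp add: e_def)
  have "spanned_at n I (e ` I) a v" if a: "a \<in> Cn n" and v: "\<And>j. j \<in> I \<Longrightarrow> holomorphic_at n (v j) a" for a v
  proof (rule spanned_at_lincomb[where T = I and d = v and w = e])
    fix j assume j: "j \<in> I"
    have "v j z = (\<Sum>t\<in>I. v t z * e t j z)" for z
      using I j by (simp add: e_def if_distrib[where f = "\<lambda>x. _ * x"] eq_commute cong: if_cong)
    then show "eventually (\<lambda>z. v j z = (\<Sum>t\<in>I. v t z * e t j z)) (near n a)" by simp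
  qed (use I v a in \<open>auto intro: spanned_at_member\<close>)
  then show ?thesis
    unfolding coherent_at_def using I eventually_near_Cn[OF x] hol
    by (intro exI[of _ "e ` I"]) (auto elim!: eventually_mono)
qed

lemma coherent_at_zero_row:
  assumes x: "x \<in> Cn n" and I: "finite I" and f: "\<And>j. j \<in> I \<Longrightarrow> eventually (\<lambda>z. f j z = 0) (near n x)"
  shows "coherent_at n I {r} (\<lambda>_. f) x"
proof -
  obtain G where G: "finite G" "eventually (\<lambda>a. (\<forall>g\<in>G. \<forall>j\<in>I. holomorphic_at n (g j) a) \<and>
     (\<forall>v. (\<forall>j\<in>I. holomorphic_at n (v j) a) \<longrightarrow> spanned_at n I G a v)) (near n x)"
    using coherent_at_no_rows[OF x I] unfolding coherent_at_def by auto
  have "eventually (\<lambda>z. \<forall>j\<in>I. f j z = 0) (near n x)"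
    using f I by (intro eventually_ball_finite) auto
  from eventually_near_near[OF x this] G(2)
  have "eventually (\<lambda>a. (\<forall>g\<in>G. relation_at n I f a g) \<and>
     (\<forall>v. relation_at n I f a v \<longrightarrow> spanned_at n I G a v)) (near n x)"
  proof eventually_elim
    case (elim a)
    have "eventually (\<lambda>z. (\<Sum>j\<in>I. f j z * v j z) = 0) (near n a)" for v
      using elim(1)[THEN conjunct2] by eventually_elim simp
    then show ?case using elim(2) unfolding relation_at_def by blast
  qed
  then show ?thesis unfolding coherent_at_single using G(1) by blast
qed

text \<open>The proof of Oka's theorem changes index types: entries of a vector become coefficients
  indexed by pairs, and generators found earlier become indices themselves.\<close>

lemma coherent_at_reindex:
  assumes b: "bij_betw b I I'" and co: "coherent_at n I' Q A' x"
    and A: "\<And>r i. r \<in> Q \<Longrightarrow> i \<in> I \<Longrightarrow> A' r (b i) = A r i"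
  shows "coherent_at n I Q A x"
proof -
  define b' where "b' = the_inv_into I b"
  have bb: "\<And>i. i \<in> I \<Longrightarrow> b' (b i) = i" "\<And>k. k \<in> I' \<Longrightarrow> b (b' k) = k \<and> b' k \<in> I" "\<And>i. i \<in> I \<Longrightarrow> b i \<in> I'"
    using b unfolding b'_def bij_betw_def
    by (auto simp: the_inv_into_f_f f_the_inv_into_f intro: the_inv_into_into)
  have rel: "(\<forall>j\<in>I. holomorphic_at n (v j) a) \<and> (\<forall>r\<in>Q. relation_at n I (A r) a v) \<longleftrightarrow>
      (\<forall>j\<in>I'. holomorphic_at n (w j) a) \<and> (\<forall>r\<in>Q. relation_at n I' (A' r) a w)"
    if vw: "\<And>i. i \<in> I \<Longrightarrow> w (b i) = v i" for a v w
  proof -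
    have "(\<Sum>k\<in>I'. A' r k z * w k z) = (\<Sum>i\<in>I. A r i z * v i z)" if "r \<in> Q" for r z
      using sum.reindex_bij_betw[OF b, of "\<lambda>k. A' r k z * w k z"] A[OF that] vw by simp
    moreover have "(\<forall>j\<in>I'. holomorphic_at n (w j) a) \<longleftrightarrow> (\<forall>j\<in>I. holomorphic_at n (v j) a)"
      using bb vw by metis
    ultimately show ?thesis unfolding relation_at_def by auto
  qed
  obtain G where G: "finite G" and ev: "eventually (\<lambda>a.
     (\<forall>g\<in>G. (\<forall>j\<in>I'. holomorphic_at n (g j) a) \<and> (\<forall>r\<in>Q. relation_at n I' (A' r) a g)) \<and>
     (\<forall>v. (\<forall>j\<in>I'. holomorphic_at n (v j) a) \<and> (\<forall>r\<in>Q. relation_at n I' (A' r) a v) \<longrightarrow> spanned_at n I' G a v))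
     (near n x)"
    using co unfolding coherent_at_def by blast
  let ?G = "(\<lambda>g. g \<circ> b) ` G"
  \<comment> \<open>Outside \<open>Cn n\<close> the filter \<open>near n x\<close> is
    trivial.\<close>
  have a: "eventually (\<lambda>a. a \<in> Cn n) (near n x)"
  proof (cases "x \<in> Cn n")
    case True
    then show ?thesis by (rule eventually_near_Cn)
  qed (simp add: nhdsin_def)
  from a ev have "eventually (\<lambda>a.
     (\<forall>g\<in>?G. (\<forall>j\<in>I. holomorphic_at n (g j) a) \<and> (\<forall>r\<in>Q. relation_at n I (A r) a g)) \<and>
     (\<forall>v. (\<forall>j\<in>I. holomorphic_at n (v j) a) \<and> (\<forall>r\<in>Q. relation_at n I (A r) a v) \<longrightarrow> spanned_at n I ?G a v))
     (near n x)"
  proof eventually_elim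
    case (elim a)
    have "(\<forall>j\<in>I. holomorphic_at n ((g \<circ> b) j) a) \<and> (\<forall>r\<in>Q. relation_at n I (A r) a (g \<circ> b))" if "g \<in> G" for g
      using rel[of g "g \<circ> b" a] elim(2) that by simp
    moreover have "spanned_at n I ?G a v"
      if "(\<forall>j\<in>I. holomorphic_at n (v j) a) \<and> (\<forall>r\<in>Q. relation_at n I (A r) a v)" for v
    proof -
      have "spanned_at n I' G a (v \<circ> b')"
        using rel[of "v \<circ> b'" v a] that elim(2) bb(1) by simp
      then obtain c where c: "\<And>g. g \<in> G \<Longrightarrow> holomorphic_at n (c g) a"
        "\<And>j. j \<in> I' \<Longrightarrow> eventually (\<lambda>z. (v \<circ> b') j z = (\<Sum>g\<in>G. c g z * g j z)) (near n a)"
        unfolding spanned_at_def by blast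
      show ?thesis
      proof (rule spanned_at_lincomb[OF elim(1) _ G c(1), where w = "\<lambda>g. g \<circ> b"])
        show "eventually (\<lambda>z. v j z = (\<Sum>t\<in>G. c t z * (t \<circ> b) j z)) (near n a)" if "j \<in> I" for j
          using c(2)[of "b j"] bb that by simp
      qed (use G elim(1) in \<open>auto intro: spanned_at_member\<close>)
    qed
    ultimately show ?case by blast
  qed
  then show ?thesis unfolding coherent_at_def using G by blast
qed

text \<open>Adding a row: the relations of the new row are computed on generators of the old ones.\<close>

lemma coherent_at_insert_row:
  assumes x: "x \<in> Cn n" and I: "finite I"
    and A: "\<And>j. j \<in> I \<Longrightarrow> holomorphic_at n (A q j) x"
    and Q: "coherent_at n I Q A x"
    and row: "\<And>(G :: 'i vector set) f. finite G \<Longrightarrow> (\<And>g. g \<in> G \<Longrightarrow> holomorphic_at n (f g) x) \<Longrightarrow> coherent_at n G {()} (\<lambda>_. f) x"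
  shows "coherent_at n (I :: 'i set) (insert q Q) A x"
proof -
  obtain G where G: "finite G" and ev: "eventually (\<lambda>a.
     (\<forall>g\<in>G. (\<forall>j\<in>I. holomorphic_at n (g j) a) \<and> (\<forall>r\<in>Q. relation_at n I (A r) a g)) \<and>
     (\<forall>v. (\<forall>j\<in>I. holomorphic_at n (v j) a) \<and> (\<forall>r\<in>Q. relation_at n I (A r) a v) \<longrightarrow> spanned_at n I G a v))
     (near n x)"
    using Q unfolding coherent_at_def by blast
  \<comment> \<open>The value of the new row on the generator \<open>g\<close>. A combination of
    generators satisfies the new row exactly if its coefficient vector, indexed by \<open>G\<close>,
    is a relation of \<open>F\<close>; this is why \<open>row\<close> is stated for vectors as
    indices.\<close>
  define F where "F = (\<lambda>g z. \<Sum>j\<in>I. A q j z * g j z)"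
  have F: "holomorphic_at n (F g) x" if "g \<in> G" for g
    unfolding F_def using eventually_near_self[OF x ev] that A
    by (intro holomorphic_at_sum holomorphic_at_mult x) auto
  obtain H where H: "finite H" and evH: "eventually (\<lambda>a.
     (\<forall>h\<in>H. relation_at n G F a h) \<and>
     (\<forall>v. relation_at n G F a v \<longrightarrow> spanned_at n G H a v)) (near n x)"
    using row[OF G, of F] F unfolding coherent_at_single by blast
  define K where "K = (\<lambda>h j z. \<Sum>g\<in>G. h g z * g j z)"
  have "eventually (\<lambda>a. \<forall>j\<in>I. holomorphic_at n (A q j) a) (near n x)"
    using I A eventually_holomorphic_at[OF x] by (intro eventually_ball_finite) auto
  with eventually_near_Cn[OF x] ev evH have "eventually (\<lambda>a.
     (\<forall>g\<in>K ` H. (\<forall>j\<in>I. holomorphic_at n (g j) a) \<and> (\<forall>r\<in>insert q Q. relation_at n I (A r) a g)) \<and>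
     (\<forall>v. (\<forall>j\<in>I. holomorphic_at n (v j) a) \<and> (\<forall>r\<in>insert q Q. relation_at n I (A r) a v) \<longrightarrow>
        spanned_at n I (K ` H) a v)) (near n x)"
  proof eventually_elim
    case (elim a)
    note a = elim(1)
    have swap: "(\<Sum>j\<in>I. f j z * K h j z) = (\<Sum>g\<in>G. h g z * (\<Sum>j\<in>I. f j z * g j z))" for f h z
      unfolding K_def sum_distrib_left by (subst sum.swap) (simp add: mult_ac)
    show ?case
    proof (intro conjI ballI allI impI)
      fix k assume "k \<in> K ` H"
      then obtain h where h: "h \<in> H" "k = K h" by blast
      have hh: "\<And>g. g \<in> G \<Longrightarrow> holomorphic_at n (h g) a" "eventually (\<lambda>z. (\<Sum>g\<in>G. F g z * h g z) = 0) (near n a)"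
        using elim(3) h by (auto simp: relation_at_def)
      have hol: "holomorphic_at n (k j) a" if "j \<in> I" for j
        unfolding h K_def using hh elim(2) that by (intro holomorphic_at_sum holomorphic_at_mult a) auto
      then show "j \<in> I \<Longrightarrow> holomorphic_at n (k j) a" for j .
      fix r assume r: "r \<in> insert q Q"
      have "eventually (\<lambda>z. (\<Sum>j\<in>I. A r j z * k j z) = 0) (near n a)"
      proof (cases "r = q")
        case True
        then show ?thesis
          using hh(2) unfolding h swap by (simp add: F_def mult.commute)
      next
        case False
        then have "eventually (\<lambda>z. \<forall>g\<in>G. (\<Sum>j\<in>I. A r j z * g j z) = 0) (near n a)"
          using elim(2) r G by (intro eventually_ball_finite) (auto simp: relation_at_def)
        then show ?thesis unfolding h swap by eventually_elim simp
      qed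
      then show "relation_at n I (A r) a k" using hol by (simp add: relation_at_def)
    next
      fix v assume v: "(\<forall>j\<in>I. holomorphic_at n (v j) a) \<and> (\<forall>r\<in>insert q Q. relation_at n I (A r) a v)"
      then have "spanned_at n I G a v" using elim(2) by blast
      then obtain c where c: "\<And>g. g \<in> G \<Longrightarrow> holomorphic_at n (c g) a"
        "\<And>j. j \<in> I \<Longrightarrow> eventually (\<lambda>z. v j z = (\<Sum>g\<in>G. c g z * g j z)) (near n a)"
        unfolding spanned_at_def by blast
      have "eventually (\<lambda>z. \<forall>j\<in>I. v j z = K c j z) (near n a)"
        unfolding K_def using c(2) I by (intro eventually_ball_finite) auto
      moreover have "eventually (\<lambda>z. (\<Sum>j\<in>I. A q j z * v j z) = 0) (near n a)"
        using v by (simp add: relation_at_def)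
      ultimately have "eventually (\<lambda>z. (\<Sum>g\<in>G. F g z * c g z) = 0) (near n a)"
      proof eventually_elim
        case (elim z)
        then have "(\<Sum>j\<in>I. A q j z * K c j z) = 0" by simp
        then show ?case unfolding swap by (simp add: F_def mult.commute)
      qed
      then have "relation_at n G F a c" using c(1) by (simp add: relation_at_def)
      then have "spanned_at n G H a c" using elim(3) by blast
      then obtain d where d: "\<And>h. h \<in> H \<Longrightarrow> holomorphic_at n (d h) a"
        "\<And>g. g \<in> G \<Longrightarrow> eventually (\<lambda>z. c g z = (\<Sum>h\<in>H. d h z * h g z)) (near n a)"
        unfolding spanned_at_def by blast
      show "spanned_at n I (K ` H) a v"
      proof (rule spanned_at_lincomb[OF a _ H d(1), where w = K])
        fix j assume j: "j \<in> I"
        have "eventually (\<lambda>z. \<forall>g\<in>G. c g z = (\<Sum>h\<in>H. d h z * h g z)) (near n a)"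
          using d(2) G by (intro eventually_ball_finite) auto
        with c(2)[OF j] show "eventually (\<lambda>z. v j z = (\<Sum>h\<in>H. d h z * K h j z)) (near n a)"
        proof eventually_elim
          case (elim z)
          have "v j z = (\<Sum>g\<in>G. \<Sum>h\<in>H. d h z * h g z * g j z)"
            using elim by (simp add: sum_distrib_right)
          also have "\<dots> = (\<Sum>h\<in>H. d h z * K h j z)"
            unfolding K_def sum_distrib_left by (subst sum.swap) (simp add: mult.assoc)
          finally show ?case .
        qed
      qed (use H a in \<open>auto intro: spanned_at_member\<close>)
    qed
  qed
  then show ?thesis unfolding coherent_at_def using H by blast
qed

text \<open>Composition with a shear preserves holomorphy, relations and generation at corresponding
  points, so coherence may be checked in coordinates in which an entry is regular.\<close>

lemma coherent_at_shear:
  fixes f :: "'i vector"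
  assumes x: "x \<in> Cn (Suc n)" and c: "c \<in> Cn n"
    and co: "coherent_at (Suc n) I {()} (\<lambda>_ j z. f j (shear n c z)) (shear n (\<lambda>i. - c i) x)"
  shows "coherent_at (Suc n) I {()} (\<lambda>_. f) x"
proof -
  define s where "s = shear n c"
  define s' where "s' = shear n (\<lambda>i. - c i)"
  have c': "(\<lambda>i. - c i) \<in> Cn n" using c by (simp add: Cn_def)
  have ss: "s (s' z) = z" "s' (s z) = z" for z
    using shear_shear[OF c] by (auto simp: s_def s'_def)
  have sC: "s z \<in> Cn (Suc n)" "s' z \<in> Cn (Suc n)" if "z \<in> Cn (Suc n)" for z
    using that shear_in_Cn c c' by (auto simp: s_def s'_def)
  have evs: "eventually (\<lambda>z. P (s z)) (near (Suc n) a)" if "a \<in> Cn (Suc n)" "eventually P (near (Suc n) (s a))" for P a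
    using eventually_near_shear[OF c that(1)] that(2) by (simp add: s_def)
  have evs': "eventually (\<lambda>z. P (s' z)) (near (Suc n) a)" if "a \<in> Cn (Suc n)" "eventually P (near (Suc n) (s' a))" for P a
    using eventually_near_shear[OF c' that(1)] that(2) by (simp add: s'_def)
  have hols: "holomorphic_at (Suc n) (\<lambda>z. g (s z)) a" if "a \<in> Cn (Suc n)" "holomorphic_at (Suc n) g (s a)" for g a
    using holomorphic_at_shear[OF c that(1)] that(2) by (simp add: s_def)
  have hols': "holomorphic_at (Suc n) (\<lambda>z. g (s' z)) a" if "a \<in> Cn (Suc n)" "holomorphic_at (Suc n) g (s' a)" for g a
    using holomorphic_at_shear[OF c' that(1)] that(2) by (simp add: s'_def)
  obtain G where G: "finite G" and ev: "eventually (\<lambda>a.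
     (\<forall>g\<in>G. relation_at (Suc n) I (\<lambda>j z. f j (s z)) a g) \<and>
     (\<forall>v. relation_at (Suc n) I (\<lambda>j z. f j (s z)) a v \<longrightarrow> spanned_at (Suc n) I G a v)) (near (Suc n) (s' x))"
    using co unfolding coherent_at_single s_def[symmetric] s'_def[symmetric] by blast
  define T where "T = (\<lambda>(g :: 'i vector) j z. g j (s' z))"
  from eventually_near_Cn[OF x] evs'[OF x ev]
  have "eventually (\<lambda>a. (\<forall>g\<in>T ` G. relation_at (Suc n) I f a g) \<and>
     (\<forall>v. relation_at (Suc n) I f a v \<longrightarrow> spanned_at (Suc n) I (T ` G) a v)) (near (Suc n) x)"
  proof eventually_elim
    case (elim a)
    note a = elim(1)
    show ?case
    proof (intro conjI ballI allI impI)
      fix k assume "k \<in> T ` G"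
      then obtain g where g: "g \<in> G" "k = T g" by blast
      then have r: "relation_at (Suc n) I (\<lambda>j z. f j (s z)) (s' a) g" using elim(2) by blast
      then have "eventually (\<lambda>z. (\<Sum>j\<in>I. f j (s (s' z)) * g j (s' z)) = 0) (near (Suc n) a)"
        unfolding relation_at_def by (intro evs' a) auto
      moreover have "holomorphic_at (Suc n) (\<lambda>z. g j (s' z)) a" if "j \<in> I" for j
        using r that unfolding relation_at_def by (intro hols' a) auto
      ultimately show "relation_at (Suc n) I f a k"
        unfolding g(2) T_def relation_at_def by (simp add: ss)
    next
      fix v assume v: "relation_at (Suc n) I f a v"
      have "relation_at (Suc n) I (\<lambda>j z. f j (s z)) (s' a) (\<lambda>j z. v j (s z))"
        using v unfolding relation_at_def
        by (auto intro!: hols sC a evs[where P = "\<lambda>z. (\<Sum>j\<in>I. f j z * v j z) = 0"] simp: ss)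
      then have "spanned_at (Suc n) I G (s' a) (\<lambda>j z. v j (s z))" using elim(2) by blast
      then obtain d where d: "\<And>g. g \<in> G \<Longrightarrow> holomorphic_at (Suc n) (d g) (s' a)"
        "\<And>j. j \<in> I \<Longrightarrow> eventually (\<lambda>z. v j (s z) = (\<Sum>g\<in>G. d g z * g j z)) (near (Suc n) (s' a))"
        unfolding spanned_at_def by blast
      show "spanned_at (Suc n) I (T ` G) a v"
      proof (rule spanned_at_lincomb[OF a _ G, where w = T and d = "\<lambda>g z. d g (s' z)"])
        show "eventually (\<lambda>z. v j z = (\<Sum>g\<in>G. d g (s' z) * T g j z)) (near (Suc n) a)" if "j \<in> I" for j
          using evs'[OF a d(2)[OF that]] by (simp add: ss T_def)
      qed (use G a d hols' in \<open>auto intro: spanned_at_member\<close>)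
    qed
  qed
  then show ?thesis unfolding coherent_at_single using G by blast
qed

text \<open>The row \<open>f'\<close> arises from \<open>f\<close> by an invertible operation: the
  pivot is scaled by the unit \<open>u\<close>, and multiples of the old pivot are subtracted from
  the other entries. Relations correspond under the transposed operation \<open>\<Phi>\<close>, for
  which the product of \<open>f\<close> with \<open>\<Phi> v\<close> equals that of
  \<open>f'\<close> with \<open>v\<close>; \<open>\<Psi>\<close> inverts it where \<open>u\<close>
  does not vanish.\<close>

lemma coherent_at_transform:
  fixes f :: "'i vector"
  assumes x: "x \<in> Cn n" and I: "finite I" "j0 \<in> I"
    and u: "holomorphic_at n u x" "u x \<noteq> 0" and q: "\<And>j. j \<in> I - {j0} \<Longrightarrow> holomorphic_at n (q j) x"
    and f0: "eventually (\<lambda>z. f' j0 z = u z * f j0 z) (near n x)"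
    and f': "\<And>j. j \<in> I - {j0} \<Longrightarrow> eventually (\<lambda>z. f' j z = f j z - q j z * f j0 z) (near n x)"
    and co: "coherent_at n I {()} (\<lambda>_. f') x"
  shows "coherent_at n I {()} (\<lambda>_. f) x"
proof -
  define J where "J = I - {j0}"
  have J: "finite J" "I = insert j0 J" "j0 \<notin> J" using I by (auto simp: J_def)
  define \<Phi> where "\<Phi> = (\<lambda>(v :: 'i vector) j z. if j = j0 then u z * v j0 z - (\<Sum>i\<in>J. q i z * v i z) else v j z)"
  define \<Psi> where "\<Psi> = (\<lambda>(v :: 'i vector) j z. if j = j0 then (v j0 z + (\<Sum>i\<in>J. q i z * v i z)) / u z else v j z)"
  have neq: "j = j0 \<longleftrightarrow> False" if "j \<in> J" for j using that J by auto
  have \<Phi>\<Psi>: "\<Phi> (\<Psi> v) j z = v j z" if "u z \<noteq> 0" for v j z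
    using that by (simp add: \<Phi>_def \<Psi>_def neq cong: sum.cong)
  have \<Phi>lin: "\<Phi> (\<lambda>j z. \<Sum>g\<in>G. c g z * g j z) j z = (\<Sum>g\<in>G. c g z * \<Phi> g j z)" for c G j z
  proof -
    have "(\<Sum>i\<in>J. q i z * (\<Sum>g\<in>G. c g z * g i z)) = (\<Sum>g\<in>G. c g z * (\<Sum>i\<in>J. q i z * g i z))"
      unfolding sum_distrib_left by (subst sum.swap) (simp add: mult_ac)
    then show ?thesis
      by (simp add: \<Phi>_def sum_distrib_left right_diff_distrib sum_subtractf mult_ac)
  qed
  have fsum: "(\<Sum>j\<in>I. f j z * \<Phi> v j z) = (\<Sum>j\<in>I. f' j z * v j z)"
    if "f' j0 z = u z * f j0 z" "\<forall>j\<in>J. f' j z = f j z - q j z * f j0 z" for v z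
  proof -
    have "(\<Sum>j\<in>J. f j z * \<Phi> v j z) = (\<Sum>j\<in>J. f j z * v j z)"
      by (rule sum.cong) (auto simp: \<Phi>_def neq)
    moreover have "(\<Sum>j\<in>J. f' j z * v j z) = (\<Sum>j\<in>J. f j z * v j z) - f j0 z * (\<Sum>i\<in>J. q i z * v i z)"
    proof -
      have "f' j z * v j z = f j z * v j z - f j0 z * (q j z * v j z)" if "j \<in> J" for j
      proof -
        have eq: "f' j z = f j z - q j z * f j0 z"
          using \<open>\<forall>j\<in>J. f' j z = f j z - q j z * f j0 z\<close> that by blast
        show ?thesis unfolding eq by (simp add: algebra_simps)
      qed
      then show ?thesis by (simp add: sum_subtractf sum_distrib_left)
    qed
    ultimately show ?thesis
      using J that(1) by (simp add: \<Phi>_def right_diff_distrib mult_ac)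
  qed
  obtain G where G: "finite G" and ev: "eventually (\<lambda>a. (\<forall>g\<in>G. relation_at n I f' a g) \<and>
     (\<forall>v. relation_at n I f' a v \<longrightarrow> spanned_at n I G a v)) (near n x)"
    using co unfolding coherent_at_single by blast
  have "eventually (\<lambda>z. \<forall>j\<in>J. f' j z = f j z - q j z * f j0 z) (near n x)"
    using f' J(1) by (intro eventually_ball_finite) (auto simp: J_def)
  with f0 holomorphic_at_eventually_nonzero[OF x u]
  have "eventually (\<lambda>z. u z \<noteq> 0 \<and> f' j0 z = u z * f j0 z \<and> (\<forall>j\<in>J. f' j z = f j z - q j z * f j0 z)) (near n x)"
    by eventually_elim auto
  note ev1 = eventually_near_near[OF x this]
  have ev2: "eventually (\<lambda>a. \<forall>j\<in>J. holomorphic_at n (q j) a) (near n x)"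
    using J(1) q[folded J_def] eventually_holomorphic_at[OF x] by (intro eventually_ball_finite) auto
  from ev ev1 ev2 eventually_holomorphic_at[OF x u(1)]
  have "eventually (\<lambda>a. (\<forall>g\<in>\<Phi> ` G. relation_at n I f a g) \<and>
     (\<forall>v. relation_at n I f a v \<longrightarrow> spanned_at n I (\<Phi> ` G) a v)) (near n x)"
  proof eventually_elim
    case (elim a)
    have a: "a \<in> Cn n" using elim(2) by blast
    note loc = elim(2)[THEN conjunct2]
    have ua: "u a \<noteq> 0" using eventually_near_self[OF a loc] by blast
    show ?case
    proof (intro conjI ballI allI impI)
      fix k assume "k \<in> \<Phi> ` G"
      then obtain g where g: "g \<in> G" "k = \<Phi> g" by blast
      have r: "\<And>j. j \<in> I \<Longrightarrow> holomorphic_at n (g j) a" "eventually (\<lambda>z. (\<Sum>j\<in>I. f' j z * g j z) = 0) (near n a)"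
        using elim(1) g unfolding relation_at_def by auto
      have "holomorphic_at n (\<Phi> g j) a" if "j \<in> I" for j
        unfolding \<Phi>_def using that r(1) I J elim
        by (cases "j = j0") (auto intro!: holomorphic_at_diff holomorphic_at_mult holomorphic_at_sum a)
      moreover have "eventually (\<lambda>z. (\<Sum>j\<in>I. f j z * \<Phi> g j z) = 0) (near n a)"
        using r(2) loc by eventually_elim (simp add: fsum)
      ultimately show "relation_at n I f a k" unfolding g(2) relation_at_def by blast
    next
      fix v assume "relation_at n I f a v"
      then have v: "\<And>j. j \<in> I \<Longrightarrow> holomorphic_at n (v j) a" "eventually (\<lambda>z. (\<Sum>j\<in>I. f j z * v j z) = 0) (near n a)"
        unfolding relation_at_def by auto
      have "holomorphic_at n (\<Psi> v j) a" if "j \<in> I" for j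
        unfolding \<Psi>_def using that v(1) I J elim ua
        by (cases "j = j0") (auto intro!: holomorphic_at_divide holomorphic_at_add holomorphic_at_mult holomorphic_at_sum a)
      moreover have "eventually (\<lambda>z. (\<Sum>j\<in>I. f' j z * \<Psi> v j z) = 0) (near n a)"
        using v(2) loc
      proof eventually_elim
        case (elim z)
        then have "(\<Sum>j\<in>I. f' j z * \<Psi> v j z) = (\<Sum>j\<in>I. f j z * \<Phi> (\<Psi> v) j z)"
          by (intro fsum[symmetric]) auto
        then show ?case using elim by (simp add: \<Phi>\<Psi>)
      qed
      ultimately have "spanned_at n I G a (\<Psi> v)" using elim(1) unfolding relation_at_def by blast
      then obtain c where c: "\<And>g. g \<in> G \<Longrightarrow> holomorphic_at n (c g) a"
        "\<And>j. j \<in> I \<Longrightarrow> eventually (\<lambda>z. \<Psi> v j z = (\<Sum>g\<in>G. c g z * g j z)) (near n a)"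
        unfolding spanned_at_def by blast
      have "eventually (\<lambda>z. \<forall>j\<in>I. \<Psi> v j z = (\<Sum>g\<in>G. c g z * g j z)) (near n a)"
        using c(2) I(1) by (intro eventually_ball_finite) auto
      with loc have evv: "eventually (\<lambda>z. \<forall>j\<in>I. v j z = (\<Sum>g\<in>G. c g z * \<Phi> g j z)) (near n a)"
      proof eventually_elim
        case (elim z)
        show ?case
        proof
          fix j assume j: "j \<in> I"
          have "v j z = \<Phi> (\<Psi> v) j z" using elim by (simp add: \<Phi>\<Psi>)
          also have "\<dots> = \<Phi> (\<lambda>j z. \<Sum>g\<in>G. c g z * g j z) j z"
            unfolding \<Phi>_def using elim(2) j I(2) J by (auto cong: sum.cong)
          finally show "v j z = (\<Sum>g\<in>G. c g z * \<Phi> g j z)" unfolding \<Phi>lin .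
        qed
      qed
      show "spanned_at n I (\<Phi> ` G) a v"
      proof (rule spanned_at_lincomb[OF a _ G c(1), where w = \<Phi>])
        show "eventually (\<lambda>z. v j z = (\<Sum>t\<in>G. c t z * \<Phi> t j z)) (near n a)" if "j \<in> I" for j
          using evv by eventually_elim (use that in auto)
      qed (use G a in \<open>auto intro: spanned_at_member\<close>)
    qed
  qed
  then show ?thesis unfolding coherent_at_single using G by blast
qed

text \<open>For \<open>i \<noteq> j0\<close> this is the trivial relation between two entries:
  \<open>f j0\<close> times the unit vector of \<open>i\<close> minus \<open>f i\<close> times the
  unit vector of \<open>j0\<close>.\<close>

definition koszul :: "'i vector \<Rightarrow> 'i \<Rightarrow> 'i \<Rightarrow> 'i vector" where
  "koszul f j0 i = (\<lambda>j z. if j = i then f j0 z else if j = j0 then - f i z else 0)"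

lemma koszul_relation:
  assumes "finite I" "j0 \<in> I" "i \<in> I" "i \<noteq> j0"
  shows "(\<Sum>j\<in>I. f j z * koszul f j0 i j z) = 0"
proof -
  have "(\<Sum>j\<in>I. f j z * koszul f j0 i j z) = (\<Sum>j\<in>{i, j0}. f j z * koszul f j0 i j z)"
    using assms by (intro sum.mono_neutral_right) (auto simp: koszul_def)
  then show ?thesis using assms by (simp add: koszul_def)
qed

lemma koszul_holomorphic:
  assumes "a \<in> Cn n" "\<And>j. j \<in> I \<Longrightarrow> holomorphic_at n (f j) a" "j0 \<in> I" "i \<in> I"
  shows "holomorphic_at n (koszul f j0 i j) a"
  using assms unfolding koszul_def
  by (cases "j = i"; cases "j = j0") (auto intro: holomorphic_at_uminus holomorphic_at_const)

lemma sum_koszul: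
  assumes "finite J" "j0 \<notin> J" "j \<in> insert j0 J"
  shows "(\<Sum>i\<in>J. g i * koszul f j0 i j z) = (if j = j0 then - (\<Sum>i\<in>J. g i * f i z) else g j * f j0 z)"
proof (cases "j = j0")
  case True
  have "(\<Sum>i\<in>J. g i * koszul f j0 i j z) = (\<Sum>i\<in>J. - (g i * f i z))"
    using assms True by (intro sum.cong) (auto simp: koszul_def)
  then show ?thesis using True by (simp add: sum_negf)
next
  case False
  then have "(\<Sum>i\<in>J. g i * koszul f j0 i j z) = (\<Sum>i\<in>J. if j = i then g i * f j0 z else 0)"
    by (intro sum.cong) (auto simp: koszul_def)
  then show ?thesis using assms False by simp
qed

text \<open>With \<open>f j0\<close> invertible, a relation \<open>v\<close> is determined by its
  entries off \<open>j0\<close> and equals the sum of Koszul relations with coefficients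
  \<open>v i / f j0\<close>. This settles the case of no variables, where a non-zero germ is a
  unit.\<close>

lemma coherent_at_unit:
  fixes f :: "'i vector"
  assumes x: "x \<in> Cn n" and I: "finite I" "j0 \<in> I"
    and f: "\<And>j. j \<in> I \<Longrightarrow> holomorphic_at n (f j) x" and nz: "f j0 x \<noteq> 0"
  shows "coherent_at n I {()} (\<lambda>_. f) x"
proof -
  define J where "J = I - {j0}"
  have J: "finite J" "I = insert j0 J" "j0 \<notin> J" using I by (auto simp: J_def)
  let ?G = "koszul f j0 ` J"
  have "eventually (\<lambda>a. \<forall>j\<in>I. holomorphic_at n (f j) a) (near n x)"
    using I f eventually_holomorphic_at[OF x] by (intro eventually_ball_finite) auto
  with eventually_near_near[OF x holomorphic_at_eventually_nonzero[OF x f[OF I(2)] nz]]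
  have "eventually (\<lambda>a. (\<forall>g\<in>?G. relation_at n I f a g) \<and>
     (\<forall>v. relation_at n I f a v \<longrightarrow> spanned_at n I ?G a v)) (near n x)"
  proof eventually_elim
    case (elim a)
    have a: "a \<in> Cn n" using elim(1) by blast
    note loc = elim(1)[THEN conjunct2]
    have fa: "f j0 a \<noteq> 0" using eventually_near_self[OF a loc] .
    show ?case
    proof (intro conjI ballI allI impI)
      fix g assume "g \<in> ?G"
      then obtain i where i: "i \<in> J" "g = koszul f j0 i" by blast
      then have iI: "i \<in> I" "i \<noteq> j0" using J by auto
      show "relation_at n I f a g"
        using koszul_relation[OF I iI] koszul_holomorphic[OF a _ I(2) iI(1)] elim(2)
        by (simp add: i relation_at_def)
    next
      fix v assume "relation_at n I f a v"
      then have v: "\<And>j. j \<in> I \<Longrightarrow> holomorphic_at n (v j) a" "eventually (\<lambda>z. (\<Sum>j\<in>I. f j z * v j z) = 0) (near n a)"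
        unfolding relation_at_def by auto
      show "spanned_at n I ?G a v"
      proof (rule spanned_at_lincomb[OF a _ J(1), where w = "koszul f j0" and d = "\<lambda>i z. v i z / f j0 z"])
        fix j assume j: "j \<in> I"
        from v(2) loc show "eventually (\<lambda>z. v j z = (\<Sum>i\<in>J. v i z / f j0 z * koszul f j0 i j z)) (near n a)"
        proof eventually_elim
          case (elim z)
          have "f j0 z * v j0 z = - (\<Sum>i\<in>J. f i z * v i z)"
            using elim(1) J by (simp add: add_eq_0_iff2)
          then have "v j0 z = - (\<Sum>i\<in>J. v i z / f j0 z * f i z)"
            using elim(2) by (simp add: field_simps sum_divide_distrib[symmetric])
          then show ?case
            using sum_koszul[OF J(1,3), of j "\<lambda>i. v i z / f j0 z" f z] j elim(2) J(2) by auto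
        qed
      qed (use J v fa elim I a in \<open>auto intro!: spanned_at_member holomorphic_at_divide\<close>)
    qed
  qed
  then show ?thesis unfolding coherent_at_single using J by blast
qed

text \<open>Index sets consist of natural numbers because the induction hypothesis cannot quantify
  over index types; \<open>rows_coherentD\<close> recovers other finite index sets through
  \<open>coherent_at_reindex\<close>.\<close>

definition rows_coherent :: "nat \<Rightarrow> bool" where
  "rows_coherent n \<longleftrightarrow> (\<forall>x\<in>Cn n. \<forall>(I :: nat set) f. finite I \<and> (\<forall>j\<in>I. holomorphic_at n (f j) x) \<longrightarrow>
     coherent_at n I {()} (\<lambda>_. f) x)"

lemma rows_coherentD:
  fixes I :: "'i set"
  assumes n: "rows_coherent n" and x: "x \<in> Cn n" and I: "finite I"
    and f: "\<And>j. j \<in> I \<Longrightarrow> holomorphic_at n (f j) x"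
  shows "coherent_at n I {()} (\<lambda>_. f) x"
proof -
  obtain b :: "'i \<Rightarrow> nat" where b: "bij_betw b I {0..<card I}"
    using ex_bij_betw_finite_nat[OF I] by blast
  let ?f = "\<lambda>k. f (the_inv_into I b k)"
  have "the_inv_into I b k \<in> I" if "k < card I" for k
    using b that by (auto simp: bij_betw_def intro: the_inv_into_into)
  then have "coherent_at n {0..<card I} {()} (\<lambda>_. ?f) x"
    using n x f unfolding rows_coherent_def by auto
  then show ?thesis
    by (rule coherent_at_reindex[OF b]) (use b in \<open>auto simp: bij_betw_def the_inv_into_f_f\<close>)
qed

text \<open>In the induction step a relation with polynomial entries solves one linear equation for
  each coefficient of the product, so systems in \<open>n\<close> variables are needed and not just
  single equations. Rows are added one at a time.\<close>

lemma matrices_coherent: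
  fixes I :: "'i set" and Q :: "'r set"
  assumes n: "rows_coherent n" and x: "x \<in> Cn n" and I: "finite I" and Q: "finite Q"
    and A: "\<And>r j. r \<in> Q \<Longrightarrow> j \<in> I \<Longrightarrow> holomorphic_at n (A r j) x"
  shows "coherent_at n I Q A x"
  using Q A
proof (induction Q rule: finite_induct)
  case empty
  show ?case by (rule coherent_at_no_rows[OF x I])
next
  case (insert q Q)
  then show ?case
    by (intro coherent_at_insert_row[OF x I]) (auto intro: rows_coherentD[OF n x])
qed

lemma rows_coherent_0: "rows_coherent 0"
  unfolding rows_coherent_def
proof (intro ballI allI impI)
  fix x and I :: "nat set" and f :: "nat vector"
  assume x: "x \<in> Cn 0" and f: "finite I \<and> (\<forall>j\<in>I. holomorphic_at 0 (f j) x)"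
  have px: "polydisc 0 x 1 = {x}" using x by (auto simp: polydisc_def Cn_def)
  show "coherent_at 0 I {()} (\<lambda>_. f) x"
  proof (cases "\<exists>j\<in>I. f j x \<noteq> 0")
    case True
    then show ?thesis using coherent_at_unit[OF x, of I _ f] f by blast
  next
    case False
    then have "eventually (\<lambda>z. f j z = 0) (near 0 x)" if "j \<in> I" for j
      unfolding eventually_near[OF x] using that px by (intro exI[of _ 1]) auto
    then show ?thesis using f by (intro coherent_at_zero_row[OF x]) auto
  qed
qed

text \<open>Weierstrass division produces powers of \<open>z n - a n\<close>, the degree bookkeeping
  uses powers of \<open>z n\<close>. The leading term is converted first:
  \<open>z n ^ d - (z n - b) ^ d\<close> has lower degree and joins the part covered by the
  induction hypothesis.\<close>

lemma polynomial_at_recenter: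
  assumes a: "a \<in> Cn (Suc n)" and f: "polynomial_at n a d f"
  shows "\<exists>c. (\<forall>k<d. holomorphic_at n (c k) (a(n := 0))) \<and>
    eventually (\<lambda>z. f z = (\<Sum>k<d. c k (z(n := 0)) * (z n - b) ^ k)) (near (Suc n) a)"
  using f
proof (induction d arbitrary: f)
  case 0
  then show ?case by (auto simp: polynomial_at_def)
next
  case (Suc d)
  obtain c where c: "\<And>k. k < Suc d \<Longrightarrow> holomorphic_at n (c k) (a(n := 0))"
    "eventually (\<lambda>z. f z = (\<Sum>k<Suc d. c k (z(n := 0)) * z n ^ k)) (near (Suc n) a)"
    using Suc.prems unfolding polynomial_at_def by blast
  have 1: "polynomial_at n a d (\<lambda>z. \<Sum>k<d. c k (z(n := 0)) * z n ^ k)"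
    by (rule polynomial_atI[where c = c]) (use c in auto)
  have 2: "polynomial_at n a d (\<lambda>z. c d (z(n := 0)) * ((z n - b) ^ d - z n ^ d))"
    using monic_at_power[OF a, of d b] c(1)[of d] unfolding monic_at_def
    by (intro polynomial_at_cmult[OF a]) auto
  obtain e where e: "\<And>k. k < d \<Longrightarrow> holomorphic_at n (e k) (a(n := 0))"
    "eventually (\<lambda>z. (\<Sum>k<d. c k (z(n := 0)) * z n ^ k) - c d (z(n := 0)) * ((z n - b) ^ d - z n ^ d)
       = (\<Sum>k<d. e k (z(n := 0)) * (z n - b) ^ k)) (near (Suc n) a)"
    using Suc.IH[OF polynomial_at_diff[OF a 1 2]] by blast
  define C where "C = (\<lambda>k. if k < d then e k else c k)"
  show ?case
  proof (intro exI[of _ C] conjI allI impI)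
    show "holomorphic_at n (C k) (a(n := 0))" if "k < Suc d" for k
      using that c(1) e(1) by (auto simp: C_def)
    show "eventually (\<lambda>z. f z = (\<Sum>k<Suc d. C k (z(n := 0)) * (z n - b) ^ k)) (near (Suc n) a)"
      using c(2) e(2)
    proof eventually_elim
      case (elim z)
      have "(\<Sum>k<Suc d. C k (z(n := 0)) * (z n - b) ^ k)
          = (\<Sum>k<d. e k (z(n := 0)) * (z n - b) ^ k) + c d (z(n := 0)) * (z n - b) ^ d"
        by (simp only: sum.lessThan_Suc) (simp add: C_def)
      also have "\<dots> = (\<Sum>k<d. c k (z(n := 0)) * z n ^ k) + c d (z(n := 0)) * z n ^ d"
        unfolding elim(2)[symmetric] by (simp only: right_diff_distrib) simp
      finally show ?case using elim(1) by (simp only: sum.lessThan_Suc)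
    qed
  qed
qed

lemma weierstrass_division_unique_polynomial:
  assumes a: "a \<in> Cn (Suc n)" and W: "holomorphic_at (Suc n) W a" and reg: "regular_at n d W a"
    and q: "holomorphic_at (Suc n) q a" and R: "polynomial_at n a d R"
    and zero: "eventually (\<lambda>z. q z * W z + R z = 0) (near (Suc n) a)"
  shows "eventually (\<lambda>z. q z = 0) (near (Suc n) a)"
proof -
  obtain c where c: "\<And>k. k < d \<Longrightarrow> holomorphic_at n (c k) (a(n := 0))"
    "eventually (\<lambda>z. R z = (\<Sum>k<d. c k (z(n := 0)) * (z n - a n) ^ k)) (near (Suc n) a)"
    using polynomial_at_recenter[OF a R] by blast
  have "eventually (\<lambda>z. q z * W z + (\<Sum>k<d. c k (z(n := 0)) * (z n - a n) ^ k) = 0) (near (Suc n) a)"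
    using zero c(2) by eventually_elim simp
  with c(1) show ?thesis by (rule weierstrass_division_unique(1)[OF a W reg q])
qed

text \<open>The coefficients found at \<open>x\<close> serve at nearby points as well, the powers of
  \<open>z n\<close> being centred at 0.\<close>

lemma polynomial_at_open:
  assumes x: "x \<in> Cn (Suc n)" and f: "polynomial_at n x d f"
  shows "eventually (\<lambda>a. polynomial_at n a d f) (near (Suc n) x)"
proof -
  obtain c where c: "\<And>k. k < d \<Longrightarrow> holomorphic_at n (c k) (x(n := 0))"
    "eventually (\<lambda>z. f z = (\<Sum>k<d. c k (z(n := 0)) * z n ^ k)) (near (Suc n) x)"
    using f by (auto simp: polynomial_at_def)
  have x0: "x(n := 0) \<in> Cn n" using drop_in_Cn[OF x] .
  have "eventually (\<lambda>z. \<forall>k\<in>{..<d}. holomorphic_at n (c k) z) (near n (x(n := 0)))"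
    using c(1) eventually_holomorphic_at[OF x0] by (intro eventually_ball_finite) auto
  from eventually_near_drop[OF x this] eventually_near_near[OF x c(2)]
  show ?thesis
  proof eventually_elim
    case (elim a)
    then show ?case by (intro polynomial_atI[where c = c]) auto
  qed
qed

text \<open>Degree at most \<open>d\<close> times degree below \<open>d\<close> leaves
  \<open>2 * d\<close> coefficients. The guard sets coefficients outside the range to 0 and prevents
  the truncated \<open>m - l\<close> from picking up \<open>\<alpha> 0\<close>. Read as linear in
  \<open>\<beta>\<close>, these are the equations for relations with polynomial entries.\<close>

lemma polynomial_product_coeffs:
  fixes \<alpha> \<beta> :: "nat \<Rightarrow> complex"
  shows "(\<Sum>k<Suc d. \<alpha> k * w ^ k) * (\<Sum>l<d. \<beta> l * w ^ l)
    = (\<Sum>m<2 * d. (\<Sum>l<d. (if l \<le> m \<and> m - l \<le> d then \<alpha> (m - l) else 0) * \<beta> l) * w ^ m)"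
proof -
  have *: "(\<Sum>k<Suc d. \<alpha> k * w ^ k) * w ^ l = (\<Sum>m<2 * d. (if l \<le> m \<and> m - l \<le> d then \<alpha> (m - l) else 0) * w ^ m)"
    if l: "l < d" for l
  proof -
    have "(\<Sum>m<2 * d. (if l \<le> m \<and> m - l \<le> d then \<alpha> (m - l) else 0) * w ^ m)
        = (\<Sum>m\<in>{l..l+d}. \<alpha> (m - l) * w ^ m)"
      using l by (intro sum.mono_neutral_cong_right) auto
    also have "\<dots> = (\<Sum>k<Suc d. \<alpha> k * w ^ (k + l))"
      by (rule sum.reindex_bij_witness[where i = "\<lambda>k. k + l" and j = "\<lambda>m. m - l"]) auto
    finally show ?thesis by (simp only: sum_distrib_right power_add mult.assoc)
  qed
  have "(\<Sum>k<Suc d. \<alpha> k * w ^ k) * (\<Sum>l<d. \<beta> l * w ^ l) = (\<Sum>l<d. \<beta> l * ((\<Sum>k<Suc d. \<alpha> k * w ^ k) * w ^ l))"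
    unfolding sum_distrib_left by (simp only: mult_ac)
  also have "\<dots> = (\<Sum>l<d. \<beta> l * (\<Sum>m<2 * d. (if l \<le> m \<and> m - l \<le> d then \<alpha> (m - l) else 0) * w ^ m))"
    by (rule sum.cong) (auto simp only: * lessThan_iff)
  also have "\<dots> = (\<Sum>m<2 * d. (\<Sum>l<d. (if l \<le> m \<and> m - l \<le> d then \<alpha> (m - l) else 0) * \<beta> l) * w ^ m)"
    unfolding sum_distrib_left sum_distrib_right by (subst sum.swap) (simp only: mult_ac)
  finally show ?thesis .
qed

text \<open>A relation whose last-variable degrees are unbounded is reduced, modulo Koszul relations and up
  to the unit \<open>E\<close>, to one with polynomial entries of degree less than \<open>d\<close>.\<close>

lemma relation_reduce:
  fixes f :: "'i vector"
  assumes a: "a \<in> Cn (Suc n)" and J: "finite J" "j0 \<notin> J"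
    and W: "monic_at n a d (f j0)" and f: "\<And>j. j \<in> J \<Longrightarrow> polynomial_at n a d (f j)"
    and v: "relation_at (Suc n) (insert j0 J) f a v"
  obtains E g y where "holomorphic_at (Suc n) E a" "E a \<noteq> 0"
    "\<And>j. j \<in> J \<Longrightarrow> holomorphic_at (Suc n) (g j) a"
    "\<And>j. j \<in> insert j0 J \<Longrightarrow> polynomial_at n a d (y j)"
    "eventually (\<lambda>z. (\<Sum>j\<in>insert j0 J. f j z * y j z) = 0) (near (Suc n) a)"
    "\<And>j. j \<in> insert j0 J \<Longrightarrow>
      eventually (\<lambda>z. v j z = inverse (E z) * y j z + (\<Sum>i\<in>J. g i z * koszul f j0 i j z)) (near (Suc n) a)"
proof -
  let ?W = "f j0"
  have Wh: "holomorphic_at (Suc n) ?W a" by (rule monic_at_holomorphic[OF a W])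
  have fh: "holomorphic_at (Suc n) (f j) a" if "j \<in> J" for j
    using polynomial_at_holomorphic[OF a f[OF that]] .
  have vh: "holomorphic_at (Suc n) (v j) a" if "j \<in> insert j0 J" for j
    using v that unfolding relation_at_def by blast
  have vrel: "eventually (\<lambda>z. f j0 z * v j0 z + (\<Sum>j\<in>J. f j z * v j z) = 0) (near (Suc n) a)"
    using v J unfolding relation_at_def by simp
  \<comment> \<open>The order \<open>e\<close> of the pivot at \<open>a\<close> may be smaller than
    the degree \<open>d\<close>, which belongs to the centre. The divisions below take place at
    order \<open>e\<close>; the final bound must still be \<open>d\<close>.\<close>
  obtain e where e: "e \<le> d" and reg: "regular_at n e ?W a"
    using monic_at_regular[OF a W] by blast
  obtain u where u: "holomorphic_at (Suc n) u a" "u a \<noteq> 0" and W': "monic_at n a e (\<lambda>z. u z * ?W z)"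
    using weierstrass_preparation[OF a Wh reg] by blast
  have "polynomial_at n a (Suc d) (\<lambda>z. z n ^ d * 1)"
    using polynomial_at_mult_power[OF a polynomial_at_const[OF a, of "\<lambda>_. 1" 0], of d]
      holomorphic_at_const[OF drop_in_Cn[OF a]] by simp
  moreover have "polynomial_at n a (Suc d) (\<lambda>z. ?W z - z n ^ d)"
    using W polynomial_at_mono[OF a] unfolding monic_at_def by auto
  ultimately have "polynomial_at n a (Suc d) ?W"
    using polynomial_at_add[OF a] by fastforce
  \<comment> \<open>\<open>W\<close> itself is divided by its Weierstrass polynomial
    \<open>u * W\<close>. Uniqueness of Weierstrass division then forces \<open>E * u = 1\<close>,
    so the inverse of \<open>u\<close> is a polynomial of degree at most
    \<open>d - e\<close>.\<close>
  from monic_division[OF a W' this] obtain E R where E: "polynomial_at n a (Suc d - e) E"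
    and R: "polynomial_at n a e R" and ER: "eventually (\<lambda>z. ?W z = E z * (u z * ?W z) + R z) (near (Suc n) a)"
    by metis
  have Eh: "holomorphic_at (Suc n) E a" by (rule polynomial_at_holomorphic[OF a E])
  have zero1: "eventually (\<lambda>z. (E z * u z - 1) * ?W z + R z = 0) (near (Suc n) a)"
    using ER by eventually_elim (simp add: algebra_simps)
  have "eventually (\<lambda>z. E z * u z - 1 = 0) (near (Suc n) a)"
    by (rule weierstrass_division_unique_polynomial[OF a Wh reg _ R zero1])
      (intro holomorphic_at_diff holomorphic_at_mult holomorphic_at_const a Eh u)
  then have Eu: "eventually (\<lambda>z. E z * u z = 1) (near (Suc n) a)" by simp
  have Ea: "E a \<noteq> 0" using eventually_near_self[OF a Eu] by auto
  have "\<exists>g \<rho>. holomorphic_at (Suc n) g a \<and> polynomial_at n a e \<rho> \<and>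
      eventually (\<lambda>z. v j z = g z * ?W z + \<rho> z) (near (Suc n) a)" if "j \<in> J" for j
  proof -
    have "holomorphic_at (Suc n) (v j) a" using vh that by blast
    then obtain g c where "holomorphic_at (Suc n) g a"
      and "\<And>k. k < e \<Longrightarrow> holomorphic_at n (c k) (a(n := 0))"
      and "eventually (\<lambda>z. v j z = g z * ?W z + (\<Sum>k<e. c k (z(n := 0)) * (z n - a n) ^ k)) (near (Suc n) a)"
      by (rule weierstrass_division[OF a Wh reg]) (rule that)
    then show ?thesis
      using polynomial_at_centered[OF a, of e c "a n"] by blast
  qed
  then have "\<forall>j\<in>J. \<exists>g \<rho>. holomorphic_at (Suc n) g a \<and> polynomial_at n a e \<rho> \<and>
      eventually (\<lambda>z. v j z = g z * ?W z + \<rho> z) (near (Suc n) a)"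
    by (rule ballI)
  from bchoice[OF this] obtain g where "\<forall>j\<in>J. \<exists>\<rho>. holomorphic_at (Suc n) (g j) a \<and>
      polynomial_at n a e \<rho> \<and> eventually (\<lambda>z. v j z = g j z * ?W z + \<rho> z) (near (Suc n) a)"
    by (rule exE)
  from bchoice[OF this] obtain \<rho> where g\<rho>0: "\<forall>j\<in>J. holomorphic_at (Suc n) (g j) a \<and>
      polynomial_at n a e (\<rho> j) \<and> eventually (\<lambda>z. v j z = g j z * ?W z + \<rho> j z) (near (Suc n) a)"
    by (rule exE)
  have g: "holomorphic_at (Suc n) (g j) a" and \<rho>: "polynomial_at n a e (\<rho> j)"
    and g\<rho>: "eventually (\<lambda>z. v j z = g j z * ?W z + \<rho> j z) (near (Suc n) a)" if "j \<in> J" for j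
    using g\<rho>0 that by blast+
  have g\<rho>': "eventually (\<lambda>z. \<forall>j\<in>J. v j z = g j z * ?W z + \<rho> j z) (near (Suc n) a)"
    using g\<rho> J by (intro eventually_ball_finite) auto
  \<comment> \<open>Subtracting the Koszul relations with coefficients \<open>g i\<close> from
    \<open>v\<close> leaves the remainders \<open>\<rho> i\<close> off \<open>j0\<close> and this
    function at \<open>j0\<close>.\<close>
  define w0 where "w0 = (\<lambda>z. v j0 z + (\<Sum>i\<in>J. g i z * f i z))"
  have w0h: "holomorphic_at (Suc n) w0 a"
    unfolding w0_def using vh g fh by (intro holomorphic_at_add holomorphic_at_sum holomorphic_at_mult a) auto
  \<comment> \<open>The relation gives \<open>W * w0 = P\<close>, a polynomial with bound
    \<open>d + e - 1\<close>. Its Euclidean quotient by \<open>u * W\<close> must agree with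
    \<open>E * w0\<close> by uniqueness, so \<open>E * w0\<close> is a polynomial although
    \<open>w0\<close> need not be one.\<close>
  define P where "P = (\<lambda>z. 0 - (\<Sum>i\<in>J. f i z * \<rho> i z))"
  have "polynomial_at n a (d + e - 1) P"
    unfolding P_def using f \<rho> by (intro polynomial_at_diff polynomial_at_zero polynomial_at_sum polynomial_at_mult a) auto
  then obtain Q' R' where Q': "polynomial_at n a (d + e - 1 - e) Q'"
    and R': "polynomial_at n a e R'" and QR': "eventually (\<lambda>z. P z = Q' z * (u z * ?W z) + R' z) (near (Suc n) a)"
    by (rule monic_division[OF a W']) (rule that)
  have WP: "eventually (\<lambda>z. ?W z * w0 z = P z) (near (Suc n) a)"
    using vrel g\<rho>'
  proof eventually_elim
    case (elim z)
    have "(\<Sum>j\<in>J. f j z * v j z) = ?W z * (\<Sum>j\<in>J. g j z * f j z) + (\<Sum>j\<in>J. f j z * \<rho> j z)"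
      using elim(2) by (simp add: sum_distrib_left sum.distrib[symmetric] algebra_simps)
    then show ?case using elim(1) unfolding w0_def P_def
      by (simp add: distrib_left eq_neg_iff_add_eq_0 add.assoc)
  qed
  have zero2: "eventually (\<lambda>z. ((E z * w0 z - Q' z) * u z) * ?W z + (0 - R' z) = 0) (near (Suc n) a)"
    using WP QR' Eu
  proof eventually_elim
    case (elim z)
    have "E z * w0 z * u z * ?W z = P z" using elim(1,3) by (metis mult.assoc mult.commute mult_1)
    then show ?case using elim(2) by (simp add: algebra_simps)
  qed
  have "polynomial_at n a e (\<lambda>z. 0 - R' z)"
    by (intro polynomial_at_diff polynomial_at_zero a R')
  from weierstrass_division_unique_polynomial[OF a Wh reg _ this zero2]
  have "eventually (\<lambda>z. (E z * w0 z - Q' z) * u z = 0) (near (Suc n) a)"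
    by (simp add: holomorphic_at_diff holomorphic_at_mult a Eh u w0h polynomial_at_holomorphic[OF a Q'])
  with Eu have EQ: "eventually (\<lambda>z. Q' z = E z * w0 z) (near (Suc n) a)"
    by eventually_elim auto
  \<comment> \<open>Multiplication by \<open>E\<close> makes the pivot entry polynomial. It raises
    the strict bound of the other entries from \<open>e\<close> to
    \<open>(Suc d - e) + e - 1 = d\<close>, which no longer depends on \<open>e\<close>.\<close>
  define y where "y = (\<lambda>j z. E z * (if j = j0 then w0 z else \<rho> j z))"
  show ?thesis
  proof (rule that[OF Eh Ea g])
    show "polynomial_at n a d (y j)" if j: "j \<in> insert j0 J" for j
    proof (cases "j = j0")
      case True
      have "polynomial_at n a d Q'" using polynomial_at_mono[OF a Q'] by simp
      then show ?thesis unfolding y_def True by (rule polynomial_at_cong) (use EQ in simp)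
    next
      case False
      then have "polynomial_at n a (Suc d - e + e - 1) (\<lambda>z. E z * \<rho> j z)"
        using j by (intro polynomial_at_mult[OF a E] \<rho>) auto
      then show ?thesis using False e by (simp add: y_def)
    qed
    show "eventually (\<lambda>z. (\<Sum>j\<in>insert j0 J. f j z * y j z) = 0) (near (Suc n) a)"
      using WP
    proof eventually_elim
      case (elim z)
      have "(\<Sum>j\<in>J. f j z * y j z) = E z * (\<Sum>j\<in>J. f j z * \<rho> j z)"
        unfolding sum_distrib_left using J by (intro sum.cong) (auto simp: y_def)
      then have "(\<Sum>j\<in>insert j0 J. f j z * y j z) = E z * (?W z * w0 z + (\<Sum>j\<in>J. f j z * \<rho> j z))"
        using J by (simp add: y_def algebra_simps)
      then show ?case using elim by (simp add: P_def)
    qed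
    fix j assume j: "j \<in> insert j0 J"
    from g\<rho>' Eu show "eventually (\<lambda>z. v j z = inverse (E z) * y j z + (\<Sum>i\<in>J. g i z * koszul f j0 i j z)) (near (Suc n) a)"
    proof eventually_elim
      case (elim z)
      have "E z \<noteq> 0" using elim(2) by auto
      then have "inverse (E z) * y j z = (if j = j0 then w0 z else \<rho> j z)"
        by (simp add: y_def)
      then show ?case
        using sum_koszul[OF J j, of "\<lambda>i. g i z" f z] elim(1) j by (auto simp: w0_def)
    qed
  qed
qed

text \<open>At every nearby point the relations are generated by the Koszul relations and those with
  polynomial entries of degree below \<open>d\<close>. The latter form the kernel of a matrix of
  germs in \<open>n\<close> variables with \<open>2 * d\<close> rows, and the hypothesis provides
  generators of that kernel valid on a neighbourhood.\<close>

lemma coherent_at_polynomial: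
  fixes f :: "'i vector"
  assumes IH: "rows_coherent n" and x: "x \<in> Cn (Suc n)" and J: "finite J" "j0 \<notin> J"
    and W: "monic_at n x d (f j0)" and f: "\<And>j. j \<in> J \<Longrightarrow> polynomial_at n x d (f j)"
  shows "coherent_at (Suc n) (insert j0 J) {()} (\<lambda>_. f) x"
proof -
  define I where "I = insert j0 J"
  have I: "finite I" "j0 \<in> I" using J by (auto simp: I_def)
  have x0: "x(n := 0) \<in> Cn n" using drop_in_Cn[OF x] .
  have "polynomial_at n x (Suc d) (\<lambda>z. z n ^ d * 1)"
    using polynomial_at_mult_power[OF x polynomial_at_const[OF x, of "\<lambda>_. 1" 0], of d]
      holomorphic_at_const[OF x0] by simp
  moreover have "polynomial_at n x (Suc d) (\<lambda>z. f j0 z - z n ^ d)"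
    using W polynomial_at_mono[OF x] unfolding monic_at_def by auto
  ultimately have "polynomial_at n x (Suc d) (f j0)"
    using polynomial_at_add[OF x] by fastforce
  then have fI: "polynomial_at n x (Suc d) (f j)" if "j \<in> I" for j
    using that polynomial_at_mono[OF x f, of j "Suc d"] by (auto simp: I_def)
  then have "\<forall>j\<in>I. \<exists>A. (\<forall>k<Suc d. holomorphic_at n (A k) (x(n := 0))) \<and>
     eventually (\<lambda>z. f j z = (\<Sum>k<Suc d. A k (z(n := 0)) * z n ^ k)) (near (Suc n) x)"
    unfolding polynomial_at_def by blast
  from bchoice[OF this] obtain A where A: "\<forall>j\<in>I. (\<forall>k<Suc d. holomorphic_at n (A j k) (x(n := 0))) \<and>
     eventually (\<lambda>z. f j z = (\<Sum>k<Suc d. A j k (z(n := 0)) * z n ^ k)) (near (Suc n) x)"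
    by (rule exE)
  define T where "T = I \<times> {..<d}"
  \<comment> \<open>Row \<open>m\<close> gives the coefficient of \<open>z n ^ m\<close> in the sum
    of products; column \<open>(j, l)\<close> belongs to the coefficient of \<open>z n ^ l\<close>
    in entry \<open>j\<close> of the relation.\<close>
  define M where "M = (\<lambda>m (j, l) z. if l \<le> m \<and> m - l \<le> d then A j (m - l) z else 0)"
  have T: "finite T" using I by (simp add: T_def)
  have sumT: "(\<Sum>t\<in>T. F t) = (\<Sum>j\<in>I. \<Sum>l<d. F (j, l))" for F :: "'i \<times> nat \<Rightarrow> complex"
    unfolding T_def by (simp add: sum.cartesian_product)
  have Mh: "holomorphic_at n (M r t) (x(n := 0))" if tT: "t \<in> T" for r t
  proof -
    obtain j l where t: "t = (j, l)" "j \<in> I" using tT by (auto simp: T_def)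
    show ?thesis
    proof (cases "l \<le> r \<and> r - l \<le> d")
      case True
      then have "M r t = A j (r - l)" "r - l < Suc d" by (auto simp: M_def t(1))
      then show ?thesis using A t(2) by simp
    next
      case False
      then have "M r t = (\<lambda>_. 0)" by (auto simp: M_def t(1))
      then show ?thesis using holomorphic_at_const[OF x0] by simp
    qed
  qed
  have "coherent_at n T {..<2 * d} M (x(n := 0))"
    by (rule matrices_coherent[OF IH x0 T _ Mh]) auto
  then obtain H where H: "finite H" and evH: "eventually (\<lambda>a.
     (\<forall>g\<in>H. (\<forall>j\<in>T. holomorphic_at n (g j) a) \<and> (\<forall>r\<in>{..<2 * d}. relation_at n T (M r) a g)) \<and>
     (\<forall>v. (\<forall>j\<in>T. holomorphic_at n (v j) a) \<and> (\<forall>r\<in>{..<2 * d}. relation_at n T (M r) a v) \<longrightarrow> spanned_at n T H a v))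
     (near n (x(n := 0)))"
    unfolding coherent_at_def by blast
  define L where "L = (\<lambda>(h :: ('i \<times> nat) vector) j z. \<Sum>l<d. h (j, l) (z(n := 0)) * z n ^ l)"
  have product: "(\<Sum>j\<in>I. f j z * L h j z) = (\<Sum>m<2 * d. (\<Sum>t\<in>T. M m t (z(n := 0)) * h t (z(n := 0))) * z n ^ m)"
    if "\<forall>j\<in>I. f j z = (\<Sum>k<Suc d. A j k (z(n := 0)) * z n ^ k)" for h z
  proof -
    have "(\<Sum>j\<in>I. f j z * L h j z) = (\<Sum>j\<in>I. \<Sum>m<2 * d. (\<Sum>l<d. M m (j, l) (z(n := 0)) * h (j, l) (z(n := 0))) * z n ^ m)"
    proof (rule sum.cong[OF refl])
      fix j assume "j \<in> I"
      then have "f j z = (\<Sum>k<Suc d. A j k (z(n := 0)) * z n ^ k)" using that by blast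
      then have "f j z * L h j z = (\<Sum>k<Suc d. A j k (z(n := 0)) * z n ^ k) * (\<Sum>l<d. h (j, l) (z(n := 0)) * z n ^ l)"
        by (simp only: L_def)
      also have "\<dots> = (\<Sum>m<2 * d. (\<Sum>l<d. M m (j, l) (z(n := 0)) * h (j, l) (z(n := 0))) * z n ^ m)"
        unfolding polynomial_product_coeffs M_def prod.case by (simp only: if_distribR)
      finally show "f j z * L h j z = (\<Sum>m<2 * d. (\<Sum>l<d. M m (j, l) (z(n := 0)) * h (j, l) (z(n := 0))) * z n ^ m)" .
    qed
    also have "\<dots> = (\<Sum>m<2 * d. (\<Sum>t\<in>T. M m t (z(n := 0)) * h t (z(n := 0))) * z n ^ m)"
      unfolding sumT by (subst sum.swap) (simp only: sum_distrib_right)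
    finally show ?thesis .
  qed
  let ?G = "L ` H \<union> koszul f j0 ` J"
  have finG: "finite ?G" using H J by simp
  have evA: "eventually (\<lambda>z. \<forall>j\<in>I. f j z = (\<Sum>k<Suc d. A j k (z(n := 0)) * z n ^ k)) (near (Suc n) x)"
    using A I by (intro eventually_ball_finite) auto
  have "eventually (\<lambda>a. \<forall>t\<in>T. \<forall>r\<in>{..<2*d}. holomorphic_at n (M r t) a) (near n (x(n := 0)))"
    by (intro eventually_ball_finite T ballI finite_lessThan eventually_holomorphic_at[OF x0] Mh)
  note evM = eventually_near_drop[OF x this]
  have evW: "eventually (\<lambda>a. monic_at n a d (f j0)) (near (Suc n) x)"
    unfolding monic_at_def using polynomial_at_open[OF x] W unfolding monic_at_def by blast
  have evf: "eventually (\<lambda>a. \<forall>j\<in>J. polynomial_at n a d (f j)) (near (Suc n) x)"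
    using J f polynomial_at_open[OF x] by (intro eventually_ball_finite) auto
  from eventually_near_near[OF x evA] eventually_near_drop[OF x evH] evM evW evf
  have "eventually (\<lambda>a. (\<forall>g\<in>?G. relation_at (Suc n) I f a g) \<and>
     (\<forall>v. relation_at (Suc n) I f a v \<longrightarrow> spanned_at (Suc n) I ?G a v)) (near (Suc n) x)"
  proof eventually_elim
    case (elim a)
    have a: "a \<in> Cn (Suc n)" using elim(1) by blast
    have a0: "a(n := 0) \<in> Cn n" using drop_in_Cn[OF a] .
    note loc = elim(1)[THEN conjunct2]
    have fh: "holomorphic_at (Suc n) (f j) a" if "j \<in> I" for j
      using that polynomial_at_holomorphic[OF a] monic_at_holomorphic[OF a] elim(4,5) by (auto simp: I_def)
    show ?case
    proof (intro conjI ballI allI impI)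
      fix k assume "k \<in> ?G"
      then consider h where "h \<in> H" "k = L h" | i where "i \<in> J" "k = koszul f j0 i" by blast
      then show "relation_at (Suc n) I f a k"
      proof cases
        case 1
        then have h: "\<And>t. t \<in> T \<Longrightarrow> holomorphic_at n (h t) (a(n := 0))"
          "\<forall>r\<in>{..<2 * d}. relation_at n T (M r) (a(n := 0)) h"
          using elim(2) by blast+
        have "holomorphic_at (Suc n) (L h j) a" if "j \<in> I" for j
          unfolding L_def using h(1) that
          by (intro holomorphic_at_sum holomorphic_at_mult holomorphic_at_power holomorphic_at_coordinate
            holomorphic_at_drop a) (auto simp: T_def)
        moreover have "eventually (\<lambda>z. \<forall>r\<in>{..<2 * d}. (\<Sum>t\<in>T. M r t z * h t z) = 0) (near n (a(n := 0)))"
          using h(2) unfolding relation_at_def by (intro eventually_ball_finite) auto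
        from eventually_near_drop[OF a this] loc
        have "eventually (\<lambda>z. (\<Sum>j\<in>I. f j z * L h j z) = 0) (near (Suc n) a)"
          by eventually_elim (simp only: product, simp)
        ultimately show ?thesis unfolding relation_at_def 1(2) by blast
      next
        case 2
        then have iI: "i \<in> I" "i \<noteq> j0" using J by (auto simp: I_def)
        show ?thesis
          using koszul_relation[OF I iI] koszul_holomorphic[OF a fh I(2) iI(1)]
          by (simp add: 2 relation_at_def)
      qed
    next
      fix v assume vr: "relation_at (Suc n) I f a v"
      obtain E g y where E: "holomorphic_at (Suc n) E a" "E a \<noteq> 0"
        and g: "\<And>j. j \<in> J \<Longrightarrow> holomorphic_at (Suc n) (g j) a"
        and y: "\<And>j. j \<in> I \<Longrightarrow> polynomial_at n a d (y j)"
        and yrel: "eventually (\<lambda>z. (\<Sum>j\<in>I. f j z * y j z) = 0) (near (Suc n) a)"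
        and v: "\<And>j. j \<in> I \<Longrightarrow>
          eventually (\<lambda>z. v j z = inverse (E z) * y j z + (\<Sum>i\<in>J. g i z * koszul f j0 i j z)) (near (Suc n) a)"
        by (rule relation_reduce[where f = f and v = v, OF a J elim(4) elim(5)[rule_format] vr[unfolded I_def],
            folded I_def], assumption) (rule that)
      have "\<forall>j\<in>I. \<exists>V. (\<forall>l<d. holomorphic_at n (V l) (a(n := 0))) \<and>
         eventually (\<lambda>z. y j z = (\<Sum>l<d. V l (z(n := 0)) * z n ^ l)) (near (Suc n) a)"
        using y unfolding polynomial_at_def by blast
      from bchoice[OF this] obtain V0 where V0: "\<forall>j\<in>I. (\<forall>l<d. holomorphic_at n (V0 j l) (a(n := 0))) \<and>
         eventually (\<lambda>z. y j z = (\<Sum>l<d. V0 j l (z(n := 0)) * z n ^ l)) (near (Suc n) a)"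
        by (rule exE)
      define V where "V = (\<lambda>(j, l). V0 j l)"
      have Vh: "\<forall>t\<in>T. holomorphic_at n (V t) (a(n := 0))" using V0 by (auto simp: V_def T_def)
      have "eventually (\<lambda>z. \<forall>j\<in>I. y j z = L V j z) (near (Suc n) a)"
        using V0 I by (intro eventually_ball_finite) (auto simp: V_def L_def)
      note yV = this
      from yrel yV loc
      have zero: "eventually (\<lambda>z. (\<Sum>m<2 * d. (\<lambda>z. \<Sum>t\<in>T. M m t z * V t z) (z(n := 0)) * z n ^ m) = 0) (near (Suc n) a)"
      proof eventually_elim
        case (elim z)
        have "(\<Sum>j\<in>I. f j z * L V j z) = 0" using elim(1,2) by simp
        then show ?case unfolding product[OF elim(3)] .
      qed
      \<comment> \<open>A polynomial in \<open>z n\<close> that vanishes near \<open>a\<close> has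
        vanishing coefficient germs, and here these are the rows of \<open>M\<close> applied to
        \<open>V\<close>.\<close>
      have "relation_at n T (M r) (a(n := 0)) V" if r: "r \<in> {..<2 * d}" for r
        unfolding relation_at_def
      proof (intro conjI Vh)
        have "holomorphic_at n (\<lambda>z. \<Sum>t\<in>T. M m t z * V t z) (a(n := 0))" if "m < 2 * d" for m
          using Vh elim(3) that by (intro holomorphic_at_sum holomorphic_at_mult a0) auto
        then show "eventually (\<lambda>z. (\<Sum>t\<in>T. M r t z * V t z) = 0) (near n (a(n := 0)))"
          using polynomial_at_coeffs_zero[OF a _ zero, of r] r by blast
      qed
      then have "spanned_at n T H (a(n := 0)) V" using elim(2) Vh by blast
      then obtain c where c: "\<And>h. h \<in> H \<Longrightarrow> holomorphic_at n (c h) (a(n := 0))"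
        "\<And>t. t \<in> T \<Longrightarrow> eventually (\<lambda>z. V t z = (\<Sum>h\<in>H. c h z * h t z)) (near n (a(n := 0)))"
        unfolding spanned_at_def by blast
      have "eventually (\<lambda>z. \<forall>t\<in>T. V t z = (\<Sum>h\<in>H. c h z * h t z)) (near n (a(n := 0)))"
        using c(2) T by (intro eventually_ball_finite) auto
      from eventually_near_drop[OF a this] yV
      have yc: "eventually (\<lambda>z. \<forall>j\<in>I. y j z = (\<Sum>h\<in>H. c h (z(n := 0)) * L h j z)) (near (Suc n) a)"
      proof eventually_elim
        case (elim z)
        show ?case
        proof
          fix j assume j: "j \<in> I"
          then have "y j z = (\<Sum>l<d. V (j, l) (z(n := 0)) * z n ^ l)" using elim(2) unfolding L_def by blast
          also have "\<dots> = (\<Sum>l<d. \<Sum>h\<in>H. c h (z(n := 0)) * (h (j, l) (z(n := 0)) * z n ^ l))"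
          proof (rule sum.cong[OF refl])
            fix l assume "l \<in> {..<d}"
            then have "V (j, l) (z(n := 0)) = (\<Sum>h\<in>H. c h (z(n := 0)) * h (j, l) (z(n := 0)))"
              using elim(1) j by (auto simp: T_def)
            then show "V (j, l) (z(n := 0)) * z n ^ l = (\<Sum>h\<in>H. c h (z(n := 0)) * (h (j, l) (z(n := 0)) * z n ^ l))"
              by (simp only: sum_distrib_right mult.assoc)
          qed
          also have "\<dots> = (\<Sum>h\<in>H. c h (z(n := 0)) * L h j z)"
            unfolding L_def sum_distrib_left by (rule sum.swap)
          finally show "y j z = (\<Sum>h\<in>H. c h (z(n := 0)) * L h j z)" .
        qed
      qed
      \<comment> \<open>The coefficients are indexed by a disjoint sum since the two families in
        \<open>?G\<close> may overlap; the factor \<open>inverse (E z)\<close> undoes the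
        multiplication made in \<open>relation_reduce\<close>.\<close>
      show "spanned_at (Suc n) I ?G a v"
      proof (rule spanned_at_lincomb[OF a finG, where T = "H <+> J" and
          d = "case_sum (\<lambda>h z. inverse (E z) * c h (z(n := 0))) g" and w = "case_sum L (koszul f j0)"])
        show "finite (H <+> J)" using H J by simp
        show "holomorphic_at (Suc n) (case_sum (\<lambda>h z. inverse (E z) * c h (z(n := 0))) g t) a" if "t \<in> H <+> J" for t
          using that g c(1) E by (auto intro!: holomorphic_at_mult holomorphic_at_inverse holomorphic_at_drop a)
        show "spanned_at (Suc n) I ?G a (case_sum L (koszul f j0) t)" if "t \<in> H <+> J" for t
          using that by (auto intro!: spanned_at_member a H(1) J(1))
        fix j assume j: "j \<in> I"
        from v[OF j] yc show "eventually (\<lambda>z. v j z = (\<Sum>t\<in>H <+> J.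
            case_sum (\<lambda>h z. inverse (E z) * c h (z(n := 0))) g t z * case_sum L (koszul f j0) t j z)) (near (Suc n) a)"
        proof eventually_elim
          case (elim z)
          have "inverse (E z) * y j z = (\<Sum>h\<in>H. inverse (E z) * c h (z(n := 0)) * L h j z)"
            using elim(2) j by (simp only: sum_distrib_left mult.assoc)
          then show ?case using elim(1) by (simp add: sum.Plus[OF H J(1)] o_def)
        qed
      qed
    qed
  qed
  then show ?thesis unfolding coherent_at_single I_def[symmetric] using finG by blast
qed

text \<open>Oka's theorem by induction on the number of variables. If all entries vanish as germs,
  every vector is a relation. Otherwise a shear makes some entry regular, Weierstrass preparation
  makes it monic up to a unit, division reduces the other entries modulo it, and
  \<open>coherent_at_polynomial\<close> applies.\<close>

theorem rows_coherent: "rows_coherent n"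
proof (induction n)
  case 0
  show ?case by (rule rows_coherent_0)
next
  case (Suc n)
  have regular: "coherent_at (Suc n) I {()} (\<lambda>_. f) x"
    if x: "x \<in> Cn (Suc n)" and I: "finite I" "j0 \<in> I" and f: "\<And>j. j \<in> I \<Longrightarrow> holomorphic_at (Suc n) (f j) x"
      and reg: "regular_at n d (f j0) x" for x I and f :: "nat vector" and j0 d
  proof -
    define J where "J = I - {j0}"
    have J: "finite J" "j0 \<notin> J" "I = insert j0 J" using I by (auto simp: J_def)
    have f0: "holomorphic_at (Suc n) (f j0) x" using f I by blast
    obtain u where u: "holomorphic_at (Suc n) u x" "u x \<noteq> 0" and W: "monic_at n x d (\<lambda>z. u z * f j0 z)"
      using weierstrass_preparation[OF x f0 reg] by blast
    have "\<forall>j\<in>J. \<exists>q. holomorphic_at (Suc n) q x \<and> (\<exists>\<rho>. polynomial_at n x d \<rho> \<and>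
        eventually (\<lambda>z. f j z = q z * f j0 z + \<rho> z) (near (Suc n) x))"
    proof
      fix j assume "j \<in> J"
      then have "holomorphic_at (Suc n) (f j) x" using f J by blast
      then obtain q c where "holomorphic_at (Suc n) q x"
        and "\<And>k. k < d \<Longrightarrow> holomorphic_at n (c k) (x(n := 0))"
        and "eventually (\<lambda>z. f j z = q z * f j0 z + (\<Sum>k<d. c k (z(n := 0)) * (z n - x n) ^ k)) (near (Suc n) x)"
        by (rule weierstrass_division[OF x f0 reg]) (rule that)
      then show "\<exists>q. holomorphic_at (Suc n) q x \<and> (\<exists>\<rho>. polynomial_at n x d \<rho> \<and>
        eventually (\<lambda>z. f j z = q z * f j0 z + \<rho> z) (near (Suc n) x))"
        using polynomial_at_centered[OF x, of d c "x n"] by blast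
    qed
    from bchoice[OF this] obtain q where q: "\<forall>j\<in>J. holomorphic_at (Suc n) (q j) x \<and> (\<exists>\<rho>. polynomial_at n x d \<rho> \<and>
        eventually (\<lambda>z. f j z = q j z * f j0 z + \<rho> z) (near (Suc n) x))"
      by (rule exE)
    \<comment> \<open>The pivot is replaced by its monic multiple, the other entries by their
      Weierstrass remainders, which have degree below \<open>d\<close>.\<close>
    define f' where "f' = (\<lambda>j z. if j = j0 then u z * f j0 z else f j z - q j z * f j0 z)"
    have "polynomial_at n x d (f' j)" if j: "j \<in> J" for j
    proof -
      obtain \<rho> where "polynomial_at n x d \<rho>" and ev: "eventually (\<lambda>z. f j z = q j z * f j0 z + \<rho> z) (near (Suc n) x)"
        using q j by blast
      moreover have "eventually (\<lambda>z. \<rho> z = f' j z) (near (Suc n) x)"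
        using ev by eventually_elim (use j J in \<open>auto simp: f'_def\<close>)
      ultimately show ?thesis using polynomial_at_cong by blast
    qed
    moreover have "monic_at n x d (f' j0)" using W by (simp add: f'_def)
    ultimately have "coherent_at (Suc n) I {()} (\<lambda>_. f') x"
      unfolding J(3) by (intro coherent_at_polynomial[OF Suc.IH x J(1,2)])
    then show ?thesis
      by (rule coherent_at_transform[OF x I u, where q = q, rotated -1]) (use q J in \<open>auto simp: f'_def\<close>)
  qed
  show ?case
    unfolding rows_coherent_def
  proof (intro ballI allI impI)
    fix x and I :: "nat set" and f :: "nat vector"
    assume x: "x \<in> Cn (Suc n)" and If: "finite I \<and> (\<forall>j\<in>I. holomorphic_at (Suc n) (f j) x)"
    show "coherent_at (Suc n) I {()} (\<lambda>_. f) x"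
    proof (cases "\<exists>j\<in>I. \<not> eventually (\<lambda>z. f j z = 0) (near (Suc n) x)")
      case False
      then show ?thesis using If by (intro coherent_at_zero_row[OF x]) auto
    next
      case True
      then obtain j0 where j0: "j0 \<in> I" and nz: "\<not> eventually (\<lambda>z. f j0 z = 0) (near (Suc n) x)" by blast
      then have "holomorphic_at (Suc n) (f j0) x" using If by blast
      then obtain c d where c: "c \<in> Cn n"
        and reg: "regular_at n d (\<lambda>z. f j0 (shear n c z)) (shear n (\<lambda>i. - c i) x)"
        using regular_after_shear[OF x _ nz] by blast
      have "(\<lambda>i. - c i) \<in> Cn n" using c by (simp add: Cn_def)
      then have sx: "shear n (\<lambda>i. - c i) x \<in> Cn (Suc n)" using shear_in_Cn x by blast
      have "holomorphic_at (Suc n) (\<lambda>z. f j (shear n c z)) (shear n (\<lambda>i. - c i) x)" if "j \<in> I" for j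
        using If that by (intro holomorphic_at_shear[OF c sx]) (simp add: shear_shear[OF c])
      then have "coherent_at (Suc n) I {()} (\<lambda>_ j z. f j (shear n c z)) (shear n (\<lambda>i. - c i) x)"
        using If j0 reg by (intro regular[OF sx]) auto
      then show ?thesis by (rule coherent_at_shear[OF x c])
    qed
  qed
qed

section \<open>Zeros of sections of locally irreducible spaces\<close>

text \<open>Ideal membership phrased for functions and not for germs, so that the results on
  relations apply; \<open>germ_in_Idl\<close> translates it to the ring of germs.\<close>

definition ideal_at :: "nat \<Rightarrow> ((nat \<Rightarrow> complex) \<Rightarrow> complex) set \<Rightarrow> (nat \<Rightarrow> complex) \<Rightarrow> ((nat \<Rightarrow> complex) \<Rightarrow> complex) \<Rightarrow> bool" where
  "ideal_at n F a v \<longleftrightarrow> (\<exists>c. (\<forall>g\<in>F. holomorphic_at n (c g) a) \<and>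
     eventually (\<lambda>z. v z = (\<Sum>g\<in>F. c g z * g z)) (near n a))"

lemma ideal_at_lincomb:
  assumes a: "a \<in> Cn n" and F: "finite F" and T: "finite T"
    and d: "\<And>t. t \<in> T \<Longrightarrow> holomorphic_at n (d t) a"
    and w: "\<And>t. t \<in> T \<Longrightarrow> ideal_at n F a (w t)"
    and v: "eventually (\<lambda>z. v z = (\<Sum>t\<in>T. d t z * w t z)) (near n a)"
  shows "ideal_at n F a v"
proof -
  have "\<forall>t\<in>T. \<exists>c. (\<forall>g\<in>F. holomorphic_at n (c g) a) \<and>
     eventually (\<lambda>z. w t z = (\<Sum>g\<in>F. c g z * g z)) (near n a)"
    using w unfolding ideal_at_def by blast
  from bchoice[OF this] obtain c where c: "\<And>t g. t \<in> T \<Longrightarrow> g \<in> F \<Longrightarrow> holomorphic_at n (c t g) a"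
    "\<And>t. t \<in> T \<Longrightarrow> eventually (\<lambda>z. w t z = (\<Sum>g\<in>F. c t g z * g z)) (near n a)"
    by blast
  show ?thesis unfolding ideal_at_def
  proof (intro exI[of _ "\<lambda>g z. \<Sum>t\<in>T. d t z * c t g z"] conjI ballI)
    show "holomorphic_at n (\<lambda>z. \<Sum>t\<in>T. d t z * c t g z) a" if "g \<in> F" for g
      using c(1) d that by (intro holomorphic_at_sum holomorphic_at_mult a) auto
    have "eventually (\<lambda>z. \<forall>t\<in>T. w t z = (\<Sum>g\<in>F. c t g z * g z)) (near n a)"
      using c(2) T by (intro eventually_ball_finite) auto
    with v show "eventually (\<lambda>z. v z = (\<Sum>g\<in>F. (\<Sum>t\<in>T. d t z * c t g z) * g z)) (near n a)"
    proof eventually_elim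
      case (elim z)
      have "v z = (\<Sum>t\<in>T. \<Sum>g\<in>F. d t z * c t g z * g z)"
        using elim by (simp add: sum_distrib_left mult.assoc)
      also have "\<dots> = (\<Sum>g\<in>F. (\<Sum>t\<in>T. d t z * c t g z) * g z)"
        by (subst sum.swap) (simp add: sum_distrib_right)
      finally show ?case .
    qed
  qed
qed

lemma ideal_at_member:
  assumes "a \<in> Cn n" "finite F" "g \<in> F"
  shows "ideal_at n F a g"
  unfolding ideal_at_def
proof (intro exI[of _ "\<lambda>h _. if h = g then 1 else 0"] conjI ballI always_eventually allI)
  show "g z = (\<Sum>h\<in>F. (if h = g then 1 else 0) * h z)" for z
    using assms by (simp add: if_distrib[where f = "\<lambda>x. x * _"] cong: if_cong)
qed (rule holomorphic_at_const[OF assms(1)])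

lemma ideal_at_open:
  assumes a: "a \<in> Cn n" and F: "finite F" and v: "ideal_at n F a v"
  shows "eventually (\<lambda>b. ideal_at n F b v) (near n a)"
proof -
  obtain c where c: "\<And>g. g \<in> F \<Longrightarrow> holomorphic_at n (c g) a"
    "eventually (\<lambda>z. v z = (\<Sum>g\<in>F. c g z * g z)) (near n a)"
    using v unfolding ideal_at_def by blast
  have "eventually (\<lambda>b. \<forall>g\<in>F. holomorphic_at n (c g) b) (near n a)"
    using F c(1) eventually_holomorphic_at[OF a] by (intro eventually_ball_finite) auto
  with eventually_near_near[OF a c(2)] show ?thesis
    by eventually_elim (auto simp: ideal_at_def)
qed

text \<open>The ideal quotient \<open>(F) : f\<close> is a coherent sheaf; if it coincides with \<open>(F)\<close> at \<open>a\<close>, it does so nearby.\<close>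

lemma ideal_at_quotient:
  assumes a: "a \<in> Cn n" and F: "finite F" "\<And>g. g \<in> F \<Longrightarrow> holomorphic_at n g a"
    and f: "holomorphic_at n f a"
    and prime: "\<And>v. holomorphic_at n v a \<Longrightarrow> ideal_at n F a (\<lambda>z. v z * f z) \<Longrightarrow> ideal_at n F a v"
  shows "eventually (\<lambda>b. ideal_at n F b f \<longrightarrow> ideal_at n F b (\<lambda>_. 1)) (near n a)"
\<comment> \<open>The row is indexed by the functions themselves, so \<open>f\<close> needs an index
  distinct from those in \<open>F\<close>. If \<open>f\<close> is one of the generators, the
  hypothesis applied to the constant 1 settles the claim.\<close>
proof (cases "f \<in> F")
  case True
  then have "ideal_at n F a (\<lambda>_. 1)"
    by (intro prime[OF holomorphic_at_const[OF a]]) (simp add: ideal_at_member[OF a F(1) True])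
  from ideal_at_open[OF a F(1) this] show ?thesis
    by eventually_elim simp
next
  case False
  let ?I = "insert f F"
  have "coherent_at n ?I {()} (\<lambda>_ j. j) a"
    by (rule rows_coherentD[OF rows_coherent a]) (use F f in auto)
  then obtain G where G: "finite G" and ev: "eventually (\<lambda>a. (\<forall>g\<in>G. relation_at n ?I (\<lambda>j. j) a g) \<and>
     (\<forall>v. relation_at n ?I (\<lambda>j. j) a v \<longrightarrow> spanned_at n ?I G a v)) (near n a)"
    unfolding coherent_at_single by blast
  have rel: "relation_at n ?I (\<lambda>j. j) a g" if "g \<in> G" for g
    using eventually_near_self[OF a ev] that by blast
  \<comment> \<open>The \<open>f\<close>-entries of relations between \<open>f\<close> and
    \<open>F\<close> are the multipliers that carry \<open>f\<close> into \<open>(F)\<close>; hence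
    those of the vectors in \<open>G\<close> generate \<open>(F) : f\<close> at every nearby
    point.\<close>
  have "ideal_at n F a (g f)" if "g \<in> G" for g
  proof (rule prime)
    show "holomorphic_at n (g f) a" using rel[OF that] by (simp add: relation_at_def)
    show "ideal_at n F a (\<lambda>z. g f z * f z)"
    proof (rule ideal_at_lincomb[OF a F(1) F(1), where w = "\<lambda>g. g" and d = "\<lambda>j z. - g j z"])
      have "eventually (\<lambda>z. (\<Sum>j\<in>?I. j z * g j z) = 0) (near n a)"
        using rel[OF that] by (simp add: relation_at_def)
      then show "eventually (\<lambda>z. g f z * f z = (\<Sum>t\<in>F. - g t z * t z)) (near n a)"
      proof eventually_elim
        case (elim z)
        then have "f z * g f z + (\<Sum>j\<in>F. j z * g j z) = 0" using F False by simp
        then show ?case by (simp add: sum_negf eq_neg_iff_add_eq_0 mult.commute)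
      qed
      show "holomorphic_at n (\<lambda>z. - g t z) a" if "t \<in> F" for t
        using rel[OF \<open>g \<in> G\<close>] that by (intro holomorphic_at_uminus a) (auto simp: relation_at_def)
    qed (auto intro: ideal_at_member a F(1))
  qed
  then have "eventually (\<lambda>b. \<forall>g\<in>G. ideal_at n F b (g f)) (near n a)"
    using G ideal_at_open[OF a F(1)] by (intro eventually_ball_finite) auto
  with ev eventually_near_Cn[OF a] show ?thesis
  proof eventually_elim
    case (elim b)
    note b = elim(2)
    show ?case
    proof
      assume "ideal_at n F b f"
      then obtain c where c: "\<And>g. g \<in> F \<Longrightarrow> holomorphic_at n (c g) b"
        "eventually (\<lambda>z. f z = (\<Sum>g\<in>F. c g z * g z)) (near n b)"
        unfolding ideal_at_def by blast
      \<comment> \<open>Membership of \<open>f\<close> in \<open>(F)\<close>, read as a relation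
        with entry -1 at \<open>f\<close>. Its generation by \<open>G\<close> exhibits -1, and hence
        1, as an element of \<open>(F)\<close>.\<close>
      define v where "v = (\<lambda>j. if j = f then (\<lambda>_. - 1) else c j)"
      have "relation_at n ?I (\<lambda>j. j) b v"
        unfolding relation_at_def
      proof
        show "\<forall>j\<in>?I. holomorphic_at n (v j) b"
          using c(1) False holomorphic_at_const[OF b] by (auto simp: v_def)
        show "eventually (\<lambda>z. (\<Sum>j\<in>?I. j z * v j z) = 0) (near n b)"
          using c(2)
        proof eventually_elim
          case (elim z)
          have "(\<Sum>j\<in>F. j z * v j z) = (\<Sum>j\<in>F. c j z * j z)"
            using False by (intro sum.cong) (auto simp: v_def)
          then show ?case using elim F False by (simp add: v_def)
        qed
      qed
      then have "spanned_at n ?I G b v" using elim(1) by blast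
      then obtain d where d: "\<And>g. g \<in> G \<Longrightarrow> holomorphic_at n (d g) b"
        "eventually (\<lambda>z. v f z = (\<Sum>g\<in>G. d g z * g f z)) (near n b)"
        unfolding spanned_at_def by blast
      show "ideal_at n F b (\<lambda>_. 1)"
      proof (rule ideal_at_lincomb[OF b F(1) G, where w = "\<lambda>g. g f" and d = "\<lambda>g z. - d g z"])
        show "eventually (\<lambda>z. 1 = (\<Sum>g\<in>G. - d g z * g f z)) (near n b)"
          using d(2)
        proof eventually_elim
          case (elim z)
          then have "(\<Sum>g\<in>G. d g z * g f z) = - 1" by (simp add: v_def)
          then show ?case by (simp add: sum_negf)
        qed
      qed (use elim(3) d(1) b in \<open>auto intro: holomorphic_at_uminus\<close>)
    qed
  qed
qed

section \<open>Rings of germs and the ideals of a local model\<close>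

lemma germ_eq_iff:
  "germ n f a = germ n g a \<longleftrightarrow> eventually (\<lambda>z. f z = g z) (near n a)"
proof
  assume "germ n f a = germ n g a"
  moreover have "f \<in> germ n f a" by (simp add: germ_def)
  ultimately show "eventually (\<lambda>z. f z = g z) (near n a)" by (auto simp: germ_def)
next
  assume "eventually (\<lambda>z. f z = g z) (near n a)"
  then show "germ n f a = germ n g a"
    unfolding germ_def by (auto elim: eventually_elim2)
qed

text \<open>The operations of \<open>germ_ring\<close> are unions over all representatives; such a
  union is a single germ since the result does not depend on them.\<close>

lemma germ_lift2:
  fixes H :: "complex \<Rightarrow> complex \<Rightarrow> complex"
  shows "(\<Union>f'\<in>germ n f a. \<Union>g'\<in>germ n g a. germ n (\<lambda>z. H (f' z) (g' z)) a) = germ n (\<lambda>z. H (f z) (g z)) a"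
proof -
  have "germ n (\<lambda>z. H (f' z) (g' z)) a = germ n (\<lambda>z. H (f z) (g z)) a"
    if "f' \<in> germ n f a" "g' \<in> germ n g a" for f' g'
    unfolding germ_eq_iff using that unfolding germ_def by (auto elim: eventually_elim2)
  moreover have "f \<in> germ n f a" "g \<in> germ n g a" by (simp_all add: germ_def)
  ultimately show ?thesis by blast
qed

lemma germ_ring_simps:
  "germ n f a \<otimes>\<^bsub>germ_ring n a\<^esub> germ n g a = germ n (\<lambda>z. f z * g z) a"
  "germ n f a \<oplus>\<^bsub>germ_ring n a\<^esub> germ n g a = germ n (\<lambda>z. f z + g z) a"
  "\<one>\<^bsub>germ_ring n a\<^esub> = germ n (\<lambda>_. 1) a"
  "\<zero>\<^bsub>germ_ring n a\<^esub> = germ n (\<lambda>_. 0) a"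
  unfolding germ_ring_def using germ_lift2[where f = f and g = g and H = "(*)"] germ_lift2[where f = f and g = g and H = "(+)"] by simp_all

lemma germ_closed: "holomorphic_at n f a \<Longrightarrow> germ n f a \<in> carrier (germ_ring n a)"
  by (auto simp: germ_ring_def)

lemma germ_carrierE:
  assumes "x \<in> carrier (germ_ring n a)"
  obtains f where "x = germ n f a" "holomorphic_at n f a"
  using assms by (auto simp: germ_ring_def)

lemma cring_germ_ring:
  assumes a: "a \<in> Cn n"
  shows "cring (germ_ring n a)"
proof (rule cringI)
  show "abelian_group (germ_ring n a)"
  proof (rule abelian_groupI)
    fix x assume "x \<in> carrier (germ_ring n a)"
    then obtain f where f: "x = germ n f a" "holomorphic_at n f a" by (rule germ_carrierE)
    show "\<exists>y\<in>carrier (germ_ring n a). y \<oplus>\<^bsub>germ_ring n a\<^esub> x = \<zero>\<^bsub>germ_ring n a\<^esub>"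
      using holomorphic_at_uminus[OF a f(2)]
      by (intro bexI[of _ "germ n (\<lambda>z. - f z) a"]) (auto simp: f germ_ring_simps intro: germ_closed)
  qed (auto elim!: germ_carrierE simp: germ_ring_simps add_ac intro!: germ_closed holomorphic_at_add holomorphic_at_const a)
  show "comm_monoid (germ_ring n a)"
    by (rule comm_monoidI)
      (auto elim!: germ_carrierE simp: germ_ring_simps mult_ac intro!: germ_closed holomorphic_at_mult holomorphic_at_const a)
qed (auto elim!: germ_carrierE simp: germ_ring_simps distrib_right)

text \<open>The germs of functions satisfying \<open>ideal_at\<close> form an ideal containing the
  generators, which bounds \<open>Idl\<close> from above; conversely a finite combination is built
  up inside \<open>Idl\<close> one generator at a time.\<close>

lemma germ_in_Idl:
  assumes a: "a \<in> Cn n" and F: "finite F" "\<And>g. g \<in> F \<Longrightarrow> holomorphic_at n g a"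
    and v: "holomorphic_at n v a"
  shows "germ n v a \<in> Idl\<^bsub>germ_ring n a\<^esub> ((\<lambda>f. germ n f a) ` F) \<longleftrightarrow> ideal_at n F a v"
proof -
  let ?R = "germ_ring n a"
  interpret cring ?R by (rule cring_germ_ring[OF a])
  let ?K = "{germ n w a | w. holomorphic_at n w a \<and> ideal_at n F a w}"
  have sub: "(\<lambda>f. germ n f a) ` F \<subseteq> carrier ?R" using F(2) by (auto intro: germ_closed)
  \<comment> \<open>Membership in \<open>?K\<close> provides only some representative with the
    property; every function with the same germ inherits it.\<close>
  have inK: "germ n w a \<in> ?K \<longleftrightarrow> ideal_at n F a w" if "holomorphic_at n w a" for w
  proof
    assume "germ n w a \<in> ?K"
    then obtain w' where w': "germ n w a = germ n w' a" "ideal_at n F a w'" by auto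
    then have "eventually (\<lambda>z. w z = (\<Sum>t\<in>{()}. 1 * w' z)) (near n a)" by (simp add: germ_eq_iff)
    then show "ideal_at n F a w"
      by (rule ideal_at_lincomb[OF a F(1), where T = "{()}" and d = "\<lambda>_ _. 1" and w = "\<lambda>_. w'", rotated 3])
        (use w' holomorphic_at_const[OF a] in auto)
  qed (use that in auto)
  have idealK: "ideal ?K ?R"
  proof (rule idealI[OF ring_axioms])
    show "subgroup ?K (add_monoid ?R)"
    proof (rule group.subgroupI[OF a_group])
      show "?K \<subseteq> carrier (add_monoid ?R)" by (auto intro: germ_closed)
      have "ideal_at n F a (\<lambda>_. 0)"
        by (rule ideal_at_lincomb[OF a F(1) finite.emptyI]) auto
      then show "?K \<noteq> {}" using holomorphic_at_const[OF a] by blast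
      fix x assume "x \<in> ?K"
      then obtain w where w: "x = germ n w a" "holomorphic_at n w a" "ideal_at n F a w" by blast
      have mw: "holomorphic_at n (\<lambda>z. - w z) a" by (rule holomorphic_at_uminus[OF a w(2)])
      have "ideal_at n F a (\<lambda>z. - w z)"
        by (rule ideal_at_lincomb[OF a F(1), where T = "{()}" and d = "\<lambda>_ _. - 1" and w = "\<lambda>_. w"])
          (use w holomorphic_at_const[OF a] in auto)
      moreover have "\<ominus>\<^bsub>?R\<^esub> x = germ n (\<lambda>z. - w z) a"
        by (rule minus_equality) (use w mw in \<open>auto simp: germ_ring_simps intro: germ_closed\<close>)
      ultimately show "inv\<^bsub>add_monoid ?R\<^esub> x \<in> ?K"
        using mw by (auto simp: a_inv_def)
      fix y assume "y \<in> ?K"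
      then obtain u where u: "y = germ n u a" "holomorphic_at n u a" "ideal_at n F a u" by blast
      have "ideal_at n F a (\<lambda>z. w z + u z)"
        by (rule ideal_at_lincomb[OF a F(1), where T = "UNIV :: bool set" and d = "\<lambda>_ _. 1"
            and w = "\<lambda>b. if b then w else u"])
          (use w u holomorphic_at_const[OF a] in \<open>auto simp: UNIV_bool add.commute\<close>)
      then show "x \<otimes>\<^bsub>add_monoid ?R\<^esub> y \<in> ?K"
        using holomorphic_at_add[OF a w(2) u(2)] by (auto simp: w(1) u(1) germ_ring_simps)
    qed
    have mult: "germ n (\<lambda>z. u z * w z) a \<in> ?K"
      if "holomorphic_at n w a" "ideal_at n F a w" "holomorphic_at n u a" for w u
    proof -
      have "ideal_at n F a (\<lambda>z. u z * w z)"
        by (rule ideal_at_lincomb[OF a F(1), where T = "{()}" and d = "\<lambda>_. u" and w = "\<lambda>_. w"])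
          (use that in auto)
      then show ?thesis using holomorphic_at_mult[OF a that(3,1)] by blast
    qed
    fix k x assume k: "k \<in> ?K" and x: "x \<in> carrier ?R"
    obtain w where w: "k = germ n w a" "holomorphic_at n w a" "ideal_at n F a w" using k by blast
    obtain u where u: "x = germ n u a" "holomorphic_at n u a" using x by (rule germ_carrierE)
    have "x \<otimes>\<^bsub>?R\<^esub> k = germ n (\<lambda>z. u z * w z) a" "k \<otimes>\<^bsub>?R\<^esub> x = germ n (\<lambda>z. u z * w z) a"
      by (simp_all add: w(1) u(1) germ_ring_simps mult.commute)
    then show "x \<otimes>\<^bsub>?R\<^esub> k \<in> ?K" "k \<otimes>\<^bsub>?R\<^esub> x \<in> ?K"
      using mult[OF w(2,3) u(2)] by simp_all
  qed
  have "(\<lambda>f. germ n f a) ` F \<subseteq> ?K"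
    using F ideal_at_member[OF a F(1)] by auto
  then have 1: "Idl\<^bsub>?R\<^esub> ((\<lambda>f. germ n f a) ` F) \<subseteq> ?K"
    by (rule genideal_minimal[OF idealK])
  interpret I: ideal "Idl\<^bsub>?R\<^esub> ((\<lambda>f. germ n f a) ` F)" ?R
    by (rule genideal_ideal[OF sub])
  have gen: "germ n g a \<in> Idl\<^bsub>?R\<^esub> ((\<lambda>f. germ n f a) ` F)" if "g \<in> F" for g
    using genideal_self[OF sub] that by blast
  have 2: "germ n v a \<in> Idl\<^bsub>?R\<^esub> ((\<lambda>f. germ n f a) ` F)" if "ideal_at n F a v"
  proof -
    obtain c where c: "\<And>g. g \<in> F \<Longrightarrow> holomorphic_at n (c g) a"
      "eventually (\<lambda>z. v z = (\<Sum>g\<in>F. c g z * g z)) (near n a)"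
      using \<open>ideal_at n F a v\<close> unfolding ideal_at_def by blast
    have "germ n (\<lambda>z. \<Sum>g\<in>F'. c g z * g z) a \<in> Idl\<^bsub>?R\<^esub> ((\<lambda>f. germ n f a) ` F)" if "F' \<subseteq> F" for F'
      using finite_subset[OF that F(1)] that
    proof (induction F' rule: finite_induct)
      case empty
      then show ?case using additive_subgroup.zero_closed[OF I.additive_subgroup_axioms] by (simp add: germ_ring_simps)
    next
      case (insert g F')
      have "germ n (c g) a \<otimes>\<^bsub>?R\<^esub> germ n g a \<in> Idl\<^bsub>?R\<^esub> ((\<lambda>f. germ n f a) ` F)"
        using insert gen c(1) by (intro I.I_l_closed) (auto intro: germ_closed)
      then have "germ n (c g) a \<otimes>\<^bsub>?R\<^esub> germ n g a \<oplus>\<^bsub>?R\<^esub> germ n (\<lambda>z. \<Sum>g\<in>F'. c g z * g z) a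
          \<in> Idl\<^bsub>?R\<^esub> ((\<lambda>f. germ n f a) ` F)"
        using insert by (intro I.a_closed) auto
      then show ?case using insert by (simp add: germ_ring_simps)
    qed
    then have "germ n (\<lambda>z. \<Sum>g\<in>F. c g z * g z) a \<in> Idl\<^bsub>?R\<^esub> ((\<lambda>f. germ n f a) ` F)" by blast
    moreover have "germ n v a = germ n (\<lambda>z. \<Sum>g\<in>F. c g z * g z) a"
      using c(2) by (simp add: germ_eq_iff)
    ultimately show ?thesis by simp
  qed
  show ?thesis using 1 2 inK[OF v] by blast
qed

lemma (in ideal) FactRing_eq_zero_iff:
  "x \<in> carrier R \<Longrightarrow> I +> x = \<zero>\<^bsub>R Quot I\<^esub> \<longleftrightarrow> x \<in> I"
  unfolding FactRing_def by (metis a_coset_join1 a_coset_join2 is_additive_subgroup partial_object.select_convs(1)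
      ring_record_simps(11) additive_subgroup.a_subgroup)

text \<open>On a reducible germ this fails: on \<open>u * v = 0\<close> the section \<open>u\<close>
  is non-zero at the origin but has zero germ at the points with \<open>u = 0\<close> and
  \<open>v \<noteq> 0\<close>. The absence of zero divisors is used in the stalk at
  \<open>x\<close>, and coherence spreads the consequence.\<close>

lemma locally_irreducible_nonzero_nearby:
  assumes X: "locally_irreducible X" and U: "openin (base X) U" "x \<in> U" and s: "s \<in> sect X U"
    and nz: "s x \<noteq> \<zero>\<^bsub>stalk X x\<^esub>"
  obtains V where "openin (base X) V" "x \<in> V" "V \<subseteq> U" "\<And>z. z \<in> V \<Longrightarrow> s z \<noteq> \<zero>\<^bsub>stalk X z\<^esub>"
proof -
  have cs: "complex_space X" using X by (simp add: locally_irreducible_def)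
  interpret ringed_space X using cs by (simp add: complex_space_def)
  have xX: "x \<in> topspace (base X)" using U openin_subset by blast
  obtain U0 n D F p h where U0: "openin (base X) U0" "x \<in> U0" and D: "openin (Cspace n) D" and F: "finite F"
    and Fh: "\<And>f z. f \<in> F \<Longrightarrow> z \<in> D \<Longrightarrow> holomorphic_at n f z"
    and iso: "ringed_isomorphism (open_subspace X U0) (local_model n D F) p h"
    using cs xX unfolding complex_space_def by metis
  define J where "J = (\<lambda>z. Idl\<^bsub>germ_ring n z\<^esub> ((\<lambda>f. germ n f z) ` F))"
  define M where "M = local_model n D F"
  have M: "base M = subtopology (subtopology (Cspace n) D) {z \<in> topspace (subtopology (Cspace n) D). J z \<noteq> carrier (germ_ring n z)}"
    "\<And>z. stalk M z = germ_ring n z Quot J z"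
    by (simp_all add: M_def local_model_def closed_subspace_def open_subspace_def Cspace_ringed_def J_def)
  have DC: "D \<subseteq> Cn n" using openin_subset[OF D] by simp
  have U0X: "U0 \<subseteq> topspace (base X)" using U0 openin_subset by blast
  have topU0: "topspace (base (open_subspace X U0)) = U0" "stalk (open_subspace X U0) = stalk X"
      "sect (open_subspace X U0) = sect X" "base (open_subspace X U0) = subtopology (base X) U0"
    using U0X by (auto simp: open_subspace_def)
  have topM: "topspace (base M) = {z \<in> D. J z \<noteq> carrier (germ_ring n z)}"
    using DC by (auto simp: M(1))
  have hom: "homeomorphic_map (subtopology (base X) U0) (base M) p"
    and hiso: "\<And>y. y \<in> U0 \<Longrightarrow> h y \<in> ring_iso (stalk M (p y)) (stalk X y)"
    and hsect: "\<And>V. openin (base M) V \<Longrightarrow> pullback_section (open_subspace X U0) p h V ` sect M V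
      = sect X {y \<in> U0. p y \<in> V}"
    using iso[unfolded ringed_isomorphism_def M_def[symmetric] topU0(1)] unfolding topU0 by blast+
  have injp: "inj_on p U0" using homeomorphic_imp_injective_map[OF hom] U0X by (simp add: Int_absorb1)
  have pM: "p y \<in> topspace (base M)" if "y \<in> U0" for y
    using homeomorphic_imp_surjective_map[OF hom] that U0X by auto
  define W where "W = U \<inter> U0"
  have W: "openin (base X) W" "x \<in> W" "W \<subseteq> U0" "W \<subseteq> U" using U U0 by (auto simp: W_def)
  have opW: "openin (subtopology (base X) U0) W"
    using W by (simp add: openin_open_subtopology U0)
  have pW: "openin (base M) (p ` W)"
    using homeomorphic_imp_open_map[OF hom] opW by (simp add: open_map_def)
  have preW: "{y \<in> U0. p y \<in> p ` W} = W"
    using injp W(3) by (auto simp: inj_on_def)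
  have "restrict s W \<in> sect X W" by (rule sect_restrict[OF U(1) W(1,4) s])
  then obtain t where t: "t \<in> sect M (p ` W)" and pt: "restrict s W = pullback_section (open_subspace X U0) p h (p ` W) t"
    using hsect[OF pW] preW by (metis (no_types, lifting) imageE)
  have st: "s y = h y (t (p y))" if "y \<in> W" for y
  proof -
    have "y \<in> U0" using that W(3) by blast
    then show ?thesis
      using fun_cong[OF pt, of y] that unfolding pullback_section_def topU0(1) by simp
  qed
  define w where "w = p x"
  have wW: "w \<in> p ` W" using W by (simp add: w_def)
  \<comment> \<open>Near \<open>w\<close> the section of the quotient sheaf is induced by a section
    on the ambient space, that is, by one holomorphic function.\<close>
  have "\<exists>W' t'. openin (subtopology (Cspace n) D) W' \<and> w \<in> W' \<and> t' \<in> sect (Cspace_ringed n) W' \<and>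
      (\<forall>z\<in>W' \<inter> p ` W. t z = J z +>\<^bsub>germ_ring n z\<^esub> t' z)"
    using t wW unfolding M_def local_model_def closed_subspace_def open_subspace_def J_def
    by (auto simp: Cspace_ringed_def)
  then obtain W' t' where W': "openin (subtopology (Cspace n) D) W'" "w \<in> W'"
    and t': "t' \<in> sect (Cspace_ringed n) W'"
    and tt: "\<forall>z\<in>W' \<inter> p ` W. t z = J z +>\<^bsub>germ_ring n z\<^esub> t' z"
    by blast
  obtain f where f: "t' = (\<lambda>z\<in>W'. germ n f z)" and fh: "\<And>z. z \<in> W' \<Longrightarrow> holomorphic_at n f z"
    using t' unfolding Cspace_ringed_def by auto
  have tf: "t z = J z +>\<^bsub>germ_ring n z\<^esub> germ n f z" if "z \<in> W'" "z \<in> p ` W" for z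
    using tt that by (simp add: f)
  have W'D: "W' \<subseteq> D" "openin (Cspace n) W'"
    using W'(1) D openin_open_subtopology by blast+
  have wD: "w \<in> D" using W' W'D by blast
  have idealJ: "ideal (J z) (germ_ring n z)" if "z \<in> D" for z
    unfolding J_def using that DC Fh
    by (intro ring.genideal_ideal cring.axioms(1) cring_germ_ring) (auto intro: germ_closed)
  have JF: "germ n v z \<in> J z \<longleftrightarrow> ideal_at n F z v" if "z \<in> D" "holomorphic_at n v z" for v z
    unfolding J_def using that DC F Fh by (intro germ_in_Idl) auto
  \<comment> \<open>The isomorphism with the local model translates vanishing of a germ into
    membership in the defining ideal, at every point of the chart.\<close>
  have zero: "h y (J (p y) +>\<^bsub>germ_ring n (p y)\<^esub> germ n v (p y)) = \<zero>\<^bsub>stalk X y\<^esub> \<longleftrightarrow> ideal_at n F (p y) v"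
    if y: "y \<in> U0" and v: "holomorphic_at n v (p y)" for y v
  proof -
    have pD: "p y \<in> D" using pM[OF y] topM by blast
    interpret I: ideal "J (p y)" "germ_ring n (p y)" by (rule idealJ[OF pD])
    have "ring (stalk X y)" using stalk_cring U0X y by (auto intro: cring.axioms(1))
    then have h0: "h y \<zero>\<^bsub>stalk M (p y)\<^esub> = \<zero>\<^bsub>stalk X y\<^esub>"
      using hiso[OF y] I.quotient_is_ring unfolding M(2) ring_iso_def
      by (intro ring_hom_zero) auto
    have inj: "inj_on (h y) (carrier (stalk M (p y)))"
      using hiso[OF y] by (auto simp: ring_iso_def bij_betw_def)
    have mem: "J (p y) +>\<^bsub>germ_ring n (p y)\<^esub> germ n v (p y) \<in> carrier (stalk M (p y))"
      unfolding M(2) FactRing_def using germ_closed[OF v] by (auto simp: A_RCOSETS_def')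
    have mem0: "\<zero>\<^bsub>stalk M (p y)\<^esub> \<in> carrier (stalk M (p y))"
      unfolding M(2) by (rule ring.ring_simprules(2)[OF I.quotient_is_ring])
    have "h y (J (p y) +>\<^bsub>germ_ring n (p y)\<^esub> germ n v (p y)) = \<zero>\<^bsub>stalk X y\<^esub> \<longleftrightarrow>
        J (p y) +>\<^bsub>germ_ring n (p y)\<^esub> germ n v (p y) = \<zero>\<^bsub>stalk M (p y)\<^esub>"
      using inj mem mem0 h0 by (metis inj_onD)
    also have "\<dots> \<longleftrightarrow> germ n v (p y) \<in> J (p y)"
      unfolding M(2) by (rule I.FactRing_eq_zero_iff[OF germ_closed[OF v]])
    also have "\<dots> \<longleftrightarrow> ideal_at n F (p y) v" by (rule JF[OF pD v])
    finally show ?thesis .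
  qed
  have wC: "w \<in> Cn n" using wD DC by blast
  have fw: "holomorphic_at n f w" using fh W'(2) by blast
  have fnot: "\<not> ideal_at n F w f"
    using nz st[OF W(2)] tf[OF W'(2) wW] zero[OF U0(2), of f] fw by (simp add: w_def)
  \<comment> \<open>The class of \<open>f\<close> is non-zero in the domain \<open>stalk X x\<close>
    and can be cancelled, so \<open>(F) : f\<close> equals \<open>(F)\<close> at
    \<open>w\<close>.\<close>
  have prime: "ideal_at n F w v" if v: "holomorphic_at n v w" and vf: "ideal_at n F w (\<lambda>z. v z * f z)" for v
  proof -
    interpret I: ideal "J w" "germ_ring n w" by (rule idealJ[OF wD])
    interpret dom: domain "stalk X x" using X xX by (simp add: locally_irreducible_def)
    let ?c = "\<lambda>g. J w +>\<^bsub>germ_ring n w\<^esub> germ n g w"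
    have mem: "?c g \<in> carrier (stalk M w)" if "holomorphic_at n g w" for g
      unfolding M(2) FactRing_def using germ_closed[OF that] by (auto simp: A_RCOSETS_def')
    have hx: "h x \<in> ring_hom (stalk M w) (stalk X x)"
      using hiso[OF U0(2)] by (simp add: ring_iso_def w_def)
    have "?c v \<otimes>\<^bsub>stalk M w\<^esub> ?c f = ?c (\<lambda>z. v z * f z)"
      unfolding M(2) FactRing_def
      using I.rcoset_mult_add[OF germ_closed[OF v] germ_closed[OF fw]] by (simp add: germ_ring_simps)
    then have "h x (?c v) \<otimes>\<^bsub>stalk X x\<^esub> h x (?c f) = h x (?c (\<lambda>z. v z * f z))"
      using ring_hom_mult[OF hx mem[OF v] mem[OF fw]] by simp
    also have "\<dots> = \<zero>\<^bsub>stalk X x\<^esub>"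
      using zero[OF U0(2), of "\<lambda>z. v z * f z"] vf holomorphic_at_mult[OF wC v fw] by (simp add: w_def)
    finally have "h x (?c v) = \<zero>\<^bsub>stalk X x\<^esub> \<or> h x (?c f) = \<zero>\<^bsub>stalk X x\<^esub>"
      using ring_hom_closed[OF hx mem[OF v]] ring_hom_closed[OF hx mem[OF fw]] dom.integral by blast
    then show ?thesis
      using zero[OF U0(2), of v] zero[OF U0(2), of f] v fw fnot by (simp add: w_def)
  qed
  have "eventually (\<lambda>b. ideal_at n F b f \<longrightarrow> ideal_at n F b (\<lambda>_. 1)) (near n w)"
    using F Fh wD fw prime by (intro ideal_at_quotient[OF wC]) auto
  then obtain S where S: "openin (Cspace n) S" "w \<in> S"
    and Sf: "\<And>b. b \<in> S \<Longrightarrow> ideal_at n F b f \<Longrightarrow> ideal_at n F b (\<lambda>_. 1)"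
    using wC unfolding eventually_nhdsin by auto
  define V where "V = {y \<in> W. p y \<in> S \<inter> W'}"
  have "continuous_map (subtopology (base X) W) (base M) p"
    using homeomorphic_imp_continuous_map[OF hom] W(3)
    by (metis continuous_map_from_subtopology inf.absorb_iff2 subtopology_subtopology)
  then have "continuous_map (subtopology (base X) W) (Cspace n) p"
    unfolding M(1) by (simp add: continuous_map_in_subtopology)
  moreover have "openin (Cspace n) (S \<inter> W')" using S W'D by auto
  ultimately have "openin (subtopology (base X) W) {y \<in> topspace (subtopology (base X) W). p y \<in> S \<inter> W'}"
    by (rule openin_continuous_map_preimage)
  then have "openin (subtopology (base X) W) V"
    using openin_subset[OF W(1)] by (simp add: V_def Int_absorb1)
  then have opV: "openin (base X) V" using W(1) openin_trans_full by blast
  have "s z \<noteq> \<zero>\<^bsub>stalk X z\<^esub>" if z: "z \<in> V" for z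
  proof
    have zW: "z \<in> W" "z \<in> U0" "p z \<in> S" "p z \<in> W'" using z W by (auto simp: V_def)
    have pzD: "p z \<in> D" using zW W'D by blast
    assume "s z = \<zero>\<^bsub>stalk X z\<^esub>"
    then have "ideal_at n F (p z) f"
      using st[OF zW(1)] tf[OF zW(4)] zW zero[OF zW(2), of f] fh by simp
    then have "ideal_at n F (p z) (\<lambda>_. 1)" by (rule Sf[OF zW(3)])
    then have "germ n (\<lambda>_. 1) (p z) \<in> J (p z)"
      using JF[OF pzD] holomorphic_at_const DC pzD by blast
    then have "\<one>\<^bsub>germ_ring n (p z)\<^esub> \<in> J (p z)" by (simp add: germ_ring_simps)
    \<comment> \<open>\<open>p z\<close> lies in the support of the local model, where the ideal is
      proper by definition.\<close>
    then have "J (p z) = carrier (germ_ring n (p z))"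
      using ideal.one_imp_carrier[OF idealJ[OF pzD]] by blast
    then show False using pM[OF zW(2)] topM by blast
  qed
  then show ?thesis
    using that[OF opV] W S W' by (auto simp: V_def w_def)
qed

section \<open>Extension of scalars of an ideal\<close>

lemma induced_const: "C \<noteq> {} \<Longrightarrow> (\<And>x. x \<in> C \<Longrightarrow> f x = c) \<Longrightarrow> induced f C = c"
  unfolding induced_def by (metis image_constant_conv image_cong the_elem_eq)

text \<open>The additive monoid of a module record and the group it is built from share carrier and
  operations but may be records of different types, so group facts have to be transferred.\<close>

lemma comm_group_cong:
  fixes G :: "('a, 'b) monoid_scheme" and H :: "('a, 'c) monoid_scheme"
  assumes "comm_group G" and H: "carrier H = carrier G" "mult H = mult G" "one H = one G"
  shows "comm_group H"
proof -
  interpret comm_group G by (rule assms(1))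
  show ?thesis
    by (rule comm_groupI) (auto simp: H m_ac intro: l_inv_ex)
qed

lemma m_inv_cong:
  fixes G :: "('a, 'b) monoid_scheme" and H :: "('a, 'c) monoid_scheme"
  assumes "carrier H = carrier G" "mult H = mult G" "one H = one G"
  shows "inv\<^bsub>H\<^esub> x = inv\<^bsub>G\<^esub> x"
  by (simp add: m_inv_def assms)

lemma subgroup_cong:
  fixes G :: "('a, 'b) monoid_scheme" and H :: "('a, 'c) monoid_scheme"
  assumes "subgroup N G" "carrier H = carrier G" "mult H = mult G" "one H = one G"
  shows "subgroup N H"
  using assms(1) m_inv_cong[OF assms(2-4)] by (simp add: subgroup_def assms)

text \<open>Only the additive structure is assumed; what is needed about a scalar is asked for in
  \<open>quot_smult\<close>. The locale is used twice: for the tensor product as a quotient of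
  formal sums of pairs, and for its quotient by torsion.\<close>

locale quotient_module =
  fixes M :: "('r, 'm) module" and N :: "'m set"
  assumes grp: "comm_group (add_monoid M)" and sub: "subgroup N (add_monoid M)"
begin

interpretation A: comm_group "add_monoid M" by (rule grp)

lemma coset_eq: "N +>\<^bsub>M\<^esub> x = N #>\<^bsub>add_monoid M\<^esub> x"
  by (simp add: a_r_coset_def)

lemma carrier_quot: "carrier (quot_module M N) = (\<lambda>x. N +>\<^bsub>M\<^esub> x) ` carrier M"
  by (auto simp: quot_module_def A_RCOSETS_def RCOSETS_def a_r_coset_def)

lemma comm_group_quot: "comm_group (add_monoid (quot_module M N))"
  by (rule comm_group_cong[OF A.abelian_FactGroup[OF sub]])
    (simp_all add: quot_module_def FactGroup_def A_RCOSETS_def set_add_def)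

lemma quot_add:
  assumes "x \<in> carrier M" "y \<in> carrier M"
  shows "(N +>\<^bsub>M\<^esub> x) \<oplus>\<^bsub>quot_module M N\<^esub> (N +>\<^bsub>M\<^esub> y) = N +>\<^bsub>M\<^esub> (x \<oplus>\<^bsub>M\<^esub> y)"
proof -
  interpret N: normal N "add_monoid M" by (rule A.subgroup_imp_normal[OF sub])
  show ?thesis using N.rcos_sum[of x y] assms
    by (simp add: quot_module_def set_add_def coset_eq)
qed

lemma quot_zero: "\<zero>\<^bsub>quot_module M N\<^esub> = N"
  by (simp add: quot_module_def)

lemma coset_mem: "x \<in> carrier M \<Longrightarrow> x \<in> N +>\<^bsub>M\<^esub> x"
  unfolding coset_eq using A.rcos_self[OF _ sub] by simp

lemma coset_cong:
  assumes "x \<in> carrier M" "y \<in> N +>\<^bsub>M\<^esub> x"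
  shows "y \<in> carrier M" "N +>\<^bsub>M\<^esub> y = N +>\<^bsub>M\<^esub> x"
  using assms A.repr_independence[of y N x] sub A.r_coset_subset_G[of N x] subgroup.subset[OF sub]
  unfolding coset_eq by auto

lemma coset_obtain:
  assumes "y \<in> N +>\<^bsub>M\<^esub> x"
  obtains n where "n \<in> N" "y = n \<oplus>\<^bsub>M\<^esub> x"
  using assms unfolding coset_eq r_coset_def by auto

lemma coset_eq_iff:
  assumes "x \<in> carrier M" "y \<in> carrier M"
  shows "N +>\<^bsub>M\<^esub> x = N +>\<^bsub>M\<^esub> y \<longleftrightarrow> x \<oplus>\<^bsub>M\<^esub> inv\<^bsub>add_monoid M\<^esub> y \<in> N"
proof -
  have "N +>\<^bsub>M\<^esub> x = N +>\<^bsub>M\<^esub> y \<longleftrightarrow> x \<in> N #>\<^bsub>add_monoid M\<^esub> y"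
    using coset_cong[OF assms(2), of x] coset_mem[OF assms(1)] unfolding coset_eq by blast
  also have "\<dots> \<longleftrightarrow> x \<oplus>\<^bsub>M\<^esub> inv\<^bsub>add_monoid M\<^esub> y \<in> N"
    using subgroup.rcos_module[OF sub A.group_axioms, of y x] assms by simp
  finally show ?thesis .
qed

lemma coset_zero_iff:
  assumes "x \<in> carrier M"
  shows "N +>\<^bsub>M\<^esub> x = N \<longleftrightarrow> x \<in> N"
  unfolding coset_eq using assms A.coset_join1[OF _ _ sub] A.coset_join2[OF _ sub] subgroup.subset[OF sub]
  by auto

lemma quot_smult:
  assumes x: "x \<in> carrier M"
    and N: "\<And>n. n \<in> N \<Longrightarrow> r \<odot>\<^bsub>M\<^esub> n \<in> N"
    and closed: "r \<odot>\<^bsub>M\<^esub> x \<in> carrier M"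
    and add: "\<And>n. n \<in> N \<Longrightarrow> r \<odot>\<^bsub>M\<^esub> (n \<oplus>\<^bsub>M\<^esub> x) = r \<odot>\<^bsub>M\<^esub> n \<oplus>\<^bsub>M\<^esub> r \<odot>\<^bsub>M\<^esub> x"
  shows "r \<odot>\<^bsub>quot_module M N\<^esub> (N +>\<^bsub>M\<^esub> x) = N +>\<^bsub>M\<^esub> (r \<odot>\<^bsub>M\<^esub> x)"
proof -
  have "induced (\<lambda>m. N +>\<^bsub>M\<^esub> (r \<odot>\<^bsub>M\<^esub> m)) (N +>\<^bsub>M\<^esub> x) = N +>\<^bsub>M\<^esub> (r \<odot>\<^bsub>M\<^esub> x)"
  proof (rule induced_const)
    show "N +>\<^bsub>M\<^esub> x \<noteq> {}" using coset_mem[OF x] by blast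
    fix y assume "y \<in> N +>\<^bsub>M\<^esub> x"
    then obtain n where n: "n \<in> N" "y = n \<oplus>\<^bsub>M\<^esub> x" by (rule coset_obtain)
    have "r \<odot>\<^bsub>M\<^esub> y \<in> N +>\<^bsub>M\<^esub> (r \<odot>\<^bsub>M\<^esub> x)"
      using N[OF n(1)] unfolding n(2) add[OF n(1)] coset_eq r_coset_def by auto
    then show "N +>\<^bsub>M\<^esub> (r \<odot>\<^bsub>M\<^esub> y) = N +>\<^bsub>M\<^esub> (r \<odot>\<^bsub>M\<^esub> x)"
      by (rule coset_cong(2)[OF closed])
  qed
  then show ?thesis by (simp add: quot_module_def)
qed

end

lemma (in comm_group) free_Abelian_group_eval:
  assumes f: "f \<in> S \<rightarrow> carrier G"
  shows "(\<lambda>u. finprod G (\<lambda>q. f q [^] Poly_Mapping.lookup u q) (Poly_Mapping.keys u)) \<in> hom (free_Abelian_group S) G"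
    (is "?e \<in> _")
proof (rule homI)
  \<comment> \<open>Cancellation can make the keys of \<open>u + v\<close> smaller than the union of
    the keys of \<open>u\<close> and \<open>v\<close>; all products are first extended to a common
    finite set.\<close>
  have ext: "?e u = finprod G (\<lambda>q. f q [^] Poly_Mapping.lookup u q) K"
    if "finite K" "Poly_Mapping.keys u \<subseteq> K" "K \<subseteq> S" for u K
    using that f by (intro finprod_mono_neutral_cong_left) (auto simp: in_keys_iff Pi_def)
  fix u v assume "u \<in> carrier (free_Abelian_group S)" "v \<in> carrier (free_Abelian_group S)"
  then have S: "Poly_Mapping.keys u \<union> Poly_Mapping.keys v \<subseteq> S" by simp
  let ?K = "Poly_Mapping.keys u \<union> Poly_Mapping.keys v"
  have "?e (u + v) = finprod G (\<lambda>q. f q [^] Poly_Mapping.lookup (u + v) q) ?K"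
    using S keys_add[of u v] by (intro ext) auto
  also have "\<dots> = finprod G (\<lambda>q. f q [^] Poly_Mapping.lookup u q \<otimes> f q [^] Poly_Mapping.lookup v q) ?K"
    using S f by (intro finprod_cong') (auto simp: lookup_add int_pow_mult Pi_def subset_iff)
  also have "\<dots> = finprod G (\<lambda>q. f q [^] Poly_Mapping.lookup u q) ?K \<otimes> finprod G (\<lambda>q. f q [^] Poly_Mapping.lookup v q) ?K"
    using S f by (intro finprod_multf) (auto simp: Pi_def subset_iff)
  also have "\<dots> = ?e u \<otimes> ?e v"
    using S ext[of ?K u] ext[of ?K v] by auto
  finally show "?e (u \<otimes>\<^bsub>free_Abelian_group S\<^esub> v) = ?e u \<otimes> ?e v" by simp
qed (use f in \<open>auto intro!: finprod_closed simp: Pi_def subset_iff\<close>)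

text \<open>The function inside \<open>base_change_unit\<close> before passing to cosets: the
  additive extension of \<open>(m, s) \<mapsto> h(m)s\<close> to formal sums of pairs.\<close>

definition eval_pairs :: "'s ring \<Rightarrow> ('r \<Rightarrow> 's) \<Rightarrow> (('r \<times> 's) \<Rightarrow>\<^sub>0 int) \<Rightarrow> 's" where
  "eval_pairs S h u = (\<Oplus>\<^bsub>S\<^esub>q\<in>Poly_Mapping.keys u.
     add_pow S (Poly_Mapping.lookup u q) (h (fst q) \<otimes>\<^bsub>S\<^esub> snd q))"

text \<open>A stalk of \<open>ideal_module\<close> as a function of the ring and the ideal alone, so
  that the algebra can be done for a single ring homomorphism without sheaves.\<close>

definition ideal_record :: "'r ring \<Rightarrow> 'r set \<Rightarrow> ('r, 'r) module" where
  "ideal_record R J = \<lparr>carrier = J, monoid.mult = undefined, one = undefined,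
     ring.zero = \<zero>\<^bsub>R\<^esub>, add = add R, smult = mult R\<rparr>"

lemma generate_induct_hom:
  assumes "group G" "subgroup K G" "A \<subseteq> K"
  shows "generate G A \<subseteq> K"
  using group.generate_subgroup_incl[OF assms(1,3,2)] .

text \<open>One stalk at a time: \<open>R\<close> is the stalk of \<open>X\<close> at
  \<open>p y\<close>, \<open>S\<close> that of \<open>Y\<close> at \<open>y\<close>. Injectivity
  makes \<open>h a\<close> a non-zero element of a domain, hence a regular one, for every non-zero
  \<open>a \<in> J\<close>.\<close>

locale ideal_base_change =
  fixes R :: "'r ring" and S :: "'s ring" and h :: "'r \<Rightarrow> 's" and J :: "'r set"
  assumes R: "cring R" and S: "domain S" and h: "h \<in> ring_hom R S" and inj: "inj_on h (carrier R)"
    and J: "ideal J R"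
begin

interpretation R: cring R by (rule R)
interpretation S: domain S by (rule S)
interpretation J: ideal J R by (rule J)

abbreviation "M \<equiv> ideal_record R J"
abbreviation "G \<equiv> free_Abelian_group (J \<times> carrier S)"
abbreviation "rel \<equiv> tensor_relations R S h M"
abbreviation "P \<equiv> free_pairs S M"
abbreviation "T \<equiv> base_change R S h M"
abbreviation "cl u \<equiv> rel +>\<^bsub>P\<^esub> u"
abbreviation "ev \<equiv> eval_pairs S h"
abbreviation "sc s \<equiv> frag_extend (\<lambda>(m, t). frag_of (m, s \<otimes>\<^bsub>S\<^esub> t))"

lemma M_simps [simp]: "carrier M = J" "\<zero>\<^bsub>M\<^esub> = \<zero>\<^bsub>R\<^esub>" "add M = add R" "smult M = mult R"
  by (simp_all add: ideal_record_def)

lemma J_sub: "m \<in> J \<Longrightarrow> m \<in> carrier R"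
  using J.a_subset by blast

lemma h_simps: "a \<in> carrier R \<Longrightarrow> h a \<in> carrier S" "h \<zero>\<^bsub>R\<^esub> = \<zero>\<^bsub>S\<^esub>"
  "a \<in> carrier R \<Longrightarrow> b \<in> carrier R \<Longrightarrow> h (a \<oplus>\<^bsub>R\<^esub> b) = h a \<oplus>\<^bsub>S\<^esub> h b"
  "a \<in> carrier R \<Longrightarrow> b \<in> carrier R \<Longrightarrow> h (a \<otimes>\<^bsub>R\<^esub> b) = h a \<otimes>\<^bsub>S\<^esub> h b"
  using ring_hom_closed[OF h] ring_hom_add[OF h] ring_hom_mult[OF h]
    ring_hom_zero[OF h R.ring_axioms S.ring_axioms] by auto

lemma P_simps [simp]: "carrier P = carrier G" "add P = (+)" "\<zero>\<^bsub>P\<^esub> = 0" "smult P = sc"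
  by (simp_all add: free_pairs_def)

definition "relators =
  {frag_of (m \<oplus>\<^bsub>M\<^esub> m', s) - frag_of (m, s) - frag_of (m', s) | m m' s.
     m \<in> carrier M \<and> m' \<in> carrier M \<and> s \<in> carrier S} \<union>
  {frag_of (m, s \<oplus>\<^bsub>S\<^esub> s') - frag_of (m, s) - frag_of (m, s') | m s s'.
     m \<in> carrier M \<and> s \<in> carrier S \<and> s' \<in> carrier S} \<union>
  {frag_of (r \<odot>\<^bsub>M\<^esub> m, s) - frag_of (m, h r \<otimes>\<^bsub>S\<^esub> s) | r m s.
     r \<in> carrier R \<and> m \<in> carrier M \<and> s \<in> carrier S}"

lemma rel_eq: "rel = generate G relators"
  by (simp add: tensor_relations_def relators_def)

lemma frag_keys: "m \<in> J \<Longrightarrow> s \<in> carrier S \<Longrightarrow> frag_of (m, s) \<in> carrier G"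
  by simp

lemma carrier_G_closed:
  "x \<in> carrier G \<Longrightarrow> y \<in> carrier G \<Longrightarrow> x + y \<in> carrier G"
  "x \<in> carrier G \<Longrightarrow> y \<in> carrier G \<Longrightarrow> x - y \<in> carrier G"
  "x \<in> carrier G \<Longrightarrow> - x \<in> carrier G" "0 \<in> carrier G"
  using keys_add[of x y] keys_diff[of x y] by (auto dest!: subsetD)

lemma relators_sub: "relators \<subseteq> carrier G"
  unfolding relators_def
  by (auto simp del: carrier_free_Abelian_group_iff
      intro!: carrier_G_closed frag_keys J.a_closed J.I_l_closed h_simps J_sub)

lemma rel_subgroup: "subgroup rel G"
  unfolding rel_eq using relators_sub by (intro group.generate_is_subgroup group_free_Abelian_group)

lemma rel_closed: "x \<in> rel \<Longrightarrow> y \<in> rel \<Longrightarrow> x + y \<in> rel" "0 \<in> rel"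
  "x \<in> rel \<Longrightarrow> - x \<in> rel" "x \<in> rel \<Longrightarrow> y \<in> rel \<Longrightarrow> x - y \<in> rel" "rel \<subseteq> carrier G"
proof -
  show s: "rel \<subseteq> carrier G" by (rule subgroup.subset[OF rel_subgroup])
  show a: "x \<in> rel \<Longrightarrow> y \<in> rel \<Longrightarrow> x + y \<in> rel" for x y
    using subgroup.m_closed[OF rel_subgroup, of x y] by simp
  show "0 \<in> rel" using subgroup.one_closed[OF rel_subgroup] by simp
  show m: "x \<in> rel \<Longrightarrow> - x \<in> rel" for x
    using subgroup.m_inv_closed[OF rel_subgroup, of x] s by (auto simp: subset_iff)
  show "x \<in> rel \<Longrightarrow> y \<in> rel \<Longrightarrow> x - y \<in> rel"
    using a[of x "- y"] m[of y] by simp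
qed

lemma rel_gen: "x \<in> relators \<Longrightarrow> x \<in> rel"
  unfolding rel_eq by (rule generate.incl)

lemma P_monoid: "carrier (add_monoid P) = carrier G" "mult (add_monoid P) = mult G"
  "one (add_monoid P) = one G"
  by (simp_all add: free_pairs_def free_Abelian_group_def)

lemma quotient_P: "quotient_module P rel"
  by (rule quotient_module.intro[OF comm_group_cong[OF abelian_free_Abelian_group P_monoid]
        subgroup_cong[OF rel_subgroup P_monoid]])

lemma inv_P: "v \<in> carrier G \<Longrightarrow> inv\<^bsub>add_monoid P\<^esub> v = - v"
  using m_inv_cong[OF P_monoid, of v] by simp

sublocale T: quotient_module P rel
  rewrites "quot_module P rel = T"
  by (rule quotient_P) (simp add: base_change_def)

lemma carrier_T: "carrier T = cl ` carrier G"
  using T.carrier_quot by simp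

lemma T_add: "u \<in> carrier G \<Longrightarrow> v \<in> carrier G \<Longrightarrow> cl u \<oplus>\<^bsub>T\<^esub> cl v = cl (u + v)"
  using T.quot_add[of u v] by simp

lemma T_zero: "\<zero>\<^bsub>T\<^esub> = cl 0" 
  using T.coset_zero_iff[of 0] rel_closed T.quot_zero by simp

lemma cl_eq_iff: "u \<in> carrier G \<Longrightarrow> v \<in> carrier G \<Longrightarrow> cl u = cl v \<longleftrightarrow> u - v \<in> rel"
  using T.coset_eq_iff[of u v] inv_P[of v] by simp

lemma ev_hom: "ev \<in> hom G (add_monoid S)"
proof -
  have "(\<lambda>q. h (fst q) \<otimes>\<^bsub>S\<^esub> snd q) \<in> J \<times> carrier S \<rightarrow> carrier (add_monoid S)"
    using h_simps J_sub by auto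
  from comm_group.free_Abelian_group_eval[OF S.a_comm_group this]
  show ?thesis unfolding eval_pairs_def finsum_def add_pow_def by simp
qed

lemma ev_closed: "u \<in> carrier G \<Longrightarrow> ev u \<in> carrier S"
  using ev_hom by (auto simp: hom_def)

lemma ev_add: "u \<in> carrier G \<Longrightarrow> v \<in> carrier G \<Longrightarrow> ev (u + v) = ev u \<oplus>\<^bsub>S\<^esub> ev v"
  using ev_hom by (auto simp: hom_def)

lemma ev_zero: "ev 0 = \<zero>\<^bsub>S\<^esub>"
  by (simp add: eval_pairs_def)

lemma ev_minus: "u \<in> carrier G \<Longrightarrow> ev (- u) = \<ominus>\<^bsub>S\<^esub> ev u"
  using ev_add[of "- u" u] ev_zero ev_closed carrier_G_closed(3)[of u]
  by (metis S.minus_equality add.left_inverse)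

lemma ev_diff: "u \<in> carrier G \<Longrightarrow> v \<in> carrier G \<Longrightarrow> ev (u - v) = ev u \<ominus>\<^bsub>S\<^esub> ev v"
  using ev_add[of u "- v"] ev_minus[of v] carrier_G_closed(3)[of v] by (simp add: a_minus_def)

lemma ev_frag: "m \<in> J \<Longrightarrow> s \<in> carrier S \<Longrightarrow> ev (frag_of (m, s)) = h m \<otimes>\<^bsub>S\<^esub> s"
proof -
  assume m: "m \<in> J" and s: "s \<in> carrier S"
  have c: "h m \<otimes>\<^bsub>S\<^esub> s \<in> carrier S" using m s by (simp add: h_simps J_sub)
  have "ev (frag_of (m, s)) = (\<Oplus>\<^bsub>S\<^esub>q\<in>{(m, s)}. h (fst q) \<otimes>\<^bsub>S\<^esub> snd q)"
    unfolding eval_pairs_def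
    by (rule S.finsum_cong') (use c in \<open>auto simp: S.add.int_pow_1\<close>)
  also have "\<dots> = h m \<otimes>\<^bsub>S\<^esub> s"
    using c by (subst S.finsum_insert) auto
  finally show ?thesis .
qed

lemma S_cancel: "x \<in> carrier S \<Longrightarrow> y \<in> carrier S \<Longrightarrow> (x \<oplus>\<^bsub>S\<^esub> y) \<ominus>\<^bsub>S\<^esub> x \<ominus>\<^bsub>S\<^esub> y = \<zero>\<^bsub>S\<^esub>"
  by (simp add: a_minus_def S.a_assoc S.a_lcomm[of y "\<ominus>\<^bsub>S\<^esub> x" "\<ominus>\<^bsub>S\<^esub> y"] S.r_neg2 S.r_neg)

lemma ev_rel: "u \<in> rel \<Longrightarrow> ev u = \<zero>\<^bsub>S\<^esub>"
proof -
  let ?K = "{u \<in> carrier G. ev u = \<zero>\<^bsub>S\<^esub>}"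
  have "subgroup ?K G"
    by (rule group.subgroupI[OF group_free_Abelian_group])
      (auto simp del: carrier_free_Abelian_group_iff
        simp: carrier_G_closed ev_zero ev_add ev_minus inv_free_Abelian_group[unfolded carrier_free_Abelian_group_iff[symmetric]]
        intro!: exI[of _ 0])
  moreover have "ev x = \<zero>\<^bsub>S\<^esub>" if "x \<in> relators" for x
    using that[unfolded relators_def M_simps]
  proof (elim UnE CollectE exE conjE)
    fix m m' s assume x: "x = frag_of (m \<oplus>\<^bsub>R\<^esub> m', s) - frag_of (m, s) - frag_of (m', s)"
      and *: "m \<in> J" "m' \<in> J" "s \<in> carrier S"
    have "ev x = (h m \<otimes>\<^bsub>S\<^esub> s \<oplus>\<^bsub>S\<^esub> h m' \<otimes>\<^bsub>S\<^esub> s) \<ominus>\<^bsub>S\<^esub> h m \<otimes>\<^bsub>S\<^esub> s \<ominus>\<^bsub>S\<^esub> h m' \<otimes>\<^bsub>S\<^esub> s"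
      unfolding x using *
      by (simp add: ev_diff ev_frag frag_keys carrier_G_closed J.a_closed h_simps J_sub S.l_distr
          del: carrier_free_Abelian_group_iff)
    then show "ev x = \<zero>\<^bsub>S\<^esub>" using * by (simp add: S_cancel h_simps J_sub)
  next
    fix m s s' assume x: "x = frag_of (m, s \<oplus>\<^bsub>S\<^esub> s') - frag_of (m, s) - frag_of (m, s')"
      and *: "m \<in> J" "s \<in> carrier S" "s' \<in> carrier S"
    have "ev x = (h m \<otimes>\<^bsub>S\<^esub> s \<oplus>\<^bsub>S\<^esub> h m \<otimes>\<^bsub>S\<^esub> s') \<ominus>\<^bsub>S\<^esub> h m \<otimes>\<^bsub>S\<^esub> s \<ominus>\<^bsub>S\<^esub> h m \<otimes>\<^bsub>S\<^esub> s'"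
      unfolding x using *
      by (simp add: ev_diff ev_frag frag_keys carrier_G_closed h_simps J_sub S.r_distr
          del: carrier_free_Abelian_group_iff)
    then show "ev x = \<zero>\<^bsub>S\<^esub>" using * by (simp add: S_cancel h_simps J_sub)
  next
    fix a m s assume x: "x = frag_of (a \<otimes>\<^bsub>R\<^esub> m, s) - frag_of (m, h a \<otimes>\<^bsub>S\<^esub> s)"
      and *: "a \<in> carrier R" "m \<in> J" "s \<in> carrier S"
    have "ev x = (h a \<otimes>\<^bsub>S\<^esub> h m) \<otimes>\<^bsub>S\<^esub> s \<ominus>\<^bsub>S\<^esub> h m \<otimes>\<^bsub>S\<^esub> (h a \<otimes>\<^bsub>S\<^esub> s)"
      unfolding x using *
      by (simp add: ev_diff ev_frag frag_keys carrier_G_closed J.I_l_closed h_simps J_sub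
          del: carrier_free_Abelian_group_iff)
    also have "h m \<otimes>\<^bsub>S\<^esub> (h a \<otimes>\<^bsub>S\<^esub> s) = (h a \<otimes>\<^bsub>S\<^esub> h m) \<otimes>\<^bsub>S\<^esub> s"
      using * S.m_lcomm[of "h m" "h a" s] by (simp add: S.m_assoc h_simps J_sub)
    finally show "ev x = \<zero>\<^bsub>S\<^esub>" using * by (simp add: h_simps J_sub S.minus_eq S.r_neg)
  qed
  ultimately have "generate G relators \<subseteq> ?K"
    by (intro generate_induct_hom[OF group_free_Abelian_group]) (auto simp del: carrier_free_Abelian_group_iff dest: subsetD[OF relators_sub])
  then show "u \<in> rel \<Longrightarrow> ev u = \<zero>\<^bsub>S\<^esub>" unfolding rel_eq by auto
qed

lemma sc_simps: "sc r 0 = 0" "sc r (u + v) = sc r u + sc r v" "sc r (u - v) = sc r u - sc r v"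
  "sc r (- u) = - sc r u" "sc r (frag_of (m, s)) = frag_of (m, r \<otimes>\<^bsub>S\<^esub> s)"
  by (simp_all add: frag_extend_add frag_extend_diff frag_extend_minus)

lemma G_induct [consumes 1, case_names zero frag diff]:
  assumes "u \<in> carrier G" and "Q 0" and "\<And>m s. m \<in> J \<Longrightarrow> s \<in> carrier S \<Longrightarrow> Q (frag_of (m, s))"
    and "\<And>u v. u \<in> carrier G \<Longrightarrow> v \<in> carrier G \<Longrightarrow> Q u \<Longrightarrow> Q v \<Longrightarrow> Q (u - v)"
  shows "Q u"
proof -
  have "u \<in> carrier G \<and> Q u"
  proof (rule frag_induction[where S = "J \<times> carrier S"])
    show "Poly_Mapping.keys u \<subseteq> J \<times> carrier S" using assms(1) by simp
    show "frag_of q \<in> carrier G \<and> Q (frag_of q)" if "q \<in> J \<times> carrier S" for q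
      using that assms(3) by (auto simp del: carrier_free_Abelian_group_iff intro!: frag_keys)
    show "0 \<in> carrier G \<and> Q 0" using assms(2) by simp
    show "a - b \<in> carrier G \<and> Q (a - b)" if "a \<in> carrier G \<and> Q a" "b \<in> carrier G \<and> Q b" for a b
      using carrier_G_closed(2)[of a b] assms(4)[of a b] that by argo
  qed
  then show ?thesis by simp
qed

lemma sc_closed: "u \<in> carrier G \<Longrightarrow> r \<in> carrier S \<Longrightarrow> sc r u \<in> carrier G"
  by (induction rule: G_induct)
    (auto simp del: carrier_free_Abelian_group_iff simp: sc_simps intro!: carrier_G_closed frag_keys)

lemma ev_sc: "u \<in> carrier G \<Longrightarrow> r \<in> carrier S \<Longrightarrow> ev (sc r u) = r \<otimes>\<^bsub>S\<^esub> ev u"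
proof (induction rule: G_induct)
  case (frag m s)
  then show ?case using S.m_lcomm[of r "h m" s] h_simps J_sub by (simp add: sc_simps ev_frag)
next
  case (diff u v)
  have "ev (sc r (u - v)) = ev (sc r u) \<ominus>\<^bsub>S\<^esub> ev (sc r v)"
    unfolding sc_simps using diff sc_closed by (intro ev_diff) auto
  also have "\<dots> = r \<otimes>\<^bsub>S\<^esub> ev (u - v)"
    using diff ev_closed S.r_minus by (simp add: ev_diff a_minus_def S.r_distr del: carrier_free_Abelian_group_iff)
  finally show ?case .
qed (simp add: sc_simps ev_zero)

lemma sc_rel: "u \<in> rel \<Longrightarrow> r \<in> carrier S \<Longrightarrow> sc r u \<in> rel"
proof -
  assume r: "r \<in> carrier S"
  let ?K = "{u \<in> carrier G. sc r u \<in> rel}"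
  have "subgroup ?K G"
    by (rule group.subgroupI[OF group_free_Abelian_group])
      (auto simp del: carrier_free_Abelian_group_iff
        simp: carrier_G_closed sc_simps rel_closed inv_free_Abelian_group[unfolded carrier_free_Abelian_group_iff[symmetric]]
        intro!: exI[of _ 0])
  moreover have "sc r x \<in> rel" if "x \<in> relators" for x
    using that[unfolded relators_def]
  proof (elim UnE CollectE exE conjE)
    fix m m' s assume x: "x = frag_of (m \<oplus>\<^bsub>M\<^esub> m', s) - frag_of (m, s) - frag_of (m', s)"
      and "m \<in> carrier M" "m' \<in> carrier M" "s \<in> carrier S"
    then show "sc r x \<in> rel" unfolding x sc_simps
      by (intro rel_gen) (use r in \<open>unfold relators_def, blast intro: S.m_closed\<close>)
  next
    fix m s s' assume x: "x = frag_of (m, s \<oplus>\<^bsub>S\<^esub> s') - frag_of (m, s) - frag_of (m, s')"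
      and *: "m \<in> carrier M" "s \<in> carrier S" "s' \<in> carrier S"
    show "sc r x \<in> rel" unfolding x sc_simps S.r_distr[OF *(2,3) r]
      by (intro rel_gen) (use r * in \<open>unfold relators_def, blast intro: S.m_closed\<close>)
  next
    fix a m s assume x: "x = frag_of (a \<odot>\<^bsub>M\<^esub> m, s) - frag_of (m, h a \<otimes>\<^bsub>S\<^esub> s)"
      and *: "a \<in> carrier R" "m \<in> carrier M" "s \<in> carrier S"
    show "sc r x \<in> rel" unfolding x sc_simps S.m_lcomm[OF r h_simps(1)[OF *(1)] *(3)]
      by (intro rel_gen) (use r * in \<open>unfold relators_def, blast intro: S.m_closed\<close>)
  qed
  ultimately have "generate G relators \<subseteq> ?K"
    by (intro generate_induct_hom[OF group_free_Abelian_group]) (auto simp del: carrier_free_Abelian_group_iff dest: subsetD[OF relators_sub])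
  then show "u \<in> rel \<Longrightarrow> sc r u \<in> rel" using rel_eq by auto
qed

lemma rel_bilinear:
  assumes "m \<in> J" "m' \<in> J" "s \<in> carrier S" "s' \<in> carrier S" "a \<in> carrier R"
  shows "frag_of (m \<oplus>\<^bsub>R\<^esub> m', s) - frag_of (m, s) - frag_of (m', s) \<in> rel"
    and "frag_of (m, s \<oplus>\<^bsub>S\<^esub> s') - frag_of (m, s) - frag_of (m, s') \<in> rel"
    and "frag_of (a \<otimes>\<^bsub>R\<^esub> m, s) - frag_of (m, h a \<otimes>\<^bsub>S\<^esub> s) \<in> rel"
  by (rule rel_gen, use assms in \<open>unfold relators_def M_simps, blast\<close>)+

text \<open>Additivity at zero plus zero leaves the negative of this generator as a relator.\<close>

lemma frag_zero_rel: "m \<in> J \<Longrightarrow> frag_of (m, \<zero>\<^bsub>S\<^esub>) \<in> rel"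
  using rel_bilinear(2)[of m m "\<zero>\<^bsub>S\<^esub>" "\<zero>\<^bsub>S\<^esub>" "\<zero>\<^bsub>R\<^esub>"] rel_closed(3) by fastforce

lemma frag_zero_left_rel: "s \<in> carrier S \<Longrightarrow> frag_of (\<zero>\<^bsub>R\<^esub>, s) \<in> rel"
  using rel_bilinear(1)[of "\<zero>\<^bsub>R\<^esub>" "\<zero>\<^bsub>R\<^esub>" s s "\<zero>\<^bsub>R\<^esub>"] rel_closed(3) by fastforce

lemma frag_diff_rel:
  assumes "m \<in> J" "x \<in> carrier S" "y \<in> carrier S"
  shows "frag_of (m, x) - frag_of (m, y) - frag_of (m, x \<ominus>\<^bsub>S\<^esub> y) \<in> rel"
proof -
  have "(x \<ominus>\<^bsub>S\<^esub> y) \<oplus>\<^bsub>S\<^esub> y = x" using assms by (simp add: a_minus_def S.a_assoc S.l_neg)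
  with rel_bilinear(2)[of m m "x \<ominus>\<^bsub>S\<^esub> y" y "\<zero>\<^bsub>R\<^esub>"] assms
  have "frag_of (m, x) - frag_of (m, x \<ominus>\<^bsub>S\<^esub> y) - frag_of (m, y) \<in> rel" by simp
  then show ?thesis by (simp add: algebra_simps)
qed

text \<open>For \<open>a \<in> J\<close> one has \<open>h(a) \<cdot> (m \<otimes> s) = am \<otimes> s = a \<otimes> h(m)s\<close>: multiplication by \<open>h(a)\<close>
  factors through the evaluation.\<close>

lemma sc_image_rel:
  assumes "u \<in> carrier G" and a: "a \<in> J"
  shows "sc (h a) u - frag_of (a, ev u) \<in> rel"
  using assms(1)
proof (induction rule: G_induct)
  case zero
  then show ?case using frag_zero_rel[OF a] rel_closed(3) by (simp add: sc_simps ev_zero)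
next
  case (frag m s)
  have "frag_of (a \<otimes>\<^bsub>R\<^esub> m, s) - frag_of (m, h a \<otimes>\<^bsub>S\<^esub> s) \<in> rel"
    "frag_of (m \<otimes>\<^bsub>R\<^esub> a, s) - frag_of (a, h m \<otimes>\<^bsub>S\<^esub> s) \<in> rel"
    using rel_bilinear(3) frag a J_sub by blast+
  from rel_closed(4)[OF this(2,1)] show ?case
    using frag a J_sub R.m_comm[of a m] by (simp add: sc_simps ev_frag)
next
  case (diff u v)
  have "(sc (h a) u - frag_of (a, ev u)) - (sc (h a) v - frag_of (a, ev v))
      + (frag_of (a, ev u) - frag_of (a, ev v) - frag_of (a, ev u \<ominus>\<^bsub>S\<^esub> ev v)) \<in> rel"
    by (rule rel_closed(1)[OF rel_closed(4)[OF diff(3,4)] frag_diff_rel[OF a ev_closed[OF diff(1)] ev_closed[OF diff(2)]]])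
  moreover have "(sc (h a) u - frag_of (a, ev u)) - (sc (h a) v - frag_of (a, ev v))
      + (frag_of (a, ev u) - frag_of (a, ev v) - frag_of (a, ev u \<ominus>\<^bsub>S\<^esub> ev v))
    = sc (h a) (u - v) - frag_of (a, ev (u - v))"
    unfolding ev_diff[OF diff(1,2)] sc_simps by simp
  ultimately show ?case by (simp only:)
qed

lemma sc_one: "u \<in> carrier G \<Longrightarrow> sc \<one>\<^bsub>S\<^esub> u = u"
  by (induction rule: G_induct) (simp_all add: sc_simps)

text \<open>The tensor product with the zero module vanishes. The case is separate because then no
  non-zero \<open>a \<in> J\<close> exists whose image could annihilate the kernel of the
  evaluation.\<close>

lemma zero_ideal_rel:
  assumes "J = {\<zero>\<^bsub>R\<^esub>}" "u \<in> carrier G"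
  shows "u \<in> rel"
  using assms(2)
proof (induction rule: G_induct)
  case (frag m s)
  then show ?case using frag_zero_left_rel[of s] assms(1) by blast
qed (use rel_closed in blast)+

lemma T_smult:
  assumes "r \<in> carrier S" "u \<in> carrier G"
  shows "r \<odot>\<^bsub>T\<^esub> cl u = cl (sc r u)"
  using T.quot_smult[of u r] assms sc_rel sc_closed by (simp add: sc_simps del: carrier_free_Abelian_group_iff)

lemma cl_zero_iff: "u \<in> carrier G \<Longrightarrow> cl u = \<zero>\<^bsub>T\<^esub> \<longleftrightarrow> u \<in> rel"
  unfolding T_zero using cl_eq_iff[of u 0] carrier_G_closed(4) by simp

abbreviation "tor \<equiv> torsion S T"

text \<open>The evaluation is \<open>S\<close>-linear with values in the domain \<open>S\<close>, so
  it kills torsion. Conversely one non-zero annihilator, \<open>h a\<close> or 1 when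
  \<open>J\<close> is zero, works for the whole kernel.\<close>

lemma tor_cl_iff:
  assumes u: "u \<in> carrier G"
  shows "cl u \<in> tor \<longleftrightarrow> ev u = \<zero>\<^bsub>S\<^esub>"
proof
  assume "cl u \<in> tor"
  then obtain r where r: "r \<in> carrier S" "\<forall>s\<in>carrier S. r \<otimes>\<^bsub>S\<^esub> s = \<zero>\<^bsub>S\<^esub> \<longrightarrow> s = \<zero>\<^bsub>S\<^esub>" "r \<odot>\<^bsub>T\<^esub> cl u = \<zero>\<^bsub>T\<^esub>"
    unfolding torsion_def by blast
  then have "sc r u \<in> rel" using u by (simp add: T_smult cl_zero_iff sc_closed del: carrier_free_Abelian_group_iff)
  then have "r \<otimes>\<^bsub>S\<^esub> ev u = \<zero>\<^bsub>S\<^esub>" using ev_rel ev_sc[OF u r(1)] by simp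
  then show "ev u = \<zero>\<^bsub>S\<^esub>" using r ev_closed[OF u] by blast
next
  assume ev: "ev u = \<zero>\<^bsub>S\<^esub>"
  have "\<exists>r\<in>carrier S. r \<noteq> \<zero>\<^bsub>S\<^esub> \<and> sc r u \<in> rel"
  proof (cases "J = {\<zero>\<^bsub>R\<^esub>}")
    case True
    then show ?thesis using zero_ideal_rel[OF True u] sc_one[OF u] by (intro bexI[of _ "\<one>\<^bsub>S\<^esub>"]) auto
  next
    case False
    then obtain a where a: "a \<in> J" "a \<noteq> \<zero>\<^bsub>R\<^esub>" using J.additive_subgroup_axioms additive_subgroup.zero_closed by blast
    then have "h a \<noteq> \<zero>\<^bsub>S\<^esub>" using inj h_simps(2) J_sub[OF a(1)] by (metis R.zero_closed inj_onD)
    moreover have "sc (h a) u \<in> rel"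
      using rel_closed(1)[OF sc_image_rel[OF u a(1)] frag_zero_rel[OF a(1)]] by (simp add: ev)
    ultimately show ?thesis using h_simps(1)[OF J_sub[OF a(1)]] by blast
  qed
  then obtain r where r: "r \<in> carrier S" "r \<noteq> \<zero>\<^bsub>S\<^esub>" "sc r u \<in> rel" by blast
  have "r \<odot>\<^bsub>T\<^esub> cl u = \<zero>\<^bsub>T\<^esub>" using r u by (simp add: T_smult cl_zero_iff sc_closed del: carrier_free_Abelian_group_iff)
  moreover have "cl u \<in> carrier T" using u carrier_T by blast
  moreover have "\<forall>s\<in>carrier S. r \<otimes>\<^bsub>S\<^esub> s = \<zero>\<^bsub>S\<^esub> \<longrightarrow> s = \<zero>\<^bsub>S\<^esub>"
    using r S.integral by blast
  ultimately show "cl u \<in> tor" using r(1) unfolding torsion_def by blast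
qed

lemma unit_cl:
  assumes u: "u \<in> carrier G"
  shows "base_change_unit S h (cl u) = ev u"
  unfolding base_change_unit_def eval_pairs_def[symmetric]
proof (rule induced_const)
  show "cl u \<noteq> {}" using T.coset_mem[of u] u by auto
  fix v assume "v \<in> cl u"
  then have "v \<in> carrier G" "cl v = cl u" using T.coset_cong[of u v] u by (simp_all only: P_simps)
  then have "ev (v - u) = \<zero>\<^bsub>S\<^esub>" "v - u \<in> carrier G" using cl_eq_iff[of v u] u ev_rel carrier_G_closed(2)[of v u] by blast+
  then show "ev v = ev u" using ev_add[of "v - u" u] u ev_closed[OF u] by (simp del: carrier_free_Abelian_group_iff)
qed

end

context ideal_base_change
begin

interpretation R: cring R by (rule R)
interpretation S: domain S by (rule S)
interpretation J: ideal J R by (rule J)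

declare carrier_free_Abelian_group_iff [simp del]

lemma group_T: "comm_group (add_monoid T)"
  by (rule T.comm_group_quot)

interpretation TA: comm_group "add_monoid T" by (rule group_T)

lemma cl_closed: "u \<in> carrier G \<Longrightarrow> cl u \<in> carrier T"
  using carrier_T by blast

lemma T_uminus: "u \<in> carrier G \<Longrightarrow> inv\<^bsub>add_monoid T\<^esub> cl u = cl (- u)"
  using TA.inv_equality[of "cl (- u)" "cl u"] T_add[of "- u" u] T_zero cl_closed carrier_G_closed(3)[of u]
  by simp

lemma tor_obtain:
  assumes "x \<in> tor"
  obtains u where "u \<in> carrier G" "x = cl u" "ev u = \<zero>\<^bsub>S\<^esub>"
proof -
  have "x \<in> carrier T" using assms unfolding torsion_def by blast
  then obtain u where "u \<in> carrier G" "x = cl u" unfolding carrier_T by blast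
  then show ?thesis using that assms tor_cl_iff by blast
qed

lemma tor_subgroup: "subgroup tor (add_monoid T)"
proof (rule TA.subgroupI)
  show "tor \<subseteq> carrier (add_monoid T)" by (auto simp: torsion_def)
  show "tor \<noteq> {}" using tor_cl_iff[OF carrier_G_closed(4)] ev_zero by blast
next
  fix x assume "x \<in> tor"
  then obtain u where u: "u \<in> carrier G" "x = cl u" "ev u = \<zero>\<^bsub>S\<^esub>" by (rule tor_obtain)
  then show "inv\<^bsub>add_monoid T\<^esub> x \<in> tor"
    by (simp add: T_uminus tor_cl_iff carrier_G_closed(3) ev_minus)
next
  fix x y assume "x \<in> tor" "y \<in> tor"
  then obtain u v where u: "u \<in> carrier G" "x = cl u" "ev u = \<zero>\<^bsub>S\<^esub>" "v \<in> carrier G" "y = cl v" "ev v = \<zero>\<^bsub>S\<^esub>"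
    by (metis tor_obtain)
  then show "x \<otimes>\<^bsub>add_monoid T\<^esub> y \<in> tor"
    by (simp add: T_add tor_cl_iff carrier_G_closed(1) ev_add)
qed

sublocale Q: quotient_module T tor
  by (rule quotient_module.intro[OF group_T tor_subgroup])

abbreviation "Q \<equiv> quot_module T tor"
abbreviation "tcl u \<equiv> tor +>\<^bsub>T\<^esub> cl u"

lemma carrier_Q: "carrier Q = tcl ` carrier G"
  by (simp add: Q.carrier_quot carrier_T image_image)

lemma tcl_closed: "u \<in> carrier G \<Longrightarrow> tcl u \<in> carrier Q"
  using carrier_Q by blast

text \<open>Torsion being the kernel of the evaluation, classes modulo torsion are separated by
  their values; injectivity of the canonical map rests on this.\<close>

lemma tcl_eq_iff:
  assumes u: "u \<in> carrier G" and v: "v \<in> carrier G"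
  shows "tcl u = tcl v \<longleftrightarrow> ev u = ev v"
proof -
  have "tcl u = tcl v \<longleftrightarrow> cl u \<oplus>\<^bsub>T\<^esub> cl (- v) \<in> tor"
    using Q.coset_eq_iff[OF cl_closed[OF u] cl_closed[OF v]] T_uminus[OF v] by simp
  also have "cl u \<oplus>\<^bsub>T\<^esub> cl (- v) = cl (u - v)"
    using T_add[OF u carrier_G_closed(3)[OF v]] by simp
  also have "cl (u - v) \<in> tor \<longleftrightarrow> ev u = ev v"
    using tor_cl_iff[OF carrier_G_closed(2)[OF u v]] ev_diff[OF u v] ev_closed[OF u] ev_closed[OF v] S.r_neg S.minus_equality[of "ev u" "\<ominus>\<^bsub>S\<^esub> ev v"]
    by (auto simp: S.minus_eq)
  finally show ?thesis .
qed

lemma tcl_obtain: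
  assumes "t \<in> tcl u" and u: "u \<in> carrier G"
  obtains v where "v \<in> carrier G" "t = cl v" "ev v = ev u"
proof -
  have t: "t \<in> carrier T" "tor +>\<^bsub>T\<^esub> t = tcl u" using Q.coset_cong[OF cl_closed[OF u] assms(1)] by blast+
  then obtain v where "v \<in> carrier G" "t = cl v" unfolding carrier_T by blast
  with t(2) show ?thesis using that tcl_eq_iff[OF _ u] by blast
qed

lemma Q_add: "u \<in> carrier G \<Longrightarrow> v \<in> carrier G \<Longrightarrow> tcl u \<oplus>\<^bsub>Q\<^esub> tcl v = tcl (u + v)"
  using Q.quot_add cl_closed by (simp add: T_add)

lemma Q_smult:
  assumes "r \<in> carrier S" "u \<in> carrier G"
  shows "r \<odot>\<^bsub>Q\<^esub> tcl u = tcl (sc r u)"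
proof -
  have "r \<odot>\<^bsub>Q\<^esub> tcl u = tor +>\<^bsub>T\<^esub> (r \<odot>\<^bsub>T\<^esub> cl u)"
  proof (rule Q.quot_smult)
    show "cl u \<in> carrier T" "r \<odot>\<^bsub>T\<^esub> cl u \<in> carrier T"
      using assms by (simp_all add: T_smult sc_closed cl_closed)
  next
    fix n assume "n \<in> tor"
    then obtain v where v: "v \<in> carrier G" "n = cl v" "ev v = \<zero>\<^bsub>S\<^esub>" by (rule tor_obtain)
    show "r \<odot>\<^bsub>T\<^esub> n \<in> tor"
      using assms v by (simp add: T_smult tor_cl_iff sc_closed ev_sc)
    show "r \<odot>\<^bsub>T\<^esub> (n \<oplus>\<^bsub>T\<^esub> cl u) = r \<odot>\<^bsub>T\<^esub> n \<oplus>\<^bsub>T\<^esub> r \<odot>\<^bsub>T\<^esub> cl u"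
      using assms v by (simp add: T_smult T_add sc_closed carrier_G_closed(1) sc_simps)
  qed
  then show ?thesis using assms by (simp add: T_smult)
qed

text \<open>Sections of the inverse image are given by finite sums of pure tensors in the stalks.
  Such a sum is identified here with the class of a formal sum, on which the evaluation is
  known.\<close>

lemma tensor_sum:
  assumes "\<And>i. i < (k::nat) \<Longrightarrow> m i \<in> J \<and> s i \<in> carrier S"
  shows "(\<Sum>i<k. frag_of (m i, s i)) \<in> carrier G" (is "?A k")
    and "(\<Oplus>\<^bsub>T\<^esub>i\<in>{..<k}. pure_tensor R S h M (m i) (s i)) = cl (\<Sum>i<k. frag_of (m i, s i))" (is "?B k")
    and "ev (\<Sum>i<k. frag_of (m i, s i)) = (\<Oplus>\<^bsub>S\<^esub>i\<in>{..<k}. h (m i) \<otimes>\<^bsub>S\<^esub> s i)" (is "?C k")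
proof -
  have "?A k \<and> ?B k \<and> ?C k" using assms
  proof (induction k)
    case 0
    have "(\<Sum>i<0. frag_of (m i, s i)) \<in> carrier G" by (simp add: carrier_G_closed(4))
    moreover have "(\<Oplus>\<^bsub>T\<^esub>i\<in>{..<0}. pure_tensor R S h M (m i) (s i)) = cl (\<Sum>i<0. frag_of (m i, s i))"
      unfolding lessThan_0 finsum_def TA.finprod_empty by (simp add: T_zero)
    moreover have "ev (\<Sum>i<0. frag_of (m i, s i)) = (\<Oplus>\<^bsub>S\<^esub>i\<in>{..<0}. h (m i) \<otimes>\<^bsub>S\<^esub> s i)"
      by (simp add: ev_zero)
    ultimately show ?case by blast
  next
    case (Suc k)
    let ?u = "\<Sum>i<k. frag_of (m i, s i)"
    have mem: "m i \<in> J" "s i \<in> carrier S" "h (m i) \<otimes>\<^bsub>S\<^esub> s i \<in> carrier S" "frag_of (m i, s i) \<in> carrier G"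
      "pure_tensor R S h M (m i) (s i) = cl (frag_of (m i, s i))" if "i < Suc k" for i
      using Suc.prems that by (simp_all add: h_simps J_sub frag_keys pure_tensor_def)
    have G: "?u \<in> carrier G" using Suc.IH Suc.prems by simp
    have 1: "(\<Sum>i<Suc k. frag_of (m i, s i)) \<in> carrier G"
      using G mem by (simp add: carrier_G_closed(1))
    have "(\<Oplus>\<^bsub>T\<^esub>i\<in>{..<Suc k}. pure_tensor R S h M (m i) (s i))
        = pure_tensor R S h M (m k) (s k) \<oplus>\<^bsub>T\<^esub> (\<Oplus>\<^bsub>T\<^esub>i\<in>{..<k}. pure_tensor R S h M (m i) (s i))"
      unfolding finsum_def lessThan_Suc using mem cl_closed
      by (subst TA.finprod_insert) auto
    also have "\<dots> = cl (frag_of (m k, s k)) \<oplus>\<^bsub>T\<^esub> cl ?u"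
      using Suc.IH Suc.prems mem(5)[of k] by simp
    also have "\<dots> = cl (\<Sum>i<Suc k. frag_of (m i, s i))"
      using T_add[OF mem(4)[of k] G] by (simp add: add.commute)
    finally have 2: "(\<Oplus>\<^bsub>T\<^esub>i\<in>{..<Suc k}. pure_tensor R S h M (m i) (s i)) = cl (\<Sum>i<Suc k. frag_of (m i, s i))" .
    have "(\<Oplus>\<^bsub>S\<^esub>i\<in>{..<Suc k}. h (m i) \<otimes>\<^bsub>S\<^esub> s i) = h (m k) \<otimes>\<^bsub>S\<^esub> s k \<oplus>\<^bsub>S\<^esub> (\<Oplus>\<^bsub>S\<^esub>i\<in>{..<k}. h (m i) \<otimes>\<^bsub>S\<^esub> s i)"
      unfolding lessThan_Suc using mem by (subst S.finsum_insert) auto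
    also have "\<dots> = ev (frag_of (m k, s k)) \<oplus>\<^bsub>S\<^esub> ev ?u"
      using Suc.IH Suc.prems mem(1,2)[of k] ev_frag by simp
    also have "\<dots> = ev (\<Sum>i<Suc k. frag_of (m i, s i))"
      using ev_add[OF mem(4)[of k] G] by (simp add: add.commute)
    finally have 3: "ev (\<Sum>i<Suc k. frag_of (m i, s i)) = (\<Oplus>\<^bsub>S\<^esub>i\<in>{..<Suc k}. h (m i) \<otimes>\<^bsub>S\<^esub> s i)" by simp
    show ?case using 1 2 3 by blast
  qed
  then show "?A k" "?B k" "?C k" by blast+
qed

text \<open>Integer multiplicities dissolve into repeated terms and signs are absorbed into the
  second factor, so that the value takes the shape required for sections of the inverse
  image.\<close>

lemma tensor_representation:
  assumes "u \<in> carrier G"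
  obtains k :: nat and m s where "\<And>i. i < k \<Longrightarrow> m i \<in> J \<and> s i \<in> carrier S"
    and "ev u = (\<Oplus>\<^bsub>S\<^esub>i\<in>{..<k}. h (m i) \<otimes>\<^bsub>S\<^esub> s i)"
proof -
  define P where "P x \<longleftrightarrow> (\<exists>(k::nat) m s. (\<forall>i<k. m i \<in> J \<and> s i \<in> carrier S) \<and>
    x = (\<Oplus>\<^bsub>S\<^esub>i\<in>{..<k}. h (m i) \<otimes>\<^bsub>S\<^esub> s i))" for x
  have step: "P (x \<oplus>\<^bsub>S\<^esub> h a \<otimes>\<^bsub>S\<^esub> b)" if "P x" and ab: "a \<in> J" "b \<in> carrier S" for x a b
  proof -
    obtain k m s where k: "\<forall>i<(k::nat). m i \<in> J \<and> s i \<in> carrier S" "x = (\<Oplus>\<^bsub>S\<^esub>i\<in>{..<k}. h (m i) \<otimes>\<^bsub>S\<^esub> s i)"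
      using \<open>P x\<close> unfolding P_def by blast
    have c: "h (m i) \<otimes>\<^bsub>S\<^esub> s i \<in> carrier S" if "i < k" for i using k(1) that by (simp add: h_simps J_sub)
    have d: "h a \<otimes>\<^bsub>S\<^esub> b \<in> carrier S" using ab by (simp add: h_simps J_sub)
    let ?m = "m(k := a)" and ?s = "s(k := b)"
    have "(\<Oplus>\<^bsub>S\<^esub>i\<in>{..<k}. h (?m i) \<otimes>\<^bsub>S\<^esub> ?s i) = x"
      unfolding k(2) using c by (intro S.finsum_cong') auto
    moreover have "(\<Oplus>\<^bsub>S\<^esub>i\<in>{..<Suc k}. h (?m i) \<otimes>\<^bsub>S\<^esub> ?s i)
        = h a \<otimes>\<^bsub>S\<^esub> b \<oplus>\<^bsub>S\<^esub> (\<Oplus>\<^bsub>S\<^esub>i\<in>{..<k}. h (?m i) \<otimes>\<^bsub>S\<^esub> ?s i)"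
      unfolding lessThan_Suc using c d by (subst S.finsum_insert) auto
    moreover have "x \<in> carrier S" unfolding k(2) using c by (intro S.finsum_closed) auto
    ultimately have "x \<oplus>\<^bsub>S\<^esub> h a \<otimes>\<^bsub>S\<^esub> b = (\<Oplus>\<^bsub>S\<^esub>i\<in>{..<Suc k}. h (?m i) \<otimes>\<^bsub>S\<^esub> ?s i)"
      using d S.a_comm by simp
    moreover have "\<forall>i<Suc k. ?m i \<in> J \<and> ?s i \<in> carrier S" using k(1) ab by (auto simp: less_Suc_eq)
    ultimately show ?thesis unfolding P_def by blast
  qed
  have P0: "P \<zero>\<^bsub>S\<^esub>" unfolding P_def by (intro exI[of _ 0]) simp
  \<comment> \<open>The claim for \<open>u\<close> alone does not pass directly through differences;
    adding \<open>u\<close> to, and subtracting it from, an arbitrary representable \<open>w\<close>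
    does.\<close>
  have "\<forall>w\<in>carrier G. P (ev w) \<longrightarrow> P (ev (w + u)) \<and> P (ev (w - u))"
    using assms
  proof (induction rule: G_induct)
    case (frag m s)
    show ?case
    proof (intro ballI impI)
      fix w assume w: "w \<in> carrier G" "P (ev w)"
      have "ev (w + frag_of (m, s)) = ev w \<oplus>\<^bsub>S\<^esub> h m \<otimes>\<^bsub>S\<^esub> s"
        using w frag by (simp add: ev_add ev_frag frag_keys)
      moreover have "ev (w - frag_of (m, s)) = ev w \<oplus>\<^bsub>S\<^esub> h m \<otimes>\<^bsub>S\<^esub> (\<ominus>\<^bsub>S\<^esub> s)"
        using w frag by (simp add: ev_diff ev_frag frag_keys S.r_minus h_simps J_sub S.minus_eq)
      ultimately show "P (ev (w + frag_of (m, s))) \<and> P (ev (w - frag_of (m, s)))"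
        using step[OF w(2) frag(1), of s] step[OF w(2) frag(1), of "\<ominus>\<^bsub>S\<^esub> s"] frag by simp
    qed
  next
    case (diff u v)
    show ?case
    proof (intro ballI impI)
      fix w assume w: "w \<in> carrier G" "P (ev w)"
      have "P (ev ((w + u) - v))" "P (ev ((w - u) + v))"
        using diff w carrier_G_closed(1,2)[of w u] by blast+
      then show "P (ev (w + (u - v))) \<and> P (ev (w - (u - v)))"
        by (simp add: algebra_simps)
    qed
  qed simp
  then have "P (ev u)" using P0 ev_zero carrier_G_closed(4) by (metis add_0)
  then show ?thesis using that unfolding P_def by blast
qed

lemma ev_image: "ev ` carrier G = Idl\<^bsub>S\<^esub> (h ` J)"
proof
  have sub: "h ` J \<subseteq> carrier S" using h_simps J_sub by blast
  interpret I: ideal "Idl\<^bsub>S\<^esub> (h ` J)" S by (rule S.genideal_ideal[OF sub])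
  have "ev u \<in> Idl\<^bsub>S\<^esub> (h ` J)" if "u \<in> carrier G" for u
    using that
  proof (induction rule: G_induct)
    case zero
    show ?case by (simp add: ev_zero I.zero_closed)
  next
    case (frag m s)
    then show ?case using S.genideal_self[OF sub] I.I_r_closed by (simp add: ev_frag image_subset_iff)
  next
    case (diff u v)
    then show ?case by (simp add: ev_diff S.minus_eq I.a_closed I.a_inv_closed)
  qed
  then show "ev ` carrier G \<subseteq> Idl\<^bsub>S\<^esub> (h ` J)" by blast
  show "Idl\<^bsub>S\<^esub> (h ` J) \<subseteq> ev ` carrier G"
  proof (rule S.genideal_minimal)
    have sg: "subgroup (ev ` carrier G) (add_monoid S)"
    proof (rule group.subgroupI[OF S.a_group])
      show "ev ` carrier G \<subseteq> carrier (add_monoid S)" using ev_closed by auto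
      show "ev ` carrier G \<noteq> {}" using carrier_G_closed(4) by blast
    next
      fix a assume "a \<in> ev ` carrier G"
      then obtain u where u: "u \<in> carrier G" "a = ev u" by blast
      then have "\<ominus>\<^bsub>S\<^esub> a = ev (- u)" by (simp add: ev_minus)
      then show "inv\<^bsub>add_monoid S\<^esub> a \<in> ev ` carrier G"
        unfolding a_inv_def[symmetric] using carrier_G_closed(3)[OF u(1)] by blast
    next
      fix a b assume "a \<in> ev ` carrier G" "b \<in> ev ` carrier G"
      then obtain u v where u: "u \<in> carrier G" "a = ev u" "v \<in> carrier G" "b = ev v" by blast
      then have "a \<oplus>\<^bsub>S\<^esub> b = ev (u + v)" by (simp add: ev_add)
      then show "a \<otimes>\<^bsub>add_monoid S\<^esub> b \<in> ev ` carrier G" using carrier_G_closed(1)[OF u(1,3)] by auto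
    qed
    have l: "x \<otimes>\<^bsub>S\<^esub> a \<in> ev ` carrier G" if "a \<in> ev ` carrier G" "x \<in> carrier S" for a x
    proof -
      obtain u where u: "u \<in> carrier G" "a = ev u" using \<open>a \<in> _\<close> by blast
      then have "x \<otimes>\<^bsub>S\<^esub> a = ev (sc x u)" using that by (simp add: ev_sc)
      then show ?thesis using sc_closed[OF u(1) that(2)] by blast
    qed
    show "ideal (ev ` carrier G) S"
    proof (rule idealI[OF S.ring_axioms sg l])
      show "a \<otimes>\<^bsub>S\<^esub> x \<in> ev ` carrier G" if "a \<in> ev ` carrier G" "x \<in> carrier S" for a x
        using l[OF that] that ev_closed S.m_comm[of a x] by auto
    qed
    show "h ` J \<subseteq> ev ` carrier G"
    proof
      fix b assume "b \<in> h ` J"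
      then obtain m where m: "m \<in> J" "b = h m" by blast
      then have "b = ev (frag_of (m, \<one>\<^bsub>S\<^esub>))" by (simp add: ev_frag h_simps J_sub)
      then show "b \<in> ev ` carrier G" using frag_keys[OF m(1) S.one_closed] by blast
    qed
  qed
qed

end

text \<open>The stalk map in \<open>canonical_map\<close> with the sheaf-level wrappers removed. The
  ideal \<open>J\<close> does not occur: its inclusion acts as the identity on representatives, and
  only the target, the full ring regarded as an ideal, is named.\<close>

definition canonical_stalk_map ::
    "'r ring \<Rightarrow> 's ring \<Rightarrow> ('r \<Rightarrow> 's) \<Rightarrow> (('r \<times> 's) \<Rightarrow>\<^sub>0 int) set set \<Rightarrow> 's" where
  "canonical_stalk_map R S h = induced (base_change_unit S h) \<circ>
     induced (\<lambda>t. torsion S (base_change R S h (ideal_record R (carrier R)))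
       +>\<^bsub>base_change R S h (ideal_record R (carrier R))\<^esub>
       base_change_map R S h (ideal_record R (carrier R)) (\<lambda>a. a) t)"

context ideal_base_change
begin

text \<open>The target of the inclusion is the same situation for the unit ideal, so torsion in the
  target is again the kernel of the evaluation.\<close>

lemma full_ideal: "ideal_base_change R S h (carrier R)"
  using R S h inj cring.axioms(1)[OF R] ring.oneideal by (intro ideal_base_change.intro) auto

interpretation U: ideal_base_change R S h "carrier R" by (rule full_ideal)

lemma carrier_G_mono: "u \<in> carrier G \<Longrightarrow> u \<in> carrier U.G"
  using J_sub by (auto simp: carrier_free_Abelian_group_iff)

text \<open>Makes the map induced by the inclusion of \<open>J\<close> independent of
  representatives. It need not be injective, since the larger group of relations also uses pairs
  whose first entry lies outside \<open>J\<close>.\<close>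

lemma rel_mono: "u \<in> rel \<Longrightarrow> u \<in> U.rel"
proof -
  have "subgroup {u \<in> carrier G. u \<in> U.rel} G"
    by (rule group.subgroupI[OF group_free_Abelian_group])
      (auto simp del: carrier_free_Abelian_group_iff
        simp: carrier_G_closed U.rel_closed inv_free_Abelian_group[unfolded carrier_free_Abelian_group_iff[symmetric]]
        intro!: exI[of _ 0])
  moreover have "relators \<subseteq> U.relators"
    unfolding relators_def U.relators_def M_simps U.M_simps using J_sub by blast
  ultimately have "generate G relators \<subseteq> {u \<in> carrier G. u \<in> U.rel}"
    by (intro generate_induct_hom[OF group_free_Abelian_group])
      (auto simp del: carrier_free_Abelian_group_iff dest: subsetD[OF relators_sub] intro: U.rel_gen)
  then show "u \<in> rel \<Longrightarrow> u \<in> U.rel" using rel_eq by auto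
qed

lemma base_change_map_cl:
  assumes u: "u \<in> carrier G"
  shows "base_change_map R S h (ideal_record R (carrier R)) (\<lambda>a. a) (cl u) = U.cl u"
  unfolding base_change_map_def
proof (rule induced_const)
  have id: "(\<lambda>(m, s). frag_of (m, s)) = (frag_of :: 'r \<times> 's \<Rightarrow> _)" by auto
  show "cl u \<noteq> {}" using T.coset_mem[of u] u by auto
  fix v assume "v \<in> cl u"
  then have v: "v \<in> carrier G" "cl v = cl u" using T.coset_cong[of u v] u by (simp_all only: P_simps)
  then have "v - u \<in> U.rel" using cl_eq_iff[of v u] u rel_mono by blast
  then have "U.cl v = U.cl u" using U.cl_eq_iff[of v u] carrier_G_mono u v by blast
  then show "U.cl (frag_extend (\<lambda>(m, s). frag_of (m, s)) v) = U.cl u"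
    unfolding id using frag_expansion[of v] by simp
qed

lemma canonical_stalk_map_tcl:
  assumes u: "u \<in> carrier G"
  shows "canonical_stalk_map R S h (tcl u) = ev u"
proof -
  have u': "u \<in> carrier U.G" by (rule carrier_G_mono[OF u])
  have "induced (\<lambda>t. U.tor +>\<^bsub>U.T\<^esub> base_change_map R S h U.M (\<lambda>a. a) t) (tcl u) = U.tcl u"
  proof (rule induced_const)
    show "tcl u \<noteq> {}" using Q.coset_mem[OF cl_closed[OF u]] by blast
    fix t assume "t \<in> tcl u"
    then obtain v where v: "v \<in> carrier G" "t = cl v" "ev v = ev u" using u by (rule tcl_obtain)
    show "U.tor +>\<^bsub>U.T\<^esub> base_change_map R S h U.M (\<lambda>a. a) t = U.tcl u"
      unfolding v(2) base_change_map_cl[OF v(1)] using U.tcl_eq_iff[OF carrier_G_mono[OF v(1)] u'] v(3) by blast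
  qed
  moreover have "induced (base_change_unit S h) (U.tcl u) = ev u"
  proof (rule induced_const)
    show "U.tcl u \<noteq> {}" using U.Q.coset_mem[OF U.cl_closed[OF u']] by blast
    fix t assume "t \<in> U.tcl u"
    then obtain v where v: "v \<in> carrier U.G" "t = U.cl v" "ev v = ev u" using u' by (rule U.tcl_obtain)
    show "base_change_unit S h t = ev u" unfolding v(2) U.unit_cl[OF v(1)] by (rule v(3))
  qed
  ultimately show ?thesis unfolding canonical_stalk_map_def comp_def by simp
qed

lemma canonical_bij: "bij_betw (canonical_stalk_map R S h) (carrier Q) (Idl\<^bsub>S\<^esub> (h ` J))"
  unfolding bij_betw_def
proof
  show "inj_on (canonical_stalk_map R S h) (carrier Q)"
  proof (rule inj_onI)
    fix a b assume "a \<in> carrier Q" "b \<in> carrier Q" and eq: "canonical_stalk_map R S h a = canonical_stalk_map R S h b"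
    then obtain u v where u: "u \<in> carrier G" "a = tcl u" and v: "v \<in> carrier G" "b = tcl v"
      unfolding carrier_Q by blast
    then show "a = b" using eq tcl_eq_iff[OF u(1) v(1)] by (simp add: canonical_stalk_map_tcl)
  qed
  show "canonical_stalk_map R S h ` carrier Q = Idl\<^bsub>S\<^esub> (h ` J)"
    unfolding carrier_Q image_image ev_image[symmetric]
    by (rule image_cong) (simp_all add: canonical_stalk_map_tcl del: carrier_free_Abelian_group_iff)
qed

lemma canonical_add:
  "a \<in> carrier Q \<Longrightarrow> b \<in> carrier Q \<Longrightarrow>
    canonical_stalk_map R S h (a \<oplus>\<^bsub>Q\<^esub> b) = canonical_stalk_map R S h a \<oplus>\<^bsub>S\<^esub> canonical_stalk_map R S h b"
  unfolding carrier_Q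
  by (auto simp: Q_add canonical_stalk_map_tcl ev_add carrier_G_closed(1) simp del: carrier_free_Abelian_group_iff)

lemma canonical_smult:
  "r \<in> carrier S \<Longrightarrow> a \<in> carrier Q \<Longrightarrow>
    canonical_stalk_map R S h (r \<odot>\<^bsub>Q\<^esub> a) = r \<otimes>\<^bsub>S\<^esub> canonical_stalk_map R S h a"
  unfolding carrier_Q
  by (auto simp: Q_smult canonical_stalk_map_tcl ev_sc sc_closed simp del: carrier_free_Abelian_group_iff)

lemma canonical_tensor_sum:
  fixes k :: nat
  assumes "\<And>i. i < k \<Longrightarrow> m i \<in> J \<and> s i \<in> carrier S"
  defines "\<tau> \<equiv> \<Oplus>\<^bsub>T\<^esub>i\<in>{..<k}. pure_tensor R S h M (m i) (s i)"
  shows "\<tau> \<in> carrier T" "tor +>\<^bsub>T\<^esub> \<tau> \<in> carrier Q"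
    "canonical_stalk_map R S h (tor +>\<^bsub>T\<^esub> \<tau>) = (\<Oplus>\<^bsub>S\<^esub>i\<in>{..<k}. h (m i) \<otimes>\<^bsub>S\<^esub> s i)"
  using tensor_sum[of k m s, OF assms(1)] cl_closed tcl_closed canonical_stalk_map_tcl unfolding \<tau>_def
  by simp_all

lemma ideal_representation:
  assumes "x \<in> Idl\<^bsub>S\<^esub> (h ` J)"
  obtains k :: nat and m s where "\<And>i. i < k \<Longrightarrow> m i \<in> J \<and> s i \<in> carrier S"
    and "x = (\<Oplus>\<^bsub>S\<^esub>i\<in>{..<k}. h (m i) \<otimes>\<^bsub>S\<^esub> s i)"
proof -
  obtain u where "u \<in> carrier G" "x = ev u" using assms unfolding ev_image[symmetric] by blast
  then show ?thesis using tensor_representation[of u] that by metis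
qed

end

section \<open>The torsion-free preimage of an ideal sheaf\<close>

context ringed_space
begin

lemma scal_zero:
  assumes x: "x \<in> topspace (base X)"
  shows "scal X x 0 = \<zero>\<^bsub>stalk X x\<^esub>"
proof -
  interpret S: cring "stalk X x" by (rule stalk_cring[OF x])
  have c: "scal X x 0 \<in> carrier (stalk X x)"
    using ring_hom_closed[OF scal_hom[OF x], of 0] by (simp add: complex_ring_def)
  have "scal X x 0 = scal X x 0 \<oplus>\<^bsub>stalk X x\<^esub> scal X x 0"
    using ring_hom_add[OF scal_hom[OF x], of 0 0] by (simp add: complex_ring_def)
  then show ?thesis using c S.add.r_cancel_one' by metis
qed

lemma scal_one: "x \<in> topspace (base X) \<Longrightarrow> scal X x 1 = \<one>\<^bsub>stalk X x\<^esub>"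
  using ring_hom_one[OF scal_hom, of x] by (simp add: complex_ring_def)

lemma germ_closed: "openin (base X) U \<Longrightarrow> s \<in> sect X U \<Longrightarrow> x \<in> U \<Longrightarrow> s x \<in> carrier (stalk X x)"
  using sect_germs[of U] by (blast dest: PiE_mem)

lemma sect_finsum:
  fixes k :: nat
  assumes U: "openin (base X) U" and f: "\<And>i. i < k \<Longrightarrow> f i \<in> sect X U"
  shows "(\<lambda>x\<in>U. \<Oplus>\<^bsub>stalk X x\<^esub>i\<in>{..<k}. f i x) \<in> sect X U"
  using f
proof (induction k)
  case 0
  have "(\<lambda>x\<in>U. \<Oplus>\<^bsub>stalk X x\<^esub>i\<in>{..<0::nat}. f i x) = (\<lambda>x\<in>U. scal X x 0)"
  proof (rule restrict_ext)
    fix x assume "x \<in> U"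
    then have x: "x \<in> topspace (base X)" using openin_subset[OF U] by blast
    interpret S: cring "stalk X x" by (rule stalk_cring[OF x])
    show "(\<Oplus>\<^bsub>stalk X x\<^esub>i\<in>{..<0::nat}. f i x) = scal X x 0"
      unfolding lessThan_0 scal_zero[OF x] by (rule S.finsum_empty)
  qed
  then show ?case using sect_scal[OF U, of 0] by (simp only:)
next
  case (Suc k)
  have "(\<lambda>x\<in>U. \<Oplus>\<^bsub>stalk X x\<^esub>i\<in>{..<Suc k}. f i x)
      = (\<lambda>x\<in>U. f k x \<oplus>\<^bsub>stalk X x\<^esub> (\<lambda>x\<in>U. \<Oplus>\<^bsub>stalk X x\<^esub>i\<in>{..<k}. f i x) x)"
  proof (rule restrict_ext)
    fix x assume x: "x \<in> U"
    have xX: "x \<in> topspace (base X)" using x openin_subset[OF U] by blast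
    interpret S: cring "stalk X x" by (rule stalk_cring[OF xX])
    have "f i x \<in> carrier (stalk X x)" if "i < Suc k" for i
      by (rule germ_closed[OF U Suc.prems[OF that] x])
    then show "(\<Oplus>\<^bsub>stalk X x\<^esub>i\<in>{..<Suc k}. f i x)
        = f k x \<oplus>\<^bsub>stalk X x\<^esub> (\<lambda>x\<in>U. \<Oplus>\<^bsub>stalk X x\<^esub>i\<in>{..<k}. f i x) x"
      using x unfolding lessThan_Suc by (subst S.finsum_insert) auto
  qed
  moreover have "(\<lambda>x\<in>U. \<Oplus>\<^bsub>stalk X x\<^esub>i\<in>{..<k}. f i x) \<in> sect X U"
    by (rule Suc.IH) (rule Suc.prems, simp)
  from sect_add[OF U Suc.prems[OF lessI] this]
  have "(\<lambda>x\<in>U. f k x \<oplus>\<^bsub>stalk X x\<^esub> (\<lambda>x\<in>U. \<Oplus>\<^bsub>stalk X x\<^esub>i\<in>{..<k}. f i x) x) \<in> sect X U" .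
  ultimately show ?case by (simp only:)
qed

end

locale modified_ideal =
  fixes X :: "('c, 'd) ringed" and Y :: "('a, 'b) ringed"
    and p :: "'a \<Rightarrow> 'c" and h :: "'a \<Rightarrow> 'd \<Rightarrow> 'b" and J :: "'c \<Rightarrow> 'd set"
  assumes irred_X: "locally_irreducible X" and irred_Y: "locally_irreducible Y"
    and modification: "proper_modification Y X p h" and ideal_J: "ideal_sheaf X J"
begin

sublocale X: ringed_space X
  using irred_X by (simp add: locally_irreducible_def complex_space_def)

sublocale Y: ringed_space Y
  using irred_Y by (simp add: locally_irreducible_def complex_space_def)

lemma morphism: "ringed_morphism Y X p h"
  using modification by (simp add: proper_modification_def holomorphic_map_def)

lemma continuous_p: "continuous_map (base Y) (base X) p"
  by (rule conjunct1[OF morphism[unfolded ringed_morphism_def]])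

lemma p_closed: "y \<in> topspace (base Y) \<Longrightarrow> p y \<in> topspace (base X)"
  using continuous_map_funspace[OF continuous_p] by (rule funcset_mem)

lemma open_preimage: "openin (base X) U \<Longrightarrow> openin (base Y) {y \<in> topspace (base Y). p y \<in> U}"
  by (rule openin_continuous_map_preimage[OF continuous_p])

lemma comorphism: "y \<in> topspace (base Y) \<Longrightarrow> h y \<in> ring_hom (stalk X (p y)) (stalk Y y)"
  using morphism by (simp add: ringed_morphism_def)

lemma pullback_sect:
  assumes "openin (base X) U" "s \<in> sect X U"
  shows "pullback_section Y p h U s \<in> sect Y {y \<in> topspace (base Y). p y \<in> U}"
proof -
  have "pullback_section Y p h U ` sect X U \<subseteq> sect Y {y \<in> topspace (base Y). p y \<in> U}"
    using morphism assms(1) by (simp add: ringed_morphism_def)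
  then show ?thesis using assms(2) by (rule subsetD[OF _ imageI])
qed

lemma domain_Y: "y \<in> topspace (base Y) \<Longrightarrow> domain (stalk Y y)"
  using irred_Y by (simp add: locally_irreducible_def)

lemma comorphism_kernel:
  assumes y: "y \<in> topspace (base Y)" and g: "g \<in> carrier (stalk X (p y))"
    and zero: "h y g = \<zero>\<^bsub>stalk Y y\<^esub>"
  shows "g = \<zero>\<^bsub>stalk X (p y)\<^esub>"
proof (rule ccontr)
  assume nz: "g \<noteq> \<zero>\<^bsub>stalk X (p y)\<^esub>"
  obtain E C where E: "analytically_rare Y E"
    and iso: "ringed_isomorphism (open_subspace Y (topspace (base Y) - E))
      (open_subspace X (topspace (base X) - C)) p h"
    using modification unfolding proper_modification_def by blast
  obtain U s where U: "openin (base X) U" "p y \<in> U" and s: "s \<in> sect X U" "s (p y) = g"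
    using X.germ_represented[OF p_closed[OF y] g] by blast
  obtain V0 where V0: "openin (base X) V0" "p y \<in> V0" "V0 \<subseteq> U"
    and nz0: "\<And>x. x \<in> V0 \<Longrightarrow> s x \<noteq> \<zero>\<^bsub>stalk X x\<^esub>"
    by (rule locally_irreducible_nonzero_nearby[OF irred_X U s(1), unfolded s(2), OF nz]) (rule that)
  let ?U = "{y \<in> topspace (base Y). p y \<in> U}"
  \<comment> \<open>The pullback of \<open>s\<close> and the zero section have the same germ at
    \<open>y\<close> and therefore coincide near \<open>y\<close>.\<close>
  have "pullback_section Y p h U s y = (\<lambda>z\<in>?U. scal Y z 0) y"
    using y U(2) s(2) zero Y.scal_zero[OF y] by (simp add: pullback_section_def)
  from Y.germ_eq[OF open_preimage[OF U(1)] pullback_sect[OF U(1) s(1)] Y.sect_scal[OF open_preimage[OF U(1)]] _ this]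
  have "\<exists>V. openin (base Y) V \<and> y \<in> V \<and> V \<subseteq> ?U \<and> (\<forall>z\<in>V. pullback_section Y p h U s z = (\<lambda>z\<in>?U. scal Y z 0) z)"
    using y U(2) by simp
  then obtain V where V: "openin (base Y) V" "y \<in> V" "V \<subseteq> ?U"
    and eq: "\<forall>z\<in>V. pullback_section Y p h U s z = (\<lambda>z\<in>?U. scal Y z 0) z"
    by (elim exE conjE) (rule that)
  define W where "W = V \<inter> {y \<in> topspace (base Y). p y \<in> V0}"
  have W: "openin (base Y) W" "y \<in> W" unfolding W_def using V(1,2) open_preimage[OF V0(1)] y V0(2) by auto
  \<comment> \<open>Were \<open>W\<close> contained in \<open>E\<close>, rarity would identify all
    sections over \<open>W\<close>, in particular 0 and 1, whose germs at \<open>y\<close> differ in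
    a domain.\<close>
  have "W - E \<noteq> {}"
  proof
    assume "W - E = {}"
    moreover have "inj_on (\<lambda>s. restrict s (W - E)) (sect Y W)"
      using E W(1) unfolding analytically_rare_def by blast
    ultimately have "inj_on (\<lambda>s. restrict s {}) (sect Y W)" by (simp only:)
    then have "(\<lambda>z\<in>W. scal Y z 0) = (\<lambda>z\<in>W. scal Y z 1)"
      by (rule inj_onD) (auto intro: Y.sect_scal[OF W(1)])
    then have "scal Y y 0 = scal Y y 1" using W(2) by (auto dest: fun_cong[of _ _ y])
    then show False using Y.scal_zero[OF y] Y.scal_one[OF y] domain.one_not_zero[OF domain_Y[OF y]] by simp
  qed
  then obtain z where z: "z \<in> W" "z \<notin> E" by blast
  have zY: "z \<in> topspace (base Y)" and pz: "p z \<in> V0" and zV: "z \<in> V" using z(1) unfolding W_def by auto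
  have hz: "h z (s (p z)) = \<zero>\<^bsub>stalk Y z\<^esub>"
    using bspec[OF eq zV] subsetD[OF V(3) zV] Y.scal_zero[OF zY] by (simp add: pullback_section_def)
  \<comment> \<open>Outside \<open>E\<close> the comorphism is bijective, so the germ of
    \<open>s\<close> at \<open>p z\<close> vanishes although \<open>p z\<close> lies in
    \<open>V0\<close>.\<close>
  have "h z \<in> ring_iso (stalk X (p z)) (stalk Y z)"
    using iso zY z(2) by (simp add: ringed_isomorphism_def open_subspace_def)
  then have inj: "inj_on (h z) (carrier (stalk X (p z)))"
    by (simp add: ring_iso_def bij_betw_def)
  interpret RX: cring "stalk X (p z)" by (rule X.stalk_cring[OF p_closed[OF zY]])
  interpret SY: cring "stalk Y z" by (rule Y.stalk_cring[OF zY])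
  have "h z \<zero>\<^bsub>stalk X (p z)\<^esub> = \<zero>\<^bsub>stalk Y z\<^esub>"
    by (rule ring_hom_zero[OF comorphism[OF zY] RX.ring_axioms SY.ring_axioms])
  then have "s (p z) = \<zero>\<^bsub>stalk X (p z)\<^esub>"
    using inj_onD[OF inj, of "s (p z)" "\<zero>\<^bsub>stalk X (p z)\<^esub>"] hz X.germ_closed[OF U(1) s(1)] pz V0(3) by auto
  with nz0[OF pz] show False by blast
qed

abbreviation "R y \<equiv> stalk X (p y)"
abbreviation "S y \<equiv> stalk Y y"
abbreviation "T y \<equiv> base_change (R y) (S y) (h y) (ideal_record (R y) (J (p y)))"
abbreviation "tor y \<equiv> torsion (S y) (T y)"
abbreviation "Q y \<equiv> quot_module (T y) (tor y)"
abbreviation "can y \<equiv> canonical_stalk_map (R y) (S y) (h y)"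
abbreviation "JB y \<equiv> Idl\<^bsub>S y\<^esub> (h y ` J (p y))"
abbreviation "pure y \<equiv> pure_tensor (R y) (S y) (h y) (ideal_record (R y) (J (p y)))"

lemma base_change_at:
  assumes y: "y \<in> topspace (base Y)"
  shows "ideal_base_change (R y) (S y) (h y) (J (p y))"
proof (rule ideal_base_change.intro)
  interpret RX: cring "R y" by (rule X.stalk_cring[OF p_closed[OF y]])
  interpret SY: cring "S y" by (rule Y.stalk_cring[OF y])
  interpret H: ring_hom_ring "R y" "S y" "h y"
    by (rule ring_hom_ringI2[OF RX.ring_axioms SY.ring_axioms comorphism[OF y]])
  show "cring (R y)" by (rule RX.is_cring)
  show "domain (S y)" by (rule domain_Y[OF y])
  show "h y \<in> ring_hom (R y) (S y)" by (rule comorphism[OF y])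
  show "ideal (J (p y)) (R y)" using ideal_J p_closed[OF y] by (simp add: ideal_sheaf_def)
  have "a_kernel (R y) (S y) (h y) = {\<zero>\<^bsub>R y\<^esub>}"
    unfolding a_kernel_def'
  proof (intro equalityI subsetI)
    fix g assume "g \<in> {x \<in> carrier (R y). h y x = \<zero>\<^bsub>S y\<^esub>}"
    then show "g \<in> {\<zero>\<^bsub>R y\<^esub>}" using comorphism_kernel[OF y, of g] by simp
  next
    fix g assume "g \<in> {\<zero>\<^bsub>R y\<^esub>}"
    then show "g \<in> {x \<in> carrier (R y). h y x = \<zero>\<^bsub>S y\<^esub>}" using H.hom_zero RX.zero_closed by simp
  qed
  then show "inj_on (h y) (carrier (R y))" by (rule H.trivial_ker_imp_inj)
qed

lemma mstalk_preimage: "mstalk (torsion_free_preimage Y X p h (ideal_module X J)) y = Q y"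
  by (simp add: torsion_free_preimage_def quot_sheaf_def inverse_image_def torsion_sheaf_def ideal_module_def
      ideal_record_def)

lemma canonical_map_eq: "canonical_map Y X p h y = can y"
  by (simp add: canonical_map_def canonical_stalk_map_def torsion_free_preimage_unit_def
      torsion_free_preimage_map_def torsion_sheaf_def inverse_image_def structure_module_def ideal_module_def
      ideal_record_def)

definition ideal_sect :: "'c set \<Rightarrow> ('c \<Rightarrow> 'd) set" where
  "ideal_sect U = {s \<in> sect X U. \<forall>x\<in>U. s x \<in> J x}"

lemma ideal_sectD: "s \<in> ideal_sect U \<Longrightarrow> s \<in> sect X U" "s \<in> ideal_sect U \<Longrightarrow> x \<in> U \<Longrightarrow> s x \<in> J x"
  by (simp_all add: ideal_sect_def)

text \<open>The sections of the inverse image of the ideal sheaf, spelled out through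
  \<open>ideal_record\<close> so that the stalk results apply verbatim;
  \<open>msect_preimage\<close> makes the connection.\<close>

definition tensor_sect :: "'a set \<Rightarrow> ('a \<Rightarrow> (('d \<times> 'b) \<Rightarrow>\<^sub>0 int) set) set" where
  "tensor_sect V = {t \<in> (\<Pi>\<^sub>E y\<in>V. carrier (T y)).
     \<forall>y\<in>V. \<exists>W U (k::nat) a g. openin (base Y) W \<and> y \<in> W \<and> W \<subseteq> V \<and> openin (base X) U \<and> p ` W \<subseteq> U \<and>
       (\<forall>i<k. a i \<in> ideal_sect U \<and> g i \<in> sect Y W) \<and>
       (\<forall>z\<in>W. t z = (\<Oplus>\<^bsub>T z\<^esub>i\<in>{..<k}. pure z (a i (p z)) (g i z)))}"

lemma msect_preimage:
  "msect (torsion_free_preimage Y X p h (ideal_module X J)) V =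
    {q \<in> (\<Pi>\<^sub>E y\<in>V. carrier (Q y)). \<forall>y\<in>V. \<exists>W s. openin (base Y) W \<and> y \<in> W \<and> W \<subseteq> V \<and>
      s \<in> tensor_sect W \<and> (\<forall>z\<in>W. q z = tor z +>\<^bsub>T z\<^esub> s z)}"
  unfolding tensor_sect_def ideal_sect_def
  by (simp add: torsion_free_preimage_def quot_sheaf_def inverse_image_def torsion_sheaf_def ideal_module_def
      ideal_record_def)

lemma pullback_sum_sect:
  fixes k :: nat
  assumes W: "openin (base Y) W" and U: "openin (base X) U" "p ` W \<subseteq> U"
    and ag: "\<And>i. i < k \<Longrightarrow> a i \<in> sect X U \<and> g i \<in> sect Y W"
  shows "(\<lambda>z\<in>W. \<Oplus>\<^bsub>S z\<^esub>i\<in>{..<k}. h z (a i (p z)) \<otimes>\<^bsub>S z\<^esub> g i z) \<in> sect Y W"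
proof -
  have sub: "W \<subseteq> {y \<in> topspace (base Y). p y \<in> U}" using openin_subset[OF W] U(2) by blast
  have "(\<lambda>z\<in>W. h z (a i (p z)) \<otimes>\<^bsub>S z\<^esub> g i z) \<in> sect Y W" if "i < k" for i
  proof -
    have "restrict (pullback_section Y p h U (a i)) W \<in> sect Y W"
      using Y.sect_restrict[OF open_preimage[OF U(1)] W sub pullback_sect[OF U(1)]] ag[OF that] by blast
    from Y.sect_mult[OF W this conjunct2[OF ag[OF that]]] have
      "(\<lambda>z\<in>W. restrict (pullback_section Y p h U (a i)) W z \<otimes>\<^bsub>S z\<^esub> g i z) \<in> sect Y W"
      .
    moreover have "(\<lambda>z\<in>W. restrict (pullback_section Y p h U (a i)) W z \<otimes>\<^bsub>S z\<^esub> g i z)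
        = (\<lambda>z\<in>W. h z (a i (p z)) \<otimes>\<^bsub>S z\<^esub> g i z)"
      using sub by (intro restrict_ext) (auto simp: pullback_section_def)
    ultimately show ?thesis by (simp only:)
  qed
  then have "(\<lambda>z\<in>W. \<Oplus>\<^bsub>S z\<^esub>i\<in>{..<k}. (\<lambda>z\<in>W. h z (a i (p z)) \<otimes>\<^bsub>S z\<^esub> g i z) z) \<in> sect Y W"
    by (rule Y.sect_finsum[OF W])
  moreover have "(\<lambda>z\<in>W. \<Oplus>\<^bsub>S z\<^esub>i\<in>{..<k}. (\<lambda>z\<in>W. h z (a i (p z)) \<otimes>\<^bsub>S z\<^esub> g i z) z)
      = (\<lambda>z\<in>W. \<Oplus>\<^bsub>S z\<^esub>i\<in>{..<k}. h z (a i (p z)) \<otimes>\<^bsub>S z\<^esub> g i z)"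
    by (rule restrict_ext) (simp only: restrict_apply')
  ultimately show ?thesis by (simp only:)
qed

lemma can_tensor_sum:
  fixes k :: nat
  assumes W: "openin (base Y) W" "z \<in> W" and U: "openin (base X) U" "p ` W \<subseteq> U"
    and ag: "\<And>i. i < k \<Longrightarrow> a i \<in> ideal_sect U \<and> g i \<in> sect Y W"
  defines "\<tau> \<equiv> \<Oplus>\<^bsub>T z\<^esub>i\<in>{..<k}. pure z (a i (p z)) (g i z)"
  shows "\<tau> \<in> carrier (T z)" "tor z +>\<^bsub>T z\<^esub> \<tau> \<in> carrier (Q z)"
    "can z (tor z +>\<^bsub>T z\<^esub> \<tau>) = (\<Oplus>\<^bsub>S z\<^esub>i\<in>{..<k}. h z (a i (p z)) \<otimes>\<^bsub>S z\<^esub> g i z)"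
proof -
  have z: "z \<in> topspace (base Y)" using openin_subset[OF W(1)] W(2) by blast
  have "a i (p z) \<in> J (p z) \<and> g i z \<in> carrier (S z)" if "i < k" for i
    using ideal_sectD(2)[of "a i" U "p z"] ag[OF that] Y.germ_closed[OF W(1) _ W(2), of "g i"] W(2) U(2) by blast
  from ideal_base_change.canonical_tensor_sum[OF base_change_at[OF z], of k "\<lambda>i. a i (p z)" "\<lambda>i. g i z", OF this]
  show "\<tau> \<in> carrier (T z)" "tor z +>\<^bsub>T z\<^esub> \<tau> \<in> carrier (Q z)"
    "can z (tor z +>\<^bsub>T z\<^esub> \<tau>) = (\<Oplus>\<^bsub>S z\<^esub>i\<in>{..<k}. h z (a i (p z)) \<otimes>\<^bsub>S z\<^esub> g i z)"
    unfolding \<tau>_def by blast+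
qed

lemma can_bij: "y \<in> topspace (base Y) \<Longrightarrow> bij_betw (can y) (carrier (Q y)) (JB y)"
  by (rule ideal_base_change.canonical_bij[OF base_change_at])

text \<open>A section of the preimage is locally the class of a finite sum of pure tensors. Its
  image is a sum of products of pulled back sections with sections on \<open>Y\<close>, and such
  local sections glue.\<close>

lemma can_sect:
  assumes V: "openin (base Y) V"
    and q: "q \<in> msect (torsion_free_preimage Y X p h (ideal_module X J)) V"
  shows "(\<lambda>y\<in>V. can y (q y)) \<in> {s \<in> sect Y V. \<forall>y\<in>V. s y \<in> JB y}"
proof -
  have VY: "V \<subseteq> topspace (base Y)" by (rule openin_subset[OF V])
  have qQ: "q y \<in> carrier (Q y)" if "y \<in> V" for y
    by (rule PiE_mem[OF conjunct1[OF q[unfolded msect_preimage mem_Collect_eq]] that])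
  have "(\<lambda>y\<in>V. can y (q y)) \<in> sect Y V"
  proof (rule Y.sect_glue[OF V])
    show "(\<lambda>y\<in>V. can y (q y)) \<in> extensional V" by simp
    fix y assume y: "y \<in> V"
    from bspec[OF conjunct2[OF q[unfolded msect_preimage mem_Collect_eq]] y]
    obtain W s where W: "openin (base Y) W" "y \<in> W" "W \<subseteq> V" "s \<in> tensor_sect W"
      and qs: "\<forall>z\<in>W. q z = tor z +>\<^bsub>T z\<^esub> s z"
      by (elim exE conjE) (rule that)
    from bspec[OF conjunct2[OF W(4)[unfolded tensor_sect_def mem_Collect_eq]] W(2)]
    obtain W' U k a g where W': "openin (base Y) W'" "y \<in> W'" "W' \<subseteq> W" and U: "openin (base X) U" "p ` W' \<subseteq> U"
      and ag: "\<forall>i<(k::nat). a i \<in> ideal_sect U \<and> g i \<in> sect Y W'"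
      and st: "\<forall>z\<in>W'. s z = (\<Oplus>\<^bsub>T z\<^esub>i\<in>{..<k}. pure z (a i (p z)) (g i z))"
      by (elim exE conjE) (rule that)
    have "restrict (\<lambda>y\<in>V. can y (q y)) W' = (\<lambda>z\<in>W'. \<Oplus>\<^bsub>S z\<^esub>i\<in>{..<k}. h z (a i (p z)) \<otimes>\<^bsub>S z\<^esub> g i z)"
    proof (rule restrict_ext)
      fix z assume z: "z \<in> W'"
      have "can z (q z) = can z (tor z +>\<^bsub>T z\<^esub> (\<Oplus>\<^bsub>T z\<^esub>i\<in>{..<k}. pure z (a i (p z)) (g i z)))"
        using qs st z W'(3) by auto
      also have "\<dots> = (\<Oplus>\<^bsub>S z\<^esub>i\<in>{..<k}. h z (a i (p z)) \<otimes>\<^bsub>S z\<^esub> g i z)"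
        using ag by (intro can_tensor_sum(3)[OF W'(1) z U]) blast
      finally show "(\<lambda>y\<in>V. can y (q y)) z = (\<Oplus>\<^bsub>S z\<^esub>i\<in>{..<k}. h z (a i (p z)) \<otimes>\<^bsub>S z\<^esub> g i z)"
        using z W'(3) W(3) by auto
    qed
    moreover have "\<dots> \<in> sect Y W'" using ag ideal_sectD(1) by (intro pullback_sum_sect[OF W'(1) U]) blast
    ultimately show "\<exists>V'. openin (base Y) V' \<and> y \<in> V' \<and> V' \<subseteq> V \<and> restrict (\<lambda>y\<in>V. can y (q y)) V' \<in> sect Y V'"
      using W' W(3) by (intro exI[of _ W']) auto
  qed
  moreover have "can y (q y) \<in> JB y" if "y \<in> V" for y
    using bspec[OF bij_betwE[OF can_bij[OF subsetD[OF VY that]]] qQ[OF that]] .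
  ultimately show ?thesis by simp
qed

text \<open>Bijectivity on stalks leaves open whether the stalkwise preimage of a section is locally
  a sum of tensors of sections. A representation of the germ at one point is spread to a
  neighbourhood; the resulting section agrees with \<open>t\<close> at that point, hence nearby, and
  injectivity of the stalk maps identifies the preimages there.\<close>

lemma can_sect_surj:
  assumes V: "openin (base Y) V" and t: "t \<in> sect Y V" and tJ: "\<And>y. y \<in> V \<Longrightarrow> t y \<in> JB y"
  shows "\<exists>q\<in>msect (torsion_free_preimage Y X p h (ideal_module X J)) V. t = (\<lambda>y\<in>V. can y (q y))"
proof
  have VY: "V \<subseteq> topspace (base Y)" by (rule openin_subset[OF V])
  define q where "q = (\<lambda>y\<in>V. the_inv_into (carrier (Q y)) (can y) (t y))"
  have bij: "inj_on (can y) (carrier (Q y))" "can y ` carrier (Q y) = JB y" if "y \<in> V" for y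
    using can_bij[of y] VY that unfolding bij_betw_def by blast+
  have "can y (q y) = t y" if "y \<in> V" for y
    using f_the_inv_into_f[OF bij(1)[OF that], of "t y"] bij(2)[OF that] tJ[OF that] that by (simp add: q_def)
  moreover have "t \<in> extensional V" using subsetD[OF Y.sect_germs[OF V] t] by (simp add: PiE_iff)
  ultimately show "t = (\<lambda>y\<in>V. can y (q y))"
    by (intro extensionalityI[of t V]) auto
  have qQ: "q \<in> (\<Pi>\<^sub>E y\<in>V. carrier (Q y))"
    unfolding q_def using the_inv_into_into[OF bij(1) _ order.refl] bij(2) tJ by auto
  have "\<exists>W s. openin (base Y) W \<and> y \<in> W \<and> W \<subseteq> V \<and> s \<in> tensor_sect W \<and> (\<forall>z\<in>W. q z = tor z +>\<^bsub>T z\<^esub> s z)"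
    if y: "y \<in> V" for y
  proof -
    have yY: "y \<in> topspace (base Y)" using y VY by blast
    obtain k :: nat and m s where ms: "\<And>i. i < k \<Longrightarrow> m i \<in> J (p y) \<and> s i \<in> carrier (S y)"
      and ty: "t y = (\<Oplus>\<^bsub>S y\<^esub>i\<in>{..<k}. h y (m i) \<otimes>\<^bsub>S y\<^esub> s i)"
      by (rule ideal_base_change.ideal_representation[OF base_change_at[OF yY] tJ[OF y]]) (rule that)
    \<comment> \<open>Germs extend to sections of the structure sheaf; membership in
      \<open>J\<close> at \<open>p y\<close> persists nearby by the subsheaf condition in
      \<open>ideal_sheaf\<close>.\<close>
    have "\<exists>U a. openin (base X) U \<and> p y \<in> U \<and> a \<in> sect X U \<and> (\<forall>x\<in>U. a x \<in> J x) \<and> a (p y) = m i" if "i < k" for i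
    proof -
      have "m i \<in> carrier (R y)" using ideal_base_change.J_sub[OF base_change_at[OF yY]] ms[OF that] by blast
      then obtain U a where U: "openin (base X) U" "p y \<in> U" "a \<in> sect X U" "a (p y) = m i"
        using X.germ_represented[OF p_closed[OF yY]] by blast
      moreover from this ms[OF that] have "a (p y) \<in> J (p y)" by simp
      ultimately obtain U' where U': "openin (base X) U'" "p y \<in> U'" "U' \<subseteq> U" "\<forall>x\<in>U'. a x \<in> J x"
        using ideal_J unfolding ideal_sheaf_def by blast
      then show ?thesis using X.sect_restrict[OF U(1) U'(1,3) U(3)] U(4)
        by (intro exI[of _ U'] exI[of _ "restrict a U'"]) auto
    qed
    then obtain U a where U: "\<And>i. i < k \<Longrightarrow> openin (base X) (U i)" "\<And>i. i < k \<Longrightarrow> p y \<in> U i"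
      and a: "\<And>i. i < k \<Longrightarrow> a i \<in> sect X (U i)" "\<And>i x. i < k \<Longrightarrow> x \<in> U i \<Longrightarrow> a i x \<in> J x"
        "\<And>i. i < k \<Longrightarrow> a i (p y) = m i" by metis
    have "\<exists>W g. openin (base Y) W \<and> y \<in> W \<and> g \<in> sect Y W \<and> g y = s i" if "i < k" for i
      using Y.germ_represented[OF yY] ms[OF that] by blast
    then obtain W g where W: "\<And>i. i < k \<Longrightarrow> openin (base Y) (W i)" "\<And>i. i < k \<Longrightarrow> y \<in> W i"
      and g: "\<And>i. i < k \<Longrightarrow> g i \<in> sect Y (W i)" "\<And>i. i < k \<Longrightarrow> g i y = s i" by metis
    \<comment> \<open>Intersecting with the whole space covers \<open>k = 0\<close>, where the
      family of neighbourhoods is empty.\<close>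
    define U0 where "U0 = topspace (base X) \<inter> \<Inter> (U ` {..<k})"
    define W0 where "W0 = V \<inter> {z \<in> topspace (base Y). p z \<in> U0} \<inter> (topspace (base Y) \<inter> \<Inter> (W ` {..<k}))"
    have U0: "openin (base X) U0" "p y \<in> U0" "\<And>i. i < k \<Longrightarrow> U0 \<subseteq> U i"
      unfolding U0_def using U p_closed[OF yY] by (auto intro!: openin_Int_Inter)
    have "openin (base Y) (topspace (base Y) \<inter> \<Inter> (W ` {..<k}))"
      using W by (auto intro!: openin_Int_Inter)
    then have W0: "openin (base Y) W0" "y \<in> W0" "W0 \<subseteq> V" "p ` W0 \<subseteq> U0" "\<And>i. i < k \<Longrightarrow> W0 \<subseteq> W i"
      unfolding W0_def using V y yY U0(2) W(2) open_preimage[OF U0(1)] by (auto intro!: openin_Int)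
    define a' where "a' i = restrict (a i) U0" for i
    have a': "a' i \<in> ideal_sect U0" "a' i (p y) = m i" if "i < k" for i
    proof -
      have "restrict (a i) U0 \<in> sect X U0" using X.sect_restrict[OF U(1) U0(1,3) a(1)] that by blast
      moreover have "a i x \<in> J x" if "x \<in> U0" for x using a(2) U0(3) \<open>i < k\<close> that by blast
      ultimately show "a' i \<in> ideal_sect U0" by (simp add: a'_def ideal_sect_def)
      show "a' i (p y) = m i" using a(3)[OF that] U0(2) by (simp add: a'_def)
    qed
    let ?f = "\<lambda>z. \<Oplus>\<^bsub>S z\<^esub>i\<in>{..<k}. h z (a' i (p z)) \<otimes>\<^bsub>S z\<^esub> restrict (g i) W0 z"
    have g': "restrict (g i) W0 \<in> sect Y W0" if "i < k" for i
      using Y.sect_restrict[OF W(1) W0(1,5) g(1)] that by blast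
    have \<sigma>: "(\<lambda>z\<in>W0. ?f z) \<in> sect Y W0"
      using ideal_sectD(1)[OF a'(1)] g' by (intro pullback_sum_sect[OF W0(1) U0(1) W0(4)]) blast
    interpret SY: cring "S y" by (rule Y.stalk_cring[OF yY])
    have "h y (m i) \<otimes>\<^bsub>S y\<^esub> s i \<in> carrier (S y)" if "i < k" for i
      using ideal_base_change.h_simps(1)[OF base_change_at[OF yY]] ideal_base_change.J_sub[OF base_change_at[OF yY]]
        ms[OF that] by blast
    then have "?f y = t y" unfolding ty using a'(2) g(2) W0(2)
      by (intro SY.finsum_cong') auto
    then have "(\<lambda>z\<in>W0. ?f z) y = restrict t W0 y" using W0(2) by simp
    from Y.germ_eq[OF W0(1) \<sigma> Y.sect_restrict[OF V W0(1,3) t] W0(2) this]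
    obtain N where N: "openin (base Y) N" "y \<in> N" "N \<subseteq> W0"
      and eq: "\<forall>z\<in>N. (\<lambda>z\<in>W0. ?f z) z = restrict t W0 z"
      by (elim exE conjE) (rule that)
    define g' where "g' i = restrict (g i) N" for i
    have gN: "g' i \<in> sect Y N" if "i < k" for i
      using Y.sect_restrict[OF W(1) N(1) _ g(1)] W0(5) N(3) that unfolding g'_def by blast
    have pN: "p ` N \<subseteq> U0" using N(3) W0(4) by blast
    define \<tau> where "\<tau> = (\<lambda>z\<in>N. \<Oplus>\<^bsub>T z\<^esub>i\<in>{..<k}. pure z (a' i (p z)) (g' i z))"
    have ag: "a' i \<in> ideal_sect U0 \<and> g' i \<in> sect Y N" if "i < k" for i
      using a'(1) gN that by blast
    have \<tau>_eq: "\<tau> z = (\<Oplus>\<^bsub>T z\<^esub>i\<in>{..<k}. pure z (a' i (p z)) (g' i z))" if "z \<in> N" for z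
      using that by (simp add: \<tau>_def)
    have \<tau>: "\<tau> z \<in> carrier (T z)" "tor z +>\<^bsub>T z\<^esub> \<tau> z \<in> carrier (Q z)"
      "can z (tor z +>\<^bsub>T z\<^esub> \<tau> z) = (\<Oplus>\<^bsub>S z\<^esub>i\<in>{..<k}. h z (a' i (p z)) \<otimes>\<^bsub>S z\<^esub> g' i z)" if "z \<in> N" for z
      unfolding \<tau>_eq[OF that] by (rule can_tensor_sum[OF N(1) that U0(1) pN ag]; assumption)+
    have "\<tau> \<in> tensor_sect N"
      unfolding tensor_sect_def
    proof (intro CollectI conjI ballI)
      show "\<tau> \<in> (\<Pi>\<^sub>E y\<in>N. carrier (T y))"
      proof (rule PiE_I)
        show "\<tau> z \<in> carrier (T z)" if "z \<in> N" for z by (rule \<tau>(1)[OF that])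
        show "\<tau> z = undefined" if "z \<notin> N" for z using that by (simp add: \<tau>_def)
      qed
      fix y' assume "y' \<in> N"
      then show "\<exists>W U (k::nat) a g. openin (base Y) W \<and> y' \<in> W \<and> W \<subseteq> N \<and> openin (base X) U \<and> p ` W \<subseteq> U \<and>
       (\<forall>i<k. a i \<in> ideal_sect U \<and> g i \<in> sect Y W) \<and>
       (\<forall>z\<in>W. \<tau> z = (\<Oplus>\<^bsub>T z\<^esub>i\<in>{..<k}. pure z (a i (p z)) (g i z)))"
        by (intro exI[of _ N] exI[of _ U0] exI[of _ k] exI[of _ a'] exI[of _ g'] conjI N(1) order.refl U0(1) pN
            allI impI ballI conjunct1[OF ag] conjunct2[OF ag] \<tau>_eq)
    qed
    moreover have "q z = tor z +>\<^bsub>T z\<^esub> \<tau> z" if z: "z \<in> N" for z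
    proof -
      have zV: "z \<in> V" using z N(3) W0(3) by blast
      have "can z (tor z +>\<^bsub>T z\<^esub> \<tau> z) = ?f z"
        unfolding \<tau>(3)[OF z] g'_def using z subsetD[OF N(3) z] by (simp only: restrict_apply')
      also have "\<dots> = t z" using bspec[OF eq z] subsetD[OF N(3) z] by (simp only: restrict_apply')
      finally show ?thesis
        using the_inv_into_f_eq[OF bij(1)[OF zV] _ \<tau>(2)[OF z]] zV by (simp add: q_def)
    qed
    ultimately show ?thesis using N(1,2) order.trans[OF N(3) W0(3)]
      by (intro exI[of _ N] exI[of _ \<tau>] conjI ballI)
  qed
  then show "q \<in> msect (torsion_free_preimage Y X p h (ideal_module X J)) V"
    unfolding msect_preimage using qQ by (intro CollectI conjI ballI)
qed

lemma canonical_iso: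
  "module_sheaf_iso Y (torsion_free_preimage Y X p h (ideal_module X J))
     (ideal_module Y (preimage_ideal Y p h J)) (canonical_map Y X p h)"
  unfolding module_sheaf_iso_def mstalk_preimage canonical_map_eq
proof (intro conjI ballI allI impI)
  let ?N = "ideal_module Y (preimage_ideal Y p h J)"
  have N: "carrier (mstalk ?N y) = JB y" "add (mstalk ?N y) = add (S y)" "smult (mstalk ?N y) = mult (S y)" for y
    by (simp_all add: ideal_module_def preimage_ideal_def)
  fix y assume y: "y \<in> topspace (base Y)"
  show "bij_betw (can y) (carrier (Q y)) (carrier (mstalk ?N y))" unfolding N by (rule can_bij[OF y])
  show "can y (a \<oplus>\<^bsub>Q y\<^esub> b) = can y a \<oplus>\<^bsub>mstalk ?N y\<^esub> can y b" if "a \<in> carrier (Q y)" "b \<in> carrier (Q y)" for a b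
    unfolding N by (rule ideal_base_change.canonical_add[OF base_change_at[OF y] that])
  show "can y (r \<odot>\<^bsub>Q y\<^esub> a) = r \<odot>\<^bsub>mstalk ?N y\<^esub> can y a" if "r \<in> carrier (S y)" "a \<in> carrier (Q y)" for r a
    unfolding N by (rule ideal_base_change.canonical_smult[OF base_change_at[OF y] that])
next
  fix V assume V: "openin (base Y) V"
  have msect_eq: "msect (ideal_module Y (preimage_ideal Y p h J)) V = {s \<in> sect Y V. \<forall>y\<in>V. s y \<in> JB y}"
    by (simp add: ideal_module_def preimage_ideal_def)
  show "(\<lambda>s. \<lambda>y\<in>V. can y (s y)) ` msect (torsion_free_preimage Y X p h (ideal_module X J)) V
      = msect (ideal_module Y (preimage_ideal Y p h J)) V"
  proof (intro equalityI subsetI)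
    fix t assume "t \<in> (\<lambda>s. \<lambda>y\<in>V. can y (s y)) ` msect (torsion_free_preimage Y X p h (ideal_module X J)) V"
    then obtain q where q: "q \<in> msect (torsion_free_preimage Y X p h (ideal_module X J)) V"
      and t: "t = (\<lambda>y\<in>V. can y (q y))" by (rule imageE)
    show "t \<in> msect (ideal_module Y (preimage_ideal Y p h J)) V" unfolding t msect_eq by (rule can_sect[OF V q])
  next
    fix t assume "t \<in> msect (ideal_module Y (preimage_ideal Y p h J)) V"
    then have "t \<in> sect Y V" "\<And>y. y \<in> V \<Longrightarrow> t y \<in> JB y" unfolding msect_eq by blast+
    then have "\<exists>q\<in>msect (torsion_free_preimage Y X p h (ideal_module X J)) V. t = (\<lambda>y\<in>V. can y (q y))"
      by (rule can_sect_surj[OF V])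
    then show "t \<in> (\<lambda>s. \<lambda>y\<in>V. can y (s y)) ` msect (torsion_free_preimage Y X p h (ideal_module X J)) V"
      by (elim bexE) (rule image_eqI)
  qed
qed

end

theorem lemma7p2:
  fixes X :: "('c, 'd) ringed" and Y :: "('a, 'b) ringed"
    and p :: "'a \<Rightarrow> 'c" and h :: "'a \<Rightarrow> 'd \<Rightarrow> 'b"
    and J\<^sub>A :: "'c \<Rightarrow> 'd set" and J\<^sub>B :: "'a \<Rightarrow> 'b set"
  assumes "locally_irreducible X"
    and "analytic_subspace_ideal X J\<^sub>A"
    and "locally_irreducible Y"
    and "proper_modification Y X p h"
    and "J\<^sub>B = preimage_ideal Y p h J\<^sub>A"
  shows "module_sheaf_iso Y (torsion_free_preimage Y X p h (ideal_module X J\<^sub>A))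
           (ideal_module Y J\<^sub>B) (canonical_map Y X p h)"
  unfolding assms(5)
  by (rule modified_ideal.canonical_iso, rule modified_ideal.intro)
    (use assms(1-4) in \<open>simp_all add: analytic_subspace_ideal_def\<close>)

end
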